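(* Let $\gamma(0)$ be a Jordan curve of finite length, whose curvature is everywhere defined and is a $C^\infty$ function of arc length, and which has finitely many inflection points; let $\mathcal D$ be the region it encloses and $T(\mathcal D)=\mathrm{Area}(\mathcal D)/2$. Fix $K>0$. Then there exists a unique solution $(\gamma(t))_{t\le T_K}$ of the anisotropic curve shortening flow $\partial_t\gamma=a(\theta)k\mathbf N$ with initial condition $\gamma(0)$ which is a Jordan curve for every $t\le T_K$. The area enclosed by $\gamma(t)$ equals $2(T(\mathcal D)-t)$. Moreover its curvature function is equicontinuous in the following sense: for every $\epsilon>0$ there exists $\delta=\delta(\epsilon,K,\gamma(0))>0$ such that if $t,t'\le T_K$, $p\in\gamma(t)$, $p'\in\gamma(t')$ with $|t-t'|\le\delta$ and $|p-p'|\le\delta$, then $|k(p,t)-k(p',t')|\le\epsilon$.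
   Context: $a(\theta)=\frac{1}{2(|\cos\theta|+|\sin\theta|)^2}$; in the flow, $\theta$ is the tangent angle, $k$ the signed curvature (positive at local convexity), $\mathbf N$ the inward unit normal, and the inward normal velocity equals $a(\theta)k$. Fix a family $(a^\omega)_{\omega\in(0,1)}$ of $C^\infty$, strictly positive functions which are $\pi/2$-periodic (like $a$), uniformly Lipschitz in $\omega$, and converge uniformly to $a$ as $\omega\to0$. For each $\omega$, let $(\gamma^\omega(t))_{t<T^\omega}$ be the (smooth, Jordan) solution of $\partial_t\gamma=a^\omega(\theta)k\mathbf N$ with $\gamma^\omega(0)=\gamma(0)$, which exists up to the time $T^\omega=\mathrm{Area}(\mathcal D)/\int_0^{2\pi}a^\omega$ at which it shrinks to a point, and let $k^\omega(\cdot,t)$ be its curvature function. For $K\ge0$ define $T_K=\sup\{t:\ \limsup_{\omega\to0}\sup_{t'\le t}\|k^\omega(\cdot,t')\|_\infty<K/2\}$. *)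

theory Defs
  imports "HOL-Complex_Analysis.Complex_Analysis"
begin

definition anis :: "real \<Rightarrow> real" where
  "anis \<theta> = 1 / (2 * (\<bar>cos \<theta>\<bar> + \<bar>sin \<theta>\<bar>)^2)"

definition smooth_real :: "(real \<Rightarrow> real) \<Rightarrow> bool" where
  "smooth_real f \<longleftrightarrow> (\<forall>n x. (deriv ^^ n) f differentiable (at x))"

definition d1 :: "(real \<Rightarrow> complex) \<Rightarrow> real \<Rightarrow> complex" where
  "d1 g s = vector_derivative g (at s)"

definition d2 :: "(real \<Rightarrow> complex) \<Rightarrow> real \<Rightarrow> complex" where
  "d2 g s = vector_derivative (d1 g) (at s)"

text \<open>Signed curvature w.r.t. the orientation of the parametrisation
  (positive at local convexity for counterclockwise curves).\<close>
definition curv1 :: "(real \<Rightarrow> complex) \<Rightarrow> real \<Rightarrow> real" where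
  "curv1 g s = Im (cnj (d1 g s) * d2 g s) / (cmod (d1 g s))^3"

definition inflection :: "(real \<Rightarrow> real) \<Rightarrow> real \<Rightarrow> bool" where
  "inflection k s \<longleftrightarrow> (\<forall>e>0. \<exists>x y. \<bar>x - s\<bar> < e \<and> \<bar>y - s\<bar> < e \<and> k x > 0 \<and> k y < 0)"

definition slice :: "(real \<Rightarrow> real \<Rightarrow> complex) \<Rightarrow> real \<Rightarrow> real \<Rightarrow> complex" where
  "slice gam t = (\<lambda>u. gam u t)"

definition curv :: "(real \<Rightarrow> real \<Rightarrow> complex) \<Rightarrow> real \<Rightarrow> real \<Rightarrow> real" where
  "curv gam t u = curv1 (slice gam t) u"

definition jordan_loop :: "(real \<Rightarrow> complex) \<Rightarrow> bool" where
  "jordan_loop g \<longleftrightarrow> (\<forall>u. g (u + 1) = g u) \<and> inj_on g {0..<1}"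

definition ccw :: "(real \<Rightarrow> complex) \<Rightarrow> bool" where
  "ccw g \<longleftrightarrow> (\<forall>z \<in> inside (range g). winding_number g z = 1)"

text \<open>Classical solution on the time set I of the flow whose inward normal velocity
  equals A(theta) k, theta the tangent angle, N = i T the inward normal (ccw orientation).
  Tangential velocity is arbitrary (geometric flow).\<close>
definition is_flow :: "(real \<Rightarrow> real) \<Rightarrow> (real \<Rightarrow> real \<Rightarrow> complex) \<Rightarrow> real set \<Rightarrow> bool" where
  "is_flow A gam I \<longleftrightarrow>
     (\<forall>t\<in>I. jordan_loop (slice gam t) \<and> ccw (slice gam t) \<and>
        (\<forall>u. slice gam t differentiable (at u) \<and> d1 (slice gam t) differentiable (at u)
             \<and> d1 (slice gam t) u \<noteq> 0)) \<and>
     continuous_on (UNIV \<times> I) (\<lambda>(u, t). gam u t) \<and>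
     continuous_on (UNIV \<times> I) (\<lambda>(u, t). d1 (slice gam t) u) \<and>
     continuous_on (UNIV \<times> I) (\<lambda>(u, t). d2 (slice gam t) u) \<and>
     (\<forall>t\<in>I. t > 0 \<longrightarrow> (\<forall>u. \<exists>v. ((\<lambda>s. gam u s) has_vector_derivative v) (at t within I) \<and>
         Re (cnj v * (\<i> * d1 (slice gam t) u / complex_of_real (cmod (d1 (slice gam t) u))))
           = A (Arg (d1 (slice gam t) u)) * curv gam t u))"

definition curv_pt :: "(real \<Rightarrow> real \<Rightarrow> complex) \<Rightarrow> real \<Rightarrow> complex \<Rightarrow> real" where
  "curv_pt gam t p = curv gam t (SOME u. u \<in> {0..<1} \<and> gam u t = p)"

text \<open>Extinction time T^omega = Area(D) / integral of a^omega.\<close>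
definition Tom :: "(real \<Rightarrow> real \<Rightarrow> real) \<Rightarrow> (real \<Rightarrow> complex) \<Rightarrow> real \<Rightarrow> real" where
  "Tom A c0 \<omega> = measure lebesgue (inside (range c0)) / integral {0..2*pi} (A \<omega>)"

definition Msup :: "(real \<Rightarrow> real \<Rightarrow> real) \<Rightarrow> (real \<Rightarrow> complex) \<Rightarrow> (real \<Rightarrow> real \<Rightarrow> real \<Rightarrow> complex)
     \<Rightarrow> real \<Rightarrow> real \<Rightarrow> ereal" where
  "Msup A c0 G \<omega> t = (if t < Tom A c0 \<omega>
      then (SUP t'\<in>{0..t}. SUP u\<in>UNIV. ereal \<bar>curv (G \<omega>) t' u\<bar>) else \<infinity>)"

definition TK :: "(real \<Rightarrow> real \<Rightarrow> real) \<Rightarrow> (real \<Rightarrow> complex) \<Rightarrow> (real \<Rightarrow> real \<Rightarrow> real \<Rightarrow> complex)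
     \<Rightarrow> real \<Rightarrow> ereal" where
  "TK A c0 G K = Sup {ereal t | t. Limsup (at_right 0) (\<lambda>\<omega>. Msup A c0 G \<omega> t) < ereal (K / 2)}"

definition times :: "ereal \<Rightarrow> real set" where
  "times T = {t. 0 \<le> t \<and> ereal t \<le> T}"

end

theory Submission
imports Defs
begin

text \<open>The curvature bound makes every approximating flow a family of graphs over boxes of uniform size. In such a box
  the graph function solves a parabolic equation whose coefficient is merely Lipschitz in the angle, and a two-point
  maximum principle bounds the velocity in space and time uniformly in the approximation; compactness then yields the
  limiting flow together with the equicontinuity of its curvature.\<close>

lemma DERIV_affine:
 fixes g :: "real => real"
 assumes g: "DERIV g (u+c*q) :> d" shows "DERIV (%q. g (u+c*q)) q :> c*d"
proof -
 have "DERIV (%q. u+c*q) q :> c" by (auto intro!: derivative_eq_intros)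
 from DERIV_chain2[where f=g, OF g this] show ?thesis by (simp only: mult.commute[of c])
qed

lemma second_derivative_nonpos_at_max:
 fixes z z' :: "real => real"
 assumes z: "eventually (%q. DERIV z q :> z' q) (nhds x)" and z': "DERIV z' x :> c"
  and max: "eventually (%q. z q <= z x) (nhds x)"
 shows "z' x = 0" "c <= 0"
proof -
 obtain e where e: "e > 0" "!!q. abs (q-x) < e ==> DERIV z q :> z' q & z q <= z x"
  using eventually_conj[OF z max] unfolding eventually_nhds_metric dist_real_def by blast
 show crit: "z' x = 0" by (rule DERIV_local_max[of z _ x e]) (use e in \<open>auto simp: abs_minus_commute\<close>)
 show "c <= 0"
 proof (rule ccontr)
  assume "~ c <= 0"
  then obtain d where d: "d > 0" "!!h. 0 < h ==> h < d ==> 0 < z' (x+h)" using DERIV_pos_inc_right[OF z'] crit by auto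
  define m where "m = min d e/2"
  have m: "m > 0" "m < d" "m < e" using d(1) e(1) by (auto simp: m_def)
  then obtain y where y: "x < y" "y < x+m" "z (x+m) - z x = m*z' y" using MVT2[of x "x+m" z z'] e(2) by force
  hence "m*z' y > 0" using d(2)[of "y-x"] m by auto
  thus False using e(2)[of "x+m"] m y(3) by auto
 qed
qed

lemma left_derivative_nonneg_at_max:
 fixes z :: "real => real"
 assumes d: "(z has_field_derivative c) (at t within {a..b})" and t: "a < t" "t <= b"
  and max: "!!s. a <= s ==> s < t ==> z s <= z t"
 shows "c >= 0"
proof (rule ccontr)
 assume "~ c >= 0"
 then obtain d where d: "d > 0" "!!h. 0 < h ==> t-h : {a..b} ==> h < d ==> z t < z (t-h)"
  using has_real_derivative_neg_dec_left[OF d] by auto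
 define m where "m = min d (t-a)/2"
 have "m > 0" "m < d" "m < t-a" using d(1) t by (auto simp: m_def)
 thus False using d(2)[of m] max[of "t-m"] t by auto
qed

definition barrier :: "real => real => real" where
 "barrier r s = s - s^2/(8*r)"

lemma barrier_bounds:
 assumes "r > 0" "0 <= s" "s <= 2*r"
 shows "3/4 * s <= barrier r s" "barrier r s <= s"
proof -
 have "s^2 <= s*(2*r)" using assms by (simp add: power2_eq_square mult_left_mono)
 thus "3/4 * s <= barrier r s" "barrier r s <= s" using assms by (auto simp: barrier_def field_simps)
qed

lemma two_point_max_conditions:
 fixes f f1 f2 :: "real => real" and L N r x y :: real
 defines "Z \<equiv> %x y. f x - f y - L*barrier r (abs (x-y)) - N*(x^2+y^2)"
 assumes r: "r > 0" and xy: "abs x < r" "abs y < r" "x ~= y"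
  and f: "!!z. abs z < r ==> DERIV f z :> f1 z" and f1: "!!z. abs z < r ==> DERIV f1 z :> f2 z"
  and max: "!!x' y'. abs x' < r ==> abs y' < r ==> Z x' y' <= Z x y"
 defines "p \<equiv> L*(1 - abs (x-y)/(4*r)) * sgn (x-y)"
 shows "f1 x = p + 2*N*x" "f1 y = p - 2*N*y"
  "a^2*f2 x - b^2*f2 y + L/(4*r)*(a-b)^2 - 2*N*(a^2+b^2) <= 0"
proof -
 define sig where "sig = sgn (x-y)"
 have sig: "abs (x-y) = sig*(x-y)" "sig* sig = 1" "abs sig = 1" using xy by (auto simp: sig_def sgn_if)
 have sigsig: "sig*(sig * v) = v" for v by (metis sig(2) mult.assoc mult_1)
 have along: "a*f1 x - b*f1 y - p*(a-b) - 2*N*(x*a + y*b) = 0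
   & a^2*f2 x - b^2*f2 y + L/(4*r)*(a-b)^2 - 2*N*(a^2+b^2) <= 0" for a b
 proof -
  define z where "z q = f (x+a*q) - f (y+b*q)
   - (L*barrier r (sig*(x-y+(a-b)*q)) + N*((x+a*q)^2 + (y+b*q)^2))" for q
  define z' where "z' q = a*f1 (x+a*q) - b*f1 (y+b*q)
   - (L*(1 - sig*(x-y+(a-b)*q)/(4*r))* sig*(a-b) + 2*N*((x+a*q)*a + (y+b*q)*b))" for q
  have der: "DERIV z q :> z' q" if "abs (x+a*q) < r" "abs (y+b*q) < r" for q unfolding z_def z'_def
  proof (intro DERIV_diff DERIV_affine f that)
   show "DERIV (%q. L*barrier r (sig*(x-y+(a-b)*q)) + N*((x+a*q)^2 + (y+b*q)^2)) q
     :> L*(1 - sig*(x-y+(a-b)*q)/(4*r))* sig*(a-b) + 2*N*((x+a*q)*a + (y+b*q)*b)"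
    unfolding barrier_def using r by (auto intro!: derivative_eq_intros simp: field_simps)
  qed
  have der2: "DERIV z' 0 :> a*(a*f2 x) - b*(b*f2 y) - (-(L/(4*r)*(a-b)^2) + 2*N*(a^2+b^2))" unfolding z'_def
  proof (intro DERIV_diff DERIV_cmult)
   show "DERIV (%q. f1 (x+a*q)) 0 :> a*f2 x" "DERIV (%q. f1 (y+b*q)) 0 :> b*f2 y"
    using DERIV_affine[of f1 "f2 x" x a 0] DERIV_affine[of f1 "f2 y" y b 0] f1 xy by auto
   show "DERIV (%q. L*(1 - sig*(x-y+(a-b)*q)/(4*r))* sig*(a-b) + 2*N*((x+a*q)*a + (y+b*q)*b)) 0
     :> -(L/(4*r)*(a-b)^2) + 2*N*(a^2+b^2)"
    using r by (auto intro!: derivative_eq_intros simp: power2_eq_square sigsig)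
  qed
  have "open {q. abs (x+a*q) < r & abs (y+b*q) < r & 0 < sig*(x-y+(a-b)*q)}"
   by (intro open_Collect_conj open_Collect_less continuous_intros)
  from eventually_nhds_in_open[OF this, of 0]
  have ev: "eventually (%q. abs (x+a*q) < r & abs (y+b*q) < r & 0 < sig*(x-y+(a-b)*q)) (nhds 0)" using xy sig(1) by simp
  have le: "z q <= z 0" if q: "abs (x+a*q) < r" "abs (y+b*q) < r" "0 < sig*(x-y+(a-b)*q)" for q
  proof -
   have "x+a*q - (y+b*q) = x-y+(a-b)*q" by (simp add: algebra_simps)
   hence "abs (x+a*q - (y+b*q)) = abs (sig*(x-y+(a-b)*q))" by (simp add: abs_mult sig(3))
   hence "z q = Z (x+a*q) (y+b*q)" using q(3) by (simp add: z_def Z_def)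
   also have "... <= Z x y" by (rule max[OF q(1,2)])
   also have "... = z 0" using sig(1) by (simp add: z_def Z_def)
   finally show ?thesis .
  qed
  have "eventually (%q. DERIV z q :> z' q) (nhds 0)" "eventually (%q. z q <= z 0) (nhds 0)"
   using ev by (auto elim!: eventually_mono intro: der le)
  from second_derivative_nonpos_at_max[OF this(1) der2 this(2)]
  show ?thesis unfolding z'_def p_def sig_def[symmetric] sig(1) by (simp add: power2_eq_square)
 qed
 show "f1 x = p + 2*N*x" "f1 y = p - 2*N*y" using along[of 1 0] along[of 0 1] by auto
 show "a^2*f2 x - b^2*f2 y + L/(4*r)*(a-b)^2 - 2*N*(a^2+b^2) <= 0" using along by blast
qed

locale parabolic_inequality =
 fixes r t0 t1 C Lambda e :: real and w w1 w2 wt beta :: "real => real => real"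
 assumes r: "r > 0" and t01: "t0 < t1" and C: "C >= 0" and e: "e >= 0"
  and cont: "continuous_on ({-r..r} \<times> {t0..t1}) (%(x,t). w x t)"
  and dx: "!!x t. abs x < r ==> t0 < t ==> t <= t1 ==> DERIV (%y. w y t) x :> w1 x t"
  and dxx: "!!x t. abs x < r ==> t0 < t ==> t <= t1 ==> DERIV (%y. w1 y t) x :> w2 x t"
  and dt: "!!x t. abs x < r ==> t0 < t ==> t <= t1
   ==> (w x has_field_derivative wt x t) (at t within {t0..t1})"
  and ineq: "!!x t. abs x < r ==> t0 < t ==> t <= t1 ==> abs (wt x t - beta x t*w2 x t) <= C*abs (w1 x t) + e"
  and coeff: "!!x t. abs x < r ==> t0 < t ==> t <= t1 ==> 0 <= beta x t & beta x t <= Lambda"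
begin

lemma negated:
 "parabolic_inequality r t0 t1 C Lambda e (%x t. -w x t) (%x t. -w1 x t) (%x t. -w2 x t) (%x t. -wt x t) beta"
proof
 show "continuous_on ({-r..r} \<times> {t0..t1}) (%(x,t). -w x t)" using continuous_on_minus[OF cont] by (simp add: case_prod_beta)
 fix x t assume "abs x < r" "t0 < t" "t <= t1"
 thus "abs (-wt x t - beta x t * -w2 x t) <= C*abs (-w1 x t) + e" using ineq[of x t] by simp
qed (use r t01 C e coeff dx dxx dt in \<open>auto intro: DERIV_minus\<close>)

lemma upper_bound_at_center:
 assumes B: "!!x t. abs x <= r ==> t0 <= t ==> t <= t1 ==> w x t <= B" "B >= 0"
  and B0: "!!x. abs x <= r ==> w x t0 <= B0" "B0 >= 0"
 shows "w 0 t1 <= B0 + (t1-t0)*(e + 2*B*(Lambda+C*r)/r^2)"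
proof (rule field_le_epsilon)
 fix d :: real assume d: "d > 0"
 define N where "N = B/r^2"
 have N: "N >= 0" "N*r^2 = B" using B(2) r by (auto simp: N_def)
 define K where "K = e + 2*N*(Lambda+C*r) + d/(t1-t0)"
 define Z where "Z = (%(x,t). w x t - N*x^2 - K*(t-t0))"
 have "continuous_on ({-r..r} \<times> {t0..t1}) Z" using cont unfolding Z_def case_prod_beta by (auto intro!: continuous_intros)
 then obtain p where p: "p : {-r..r} \<times> {t0..t1}" "!!q. q : {-r..r} \<times> {t0..t1} ==> Z q <= Z p"
  using continuous_attains_sup[of "{-r..r} \<times> {t0..t1}" Z] r t01 by (auto simp: compact_Times)
 obtain x t where "p = (x,t)" by (cases p)
 hence xt: "abs x <= r" "t0 <= t" "t <= t1"
  and max: "!!x' t'. abs x' <= r ==> t0 <= t' ==> t' <= t1 ==> Z (x',t') <= Z (x,t)"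
  using p by (auto simp: abs_le_iff)
 have "Z (x,t) <= B0"
 proof (rule ccontr)
  assume neg: "~ Z (x,t) <= B0"
  have Kt: "K*(t-t0) >= 0" and Nx: "N*x^2 >= 0" using e N coeff[of 0 t1] r t01 C d xt by (auto simp: K_def)
  have "abs x ~= r" using neg N B(1)[of x t] xt Kt B0 by (auto simp: Z_def)
  hence x: "abs x < r" using xt by auto
  have "t ~= t0" using neg Nx B0(1)[of x] xt by (auto simp: Z_def)
  hence t: "t0 < t" "t <= t1" using xt by auto
  have "open {q. abs q < r}" by (intro open_Collect_less continuous_intros)
  from eventually_nhds_in_open[OF this, of x] have ev: "eventually (%q. abs q < r) (nhds x)" using x by simp
  have "DERIV (%q. Z (q,t)) q :> w1 q t - 2*N*q" if "abs q < r" for q unfolding Z_def by (rule derivative_eq_intros dx that t refl | simp)+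
  with ev have "eventually (%q. DERIV (%q. Z (q,t)) q :> w1 q t - 2*N*q) (nhds x)" by (auto elim!: eventually_mono)
  moreover have "DERIV (%q. w1 q t - 2*N*q) x :> w2 x t - 2*N" by (rule derivative_eq_intros dxx x t refl | simp)+
  moreover have "eventually (%q. Z (q,t) <= Z (x,t)) (nhds x)" using ev by (rule eventually_mono) (use max t in auto)
  ultimately have crit: "w1 x t - 2*N*x = 0" "w2 x t - 2*N <= 0" by (rule second_derivative_nonpos_at_max)+
  have "((%t. Z (x,t)) has_field_derivative (wt x t - K)) (at t within {t0..t1})"
   unfolding Z_def by (rule derivative_eq_intros dt[OF x t] refl | simp)+
  hence "wt x t - K >= 0" by (rule left_derivative_nonneg_at_max[OF _ t]) (use max xt in auto)
  moreover have "beta x t*w2 x t <= Lambda*(2*N)"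
   using coeff[OF x t] crit(2) N by (meson diff_le_0_iff_le mult_left_mono mult_right_mono mult_nonneg_nonneg order_trans zero_le_numeral)
  moreover have "C*abs (w1 x t) <= C*(2*N*r)" using crit(1) x N C by (intro mult_left_mono) (auto simp: abs_mult mult_left_mono)
  moreover have "d/(t1-t0) > 0" using d t01 by auto
  ultimately show False using ineq[OF x t] unfolding K_def by (simp add: algebra_simps)
 qed
 hence "w 0 t1 - K*(t1-t0) <= B0" using max[of 0 t1] r t01 by (simp add: Z_def)
 moreover have "K*(t1-t0) = (t1-t0)*(e + 2*B*(Lambda+C*r)/r^2) + d" unfolding K_def N_def using t01 by (simp add: field_simps)
 ultimately show "w 0 t1 <= B0 + (t1-t0)*(e + 2*B*(Lambda+C*r)/r^2) + d" by linarith
qed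

end

locale two_point_comparison = parabolic_inequality +
 fixes l W L N N2 d :: real
 assumes l: "l > 0" "4*C*r <= l"
  and elliptic: "!!x t. abs x < r ==> t0 < t ==> t <= t1 ==> l <= beta x t"
  and W: "!!x t. abs x <= r ==> t0 <= t ==> t <= t1 ==> abs (w x t) <= W"
  and N: "N = 2*W/r^2" and N2: "N2 >= 0" and d: "d >= 0"
  and L: "L >= 0" "L*l/(2*r) > 4*N*Lambda + 4*C*N*r + N2 + 2*e"
  and init: "!!x y. abs x <= r ==> abs y <= r ==> w x t0 - w y t0 <= 3/4*L*abs (x-y) + N2*(t1-t0) + d"
begin

definition Z :: "real => real => real => real" where
 "Z x y t = w x t - w y t - L*barrier r (abs (x-y)) - N*(x^2+y^2) - N2*(t1-t)"

lemma N_nonneg: "N >= 0" using W[of 0 t0] r t01 N by auto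

lemma Z_attains_max:
 obtains x y t where "abs x <= r" "abs y <= r" "t0 <= t" "t <= t1"
  "!!x' y' t'. abs x' <= r ==> abs y' <= r ==> t0 <= t' ==> t' <= t1 ==> Z x' y' t' <= Z x y t"
proof -
 define S where "S = {-r..r} \<times> {-r..r} \<times> {t0..t1}"
 have c: "continuous_on S (%p. w (h p) (snd (snd p)))"
  if "continuous_on S h" "!!p. p : S ==> h p : {-r..r}" for h
  using continuous_on_compose2[OF cont continuous_on_Pair, of S h "%p. snd (snd p)"] that
  by (fastforce simp: S_def intro!: continuous_intros)
 have "continuous_on S fst" "continuous_on S (%p. fst (snd p))" by (intro continuous_intros)+
 hence "continuous_on S (%p. w (fst p) (snd (snd p)))" "continuous_on S (%p. w (fst (snd p)) (snd (snd p)))" using c by (auto simp: S_def)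
 hence "continuous_on S (%p. Z (fst p) (fst (snd p)) (snd (snd p)))" unfolding Z_def barrier_def using r by (auto intro!: continuous_intros)
 moreover have "compact S" "S ~= {}" using r t01 by (auto simp: S_def intro!: compact_Times)
 ultimately obtain p where p: "p : S"
  "!!q. q : S ==> Z (fst q) (fst (snd q)) (snd (snd q)) <= Z (fst p) (fst (snd p)) (snd (snd p))"
  using continuous_attains_sup[of S "%p. Z (fst p) (fst (snd p)) (snd (snd p))"] by blast
 show thesis
 proof (rule that[of "fst p" "fst (snd p)" "snd (snd p)"])
  fix x' y' t' assume "abs x' <= r" "abs y' <= r" "t0 <= t'" "t' <= t1"
  thus "Z x' y' t' <= Z (fst p) (fst (snd p)) (snd (snd p))" using p(2)[of "(x',y',t')"] by (auto simp: S_def abs_le_iff)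
 qed (use p(1) in \<open>auto simp: S_def abs_le_iff\<close>)
qed

lemma Z_large_imp_interior:
 assumes xyt: "abs x <= r" "abs y <= r" "t0 <= t" "t <= t1" and large: "Z x y t > d"
 shows "abs x < r" "abs y < r" "t0 < t" "x ~= y"
proof -
 have bar: "L*(3/4*abs (x-y)) <= L*barrier r (abs (x-y))" using xyt r L(1) by (intro mult_left_mono barrier_bounds) auto
 have bar0: "0 <= L*barrier r (abs (x-y))" by (rule order_trans[OF mult_nonneg_nonneg bar]) (use L(1) in auto)
 have nonneg: "N2*(t1-t) >= 0" "N*x^2 >= 0" "N*y^2 >= 0" using N2 xyt N_nonneg by auto
 have "w x t - w y t <= N*r^2" using W[of x t] W[of y t] xyt N by auto
 hence "N*(x^2+y^2) < N*r^2" using large bar0 nonneg(1) d unfolding Z_def by linarith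
 hence "N*x^2 < N*r^2" "N*y^2 < N*r^2" using nonneg by (simp_all add: distrib_left)
 thus "abs x < r" "abs y < r" using N_nonneg r power2_less_imp_less[of "abs x" r] power2_less_imp_less[of "abs y" r]
  by (auto simp: mult_less_cancel_left)
 show "x ~= y" using large nonneg d by (auto simp: Z_def barrier_def)
 have "t ~= t0" using init[OF xyt(1,2)] bar nonneg large by (auto simp: Z_def distrib_left)
 thus "t0 < t" using xyt by auto
qed

lemma no_interior_max:
 assumes x: "abs x < r" and y: "abs y < r" and t: "t0 < t" "t <= t1" and ne: "x ~= y"
  and max: "!!x' y' t'. abs x' <= r ==> abs y' <= r ==> t0 <= t' ==> t' <= t1 ==> Z x' y' t' <= Z x y t"
 shows False
proof -
 define p where "p = L*(1 - abs (x-y)/(4*r)) * sgn (x-y)"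
 have max_t: "w x' t - w y' t - L*barrier r (abs (x'-y')) - N*(x'^2+y'^2)
  <= w x t - w y t - L*barrier r (abs (x-y)) - N*(x^2+y^2)" if "abs x' < r" "abs y' < r" for x' y'
  using max[of x' y' t] that t by (simp add: Z_def)
 have cond: "w1 x t = p + 2*N*x" "w1 y t = p - 2*N*y"
  "a^2*w2 x t - b^2*w2 y t + L/(4*r)*(a-b)^2 - 2*N*(a^2+b^2) <= 0" for a b
  using two_point_max_conditions[where f= "%x. w x t", OF r x y ne dx[OF _ t] dxx[OF _ t] max_t] unfolding p_def by blast+
 have "abs p <= L" using x y L(1) unfolding p_def by (simp add: abs_mult mult_left_le)
 moreover have "abs (2*N*x) <= 2*N*r" "abs (2*N*y) <= 2*N*r" using x y N_nonneg by (auto simp: abs_mult intro!: mult_left_mono)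
 ultimately have slope: "abs (w1 x t) <= L + 2*N*r" "abs (w1 y t) <= L + 2*N*r" unfolding cond(1,2) by linarith+
 define a b where "a = sqrt (beta x t)" and "b = -sqrt (beta y t)"
 have beta: "l <= beta x t" "beta x t <= Lambda" "l <= beta y t" "beta y t <= Lambda" using coeff elliptic x y t by auto
 have ab: "a^2 = beta x t" "b^2 = beta y t" using beta l by (auto simp: a_def b_def)
 have "2 * sqrt l <= a - b" using real_sqrt_le_mono[OF beta(1)] real_sqrt_le_mono[OF beta(3)] unfolding a_def b_def by linarith
 hence "(2 * sqrt l)^2 <= (a-b)^2" using l by (intro power_mono) auto
 hence "L/(4*r)*(4*l) <= L/(4*r)*(a-b)^2" using L(1) r l by (intro mult_left_mono) auto
 moreover have "N*beta x t <= N*Lambda" "N*beta y t <= N*Lambda" using beta N_nonneg by (auto intro: mult_left_mono)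
 ultimately have second: "beta x t*w2 x t - beta y t*w2 y t <= 4*N*Lambda - L*l/r"
  using cond(3)[of a b] unfolding ab by (simp add: algebra_simps)
 have "(Z x y has_field_derivative (wt x t - wt y t + N2)) (at t within {t0..t1})"
  unfolding Z_def[abs_def] by (rule derivative_eq_intros dt x y t refl | simp)+
 hence "wt x t - wt y t + N2 >= 0" by (rule left_derivative_nonneg_at_max[OF _ t]) (use max x y t in auto)
 moreover have "C*abs (w1 x t) <= C*(L+2*N*r)" "C*abs (w1 y t) <= C*(L+2*N*r)" using slope C by (auto intro: mult_left_mono)
 ultimately have "0 <= N2 + 2*e + 2*(C*(L+2*N*r)) + (4*N*Lambda - L*l/r)" using second ineq[OF x t] ineq[OF y t] by linarith
 moreover have "2*C*L <= L*l/(2*r)" using mult_right_mono[OF l(2) L(1)] r by (simp add: field_simps)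
 moreover have "2*(C*(L+2*N*r)) = 2*C*L + 4*C*N*r" by (simp add: algebra_simps)
 ultimately show False using L(2) by linarith
qed

lemma difference_upper_bound:
 assumes x0: "abs x0 <= r" shows "w x0 t1 - w 0 t1 <= (L+N*r)*abs x0 + d"
proof (rule ccontr)
 assume neg: "~ ?thesis"
 have "L*barrier r (abs x0) <= L*abs x0" using barrier_bounds(2) x0 r L(1) by (intro mult_left_mono) auto
 moreover have "N*x0^2 <= N*(r*abs x0)"
  using mult_right_mono[OF x0, of "abs x0"] N_nonneg by (intro mult_left_mono) (auto simp: power2_eq_square)
 ultimately have large: "Z x0 0 t1 > d" using neg by (simp add: Z_def algebra_simps)
 obtain x y t where max: "abs x <= r" "abs y <= r" "t0 <= t" "t <= t1"
  "!!x' y' t'. abs x' <= r ==> abs y' <= r ==> t0 <= t' ==> t' <= t1 ==> Z x' y' t' <= Z x y t"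
  by (rule Z_attains_max) blast
 have "Z x y t > d" using large max(5)[of x0 0 t1] x0 r t01 by auto
 from Z_large_imp_interior[OF max(1-4) this] no_interior_max max(4,5) show False by blast
qed

lemma negated_comparison:
 "two_point_comparison r t0 t1 C Lambda e (%x t. -w x t) (%x t. -w1 x t) (%x t. -w2 x t) (%x t. -wt x t) beta l W L N N2 d"
proof (intro two_point_comparison.intro two_point_comparison_axioms.intro negated)
 fix x y assume "abs x <= r" "abs y <= r"
 thus "-w x t0 - -w y t0 <= 3/4*L*abs (x-y) + N2*(t1-t0) + d" using init[of y x] by (simp add: abs_minus_commute)
qed (use l elliptic W N N2 d L in auto)

theorem difference_bound:
 assumes "abs x0 <= r" shows "abs (w x0 t1 - w 0 t1) <= (L+N*r)*abs x0 + d"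
 using difference_upper_bound[OF assms] two_point_comparison.difference_upper_bound[OF negated_comparison assms] by auto

end

lemma second_derivative_interpolation:
 fixes g g1 g2 :: "real => real"
 assumes h: "h > 0" and d1: "!!y. abs (y-x) <= h ==> DERIV g y :> g1 y"
  and d2: "!!y. abs (y-x) <= h ==> DERIV g1 y :> g2 y"
  and small: "!!y. abs (y-x) <= h ==> abs (g y) <= e"
  and lip: "!!y. abs (y-x) <= h ==> abs (g2 y - g2 x) <= L*abs (y-x)" and L: "L >= 0"
 shows "abs (g2 x) <= 4*e/h^2 + L*h"
proof -
 have "DERIV (%q. g (q+h) - g q) q :> g1 (q+h) - g1 q" if "x-h <= q" "q <= x" for q
  using DERIV_shift[of g "g1 (q+h)" q h] d1 that by (intro DERIV_diff) auto
 from MVT2[of "x-h" x, OF _ this] h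
 obtain z where z: "x-h < z" "z < x" "g (x+h) - 2*g x + g (x-h) = h*(g1 (z+h) - g1 z)" by auto
 obtain y where y: "z < y" "y < z+h" "g1 (z+h) - g1 z = h*g2 y" using MVT2[of z "z+h" g1 g2] z d2 by auto
 have g2y: "g2 y = (g (x+h) - 2*g x + g (x-h))/h^2" using z(3) y(3) h by (simp add: power2_eq_square)
 have yx: "abs (y-x) <= h" using y z by auto
 have "abs (g2 y) <= 4*e/h^2" using small[of "x+h"] small[of x] small[of "x-h"] h unfolding g2y by (simp add: divide_right_mono)
 moreover have "L*abs (y-x) <= L*h" using yx L by (intro mult_left_mono) auto
 ultimately show ?thesis using lip[OF yx] by linarith
qed

lemma first_derivative_interpolation:
 fixes g g1 g2 :: "real => real"
 assumes h: "h > 0" and d1: "!!y. abs (y-x) <= h ==> DERIV g y :> g1 y"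
  and d2: "!!y. abs (y-x) <= h ==> DERIV g1 y :> g2 y"
  and small: "!!y. abs (y-x) <= h ==> abs (g y) <= e"
  and S: "!!y. abs (y-x) <= h ==> abs (g2 y) <= S"
 shows "abs (g1 x) <= 2*e/h + S*h"
proof -
 obtain z where z: "x < z" "z < x+h" "g (x+h) - g x = h*g1 z" using MVT2[of x "x+h" g g1] h d1 by auto
 obtain y where y: "x < y" "y < z" "g1 z - g1 x = (z-x)*g2 y" using MVT2[of x z g1 g2] z d2 by auto
 have "abs (h*g1 z) <= 2*e" using small[of "x+h"] small[of x] h unfolding z(3)[symmetric] by auto
 hence "abs (g1 z) <= 2*e/h" using h by (simp add: field_simps)
 moreover have "abs ((z-x)*g2 y) <= h*S" unfolding abs_mult using S[of y] y z by (intro mult_mono) auto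
 ultimately show ?thesis using y(3) by (simp add: mult.commute)
qed

lemma penalized_min_imp_steep:
 fixes f :: "real => real"
 assumes d: "(f has_field_derivative d) (at t within {a..b})" and t: "t : {a..b}" "s : {a..b}" "t ~= s"
  and min: "!!t'. t' : {a..b} ==> f t + K*abs (t-s) <= f t' + K*abs (t'-s)"
 shows "K <= abs d"
proof (rule ccontr)
 assume steep: "~ K <= abs d"
 show False
 proof (cases "t < s")
  case True
  have "((%x. f x - K*x) has_field_derivative (d-K)) (at t within {a..b})" "d - K < 0" using steep by (auto intro!: derivative_eq_intros d)
  from has_real_derivative_neg_dec_right[OF this]
  obtain e where e: "e > 0" "!!h. h > 0 ==> t+h : {a..b} ==> h < e ==> f (t+h) - K*(t+h) < f t - K*t" by blast
  define h where "h = min e (s-t)/2"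
  have "h > 0" "h < e" "h < s-t" using e(1) True by (auto simp: h_def)
  thus False using e(2)[of h] min[of "t+h"] t by (auto simp: algebra_simps)
 next
  case False
  have "((%x. f x + K*x) has_field_derivative (d+K)) (at t within {a..b})" "0 < d + K" using steep by (auto intro!: derivative_eq_intros d)
  from has_real_derivative_pos_inc_left[OF this]
  obtain e where e: "e > 0" "!!h. h > 0 ==> t-h : {a..b} ==> h < e ==> f (t-h) + K*(t-h) < f t + K*t" by blast
  define h where "h = min e (t-s)/2"
  have "h > 0" "h < e" "h < t-s" using e(1) False t(3) by (auto simp: h_def)
  thus False using e(2)[of h] min[of "t-h"] t by (auto simp: algebra_simps)
 qed
qed

lemma mvt_between:
 fixes f :: "real => real"
 assumes "!!z. min x y <= z ==> z <= max x y ==> DERIV f z :> f' z"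
 obtains z where "min x y <= z" "z <= max x y" "f y - f x = f' z*(y-x)"
proof (cases x y rule: linorder_cases)
 case less
 then obtain z where "x < z" "z < y" "f y - f x = (y-x)*f' z" using MVT2[of x y f f'] assms by auto
 thus thesis using that[of z] by simp
next
 case greater
 then obtain z where "y < z" "z < x" "f x - f y = (x-y)*f' z" using MVT2[of y x f f'] assms by auto
 thus thesis using that[of z] by (simp add: algebra_simps)
qed (use that in auto)

text \<open>Chain rule for F s (X s) where F is differentiable in s only along the fixed argument X t: each of the
 derivatives of s |-> F s (X t), X and s |-> F s (X s) at t is determined by the other two.\<close>

context
 fixes F F1 :: "real => real => real" and X :: "real => real" and S :: "real set" and t a b :: real
 assumes t: "t : S" "X t : {a<..<b}"
  and F: "!!s x. s : S ==> x : {a<..<b} ==> DERIV (F s) x :> F1 s x"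
  and F1: "continuous_on (S \<times> {a<..<b}) (%(s,x). F1 s x)"
begin

lemma mvt_quotient:
 assumes X: "(X \<longlongrightarrow> X t) (at t within S)"
 obtains m where "(m \<longlongrightarrow> F1 t (X t)) (at t within S)" "eventually (%s. (F s (X s) - F t (X t))/(s-t)
  = (F s (X t) - F t (X t))/(s-t) + m s*((X s - X t)/(s-t))) (at t within S)"
proof -
 have ev: "eventually (%s. s : S & X s : {a<..<b}) (at t within S)"
  using topological_tendstoD[OF X open_greaterThanLessThan t(2)] by (auto simp: eventually_at_filter)
 have "EX z. s : S & X s : {a<..<b} --> z : {a<..<b} & abs (z - X t) <= abs (X s - X t)
   & F s (X s) - F s (X t) = F1 s z*(X s - X t)" for s
 proof (cases "s : S & X s : {a<..<b}")
  case True
  hence "DERIV (F s) z :> F1 s z" if "min (X t) (X s) <= z" "z <= max (X t) (X s)" for z using that t(2) by (intro F) auto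
  from mvt_between[OF this]
  obtain z where "min (X t) (X s) <= z" "z <= max (X t) (X s)" "F s (X s) - F s (X t) = F1 s z*(X s - X t)" .
  thus ?thesis using t(2) by (intro exI[of _ z]) auto
 qed auto
 then obtain z where z: "!!s. s : S ==> X s : {a<..<b} ==> z s : {a<..<b}"
   "!!s. s : S ==> X s : {a<..<b} ==> abs (z s - X t) <= abs (X s - X t)"
   "!!s. s : S ==> X s : {a<..<b} ==> F s (X s) - F s (X t) = F1 s (z s)*(X s - X t)"
  by metis
 have "((%s. z s - X t) \<longlongrightarrow> 0) (at t within S)"
  using ev by (intro Lim_null_comparison[OF _ tendsto_rabs_zero[OF LIM_zero[OF X]]]) (auto elim!: eventually_mono intro: z)
 hence "((%s. (s, z s)) \<longlongrightarrow> (t, X t)) (at t within S)" by (intro tendsto_Pair tendsto_ident_at) (simp add: LIM_zero_iff)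
 moreover have "eventually (%s. (s, z s) : S \<times> {a<..<b}) (at t within S)" using ev by (rule eventually_mono) (use z(1) in force)
 ultimately have "((%s. F1 s (z s)) \<longlongrightarrow> F1 t (X t)) (at t within S)"
  using continuous_on_tendsto_compose[OF F1, of "%s. (s, z s)" "(t, X t)"] t by auto
 moreover have "eventually (%s. (F s (X s) - F t (X t))/(s-t)
   = (F s (X t) - F t (X t))/(s-t) + F1 s (z s)*((X s - X t)/(s-t))) (at t within S)"
  using ev
 proof (rule eventually_mono)
  fix s assume "s : S & X s : {a<..<b}"
  hence "F s (X s) - F t (X t) = F s (X t) - F t (X t) + F1 s (z s)*(X s - X t)" using z(3)[of s] by simp
  thus "(F s (X s) - F t (X t))/(s-t) = (F s (X t) - F t (X t))/(s-t) + F1 s (z s)*((X s - X t)/(s-t))"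
   by (simp only: add_divide_distrib times_divide_eq_right)
 qed
 ultimately show thesis by (rule that)
qed

lemma composite_derivative:
 assumes e: "((%s. F s (X t)) has_field_derivative e) (at t within S)" and d: "(X has_field_derivative d) (at t within S)"
 shows "((%s. F s (X s)) has_field_derivative e + F1 t (X t)*d) (at t within S)"
proof -
 obtain m where m: "(m \<longlongrightarrow> F1 t (X t)) (at t within S)" "eventually (%s. (F s (X s) - F t (X t))/(s-t)
   = (F s (X t) - F t (X t))/(s-t) + m s*((X s - X t)/(s-t))) (at t within S)"
  using mvt_quotient DERIV_continuous[OF d] unfolding continuous_within by blast
 have "((%s. (F s (X t) - F t (X t))/(s-t) + m s*((X s - X t)/(s-t))) \<longlongrightarrow> e + F1 t (X t)*d) (at t within S)"
  using e d unfolding has_field_derivative_iff by (intro tendsto_intros m(1))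
 thus ?thesis unfolding has_field_derivative_iff tendsto_cong[OF m(2)] .
qed

lemma partial_derivative:
 assumes c: "((%s. F s (X s)) has_field_derivative c) (at t within S)" and d: "(X has_field_derivative d) (at t within S)"
 shows "((%s. F s (X t)) has_field_derivative c - F1 t (X t)*d) (at t within S)"
proof -
 obtain m where m: "(m \<longlongrightarrow> F1 t (X t)) (at t within S)" "eventually (%s. (F s (X s) - F t (X t))/(s-t)
   = (F s (X t) - F t (X t))/(s-t) + m s*((X s - X t)/(s-t))) (at t within S)"
  using mvt_quotient DERIV_continuous[OF d] unfolding continuous_within by blast
 have "((%s. (F s (X s) - F t (X t))/(s-t) - m s*((X s - X t)/(s-t))) \<longlongrightarrow> c - F1 t (X t)*d) (at t within S)"
  using c d unfolding has_field_derivative_iff by (intro tendsto_intros m(1))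
 thus ?thesis unfolding has_field_derivative_iff by (rule Lim_transform_eventually) (use m(2) in \<open>auto elim!: eventually_mono\<close>)
qed

lemma implicit_derivative:
 assumes X: "(X \<longlongrightarrow> X t) (at t within S)" and zero: "!!s. s : S ==> F s (X s) = 0"
  and e: "((%s. F s (X t)) has_field_derivative e) (at t within S)" and nz: "F1 t (X t) ~= 0"
 shows "(X has_field_derivative -e/F1 t (X t)) (at t within S)"
proof -
 obtain m where m: "(m \<longlongrightarrow> F1 t (X t)) (at t within S)" "eventually (%s. (F s (X s) - F t (X t))/(s-t)
   = (F s (X t) - F t (X t))/(s-t) + m s*((X s - X t)/(s-t))) (at t within S)"
  using mvt_quotient[OF X] by blast
 have "((%s. -((F s (X t) - F t (X t))/(s-t))/m s) \<longlongrightarrow> -e/F1 t (X t)) (at t within S)"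
  using e nz unfolding has_field_derivative_iff by (intro tendsto_intros m(1))
 moreover have "eventually (%s. s : S) (at t within S)" by (simp add: eventually_at_filter)
 with m(2) tendsto_imp_eventually_ne[OF m(1) nz]
 have "eventually (%s. -((F s (X t) - F t (X t))/(s-t))/m s = (X s - X t)/(s-t)) (at t within S)"
 proof eventually_elim
  case (elim s)
  hence "m s*((X s - X t)/(s-t)) = -((F s (X t) - F t (X t))/(s-t))" using zero t by simp
  thus ?case using elim(2) by (metis nonzero_mult_div_cancel_left)
 qed
 ultimately show ?thesis unfolding has_field_derivative_iff by (rule Lim_transform_eventually)
qed

end

lemma local_inverse:
 fixes X X' :: "real => real"
 assumes X: "!!u. DERIV X u :> X' u" and X': "continuous_on UNIV X'" and nz: "X' u ~= 0"
 obtains V v where "open V" "X u : V" "!!y. y : V ==> X (v y) = y" "v (X u) = u" "DERIV v (X u) :> inverse (X' u)"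
proof -
 define D where "D w = X' w *\<^sub>R (id_blinfun :: real \<Rightarrow>\<^sub>L real)" for w
 have "(X has_derivative D w) (at w)" for w using X[of w] by (simp add: has_field_derivative_def D_def scaleR_blinfun.rep_eq)
 moreover have "continuous_on UNIV D" unfolding D_def using X' by (intro continuous_intros)
 moreover have "inverse (X' u) *\<^sub>R id_blinfun o\<^sub>L D u = id_blinfun"
  using nz by (intro blinfun_eqI) (simp add: D_def scaleR_blinfun.rep_eq)
 ultimately obtain U V v v' where V: "open V" "X u : V" "u : U" "homeomorphism U V X v"
  "!!y. y : V ==> (v has_derivative v' y) (at y)"
  using inverse_function_theorem[of UNIV X D u "inverse (X' u) *\<^sub>R id_blinfun"] by (metis UNIV_I open_UNIV)
 have v: "X (v y) = y" if "y : V" for y using V(4) that by (simp add: homeomorphism_apply2)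
 have vu: "v (X u) = u" using V(3,4) by (simp add: homeomorphism_apply1)
 obtain e where e: "e > 0" "ball (X u) e <= V" using V(1,2) open_contains_ball by blast
 have "DERIV v (X u) :> inverse (X' u)"
 proof (rule DERIV_inverse_function[where f=X and D= "X' u" and a= "X u - e" and b= "X u + e"])
  show "isCont v (X u)" using has_derivative_continuous[OF V(5)[OF V(2)]] .
  show "X (v y) = y" if "X u - e < y" "y < X u + e" for y using that e(2) by (intro v) (auto simp: dist_real_def)
 qed (use X nz e(1) vu in auto)
 thus thesis using that[OF V(1,2) v vu] by blast
qed

lemma tendsto_of_compact_subsequences:
 fixes x :: "nat => 'a :: metric_space" and f :: "nat => 'b :: metric_space"
 assumes K: "compact K" "!!n. x n : K"
  and sub: "!!r l. strict_mono r ==> (x \<circ> r) \<longlonglongrightarrow> l ==> (f \<circ> r) \<longlonglongrightarrow> a"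
 shows "f \<longlonglongrightarrow> a"
proof (rule ccontr)
 assume "~ f \<longlonglongrightarrow> a"
 then obtain e where e: "e > 0" "~ eventually (%n. dist (f n) a < e) sequentially" unfolding tendsto_iff by auto
 then obtain r :: "nat => nat" where r: "strict_mono r" "!!n. ~ dist (f (r n)) a < e" using infinite_enumerate[of "{n. ~ dist (f n) a < e}"]
  by (auto simp: INFM_iff_infinite cofinite_eq_sequentially[symmetric])
 have "ALL n. (x \<circ> r) n : K" using K(2) by simp
 then obtain l q where q: "strict_mono q" "((x \<circ> r) \<circ> q) \<longlonglongrightarrow> l" using K(1) unfolding compact_def by blast
 hence "(f \<circ> (r \<circ> q)) \<longlonglongrightarrow> a" using sub[OF strict_mono_o[OF r(1) q(1)]] by (simp add: o_assoc)
 hence "eventually (%n. dist (f (r (q n))) a < e) sequentially" using e(1) unfolding tendsto_iff by auto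
 thus False using r(2) by auto
qed

definition c2loop :: "(real => complex) => bool" where
 "c2loop g \<longleftrightarrow> jordan_loop g & continuous_on UNIV (d2 g)
  & (ALL u. g differentiable (at u) & d1 g differentiable (at u) & d1 g u ~= 0)"

definition tangent :: "(real => complex) => real => complex" where
 "tangent g u = d1 g u/complex_of_real (cmod (d1 g u))"

definition arclen :: "(real => complex) => real => real => real" where
 "arclen g u v = (v-u)*integral {0..1} (%q. cmod (d1 g (u + (v-u)*q)))"

definition coord :: "complex => complex => complex => complex" where
 "coord p T z = cnj T*(z-p)"

abbreviation tcoord :: "(real => complex) => real => complex => complex" where
 "tcoord g u \<equiv> coord (g u) (tangent g u)"

lemma c2loopD:
 assumes "c2loop g"
 shows "jordan_loop g" "!!u. (g has_vector_derivative d1 g u) (at u)"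
  "!!u. (d1 g has_vector_derivative d2 g u) (at u)" "!!u. d1 g u ~= 0"
  "continuous_on UNIV (d2 g)" "!!u. g (u+1) = g u" "inj_on g {0..<1}"
  "continuous_on UNIV g" "continuous_on UNIV (d1 g)" "!!u. cmod (d1 g u) > 0"
proof -
 show der: "!!u. (g has_vector_derivative d1 g u) (at u)" "!!u. (d1 g has_vector_derivative d2 g u) (at u)"
  using assms unfolding c2loop_def d2_def[of g] by (auto simp: vector_derivative_works[symmetric] d1_def)
 show "continuous_on UNIV g" "continuous_on UNIV (d1 g)"
  using der by (auto simp: continuous_on_eq_continuous_at intro: has_vector_derivative_continuous)
qed (use assms in \<open>auto simp: c2loop_def jordan_loop_def\<close>)

lemma has_vector_derivative_shift:
 assumes "(g has_vector_derivative y) (at (u+a))"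
 shows "((%u. g (u+a)) has_vector_derivative y) (at (u :: real))"
proof -
 have "((%u. u+a) has_vector_derivative 1) (at u)" by (auto intro!: derivative_eq_intros)
 from vector_diff_chain_at[OF this assms] show ?thesis by (simp add: o_def)
qed

lemma periodic_int:
 fixes f :: "real => 'a"
 assumes "!!u. f (u+1) = f u"
 shows "f (u + of_int n) = f u"
proof (induction n rule: int_induct[where k = 0])
 case (step1 i) thus ?case using assms[of "u + of_int i"] by (simp add: add.assoc)
next
 case (step2 i) thus ?case using assms[of "u + of_int (i-1)"] by simp
qed simp

lemma periodic_frac:
 fixes f :: "real => 'a"
 assumes "!!u. f (u+1) = f u"
 shows "f (frac u) = f u"
 using periodic_int[of f "frac u" "\<lfloor>u\<rfloor>", OF assms] by (simp add: frac_def)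

lemma periodic_range:
 fixes f :: "real => 'a"
 assumes "!!u. f (u+1) = f u"
 shows "range f = f ` {0..1}"
proof (intro equalityI image_subsetI)
 fix u show "f u : f ` {0..1}"
  using periodic_frac[of f u, OF assms] frac_lt_1[of u] by (intro image_eqI[of _ _ "frac u"]) auto
qed auto

lemma periodic_attains_inf:
 fixes h :: "real => real"
 assumes c: "continuous_on UNIV h" and per: "!!u. h (u+1) = h u"
 obtains u0 where "u0 : {0..1}" "!!u. h u0 <= h u"
proof -
 obtain u0 where u0: "u0 : {0..1}" "!!u. u : {0..1} ==> h u0 <= h u"
  using continuous_attains_inf[of "{0..1}" h] continuous_on_subset[OF c] by auto
 have "h u0 <= h u" for u using u0(2)[of "frac u"] periodic_frac[of h, OF per] frac_lt_1[of u] by auto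
 thus thesis using that u0(1) by blast
qed

lemma c2loop_periodic:
 assumes "c2loop g"
 shows "d1 g (u+1) = d1 g u" "d2 g (u+1) = d2 g u" "curv1 g (u+1) = curv1 g u" "tangent g (u+1) = tangent g u"
proof -
 note c = c2loopD[OF assms]
 have d1: "d1 g (u+1) = d1 g u" for u
  using has_vector_derivative_shift[OF c(2)[of "u+1"]] c(6) by (intro vector_derivative_unique_at[OF _ c(2)]) simp
 thus "d1 g (u+1) = d1 g u" .
 show d2: "d2 g (u+1) = d2 g u"
  using has_vector_derivative_shift[OF c(3)[of "u+1"]] d1 by (intro vector_derivative_unique_at[OF _ c(3)]) simp
 show "curv1 g (u+1) = curv1 g u" "tangent g (u+1) = tangent g u" using d1 d2 by (simp_all add: curv1_def tangent_def)
qed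

lemma tangent_unit: assumes "c2loop g" shows "cmod (tangent g u) = 1" "d1 g u = cmod (d1 g u)*tangent g u"
 using c2loopD(4)[OF assms, of u] by (auto simp: tangent_def norm_divide)

lemma norm_has_real_derivative:
 assumes h: "(h has_vector_derivative h') (at u)" and nz: "h u ~= (0 :: complex)"
 shows "DERIV (%w. cmod (h w)) u :> Re (cnj (h u)*h')/cmod (h u)"
 unfolding has_field_derivative_def
 by (rule has_derivative_eq_rhs[OF has_derivative_compose[OF h[unfolded has_vector_derivative_def] has_derivative_norm[OF nz]]])
  (simp add: fun_eq_iff inner_complex_def divide_inverse algebra_simps)

lemma unit_has_vector_derivative:
 assumes h: "(h has_vector_derivative h') (at u)" "h u ~= 0"
 shows "((%w. h w/complex_of_real (cmod (h w))) has_vector_derivative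
  \<i> * of_real (Im (cnj (h u)*h')/(cmod (h u))^3)*h u) (at u)"
proof -
 define a n R J where "a = h u" and "n = cmod a" and "R = Re (cnj a*h')" and "J = Im (cnj a*h')"
 have "DERIV (%w. inverse (cmod (h w))) u :> -(R/n^3)" using DERIV_inverse_fun[OF norm_has_real_derivative[OF h]] h(2)
  by (simp add: R_def n_def a_def power3_eq_cube divide_inverse mult.assoc)
 from has_vector_derivative_scaleR[OF this h(1)]
 have "((%w. h w/complex_of_real (cmod (h w))) has_vector_derivative h'/of_real n - of_real (R/n^3)*a) (at u)"
  by (simp add: scaleR_conv_of_real divide_inverse mult.commute n_def a_def)
 moreover have "h' = a*(of_real R + \<i> * of_real J)/of_real (n^2)"
 proof -
  have "a*cnj a = of_real (n^2)" unfolding n_def by (metis complex_norm_square)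
  hence "h' * of_real (n^2) = a*(cnj a*h')" by (metis mult.assoc mult.commute)
  also have "cnj a*h' = of_real R + \<i> * of_real J" unfolding R_def J_def by (rule complex_eq)
  finally show ?thesis using h(2) by (simp add: field_simps n_def a_def)
 qed
 hence "h'/of_real n - of_real (R/n^3)*a = \<i> * of_real (J/n^3)*a"
  using h(2) by (simp add: field_simps power2_eq_square power3_eq_cube n_def a_def)
 ultimately show ?thesis unfolding J_def n_def a_def by simp
qed

lemma tangent_has_vector_derivative:
 assumes "c2loop g"
 shows "(tangent g has_vector_derivative (\<i>*curv1 g u*d1 g u)) (at u)"
 using unit_has_vector_derivative[OF c2loopD(3,4)[OF assms]] unfolding tangent_def[abs_def] curv1_def .

lemma continuous_antiderivative:
 fixes h :: "real => real"
 assumes "continuous_on UNIV h"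
 obtains H where "!!u. DERIV H u :> h u"
 using einterval_antiderivative[of "-\<infinity>" \<infinity> h] assms
 by (auto simp: continuous_on_eq_continuous_at has_real_derivative_iff_has_vector_derivative)

lemma arclen_eq_diff:
 assumes "!!u. DERIV H u :> cmod (d1 g u)"
 shows "arclen g u v = H v - H u"
proof -
 have "((%q. (v-u)*cmod (d1 g (u + (v-u)*q))) has_integral H (u + (v-u)*1) - H (u + (v-u)*0)) {0..1}"
 proof (rule fundamental_theorem_of_calculus)
  fix q :: real
  have "DERIV (%q. H (u + (v-u)*q)) q :> cmod (d1 g (u + (v-u)*q))*(v-u)"
   by (rule DERIV_chain2[OF assms]) (auto intro!: derivative_eq_intros)
  thus "((%q. H (u + (v-u)*q)) has_vector_derivative (v-u)*cmod (d1 g (u + (v-u)*q))) (at q within {0..1})"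
   by (simp add: has_real_derivative_iff_has_vector_derivative mult.commute has_vector_derivative_at_within)
 qed simp
 from integral_unique[OF this] show ?thesis unfolding arclen_def by simp
qed

lemma arclen_refl [simp]: "arclen g u u = 0" by (simp add: arclen_def)

context
 fixes g :: "real => complex"
 assumes c: "c2loop g"
begin

lemma arclen_position:
 obtains H where "!!u. DERIV H u :> cmod (d1 g u)" "!!u v. arclen g u v = H v - H u"
proof -
 have "continuous_on UNIV (%u. cmod (d1 g u))" using c2loopD(9)[OF c] by (intro continuous_intros)
 then obtain H where H: "!!u. DERIV H u :> cmod (d1 g u)" using continuous_antiderivative by blast
 thus thesis using that arclen_eq_diff[OF H] by blast
qed

lemma arclen_add: "arclen g u v + arclen g v w = arclen g u w" by (rule arclen_position) simp

lemma arclen_commute: "arclen g v u = -arclen g u v" using arclen_add[of u v u] by simp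

lemma DERIV_arclen: "DERIV (arclen g u) v :> cmod (d1 g v)"
proof (rule arclen_position)
 fix H assume H: "!!u. DERIV H u :> cmod (d1 g u)" "!!u v. arclen g u v = H v - H u"
 show ?thesis unfolding H(2)[abs_def] using DERIV_diff[OF H(1) DERIV_const] by simp
qed

lemma arclen_pos_iff: "0 < arclen g u v \<longleftrightarrow> u < v"
proof -
 have pos: "0 < arclen g u v" if "u < v" for u v
  using DERIV_pos_imp_increasing[OF that, of "arclen g u"] DERIV_arclen c2loopD(10)[OF c] by fastforce
 show ?thesis using pos[of u v] pos[of v u] arclen_commute[of u v] by (cases u v rule: linorder_cases) auto
qed

lemma arclen_less_iff: "arclen g u v < arclen g u w \<longleftrightarrow> v < w" using arclen_pos_iff[of v w] arclen_add[of u v w] by auto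

lemma arclen_le_iff: "arclen g u v <= arclen g u w \<longleftrightarrow> v <= w" using arclen_less_iff[of u w v] by auto

lemma arclen_nonneg_iff: "0 <= arclen g u v \<longleftrightarrow> u <= v" using arclen_le_iff[of u u v] by simp

lemma abs_arclen_between:
 assumes "min u v <= w" "w <= max u v" shows "abs (arclen g u w) <= abs (arclen g u v)"
 using assms arclen_le_iff[of u w v] arclen_nonneg_iff[of u w] by (auto simp: min_def split: if_splits)

lemma arclen_surj: obtains v where "arclen g u v = s"
proof -
 have "continuous_on UNIV (%u. cmod (d1 g u))" using c2loopD(9)[OF c] by (intro continuous_intros)
 then obtain u0 where u0: "!!u. cmod (d1 g u0) <= cmod (d1 g u)"
  using periodic_attains_inf[of "%u. cmod (d1 g u)"] c2loop_periodic(1)[OF c] by metis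
 define m where "m = cmod (d1 g u0)"
 have grow: "m*(b-a) <= arclen g a b" if "a <= b" for a b
 proof -
  have "arclen g a a - m*a <= arclen g a b - m*b"
  proof (rule DERIV_nonneg_imp_nondecreasing[OF that], intro exI conjI)
   show "DERIV (%x. arclen g a x - m*x) x :> cmod (d1 g x) - m" for x by (rule derivative_eq_intros DERIV_arclen refl | simp)+
  qed (use u0 in \<open>simp add: m_def\<close>)
  thus ?thesis by (simp add: algebra_simps)
 qed
 define w where "w = abs s/m"
 have w: "w >= 0" "m*w = abs s" using c2loopD(10)[OF c] by (auto simp: w_def m_def)
 have "continuous_on {u-w..u+w} (arclen g u)" using DERIV_arclen by (meson DERIV_isCont continuous_at_imp_continuous_on)
 hence "EX v >= u-w. v <= u+w & arclen g u v = s" using grow[of "u-w" u] grow[of u "u+w"] w arclen_commute[of "u-w" u] by (intro IVT') auto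
 thus thesis using that by blast
qed

end

lemma norm_diff_le_of_derivative_bound:
 fixes f f' :: "real => 'a :: real_normed_vector" and \<phi> \<phi>' :: "real => real"
 assumes "a <= b" "!!x. (f has_vector_derivative f' x) (at x)" "!!x. DERIV \<phi> x :> \<phi>' x"
  "!!x. a <= x ==> x <= b ==> norm (f' x) <= \<phi>' x"
 shows "norm (f b - f a) <= \<phi> b - \<phi> a"
proof (cases "a = b")
 case False
 thus ?thesis using assms
  by (intro differentiable_bound_general[where f' = f' and \<phi>' = \<phi>'])
   (auto intro!: continuous_at_imp_continuous_on has_vector_derivative_continuous simp: has_real_derivative_iff_has_vector_derivative[symmetric])
qed auto

lemma tangent_lipschitz:
 assumes c: "c2loop g" and k: "!!u. abs (curv1 g u) <= M"
 shows "cmod (tangent g v - tangent g u) <= M*abs (arclen g u v)"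
proof (induction u v rule: linorder_wlog)
 case (le u v)
 have "cmod (tangent g v - tangent g u) <= M*arclen g u v - M*arclen g u u"
 proof (rule norm_diff_le_of_derivative_bound[OF le tangent_has_vector_derivative[OF c]])
  show "DERIV (%v. M*arclen g u v) x :> M*cmod (d1 g x)" for x by (rule DERIV_cmult[OF DERIV_arclen[OF c]])
 qed (use k in \<open>auto simp: norm_mult mult_right_mono\<close>)
 thus ?case using le by (simp add: arclen_nonneg_iff[OF c])
next
 case (sym u v) thus ?case by (simp add: norm_minus_commute arclen_commute[OF c, of v])
qed

lemma chord_le_arclen:
 assumes c: "c2loop g" shows "cmod (g v - g u) <= abs (arclen g u v)"
proof (induction u v rule: linorder_wlog)
 case (le u v)
 thus ?case using norm_diff_le_of_derivative_bound[OF le c2loopD(2)[OF c] DERIV_arclen[OF c, of u]] by simp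
next
 case (sym u v) thus ?case by (simp add: norm_minus_commute arclen_commute[OF c, of v])
qed

lemma Re_cnj_unit:
 assumes "cmod S = 1" "cmod T = 1"
 shows "Re (cnj S*T) = 1 - (cmod (T-S))^2/2"
proof -
 have "(cmod (T-S))^2 = (cmod T)^2 + (cmod S)^2 - 2*Re (cnj S*T)" unfolding cmod_power2 by (simp add: power2_eq_square algebra_simps)
 thus ?thesis using assms by (simp add: field_simps)
qed

lemma Im_cnj_unit:
 assumes "cmod S = 1"
 shows "abs (Im (cnj S*T)) <= cmod (T-S)"
proof -
 have "Im (cnj S*T) = Im (cnj S*(T-S))" by (simp add: right_diff_distrib)
 thus ?thesis using abs_Im_le_cmod[of "cnj S*(T-S)"] assms by (simp add: norm_mult)
qed

lemma coord_derivative: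
 assumes c: "c2loop h"
 shows "((%v. coord p T (h v)) has_vector_derivative cnj T*d1 h v) (at v)"
  "DERIV (%v. Re (coord p T (h v))) v :> cmod (d1 h v)*Re (cnj T*tangent h v)"
  "DERIV (%v. Im (coord p T (h v))) v :> cmod (d1 h v)*Im (cnj T*tangent h v)"
proof -
 show der: "((%v. coord p T (h v)) has_vector_derivative cnj T*d1 h v) (at v)"
  unfolding coord_def by (rule derivative_eq_intros c2loopD(2)[OF c] refl | simp)+
 have eq: "cnj T*d1 h v = of_real (cmod (d1 h v))*(cnj T*tangent h v)" using tangent_unit(2)[OF c, of v] by (metis mult.left_commute)
 show "DERIV (%v. Re (coord p T (h v))) v :> cmod (d1 h v)*Re (cnj T*tangent h v)"
  "DERIV (%v. Im (coord p T (h v))) v :> cmod (d1 h v)*Im (cnj T*tangent h v)"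
  using der unfolding has_vector_derivative_complex_iff eq by simp_all
qed

lemma coord_diff: "coord p T z - coord p T z' = cnj T*(z-z')" by (simp add: coord_def algebra_simps)

lemma norm_coord_diff: "cmod T = 1 ==> cmod (coord p T z - coord p T z') = cmod (z-z')" by (simp add: coord_diff norm_mult)

lemma coord_base [simp]: "coord p T p = 0" by (simp add: coord_def)

lemma cauchy_mvt_between:
 fixes f h :: "real => real"
 assumes "u ~= v" "!!x. DERIV f x :> f' x" "!!x. DERIV h x :> h' x"
 obtains c where "min u v < c" "c < max u v" "(f v - f u)*h' c = (h v - h u)*f' c"
proof (cases "u < v")
 case True
 thus thesis using GMVT'[of u v f h h' f'] assms(2,3) that by (force intro: DERIV_isCont)
next
 case False
 then obtain c where "v < c" "c < u" "(f u - f v)*h' c = (h u - h v)*f' c"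
  using GMVT'[of v u f h h' f'] assms by (force intro: DERIV_isCont)
 thus thesis using that[of c] by (simp add: left_diff_distrib)
qed

text \<open>Both estimates compare the coordinate of the arc with a function of its length by Cauchy's mean
 value theorem, so that no case distinction on the direction of the arc is needed.\<close>

lemma arc_advance:
 assumes c: "c2loop g" and k: "!!u. abs (curv1 g u) <= M" and s: "M*abs (arclen g u v) <= 1"
 obtains q where "1/2 <= q" "Re (tcoord g u (g v)) = q*arclen g u v"
proof (cases "u = v")
 case False
 obtain w where w: "min u v < w" "w < max u v" "(Re (tcoord g u (g v)) - Re (tcoord g u (g u)))*cmod (d1 g w)
   = (arclen g u v - arclen g u u)*(cmod (d1 g w)*Re (cnj (tangent g u)*tangent g w))"
  using cauchy_mvt_between[OF False coord_derivative(2)[OF c] DERIV_arclen[OF c]] by blast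
 have M: "M >= 0" using k[of 0] by auto
 have "cmod (tangent g w - tangent g u) <= M*abs (arclen g u w)" by (rule tangent_lipschitz[OF c k])
 also have "... <= 1" using abs_arclen_between[OF c, of u v w] w s M by (meson less_imp_le mult_left_mono order_trans)
 finally have "(cmod (tangent g w - tangent g u))^2 <= 1" by (simp add: power_le_one)
 hence "1/2 <= Re (cnj (tangent g u)*tangent g w)" using Re_cnj_unit tangent_unit(1)[OF c] by simp
 moreover have "Re (tcoord g u (g v)) = Re (cnj (tangent g u)*tangent g w)*arclen g u v" using w(3) c2loopD(4)[OF c, of w] by simp
 ultimately show thesis by (rule that)
qed (use that[of 1] in simp)

lemma arc_advance_ge:
 assumes "c2loop g" "!!u. abs (curv1 g u) <= M" "M*abs (arclen g u v) <= 1"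
 shows "abs (arclen g u v)/2 <= abs (Re (tcoord g u (g v)))"
  "0 <= arclen g u v ==> arclen g u v/2 <= Re (tcoord g u (g v))"
proof -
 obtain q where q: "1/2 <= q" "Re (tcoord g u (g v)) = q*arclen g u v" by (rule arc_advance[OF assms])
 show "abs (arclen g u v)/2 <= abs (Re (tcoord g u (g v)))" using mult_right_mono[OF q(1), of "abs (arclen g u v)"] q by simp
 show "arclen g u v/2 <= Re (tcoord g u (g v))" if "0 <= arclen g u v" using mult_right_mono[OF q(1) that] q by simp
qed

lemma arc_deviation:
 assumes c: "c2loop g" and k: "!!u. abs (curv1 g u) <= M"
 shows "abs (Im (tcoord g u (g v))) <= M*(arclen g u v)^2/2"
proof (cases "u = v")
 case False
 have "DERIV (%w. (arclen g u w)^2/2) w :> cmod (d1 g w)*arclen g u w" for w by (rule derivative_eq_intros DERIV_arclen[OF c] refl | simp)+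
 from cauchy_mvt_between[OF False coord_derivative(3)[OF c] this]
 obtain w where w: "min u v < w" "w < max u v"
  "(Im (tcoord g u (g v)) - Im (tcoord g u (g u)))*(cmod (d1 g w)*arclen g u w)
   = ((arclen g u v)^2/2 - (arclen g u u)^2/2)*(cmod (d1 g w)*Im (cnj (tangent g u)*tangent g w))"
  by blast
 hence "Im (tcoord g u (g v))*arclen g u w = (arclen g u v)^2/2*Im (cnj (tangent g u)*tangent g w)" using c2loopD(4)[OF c, of w] by simp
 from arg_cong[OF this, of abs] have eq: "abs (Im (tcoord g u (g v)))*abs (arclen g u w)
   = (arclen g u v)^2/2*abs (Im (cnj (tangent g u)*tangent g w))"
  by (simp add: abs_mult)
 have "abs (Im (cnj (tangent g u)*tangent g w)) <= M*abs (arclen g u w)"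
  using Im_cnj_unit[OF tangent_unit(1)[OF c]] tangent_lipschitz[OF c k] by (rule order_trans)
 from mult_left_mono[OF this, of "(arclen g u v)^2/2"]
 have "abs (Im (tcoord g u (g v)))*abs (arclen g u w) <= M*(arclen g u v)^2/2*abs (arclen g u w)" unfolding eq by (simp add: ac_simps)
 moreover have "arclen g u w ~= 0" using arclen_less_iff[OF c, of u u w] arclen_less_iff[OF c, of u w u] w(1,2) by auto
 ultimately show ?thesis by simp
qed simp

lemma arc_reaches_abscissa:
 assumes c: "c2loop h" and dir: "!!w. abs (arclen h v w) <= r ==> q <= s*Re (cnj T*tangent h w)"
  and s: "abs s = 1" and r: "r >= 0" and x: "abs (x - Re (coord p T (h v))) <= q*r"
 obtains w where "abs (arclen h v w) <= r" "Re (coord p T (h w)) = x"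
proof -
 define X where "X w = s*Re (coord p T (h w))" for w
 obtain a b where ab: "arclen h v a = -r" "arclen h v b = r" using arclen_surj[OF c] by metis
 have order: "a <= v" "v <= b" using arclen_le_iff[OF c, of v] ab r by (metis arclen_refl neg_le_0_iff_le)+
 have range: "abs (arclen h v w) <= r" if "a <= w" "w <= b" for w
  using that ab arclen_le_iff[OF c, of v w b] arclen_le_iff[OF c, of v a w] by simp
 have X: "DERIV X w :> cmod (d1 h w)*(s*Re (cnj T*tangent h w))" for w
  using DERIV_cmult[OF coord_derivative(2)[OF c], of s] unfolding X_def[abs_def] by (simp only: mult.left_commute)
 have mono: "X y - q*arclen h v y <= X z - q*arclen h v z" if "a <= y" "y <= z" "z <= b" for y z
 proof (rule DERIV_nonneg_imp_nondecreasing[OF that(2)], intro exI conjI)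
  fix w assume "y <= w" "w <= z"
  thus "0 <= cmod (d1 h w)*(s*Re (cnj T*tangent h w)) - q*cmod (d1 h w)"
   using mult_left_mono[OF dir[OF range], of w "cmod (d1 h w)"] that by (simp add: mult.commute)
 next
  show "DERIV (%w. X w - q*arclen h v w) w :> cmod (d1 h w)*(s*Re (cnj T*tangent h w)) - q*cmod (d1 h w)" for w
   by (rule DERIV_diff[OF X DERIV_cmult[OF DERIV_arclen[OF c]]])
 qed
 have "abs (s*x - X v) <= q*r" using x s unfolding X_def right_diff_distrib[symmetric] by (simp add: abs_mult)
 hence "X a <= s*x" "s*x <= X b" using mono[of a v] mono[of v b] order ab by auto
 moreover have "continuous_on {a..b} X" using X by (meson DERIV_isCont continuous_at_imp_continuous_on)
 ultimately obtain w where "a <= w" "w <= b" "X w = s*x" using IVT'[of X a "s*x" b] order by auto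
 thus thesis using that[of w] range s by (auto simp: X_def)
qed

lemma arc_reaches_tangent_abscissa:
 assumes c: "c2loop g" and k: "!!u. abs (curv1 g u) <= M" and r: "M*r <= 1" "abs x <= r/2"
 obtains w where "abs (arclen g u w) <= r" "Re (tcoord g u (g w)) = x"
proof (rule arc_reaches_abscissa[OF c, of u r "1/2" 1 "tangent g u" x "g u"])
 fix w assume w: "abs (arclen g u w) <= r"
 have "cmod (tangent g w - tangent g u) <= M*abs (arclen g u w)" by (rule tangent_lipschitz[OF c k])
 also have "... <= 1" using w r(1) k[of 0] by (meson abs_ge_zero mult_left_mono order_trans)
 finally have "(cmod (tangent g w - tangent g u))^2 <= 1" by (simp add: power_le_one)
 thus "1/2 <= 1*Re (cnj (tangent g u)*tangent g w)" using Re_cnj_unit tangent_unit(1)[OF c] by simp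
qed (use r that in auto)

definition hugs_tangents :: "real => real => (real => complex) => bool" where
 "hugs_tangents M eta g \<longleftrightarrow> (ALL u v. cmod (g v - g u) < eta
  --> abs (Im (tcoord g u (g v))) <= 2*M*(Re (tcoord g u (g v)))^2)"

definition noncollapsed :: "real => real => (real => complex) => bool" where
 "noncollapsed M eta g \<longleftrightarrow> (ALL u v. u <= v --> v <= u+1 --> cmod (g v - g u) < eta
  --> M*arclen g u v <= 1 | M*arclen g v (u+1) <= 1)"

definition in_box :: "complex => complex => real => complex => bool" where
 "in_box p T r z \<longleftrightarrow> abs (Re (coord p T z)) <= r & abs (Im (coord p T z)) <= r"

definition box_graph :: "complex => complex => real => (real => complex) => bool" where
 "box_graph p T r g \<longleftrightarrow>
  (ALL x. abs x <= r --> (EX u. Re (coord p T (g u)) = x & abs (Im (coord p T (g u))) <= r/2))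
  & (ALL u v. in_box p T r (g u) --> in_box p T r (g v)
    --> Re (coord p T (g u)) = Re (coord p T (g v)) --> g u = g v)
  & (ALL u. in_box p T r (g u) --> abs (Im (coord p T (g u))) <= r/2
    & 2*abs (Im (cnj T*d1 g u)) <= abs (Re (cnj T*d1 g u)))"

lemma noncollapsed_imp_hugs_tangents:
 assumes c: "c2loop g" and k: "!!u. abs (curv1 g u) <= M" and nc: "noncollapsed M eta g"
 shows "hugs_tangents M eta g"
 unfolding hugs_tangents_def
proof (intro allI impI)
 fix u v assume small: "cmod (g v - g u) < eta"
 define v' where "v' = u + frac (v-u)"
 have v': "u <= v'" "v' <= u+1" by (auto simp: v'_def frac_lt_1 less_imp_le)
 have gv: "g v' = g v" using periodic_int[of g v' "\<lfloor>v-u\<rfloor>"] c2loopD(6)[OF c] by (simp add: v'_def frac_def)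
 have short: "abs (Im (tcoord g a (g b))) <= 2*M*(Re (tcoord g a (g b)))^2" if "M*abs (arclen g a b) <= 1" for a b
 proof -
  have "abs (arclen g a b) <= abs (2*Re (tcoord g a (g b)))" using arc_advance_ge(1)[OF c k that] by simp
  hence "M*(arclen g a b)^2 <= M*(2*Re (tcoord g a (g b)))^2" using k[of 0] by (intro mult_left_mono) (auto simp: abs_le_square_iff)
  thus ?thesis using arc_deviation[OF c k, of a b] by simp
 qed
 have "M*arclen g u v' <= 1 | M*arclen g v' (u+1) <= 1" using nc v' small gv unfolding noncollapsed_def by auto
 thus "abs (Im (tcoord g u (g v))) <= 2*M*(Re (tcoord g u (g v)))^2"
 proof
  assume "M*arclen g u v' <= 1"
  thus ?thesis using short[of u v'] gv arclen_nonneg_iff[OF c, of u v'] v' by simp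
 next
  assume "M*arclen g v' (u+1) <= 1"
  moreover have "abs (arclen g (u+1) v') = arclen g v' (u+1)"
   using arclen_nonneg_iff[OF c, of v' "u+1"] arclen_commute[OF c, of "u+1" v'] v' by simp
  ultimately show ?thesis using short[of "u+1" v'] gv c2loopD(6)[OF c, of u] c2loop_periodic(4)[OF c, of u] by simp
 qed
qed

lemma abs_Re_of_small_Im:
 assumes "cmod c = 1" "abs (Im c) <= 2/10" shows "abs (Re c) >= 9/10"
proof -
 have "(Im c)^2 <= (2/10)^2" using assms(2) by (intro abs_le_square_iff[THEN iffD1]) auto
 hence "(9/10)^2 <= (Re c)^2" using assms(1) cmod_power2[of c] by (simp add: power2_eq_square)
 thus ?thesis using abs_le_square_iff[of "9/10" "Re c"] by simp
qed

lemma hugs_tangents_rotated: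
 fixes p T :: complex and h :: "real => complex"
 assumes h: "c2loop h" "hugs_tangents M eta h" and T: "cmod T = 1" and M: "M >= 0"
 defines "c \<equiv> %v. cnj T*tangent h v" and "zeta \<equiv> %v v'. coord p T (h v') - coord p T (h v)"
 assumes near: "cmod (zeta v v') < eta"
 shows "abs (Im (cnj (c v)*zeta v v')) <= 2*M*(Re (cnj (c v)*zeta v v'))^2"
  "abs (Im (c v))*abs (Re (zeta v v')) <= abs (Im (zeta v v')) + 2*M*(cmod (zeta v v'))^2"
  "abs (Re (c v))*abs (Im (zeta v v')) <= abs (Im (c v))*abs (Re (zeta v v')) + 2*M*(cmod (zeta v v'))^2"
proof -
 define k z where "k = c v" and "z = zeta v v'"
 have z: "z = cnj T*(h v' - h v)" unfolding z_def zeta_def coord_diff ..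
 have k: "cmod k = 1" unfolding k_def c_def using T tangent_unit(1)[OF h(1)] by (simp add: norm_mult)
 have "cnj k*z = tcoord h v (h v')" unfolding k_def c_def z using T by (simp add: coord_def complex_norm_square[symmetric])
 thus hug: "abs (Im (cnj (c v)*zeta v v')) <= 2*M*(Re (cnj (c v)*zeta v v'))^2"
  using h(2) near z T unfolding hugs_tangents_def k_def z_def by (simp add: norm_mult)
 have "(Re (cnj k*z))^2 <= (cmod z)^2" using abs_Re_le_cmod[of "cnj k*z"] k by (intro abs_le_square_iff[THEN iffD1]) (simp add: norm_mult)
 hence "2*M*(Re (cnj k*z))^2 <= 2*M*(cmod z)^2" using M by (intro mult_left_mono) auto
 hence cross: "abs (Re k*Im z - Im k*Re z) <= 2*M*(cmod z)^2" using hug unfolding k_def z_def by simp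
 have "abs (Re k*Im z) <= abs (Im z)" using abs_Re_le_cmod[of k] k by (simp add: abs_mult mult_left_le_one_le)
 thus "abs (Im (c v))*abs (Re (zeta v v')) <= abs (Im (zeta v v')) + 2*M*(cmod (zeta v v'))^2"
  "abs (Re (c v))*abs (Im (zeta v v')) <= abs (Im (c v))*abs (Re (zeta v v')) + 2*M*(cmod (zeta v v'))^2"
  using cross unfolding abs_mult[symmetric] k_def[symmetric] z_def[symmetric] by linarith+
qed

text \<open>In a tangent box of the curve g at scale l, a curve h that stays close to g is a graph: two chords of h,
 from its point near the centre of the box and from a point one arc length 2l ahead, control the tangent of h.\<close>

context
 fixes g h :: "real => complex" and M eta l u0 :: real
 assumes g: "c2loop g" "!!u. abs (curv1 g u) <= M" and h: "c2loop h" "!!u. abs (curv1 h u) <= M"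
  and hug: "hugs_tangents M eta h" and l: "l > 0" "1000*M*l <= 1" "8*l <= eta"
  and near: "!!u. EX v. cmod (h v - g u) <= l/100"
begin

abbreviation position :: "real => complex" where "position v \<equiv> tcoord g u0 (h v)"
abbreviation direction :: "real => complex" where "direction v \<equiv> cnj (tangent g u0)*tangent h v"
abbreviation boxed :: "real => bool" where "boxed v \<equiv> in_box (g u0) (tangent g u0) (l/2) (h v)"

lemma M_nonneg: "M >= 0" using g(2)[of 0] by auto

lemma quadratic_error: "2*M*(cmod zeta)^2 <= a^2*l/500" if "cmod zeta <= a*l"
proof -
 have "(1000*M*l)*(a^2*l) <= 1*(a^2*l)" using l by (intro mult_right_mono) auto
 moreover have "M*(cmod zeta)^2 <= M*(a*l)^2" using that M_nonneg by (intro mult_left_mono power_mono) auto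
 ultimately show ?thesis by (simp add: power2_eq_square algebra_simps)
qed

lemma relative_tangent_unit: "cmod (direction v) = 1" using tangent_unit(1)[OF g(1)] tangent_unit(1)[OF h(1)] by (simp add: norm_mult)

lemmas relative_hug = hugs_tangents_rotated[OF h(1) hug tangent_unit(1)[OF g(1)] M_nonneg, of "g u0" u0]

lemma point_ahead:
 obtains v where "99/100*l <= Re (position v)" "Re (position v) <= 201/100*l"
  "abs (Im (position v)) <= 12/1000*l"
proof -
 obtain w where w: "arclen g u0 w = 2*l" by (rule arclen_surj[OF g(1)])
 have "M*abs (arclen g u0 w) <= 1" using w l by simp
 hence "l <= Re (tcoord g u0 (g w))" using arc_advance_ge(2)[OF g] w l by fastforce
 moreover have "abs (Im (tcoord g u0 (g w))) <= l/500" using arc_deviation[OF g, of u0 w] quadratic_error[of "2*l" 2] l w by simp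
 moreover have "cmod (tcoord g u0 (g w) - tcoord g u0 (g u0)) <= 2*l"
  using chord_le_arclen[OF g(1), of w u0] w l by (simp add: norm_coord_diff[OF tangent_unit(1)[OF g(1)]] del: coord_base)
 hence "Re (tcoord g u0 (g w)) <= 2*l" using complex_Re_le_cmod[of "tcoord g u0 (g w)"] by simp
 moreover obtain v where "cmod (h v - g w) <= l/100" using near by blast
 hence "cmod (position v - tcoord g u0 (g w)) <= l/100" by (simp add: norm_coord_diff tangent_unit(1)[OF g(1)])
 ultimately show thesis using abs_Re_le_cmod[of "position v - tcoord g u0 (g w)"]
   abs_Im_le_cmod[of "position v - tcoord g u0 (g w)"] by (intro that[of v]) auto
qed

lemma chord_tilt:
 assumes "cmod (position v' - position v) <= a*l" "a <= 7"
  and "b*l <= abs (Re (position v' - position v))"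
  and "abs (Im (position v' - position v)) <= d*l"
 shows "b*abs (Im (direction v)) <= d + a^2/500"
proof -
 define zeta where "zeta = position v' - position v"
 have "abs (Im (direction v))*abs (Re zeta) <= abs (Im zeta) + 2*M*(cmod zeta)^2"
  using assms(2) l mult_right_mono[of a 7 l] relative_hug(2)[of v' v] assms(1) unfolding zeta_def by linarith
 moreover have "abs (Im (direction v))*(b*l) <= abs (Im (direction v))*abs (Re zeta)"
  using assms(3) unfolding zeta_def by (intro mult_left_mono) auto
 moreover have "(d + a^2/500)*l = d*l + a^2*l/500" by (simp add: algebra_simps)
 ultimately have "abs (Im (direction v))*(b*l) <= (d + a^2/500)*l"
  using quadratic_error[OF assms(1)] assms(4) unfolding zeta_def by linarith
 hence "(b*abs (Im (direction v)))*l <= (d + a^2/500)*l" by (simp only: mult_ac)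
 thus ?thesis using l(1) by simp
qed

lemma point_at_base:
 obtains v where "abs (Re (position v)) <= l/100" "abs (Im (position v)) <= l/100"
  "abs (Im (direction v)) <= 4/100"
proof -
 obtain v where "cmod (h v - g u0) <= l/100" using near by blast
 hence "cmod (position v - tcoord g u0 (g u0)) <= l/100" by (simp only: norm_coord_diff tangent_unit(1)[OF g(1)])
 hence v: "abs (Re (position v)) <= l/100" "abs (Im (position v)) <= l/100"
  using abs_Re_le_cmod[of "position v"] abs_Im_le_cmod[of "position v"] by auto
 obtain v' where v': "99/100*l <= Re (position v')" "Re (position v') <= 201/100*l"
  "abs (Im (position v')) <= 12/1000*l" by (rule point_ahead)
 define zeta where "zeta = position v' - position v"
 have zeta: "98/100*l <= Re zeta" "Re zeta <= 202/100*l" "abs (Im zeta) <= 22/1000*l"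
  using v v' unfolding zeta_def minus_complex.simps by linarith+
 have "cmod zeta <= 205/100*l" using cmod_le[of zeta] zeta by linarith
 from chord_tilt[OF this[unfolded zeta_def], of "98/100" "22/1000"] zeta l
 have "abs (Im (direction v)) <= 4/100" unfolding zeta_def by (simp add: power2_eq_square)
 thus thesis by (rule that[OF v])
qed

lemma box_height:
 assumes "boxed v"
 shows "abs (Im (position v)) <= 35/1000*l"
proof -
 obtain v0 where v0: "abs (Re (position v0)) <= l/100" "abs (Im (position v0)) <= l/100"
  "abs (Im (direction v0)) <= 4/100" by (rule point_at_base)
 define zeta c where "zeta = position v - position v0" and "c = direction v0"
 have zeta: "abs (Re zeta) <= 51/100*l" "abs (Im zeta) <= 51/100*l"
  using v0 assms unfolding zeta_def in_box_def minus_complex.simps by linarith+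
 have n: "cmod zeta <= 102/100*l" using cmod_le[of zeta] zeta by linarith
 have "abs (Re c)*abs (Im zeta) <= abs (Im c)*abs (Re zeta) + 2*M*(cmod zeta)^2"
  using relative_hug(3)[of v v0] n l unfolding zeta_def c_def by auto
 moreover have "abs (Im c)*abs (Re zeta) <= 4/100*(51/100*l)" using v0 zeta unfolding c_def by (intro mult_mono) auto
 moreover have "9/10*abs (Im zeta) <= abs (Re c)*abs (Im zeta)"
  using abs_Re_of_small_Im[OF relative_tangent_unit] v0 unfolding c_def by (intro mult_right_mono) auto
 ultimately have "9/10*abs (Im zeta) <= 225/10000*l" using quadratic_error[OF n] l by (simp add: power2_eq_square)
 hence "abs (Im zeta) <= 25/1000*l" by simp
 thus ?thesis using v0 unfolding zeta_def minus_complex.simps by linarith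
qed

lemma box_tilt:
 assumes "boxed v"
 shows "abs (Im (direction v)) <= 13/100"
proof -
 obtain v' where v': "99/100*l <= Re (position v')" "Re (position v') <= 201/100*l"
  "abs (Im (position v')) <= 12/1000*l" by (rule point_ahead)
 define zeta where "zeta = position v' - position v"
 have zeta: "49/100*l <= Re zeta" "Re zeta <= 251/100*l" "abs (Im zeta) <= 47/1000*l"
  using assms box_height[OF assms] v' unfolding zeta_def in_box_def minus_complex.simps by linarith+
 have "cmod zeta <= 26/10*l" using cmod_le[of zeta] zeta by linarith
 from chord_tilt[OF this[unfolded zeta_def], of "49/100" "47/1000"] zeta l
 show ?thesis unfolding zeta_def by (simp add: power2_eq_square)
qed

lemma box_injective:
 assumes v: "boxed v" and v': "boxed v'"
  and eq: "Re (position v) = Re (position v')"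
 shows "h v = h v'"
proof (rule ccontr)
 assume ne: "h v ~= h v'"
 define zeta c where "zeta = position v' - position v" and "c = direction v"
 have Re0: "Re zeta = 0" using eq by (simp add: zeta_def)
 hence norm: "cmod zeta = abs (Im zeta)" by (simp add: cmod_def)
 have pos: "abs (Im zeta) > 0"
  using ne norm norm_coord_diff[OF tangent_unit(1)[OF g(1), of u0], of "g u0" "h v'" "h v"] unfolding zeta_def by auto
 have small: "abs (Im zeta) <= 7/100*l" using box_height[OF v] box_height[OF v'] unfolding zeta_def minus_complex.simps by linarith
 have "abs (Re c*Im zeta) <= 2*M*(Im c*Im zeta)^2"
  using relative_hug(1)[of v' v] norm small l Re0 unfolding zeta_def c_def by (auto simp: algebra_simps)
 also have "... <= 2*M*(Im zeta)^2"
 proof (intro mult_left_mono abs_le_square_iff[THEN iffD1])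
  show "abs (Im c*Im zeta) <= abs (Im zeta)" using box_tilt[OF v] unfolding c_def by (simp add: abs_mult mult_left_le_one_le)
 qed (use M_nonneg in auto)
 also have "... = (2*M*abs (Im zeta))*abs (Im zeta)" by (simp add: power2_eq_square)
 also have "... <= 1/2*abs (Im zeta)" using mult_left_mono[OF small M_nonneg] l(2) by (intro mult_right_mono) auto
 finally have "abs (Re c)*abs (Im zeta) <= 1/2*abs (Im zeta)" by simp
 thus False using pos abs_Re_of_small_Im[OF relative_tangent_unit, of v] box_tilt[OF v] unfolding c_def by auto
qed

lemma box_surjective:
 assumes x: "abs x <= l/2"
 obtains v where "Re (position v) = x" "abs (Im (position v)) <= l/4"
proof -
 obtain v0 where v0: "abs (Re (position v0)) <= l/100" "abs (Im (position v0)) <= l/100"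
  "abs (Im (direction v0)) <= 4/100" by (rule point_at_base)
 define c where "c v = direction v" for v
 define s where "s = sgn (Re (c v0))"
 have Re0: "abs (Re (c v0)) >= 9/10" using abs_Re_of_small_Im[OF relative_tangent_unit] v0(3) unfolding c_def by auto
 hence s: "abs s = 1" "s*Re (c v0) = abs (Re (c v0))" by (auto simp: s_def sgn_if)
 have tilt: "89/100 <= s*Re (c v)" "abs (Im (c v)) <= 41/1000" if "abs (arclen h v0 v) <= l" for v
 proof -
  have "c v - c v0 = cnj (tangent g u0)*(tangent h v - tangent h v0)" by (simp add: c_def algebra_simps)
  hence "cmod (c v - c v0) = cmod (tangent h v - tangent h v0)" using tangent_unit(1)[OF g(1)] by (simp add: norm_mult)
  also have "... <= M*abs (arclen h v0 v)" by (rule tangent_lipschitz[OF h])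
  also have "... <= 1/1000" using mult_left_mono[OF that M_nonneg] l by linarith
  finally have d: "abs (Re (c v) - Re (c v0)) <= 1/1000" "abs (Im (c v) - Im (c v0)) <= 1/1000"
   using abs_Re_le_cmod[of "c v - c v0"] abs_Im_le_cmod[of "c v - c v0"] by auto
  have "abs (s*Re (c v) - s*Re (c v0)) <= 1/1000" using d(1) s(1) by (metis abs_mult mult_1 right_diff_distrib)
  thus "89/100 <= s*Re (c v)" using s(2) Re0 by linarith
  show "abs (Im (c v)) <= 41/1000" using d(2) v0(3) unfolding c_def by linarith
 qed
 have "abs (x - Re (position v0)) <= 89/100*l" using x v0(1) by linarith
 then obtain v where v: "abs (arclen h v0 v) <= l" "Re (position v) = x"
  using arc_reaches_abscissa[OF h(1), of v0 l "89/100" s "tangent g u0" x "g u0"] tilt(1) s(1) l(1) unfolding c_def by auto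
 have "abs (Im (position v) - Im (position v0)) <= 41/1000*l"
 proof (cases "v = v0")
  case False
  obtain w where w: "min v0 v < w" "w < max v0 v" "(Im (position v) - Im (position v0))*cmod (d1 h w)
    = (arclen h v0 v - arclen h v0 v0)*(cmod (d1 h w)*Im (c w))"
   using cauchy_mvt_between[OF False[symmetric] coord_derivative(3)[OF h(1)] DERIV_arclen[OF h(1)]] c_def by metis
  have "abs (Im (c w)) <= 41/1000" using abs_arclen_between[OF h(1), of v0 v w] w v(1) by (intro tilt) auto
  moreover have "Im (position v) - Im (position v0) = arclen h v0 v * Im (c w)" using w(3) c2loopD(4)[OF h(1), of w] by simp
  ultimately show ?thesis using mult_mono[OF v(1), of "abs (Im (c w))" "41/1000"] l(1) by (simp add: abs_mult)
 qed (use l in auto)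
 hence "abs (Im (position v)) <= l/4" using v0(2) by linarith
 thus thesis using that v(2) by blast
qed

theorem box_graph_of_close: "box_graph (g u0) (tangent g u0) (l/2) h"
proof -
 have "2*abs (Im (cnj (tangent g u0)*d1 h v)) <= abs (Re (cnj (tangent g u0)*d1 h v))"
  if "boxed v" for v
 proof -
  define c where "c = direction v"
  have "cmod (d1 h v)*(2*abs (Im c)) <= cmod (d1 h v)*abs (Re c)"
   using box_tilt[OF that] abs_Re_of_small_Im[OF relative_tangent_unit, of v] unfolding c_def by (intro mult_left_mono) auto
  moreover have "cnj (tangent g u0)*d1 h v = of_real (cmod (d1 h v))*c"
   unfolding c_def using tangent_unit(2)[OF h(1), of v] by (metis mult.left_commute)
  ultimately show ?thesis by (simp add: abs_mult)
 qed
 moreover have "abs (Im (position v)) <= l/2/2" if "boxed v" for v using box_height[OF that] by linarith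
 moreover have "EX v. Re (position v) = x & abs (Im (position v)) <= l/2/2" if "abs x <= l/2" for x by (rule box_surjective[OF that]) auto
 ultimately show ?thesis unfolding box_graph_def using box_injective by blast
qed

end

definition gval :: "complex => complex => real => (real => complex) => real => real" where
 "gval p T r g x = (THE y. abs y <= r & (EX u. coord p T (g u) = Complex x y))"

definition gpar :: "complex => complex => real => (real => complex) => real => real" where
 "gpar p T r g x = (SOME u. u : {0..<1} & coord p T (g u) = Complex x (gval p T r g x))"

definition gslope :: "complex => complex => real => (real => complex) => real => real" where
 "gslope p T r g x = (let u = gpar p T r g x in Im (cnj T*d1 g u)/Re (cnj T*d1 g u))"

definition gsecond :: "complex => complex => real => (real => complex) => real => real" where
 "gsecond p T r g x = (let u = gpar p T r g x in Im (cnj (d1 g u)*d2 g u)/(Re (cnj T*d1 g u))^3)"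

lemma jordan_loop_eqE:
 assumes g: "jordan_loop g" and "g u = g w"
 obtains n :: int where "w = u + of_int n"
proof -
 have "g (frac u) = g (frac w)" using assms periodic_frac[of g] by (metis jordan_loop_def)
 hence "frac u = frac w" using g unfolding jordan_loop_def by (auto dest!: inj_onD simp: frac_lt_1)
 hence "w = u + of_int (\<lfloor>w\<rfloor> - \<lfloor>u\<rfloor>)" by (simp add: frac_def)
 thus thesis by (rule that)
qed

lemma periodic_jordan_eq:
 assumes "jordan_loop g" "g u = g w" "!!u. Phi (u+1) = Phi u"
 shows "Phi u = (Phi w :: 'a)"
 using jordan_loop_eqE[OF assms(1,2)] periodic_int[of Phi u] assms(3) by metis

lemma coord_inj: "cmod T = 1 ==> coord p T z = coord p T z' \<longleftrightarrow> z = z'" by (auto simp: coord_def)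

context
 fixes p T :: complex and r :: real and g :: "real => complex"
 assumes b: "box_graph p T r g" and T: "cmod T = 1" and c: "c2loop g"
begin

lemma gval_unique:
 assumes "in_box p T r (g u)"
 shows "gval p T r g (Re (coord p T (g u))) = Im (coord p T (g u))"
 unfolding gval_def
proof (rule the_equality)
 show "abs (Im (coord p T (g u))) <= r & (EX v. coord p T (g v) = Complex (Re (coord p T (g u))) (Im (coord p T (g u))))"
  using assms by (auto simp: in_box_def)
 fix y assume "abs y <= r & (EX v. coord p T (g v) = Complex (Re (coord p T (g u))) y)"
 then obtain v where v: "abs y <= r" "coord p T (g v) = Complex (Re (coord p T (g u))) y" by auto
 hence "in_box p T r (g v)" using assms by (auto simp: in_box_def)
 hence "g v = g u" using b assms v unfolding box_graph_def by auto
 thus "y = Im (coord p T (g u))" using v(2) by (metis complex.sel(2))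
qed

lemma gpar_props:
 assumes x: "abs x <= r"
 shows "gpar p T r g x : {0..<1}" "coord p T (g (gpar p T r g x)) = Complex x (gval p T r g x)"
  "abs (gval p T r g x) <= r/2" "in_box p T r (g (gpar p T r g x))"
proof -
 obtain u where u: "Re (coord p T (g u)) = x" "abs (Im (coord p T (g u))) <= r/2" using b x unfolding box_graph_def by blast
 hence gv: "gval p T r g x = Im (coord p T (g u))" using gval_unique[of u] x by (auto simp: in_box_def)
 thus half: "abs (gval p T r g x) <= r/2" using u by simp
 have "EX v. v : {0..<1} & coord p T (g v) = Complex x (gval p T r g x)"
  using periodic_frac[of g] c2loopD(6)[OF c] u gv frac_lt_1[of u]
   by (intro exI[of _ "frac u"]) (metis atLeastLessThan_iff frac_ge_0 complex.collapse)
 from someI_ex[OF this] show "gpar p T r g x : {0..<1}"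
  "coord p T (g (gpar p T r g x)) = Complex x (gval p T r g x)" unfolding gpar_def by blast+
 thus "in_box p T r (g (gpar p T r g x))" using x half by (auto simp: in_box_def)
qed

lemma gpar_periodic:
 assumes u: "in_box p T r (g u)" and per: "!!u. Phi (u+1) = Phi u"
 shows "Phi (gpar p T r g (Re (coord p T (g u)))) = (Phi u :: 'a)"
proof (rule periodic_jordan_eq[where g=g and Phi=Phi, OF c2loopD(1)[OF c] _ per])
 have "coord p T (g (gpar p T r g (Re (coord p T (g u))))) = coord p T (g u)"
  using gpar_props(2) gval_unique[OF u] u by (simp add: in_box_def)
 thus "g (gpar p T r g (Re (coord p T (g u)))) = g u" using coord_inj[OF T] by blast
qed

lemma box_graph_Re_d1:
 assumes "in_box p T r (g u)"
 shows "Re (cnj T*d1 g u) ~= 0" "2*abs (Im (cnj T*d1 g u)) <= abs (Re (cnj T*d1 g u))"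
proof -
 show le: "2*abs (Im (cnj T*d1 g u)) <= abs (Re (cnj T*d1 g u))" using b assms unfolding box_graph_def by blast
 show "Re (cnj T*d1 g u) ~= 0"
 proof
  assume "Re (cnj T*d1 g u) = 0"
  hence "cnj T*d1 g u = 0" using le by (simp add: complex_eq_iff)
  thus False using T c2loopD(4)[OF c] by auto
 qed
qed

lemma gpar_has_derivative:
 fixes Phi :: "real => real"
 assumes x: "abs x < r" and per: "!!u. Phi (u+1) = Phi u" and d: "DERIV Phi (gpar p T r g x) :> Phi'"
 shows "DERIV (%x. Phi (gpar p T r g x)) x :> Phi'/Re (cnj T*d1 g (gpar p T r g x))"
proof -
 define u where "u = gpar p T r g x"
 define X where "X w = Re (coord p T (g w))" for w
 note gp = gpar_props[OF less_imp_le[OF x], folded u_def]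
 have X: "DERIV X w :> Re (cnj T*d1 g w)" for w
  using coord_derivative(1)[OF c, of p T w] unfolding has_vector_derivative_complex_iff X_def[abs_def] by blast
 have Xu: "X u = x" using gp(2) by (simp add: X_def)
 have "continuous_on UNIV (%w. Re (cnj T*d1 g w))" using c2loopD(9)[OF c] by (intro continuous_intros)
 from local_inverse[of X, OF X this box_graph_Re_d1(1)[OF gp(4)]]
 obtain V v where V: "open V" "x : V" "!!y. y : V ==> X (v y) = y" "v x = u" "DERIV v x :> inverse (Re (cnj T*d1 g u))"
  unfolding Xu by metis
 have "isCont (%w. abs (Im (coord p T (g w)))) u"
  using has_vector_derivative_continuous[OF c2loopD(2)[OF c]] unfolding coord_def by (intro isCont_Im continuous_intros)
 hence "isCont (%y. abs (Im (coord p T (g (v y))))) x" using isCont_o2[OF DERIV_isCont[OF V(5)]] V(4) by simp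
 hence "((%y. abs (Im (coord p T (g (v y))))) \<longlongrightarrow> abs (Im (coord p T (g (v x))))) (nhds x)"
  unfolding isCont_def by (rule tendsto_at_iff_tendsto_nhds[THEN iffD1])
 moreover have "abs (Im (coord p T (g (v x)))) < r" using gp(2,3) x V(4) by auto
 ultimately have "eventually (%y. abs (Im (coord p T (g (v y)))) < r) (nhds x)" by (rule order_tendstoD)
 moreover have "eventually (%y. y : V) (nhds x)" using V(1,2) by (rule eventually_nhds_in_open)
 moreover have "eventually (%y. y : {-r<..<r}) (nhds x)" using x by (intro eventually_nhds_in_open) auto
 ultimately have ev: "eventually (%y. Phi (v y) = Phi (gpar p T r g y)) (nhds x)"
 proof eventually_elim
  case (elim y)
  hence "in_box p T r (g (v y))" using V(3)[of y] by (auto simp: in_box_def X_def)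
  thus ?case using gpar_periodic[where Phi=Phi and u= "v y", OF _ per] V(3)[OF elim(2)] by (simp add: X_def)
 qed
 have "DERIV (%y. Phi (v y)) x :> Phi'*inverse (Re (cnj T*d1 g u))" using DERIV_chain2[OF _ V(5), of Phi Phi'] d V(4) by (simp add: u_def)
 with DERIV_cong_ev[OF refl ev refl] show ?thesis unfolding u_def[symmetric] divide_inverse by blast
qed

lemma gval_derivative:
 assumes x: "abs x < r" shows "DERIV (gval p T r g) x :> gslope p T r g x"
proof (rule has_field_derivative_transform_within_open[where S= "{-r<..<r}"])
 have "DERIV (%u. Im (coord p T (g u))) u :> Im (cnj T*d1 g u)" for u
  using coord_derivative(1)[OF c, of p T u] unfolding has_vector_derivative_complex_iff by blast
 thus "DERIV (%x. Im (coord p T (g (gpar p T r g x)))) x :> gslope p T r g x"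
  using gpar_has_derivative[OF x, of "%u. Im (coord p T (g u))"] c2loopD(6)[OF c] unfolding gslope_def Let_def by simp
qed (use x gpar_props(2) in auto)

lemma gslope_derivative:
 assumes x: "abs x < r" shows "DERIV (gslope p T r g) x :> gsecond p T r g x"
proof -
 define u where "u = gpar p T r g x"
 have R: "DERIV (%u. Re (cnj T*d1 g u)) u :> Re (cnj T*d2 g u)"
  "DERIV (%u. Im (cnj T*d1 g u)) u :> Im (cnj T*d2 g u)"
  unfolding has_vector_derivative_complex_iff by (rule derivative_eq_intros c2loopD(3)[OF c] refl | simp)+
 have nz: "Re (cnj T*d1 g u) ~= 0" unfolding u_def by (rule box_graph_Re_d1(1)[OF gpar_props(4)]) (use x in auto)
 have "cnj (d1 g u)*d2 g u = cnj (cnj T*d1 g u)*(cnj T*d2 g u)" using T by (simp add: complex_norm_square[symmetric])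
 moreover have "Im (cnj a*b) = Im b*Re a - Im a*Re b" for a b by simp
 ultimately have "Im (cnj (d1 g u)*d2 g u)
   = Im (cnj T*d2 g u)*Re (cnj T*d1 g u) - Im (cnj T*d1 g u)*Re (cnj T*d2 g u)" by metis
 with DERIV_divide[OF R(2,1) nz]
 have "DERIV (%u. Im (cnj T*d1 g u)/Re (cnj T*d1 g u)) u :> Im (cnj (d1 g u)*d2 g u)/(Re (cnj T*d1 g u))^2" by (simp only: power2_eq_square)
 from gpar_has_derivative[OF x _ this[unfolded u_def]] show ?thesis
  using c2loop_periodic(1)[OF c] unfolding gslope_def[abs_def] gsecond_def Let_def by (simp add: power2_eq_square power3_eq_cube)
qed

lemma abs_gslope_le:
 assumes "abs x <= r" shows "abs (gslope p T r g x) <= 1/2"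
 using box_graph_Re_d1[OF gpar_props(4)[OF assms]] unfolding gslope_def Let_def by simp

lemma abs_gsecond_le:
 assumes x: "abs x <= r" and k: "!!u. abs (curv1 g u) <= M" shows "abs (gsecond p T r g x) <= 2*M"
proof -
 define u where "u = gpar p T r g x"
 define R q where "R = abs (Re (cnj T*d1 g u))" and "q = cmod (d1 g u)/R"
 note slope = box_graph_Re_d1[OF gpar_props(4)[OF x], folded u_def]
 have R: "R > 0" using slope by (simp add: R_def)
 have "(Im (cnj T*d1 g u))^2 <= (R/2)^2" using slope(2) unfolding R_def by (intro abs_le_square_iff[THEN iffD1]) auto
 hence "(cmod (cnj T*d1 g u))^2 <= 5/4*R^2" unfolding cmod_power2 R_def by (simp add: power_divide)
 hence q2: "q^2 <= 5/4" using T by (simp add: q_def power_divide divide_le_eq norm_mult)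
 hence "q^2 <= (5/4)^2" by (simp add: power_divide)
 hence "q <= 5/4" by (rule power2_le_imp_le) simp
 hence "q^2*q <= 5/4*(5/4)" using q2 R by (intro mult_mono) (auto simp: q_def)
 hence q3: "q^3 <= 2" by (simp add: power2_eq_square power3_eq_cube)
 have "abs (gsecond p T r g x) = abs (curv1 g u)*q^3" unfolding curv1_def
  unfolding gsecond_def u_def[symmetric] q_def R_def by (simp add: power_divide power_abs)
 also have "... <= M*2" using k q3 R order_trans[OF abs_ge_zero k[of 0]] by (intro mult_mono) (auto simp: q_def)
 finally show ?thesis by simp
qed

end

lemma gpar_continuous:
 fixes gam :: "real => real => complex" and Phi :: "real => real => 'a :: metric_space"
 assumes T: "cmod T = 1" and b: "!!t. t : J ==> box_graph p T r (slice gam t)"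
  and c: "!!t. t : J ==> c2loop (slice gam t)"
  and gam: "continuous_on (UNIV \<times> J) (%(u,t). gam u t)" and Phi: "continuous_on (UNIV \<times> J) (%(u,t). Phi u t)"
  and per: "!!u t. t : J ==> Phi (u+1) t = Phi u t"
 shows "continuous_on ({-r..r} \<times> J) (%(x,t). Phi (gpar p T r (slice gam t) x) t)"
 unfolding continuous_on_sequentially
proof (intro allI ballI impI)
 fix s :: "nat => real \<times> real" and a
 assume "a : {-r..r} \<times> J" and s: "(ALL n. s n : {-r..r} \<times> J) & s \<longlonglongrightarrow> a"
 define x t where "x = fst a" and "t = snd a"
 define xs ts where "xs n = fst (s n)" and "ts n = snd (s n)" for n
 have a: "abs x <= r" "t : J" using \<open>a : _\<close> by (auto simp: x_def t_def)
 have st: "abs (xs n) <= r" "ts n : J" for n using s by (auto simp: xs_def ts_def mem_Times_iff abs_le_iff minus_le_iff)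
 have lims: "xs \<longlonglongrightarrow> x" "ts \<longlonglongrightarrow> t"
  unfolding xs_def[abs_def] ts_def[abs_def] x_def t_def using s by (auto intro: tendsto_fst tendsto_snd)
 define U where "U n = gpar p T r (slice gam (ts n)) (xs n)" for n
 have pt: "Re (coord p T (gam (U n) (ts n))) = xs n" "abs (Im (coord p T (gam (U n) (ts n)))) <= r" "U n : {0..1}" for n
  using gpar_props[OF b[OF st(2)] T c[OF st(2)] st(1), of n n] unfolding U_def[symmetric] by (auto simp: slice_def)
 have "(%n. Phi (U n) (ts n)) \<longlonglongrightarrow> Phi (gpar p T r (slice gam t) x) t"
 proof (rule tendsto_of_compact_subsequences[of "{0..1}" U])
  fix q l assume q: "strict_mono (q :: nat => nat)" "(U \<circ> q) \<longlonglongrightarrow> l"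
  have ts: "(ts \<circ> q) \<longlonglongrightarrow> t" and xs: "(xs \<circ> q) \<longlonglongrightarrow> x" using lims q(1)
   by (auto intro: LIMSEQ_subseq_LIMSEQ)
  have lim: "(%n. f (U (q n)) (ts (q n))) \<longlonglongrightarrow> f l t" if "continuous_on (UNIV \<times> J) (%(u,t). f u t)"
   for f :: "real => real => 'c :: metric_space"
   using continuous_on_tendsto_compose[OF that tendsto_Pair[OF q(2) ts]] a(2) st(2) by simp
  have lc: "(%n. coord p T (gam (U (q n)) (ts (q n)))) \<longlonglongrightarrow> coord p T (gam l t)"
   unfolding coord_def by (intro tendsto_intros lim gam)
  have "Re (coord p T (gam l t)) = x" using tendsto_Re[OF lc] xs unfolding pt o_def by (rule LIMSEQ_unique)
  moreover have "abs (Im (coord p T (gam l t))) <= r" by (rule LIMSEQ_le_const2[OF tendsto_rabs[OF tendsto_Im[OF lc]]]) (use pt in auto)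
  ultimately have "Phi (gpar p T r (slice gam t) x) t = Phi l t"
   using gpar_periodic[where Phi= "%u. Phi u t" and u=l, OF b[OF a(2)] T c[OF a(2)] _ per[OF a(2)]] a(1)
   by (auto simp: in_box_def slice_def)
  thus "((%n. Phi (U n) (ts n)) \<circ> q) \<longlonglongrightarrow> Phi (gpar p T r (slice gam t) x) t" using lim[OF Phi] by (simp add: o_def)
 qed (use pt in auto)
 thus "((%(x,t). Phi (gpar p T r (slice gam t) x) t) \<circ> s) \<longlonglongrightarrow> (%(x,t). Phi (gpar p T r (slice gam t) x) t) a"
  by (simp add: case_prod_beta o_def U_def xs_def ts_def x_def t_def)
qed

lemma is_flow_c2loop:
 assumes "is_flow A gam I" "t : I" shows "c2loop (slice gam t)"
proof -
 have "continuous_on (UNIV \<times> I) (%(u,t). d2 (slice gam t) u)" using assms(1) by (simp add: is_flow_def)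
 hence "continuous_on UNIV (%u. (%(u,t). d2 (slice gam t) u) (u,t))"
  by (rule continuous_on_compose2) (use assms(2) in \<open>auto intro!: continuous_intros\<close>)
 thus ?thesis using assms unfolding c2loop_def is_flow_def by auto
qed

lemma is_flow_continuous:
 assumes "is_flow A gam I" "J <= I"
 shows "continuous_on (UNIV \<times> J) (%(u,t). gam u t)" "continuous_on (UNIV \<times> J) (%(u,t). d1 (slice gam t) u)"
  "continuous_on (UNIV \<times> J) (%(u,t). d2 (slice gam t) u)"
 using assms by (auto simp: is_flow_def intro: continuous_on_subset)

abbreviation curvature_velocity :: "(real => real) => (real => real => complex) => real set => real => real => complex => bool" where
 "curvature_velocity A gam I t u v \<equiv> (gam u has_vector_derivative v) (at t within I)
  & Re (cnj v * (\<i>*d1 (slice gam t) u/complex_of_real (cmod (d1 (slice gam t) u)))) = A (Arg (d1 (slice gam t) u))*curv gam t u"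

lemma is_flow_subset:
 assumes fl: "is_flow A gam I" and J: "J <= I" shows "is_flow A gam J"
 unfolding is_flow_def
proof (intro conjI ballI impI allI)
 fix t u assume "t : J" "t > 0"
 then obtain v where "curvature_velocity A gam I t u v" using fl J unfolding is_flow_def by blast
 thus "EX v. curvature_velocity A gam J t u v" using has_vector_derivative_within_subset[OF _ J] by blast
qed (use fl J in \<open>auto simp: is_flow_def intro: continuous_on_subset\<close>)

lemma flow_normal_velocity:
 assumes fl: "is_flow A gam I" and t: "t : I" "t > 0"
 obtains v where "((%s. gam u s) has_vector_derivative v) (at t within I)"
  "Im (cnj (tangent (slice gam t) u) * v) = A (Arg (d1 (slice gam t) u))*curv gam t u"
proof -
 obtain v where v: "curvature_velocity A gam I t u v" using fl t unfolding is_flow_def by blast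
 have "Re (cnj v * (\<i>*d1 (slice gam t) u/complex_of_real (cmod (d1 (slice gam t) u))))
   = Im (cnj (tangent (slice gam t) u) * v)"
  unfolding tangent_def by simp
 thus thesis using that v by metis
qed

lemma Arg_direction_periodic:
 fixes A :: "real => real"
 assumes per: "!!theta. A (theta+pi/2) = A theta" and r: "r ~= 0" and T: "T ~= 0" and z: "z = of_real r*(T*Complex 1 q)"
 shows "A (Arg z) = A (Arg T + arctan q)"
proof -
 define beta where "beta = Arg T + arctan q"
 have "Complex 1 q ~= 0" by (simp add: complex_eq_iff)
 hence z0: "z ~= 0" using r T z by simp
 have q: "sqrt (1+q^2) ~= 0" using zero_le_power2[of q] by (smt (verit) real_sqrt_eq_0_iff)
 have "Complex 1 q = of_real (sqrt (1+q^2))*cis (arctan q)" using q by (simp add: complex_eq_iff cos_arctan sin_arctan)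
 hence "z = of_real (r*cmod T * sqrt (1+q^2))*cis beta" using z rcis_cmod_Arg[of T] unfolding beta_def rcis_def cis_mult[symmetric] by simp
 hence "of_real (cmod z)*cis (Arg z)*cis (-beta) = of_real (r*cmod T * sqrt (1+q^2))*(cis beta*cis (-beta))"
  using rcis_cmod_Arg[of z] unfolding rcis_def by simp
 hence "of_real (cmod z)*cis (Arg z - beta) = complex_of_real (r*cmod T * sqrt (1+q^2))" by (simp add: cis_mult mult.assoc)
 from arg_cong[OF this, of Im] have "sin (Arg z - beta) = 0" using z0 by simp
 then obtain n :: int where n: "Arg z = beta + of_int n*pi" unfolding sin_zero_iff_int2 by (auto simp: algebra_simps)
 have "A (theta+pi) = A theta" for theta using per[of theta] per[of "theta+pi/2"] by (simp add: add.assoc)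
 hence "A (pi*(x+1)) = A (pi*x)" for x by (simp add: distrib_left)
 from periodic_int[of "%x. A (pi*x)", OF this, of "beta/pi" n] show ?thesis
  unfolding n beta_def[symmetric] by (simp add: distrib_left mult.commute)
qed

lemma Re_cnj_mult_in_frame:
 assumes "cmod T = 1"
 shows "Re (cnj z*w) = Re (cnj T*z)*Re (cnj T*w) + Im (cnj T*z)*Im (cnj T*w)"
proof -
 have "cnj z*w = cnj (cnj T*z)*(cnj T*w)" using assms by (simp add: complex_norm_square[symmetric])
 moreover have "Re (cnj a*b) = Re a*Re b + Im a*Im b" for a b by simp
 ultimately show ?thesis by metis
qed

lemma Im_cnj_mult_slope: "Im (cnj (of_real y*(T*Complex 1 q)) * v) = y*(Im (cnj T * v) - q*Re (cnj T * v))" by (simp add: algebra_simps)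

context
 fixes A :: "real => real" and gam :: "real => real => complex" and I J :: "real set" and p T :: complex and r :: real
 assumes fl: "is_flow A gam I" and T: "cmod T = 1" and J: "J <= I"
  and b: "!!t. t : J ==> box_graph p T r (slice gam t)"
begin

lemma flow_graph_continuous:
 "continuous_on ({-r..r} \<times> J) (%(x,t). gval p T r (slice gam t) x)"
 "continuous_on ({-r..r} \<times> J) (%(x,t). gslope p T r (slice gam t) x)"
 "continuous_on ({-r..r} \<times> J) (%(x,t). gsecond p T r (slice gam t) x)"
proof -
 have c: "c2loop (slice gam t)" if "t : J" for t using is_flow_c2loop[OF fl] J that by auto
 note cont = is_flow_continuous[OF fl J]
 note gp = gpar_props[OF b T c]
 note gc = gpar_continuous[OF T b c cont(1)]
 define R where "R u t = Re (cnj T*d1 (slice gam t) u)" for u t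
 have R: "R (gpar p T r (slice gam t) x) t ~= 0" if "t : J" "abs x <= r" for t x
  unfolding R_def using box_graph_Re_d1(1)[OF b T c gp(4)] that by blast
 have "continuous_on ({-r..r} \<times> J) (%(x,t). Im (coord p T (gam (gpar p T r (slice gam t) x) t)))"
  by (rule gc[where Phi= "%u t. Im (coord p T (gam u t))"])
   (use cont(1) c2loopD(6)[OF c] in \<open>auto simp: coord_def case_prod_beta slice_def intro!: continuous_intros\<close>)
 thus "continuous_on ({-r..r} \<times> J) (%(x,t). gval p T r (slice gam t) x)"
  by (rule continuous_on_eq) (use gp(2) in \<open>auto simp: slice_def abs_le_iff\<close>)
 have cR: "continuous_on ({-r..r} \<times> J) (%(x,t). R (gpar p T r (slice gam t) x) t)"
  by (rule gc) (use cont(2) c2loop_periodic[OF c] in \<open>auto simp: R_def case_prod_beta intro!: continuous_intros\<close>)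
 have "continuous_on ({-r..r} \<times> J) (%(x,t). Im (cnj T*d1 (slice gam t) (gpar p T r (slice gam t) x)))"
  by (rule gc[where Phi= "%u t. Im (cnj T*d1 (slice gam t) u)"])
   (use cont(2) c2loop_periodic[OF c] in \<open>auto simp: case_prod_beta intro!: continuous_intros\<close>)
 with cR show "continuous_on ({-r..r} \<times> J) (%(x,t). gslope p T r (slice gam t) x)"
  using R unfolding gslope_def Let_def case_prod_beta R_def by (intro continuous_on_divide) auto
 have "continuous_on ({-r..r} \<times> J) (%(x,t). Im (cnj (d1 (slice gam t) (gpar p T r (slice gam t) x))
   *d2 (slice gam t) (gpar p T r (slice gam t) x)))"
  by (rule gc[where Phi= "%u t. Im (cnj (d1 (slice gam t) u)*d2 (slice gam t) u)"])
   (use cont(2,3) c2loop_periodic[OF c] in \<open>auto simp: case_prod_beta intro!: continuous_intros\<close>)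
 with cR show "continuous_on ({-r..r} \<times> J) (%(x,t). gsecond p T r (slice gam t) x)"
  using R unfolding gsecond_def Let_def case_prod_beta R_def by (intro continuous_on_divide continuous_on_power) auto
qed

text \<open>The point with parameter u moves to abscissa X s and height Y s = gval (X s), so the chain rule gives the
 time derivative of gval at a fixed abscissa; only the normal part of the velocity survives.\<close>

lemma gval_derivative_of_velocity:
 assumes t: "t : J" and x: "abs x < r" and v: "((%s. gam (gpar p T r (slice gam t) x) s) has_vector_derivative v) (at t within J)"
 shows "((%s. gval p T r (slice gam s) x) has_field_derivative Im (cnj T * v) - gslope p T r (slice gam t) x*Re (cnj T * v)) (at t within J)"
proof -
 have c: "c2loop (slice gam t)" if "t : J" for t using is_flow_c2loop[OF fl] J that by auto
 define g u where "g = slice gam t" and "u = gpar p T r g x"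
 note gp = gpar_props[OF b[OF t] T c[OF t] less_imp_le[OF x], folded g_def, folded u_def]
 define X Y where "X s = Re (coord p T (gam u s))" and "Y s = Im (coord p T (gam u s))" for s
 have "((%s. coord p T (gam u s)) has_vector_derivative cnj T * v) (at t within J)"
  unfolding coord_def by (rule derivative_eq_intros v[folded g_def, folded u_def] refl | simp)+
 hence XY: "(X has_field_derivative Re (cnj T * v)) (at t within J)" "(Y has_field_derivative Im (cnj T * v)) (at t within J)"
  unfolding has_vector_derivative_complex_iff X_def[abs_def] Y_def[abs_def] by blast+
 have Xt: "X t = x" and Yt: "Y t = gval p T r g x" using gp(2) by (auto simp: X_def Y_def g_def slice_def)
 have "((%s. abs (X s)) \<longlongrightarrow> abs x) (at t within J)"
  "((%s. abs (Y s)) \<longlongrightarrow> abs (gval p T r g x)) (at t within J)"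
  using XY[THEN DERIV_continuous] Xt Yt unfolding continuous_within by (auto intro: tendsto_rabs)
 hence "eventually (%s. abs (X s) < r) (at t within J)" "eventually (%s. abs (Y s) < r) (at t within J)"
  "eventually (%s. s : J) (at t within J)"
  using order_tendstoD(2) x gp(3) by (fastforce simp: eventually_at_filter)+
 hence "eventually (%s. Y s = gval p T r (slice gam s) (X s)) (at t within J)"
 proof eventually_elim
  case (elim s)
  thus ?case using gval_unique[OF b T c, of s u] by (simp add: X_def Y_def slice_def in_box_def)
 qed
 from has_field_derivative_cong_eventually[OF this] Xt Yt XY(2)
 have comp: "((%s. gval p T r (slice gam s) (X s)) has_field_derivative Im (cnj T * v)) (at t within J)" by (simp add: g_def)
 show ?thesis unfolding Xt[symmetric]
 proof (rule partial_derivative[where F= "%s. gval p T r (slice gam s)" and ?F1.0= "%s. gslope p T r (slice gam s)"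
    and X=X and a= "-r" and b=r, OF t _ _ _ comp XY(1)])
  show "DERIV (gval p T r (slice gam s)) y :> gslope p T r (slice gam s) y" if "s : J" "y : {-r<..<r}" for s y
   using that by (intro gval_derivative b T c) auto
  show "continuous_on (J \<times> {-r<..<r}) (%(s,y). gslope p T r (slice gam s) y)" unfolding case_prod_beta
   by (intro continuous_on_compose2[OF flow_graph_continuous(2), of _ "%y. (snd y, fst y)", simplified case_prod_beta fst_conv snd_conv])
    (auto intro!: continuous_intros)
 qed (use x Xt in auto)
qed

lemma flow_graph_time_derivative:
 assumes per: "!!theta. A (theta+pi/2) = A theta" and t: "t : J" "t > 0" and x: "abs x < r"
 defines "m \<equiv> gslope p T r (slice gam t) x"
 shows "((%s. gval p T r (slice gam s) x) has_field_derivative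
  A (Arg T + arctan m)/(1+m^2)*gsecond p T r (slice gam t) x) (at t within J)"
proof -
 define g u where "g = slice gam t" and "u = gpar p T r g x"
 have ct: "c2loop g" using is_flow_c2loop[OF fl] J t(1) by (auto simp: g_def)
 note bt = b[OF t(1), folded g_def]
 obtain v where v: "((%s. gam u s) has_vector_derivative v) (at t within I)"
  "Im (cnj (tangent g u) * v) = A (Arg (d1 g u))*curv gam t u"
  using flow_normal_velocity[OF fl, of t u] t J unfolding g_def by blast
 define R n where "R = Re (cnj T*d1 g u)" and "n = cmod (d1 g u)"
 have R: "R ~= 0" unfolding R_def u_def by (rule box_graph_Re_d1[OF bt T ct gpar_props(4)[OF bt T ct less_imp_le[OF x]]])
 have n: "n > 0" using c2loopD(10)[OF ct] by (simp add: n_def)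
 have "cnj T*d1 g u = of_real R*Complex 1 m" using R by (simp add: complex_eq_iff m_def gslope_def Let_def R_def u_def g_def)
 hence "T*cnj T*d1 g u = of_real R*(T*Complex 1 m)" by simp
 hence d: "d1 g u = of_real R*(T*Complex 1 m)" using T by (simp add: complex_norm_square[symmetric])
 have m2: "1 + m^2 = n^2/R^2" using T unfolding n_def d norm_mult power_mult_distrib using R by (simp add: cmod_def)
 have "A (Arg T + arctan m) = A (Arg (d1 g u))" using Arg_direction_periodic[where A=A, OF per R _ d] T by force
 also have "...*curv gam t u = Im (cnj (d1 g u) * v)/n"
  unfolding v(2)[symmetric] tangent_def n_def[symmetric] complex_cnj_divide complex_cnj_complex_of_real times_divide_eq_left
  by (rule Im_divide_of_real)
 finally have "Im (cnj T * v) - m*Re (cnj T * v) = A (Arg T + arctan m)*curv gam t u*n/R" using R n unfolding d Im_cnj_mult_slope by simp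
 also have "... = A (Arg T + arctan m)/(1+m^2)*(curv gam t u*n^3/R^3)" unfolding m2 by (simp add: power2_eq_square power3_eq_cube)
 also have "curv gam t u*n^3/R^3 = gsecond p T r (slice gam t) x"
  using n unfolding gsecond_def Let_def curv_def curv1_def g_def[symmetric] u_def[symmetric] R_def[symmetric] n_def[symmetric] by simp
 finally show ?thesis
  using gval_derivative_of_velocity[OF t(1) x has_vector_derivative_within_subset[OF v(1)[unfolded u_def g_def] J]] unfolding m_def by simp
qed

end

lemma norm_sq_has_real_derivative:
 assumes h: "(h has_vector_derivative h') (at u within S)"
 shows "((%w. (cmod (h w - p))^2) has_field_derivative 2*Re (cnj (h u - p)*h')) (at u within S)"
proof -
 have "((%w. h w - p) has_derivative (%x. x *\<^sub>R h')) (at u within S)"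
  using h by (auto simp: has_vector_derivative_def intro: derivative_eq_intros)
 from has_derivative_inner[OF this this] show ?thesis unfolding power2_norm_eq_inner has_field_derivative_def
  by (rule has_derivative_eq_rhs) (auto simp: inner_complex_def algebra_simps)
qed

lemma nearest_point_orthogonal:
 assumes g: "c2loop g" and e: "e > 0" and min: "!!a. abs (a-w) < e ==> cmod (g w - p) <= cmod (g a - p)"
 shows "Re (cnj (tangent g w)*(g w - p)) = 0"
proof -
 have "2*Re (cnj (g w - p)*d1 g w) = 0" by (rule DERIV_local_min[OF norm_sq_has_real_derivative[OF c2loopD(2)[OF g]] e])
   (use min in \<open>auto intro!: power_mono simp: abs_minus_commute\<close>)
 moreover have "cnj (g w - p)*d1 g w = of_real (cmod (d1 g w))*(cnj (g w - p)*tangent g w)"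
  using tangent_unit(2)[OF g, of w] by (metis mult.left_commute)
 moreover have "Re (of_real r*x) = r*Re x" for r x by simp
 ultimately have "Re (cnj (g w - p)*tangent g w) = 0" using c2loopD(4)[OF g, of w] by (metis mult_eq_0_iff norm_eq_zero zero_neq_numeral)
 thus ?thesis by (simp add: algebra_simps)
qed

lemma regularized_distance_derivative:
 assumes fl: "is_flow A gam {a..b}" and t: "t : {a..b}" "t > 0" and delta: "delta > 0"
  and V: "abs (A (Arg (d1 (slice gam t) v))*curv gam t v) <= V"
  and min: "!!v'. cmod (gam v t - p) <= cmod (gam v' t - p)"
 obtains d where "((%s. sqrt ((cmod (gam v s - p))^2 + delta^2)) has_field_derivative d) (at t within {a..b})" "abs d <= V"
proof -
 note c = is_flow_c2loop[OF fl t(1)]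
 define z T q where "z = gam v t - p" and "T = tangent (slice gam t) v" and "q = sqrt ((cmod z)^2 + delta^2)"
 have T: "cmod T = 1" using tangent_unit(1)[OF c] by (simp add: T_def)
 have q: "q > 0" "cmod z <= q" using delta unfolding q_def by (auto simp: add_nonneg_pos)
 have perp: "Re (cnj T*z) = 0" using nearest_point_orthogonal[OF c, of 1 v p] min by (simp add: T_def z_def slice_def)
 obtain w where w: "((%s. gam v s) has_vector_derivative w) (at t within {a..b})"
  "Im (cnj T*w) = A (Arg (d1 (slice gam t) v))*curv gam t v"
  unfolding T_def by (rule flow_normal_velocity[OF fl t, of v]) blast
 have "abs (Re (cnj z*w)) = cmod (cnj T*z)*abs (Im (cnj T*w))"
  using Re_cnj_mult_in_frame[OF T, of z w] perp by (simp add: abs_mult cmod_def)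
 also have "... <= q*V" unfolding w(2) using q V T by (intro mult_mono) (auto simp: norm_mult)
 finally have le: "abs (Re (cnj z*w)/q) <= V" using q by (simp add: divide_le_eq mult.commute)
 have "((%s. (cmod (gam v s - p))^2 + delta^2) has_field_derivative 2*Re (cnj z*w)) (at t within {a..b})"
  using DERIV_add[OF norm_sq_has_real_derivative[OF w(1)] DERIV_const] unfolding z_def by simp
 from DERIV_chain2[OF DERIV_real_sqrt this] q(1)
 have "((%s. sqrt ((cmod (gam v s - p))^2 + delta^2)) has_field_derivative inverse q/2*(2*Re (cnj z*w))) (at t within {a..b})"
  unfolding q_def z_def by simp
 moreover have "inverse q/2*(2*Re (cnj z*w)) = Re (cnj z*w)/q" by (simp only: divide_inverse) simp
 ultimately show thesis using that le by metis
qed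

context
 fixes A :: "real => real" and gam :: "real => real => complex" and tau V :: real
 assumes fl: "is_flow A gam {0..tau}"
  and V: "!!t u. t : {0..tau} ==> abs (A (Arg (d1 (slice gam t) u))*curv gam t u) <= V"
begin

lemma flow_reaches_near:
 assumes s: "s : {0..tau}" and t: "t : {0..tau}" and st: "s > 0 | t <= s" and e: "e > 0"
 shows "EX v. cmod (gam v t - gam u s) <= e + (V+e)*abs (s-t)"
proof -
 define p a b where "p = gam u s" and "a = min s t" and "b = max s t"
 have ab: "{a..b} <= {0..tau}" "s : {a..b}" "t : {a..b}" using s t by (auto simp: a_def b_def)
 define \<phi> where "\<phi> v t' = sqrt ((cmod (gam v t' - p))^2 + e^2)" for v t'
 have "continuous_on ({0..1} \<times> {a..b}) (%(u,t). gam u t)"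
  using continuous_on_subset[OF is_flow_continuous(1)[OF fl ab(1)], of "{0..1} \<times> {a..b}"] by auto
 hence "continuous_on ({0..1} \<times> {a..b}) (%x. \<phi> (fst x) (snd x) + (V+e)*abs (snd x - t))"
  unfolding \<phi>_def case_prod_beta by (intro continuous_intros)
 then obtain x where x: "x : {0..1} \<times> {a..b}" "!!y. y : {0..1} \<times> {a..b} ==>
   \<phi> (fst x) (snd x) + (V+e)*abs (snd x - t) <= \<phi> (fst y) (snd y) + (V+e)*abs (snd y - t)"
  using continuous_attains_inf[of "{0..1} \<times> {a..b}" "%x. \<phi> (fst x) (snd x) + (V+e)*abs (snd x - t)"] ab
  by (auto simp: compact_Times)
 define v t' where "v = fst x" and "t' = snd x"
 have t': "t' : {a..b}" using x(1) by (auto simp: t'_def)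
 have min: "\<phi> v t' + (V+e)*abs (t'-t) <= \<phi> w s' + (V+e)*abs (s'-t)" if "s' : {a..b}" for w s'
 proof -
  have "gam (frac w) s' = gam w s'"
   using periodic_frac[of "slice gam s'"] c2loopD(6)[OF is_flow_c2loop[OF fl]] that ab(1) by (force simp: slice_def)
  thus ?thesis using x(2)[of "(frac w, s')"] that frac_lt_1[of w] by (simp add: v_def t'_def \<phi>_def)
 qed
 have "t' = t"
 proof (rule ccontr)
  assume ne: "t' ~= t"
  have pos: "t' > 0" using ne t' st t by (auto simp: a_def)
  have "is_flow A gam {a..b}" by (rule is_flow_subset[OF fl ab(1)])
  moreover have "cmod (gam v t' - p) <= cmod (gam v' t' - p)" for v' using min[OF t', of v'] by (simp add: \<phi>_def)
  ultimately obtain d where d: "(\<phi> v has_field_derivative d) (at t' within {a..b})" "abs d <= V"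
   using regularized_distance_derivative[of A gam a b t' e v V p] t' pos e V ab(1) unfolding \<phi>_def[abs_def] by blast
  show False using penalized_min_imp_steep[OF d(1) t' ab(3) ne min] d(2) e by linarith
 qed
 hence "\<phi> v t <= e + (V+e)*abs (s-t)" using min[OF ab(2), of u] e by (simp add: \<phi>_def p_def)
 moreover have "cmod (gam v t - p) <= \<phi> v t" unfolding \<phi>_def by simp
 ultimately show ?thesis unfolding p_def by (intro exI[of _ v]) linarith
qed

lemma flow_speed:
 assumes s: "s : {0..tau}" and t: "t : {0..tau}"
 shows "EX v. cmod (gam v t - gam u s) <= V*abs (t-s)"
proof -
 define Gam where "Gam = range (slice gam t)"
 have inf: "infdist (gam u s) Gam <= V*abs (t-s)" if s: "s : {0..tau}" and st: "s > 0 | t <= s" for s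
 proof (rule field_le_epsilon)
  fix e :: real assume e: "e > 0"
  define e' where "e' = e/(1+abs (s-t))"
  have e': "e' > 0" "e'*(1+abs (s-t)) = e" using e by (auto simp: e'_def)
  obtain v where "cmod (gam v t - gam u s) <= e' + (V+e')*abs (s-t)" using flow_reaches_near[OF s t st e'(1)] by blast
  moreover have "infdist (gam u s) Gam <= cmod (gam v t - gam u s)"
   using infdist_le[of "slice gam t v" Gam "gam u s"] by (simp add: Gam_def slice_def dist_norm norm_minus_commute)
  ultimately show "infdist (gam u s) Gam <= V*abs (t-s) + e" using e'(2) by (simp add: algebra_simps abs_minus_commute)
 qed
 have "infdist (gam u s) Gam <= V*abs (t-s)"
 proof (cases "s > 0 | t <= s")
  case False
  hence tau: "s = 0" "0 < tau" using s t by auto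
  have "continuous_on {0..tau} (%s. (%(u,t). gam u t) (u,s))"
   by (rule continuous_on_compose2[OF is_flow_continuous(1)[OF fl subset_refl]]) (auto intro!: continuous_intros)
  hence "continuous_on (closure {0<..tau}) (%s. V*abs (t-s) - infdist (gam u s) Gam)" using tau by (auto intro!: continuous_intros)
  from continuous_ge_on_closure[OF this, of s 0] show ?thesis using inf tau by auto
 qed (use inf s in blast)
 moreover have "closed Gam" "Gam ~= {}"
 proof -
  have "Gam = slice gam t ` {0..1}" unfolding Gam_def by (rule periodic_range) (rule c2loopD(6)[OF is_flow_c2loop[OF fl t]])
  thus "closed Gam" using compact_continuous_image[of "{0..1}" "slice gam t"]
   continuous_on_subset[OF c2loopD(8)[OF is_flow_c2loop[OF fl t]]] by (simp add: compact_imp_closed)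
 qed (simp add: Gam_def)
 then obtain x where "x : Gam" "infdist (gam u s) Gam = dist (gam u s) x" by (metis infdist_attains_inf)
 ultimately show ?thesis by (auto simp: Gam_def slice_def dist_norm norm_minus_commute)
qed

end

lemma arclen_shift:
 assumes "c2loop g" shows "arclen g (u + of_int n) (v + of_int n) = arclen g u v"
proof -
 have "d1 g (w + of_int n) = d1 g w" for w by (rule periodic_int) (rule c2loop_periodic(1)[OF assms])
 hence "d1 g (u + of_int n + (v-u)*q) = d1 g (u + (v-u)*q)" for q by (metis add.assoc add.commute)
 thus ?thesis unfolding arclen_def by simp
qed

lemma arclen_continuous:
 assumes "is_flow A gam I"
 shows "continuous_on (UNIV \<times> UNIV \<times> I) (%(u,v,t). arclen (slice gam t) u v)"
proof -
 have "continuous_on ((UNIV \<times> UNIV \<times> I) \<times> cbox 0 1) (%x. (%(u,t). d1 (slice gam t) u)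
   (fst (fst x) + (fst (snd (fst x)) - fst (fst x)) * snd x, snd (snd (fst x))))"
  by (rule continuous_on_compose2[OF is_flow_continuous(2)[OF assms subset_refl]]) (auto intro!: continuous_intros)
 hence "continuous_on ((UNIV \<times> UNIV \<times> I) \<times> cbox 0 1)
   (%(x,q). cmod (d1 (slice gam (snd (snd x))) (fst x + (fst (snd x) - fst x)*q)))"
  by (auto simp: case_prod_beta intro!: continuous_intros)
 from integral_continuous_on_param[OF this]
 show ?thesis unfolding arclen_def case_prod_beta by (intro continuous_intros) simp
qed

lemma Re_Im_cnj_mult_derivative:
 assumes h: "(h has_vector_derivative h') (at u within S)" and k: "(k has_vector_derivative k') (at u within S)"
 shows "((%u. Re (cnj (h u)*k u)) has_field_derivative Re (cnj h'*k u + cnj (h u)*k')) (at u within S)"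
  "((%u. Im (cnj (h u)*k u)) has_field_derivative Im (cnj h'*k u + cnj (h u)*k')) (at u within S)"
 using has_vector_derivative_mult[OF has_vector_derivative_cnj[OF h] k]
 unfolding has_vector_derivative_complex_iff by (simp_all add: add.commute)

lemma chord_second_variation:
 fixes alpha beta :: real
 assumes g: "c2loop g" and e: "e > 0"
  and min: "!!a b. abs (a-u) < e ==> abs (b-v) < e ==> cmod (g u - g v) <= cmod (g a - g b)"
  and balance: "of_real alpha*d1 g u = of_real beta*d1 g v"
 shows "0 <= alpha^2*Re (cnj (g u - g v)*d2 g u) - beta^2*Re (cnj (g u - g v)*d2 g v)"
proof -
 note cd = c2loopD[OF g]
 have affine: "((%q. h (w+c*q)) has_vector_derivative of_real c*h' (w+c*q)) (at q)"
  if "!!x. (h has_vector_derivative h' x) (at x)" for h h' :: "real => complex" and w q c :: real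
 proof -
  have "((%q. w+c*q) has_vector_derivative c) (at q)" by (auto intro!: derivative_eq_intros)
  from vector_diff_chain_at[OF this that] show ?thesis by (simp add: o_def scaleR_conv_of_real)
 qed
 define Z where "Z q = g (u+alpha*q) - g (v+beta*q)" for q
 define Z' where "Z' q = of_real alpha*d1 g (u+alpha*q) - of_real beta*d1 g (v+beta*q)" for q
 define Z'' where "Z'' = of_real alpha*(of_real alpha*d2 g u) - of_real beta*(of_real beta*d2 g v)"
 have Z: "(Z has_vector_derivative Z' q) (at q)" for q unfolding Z_def Z'_def by (intro has_vector_derivative_diff affine cd(2))
 have Z': "(Z' has_vector_derivative Z'') (at 0)"
  unfolding Z'_def[abs_def] Z''_def using affine[of "d1 g" "d2 g" u alpha 0] affine[of "d1 g" "d2 g" v beta 0] cd(3)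
  by (intro has_vector_derivative_diff has_vector_derivative_mult_right) auto
 have "eventually (%q. DERIV (%q. -((cmod (Z q - 0))^2)) q :> -(2*Re (cnj (Z q - 0)*Z' q))) (nhds 0)"
  by (intro always_eventually allI DERIV_minus norm_sq_has_real_derivative Z)
 moreover have "DERIV (%q. -(2*Re (cnj (Z q - 0)*Z' q))) 0 :> -(2*Re (cnj (Z' 0)*Z' 0 + cnj (Z 0)*Z''))"
  using Re_Im_cnj_mult_derivative(1)[OF Z Z'] by (intro DERIV_minus DERIV_cmult) simp
 moreover have "eventually (%q. -((cmod (Z q - 0))^2) <= -((cmod (Z 0 - 0))^2)) (nhds 0)"
 proof -
  have "open {q. abs (alpha*q) < e & abs (beta*q) < e}" by (intro open_Collect_conj open_Collect_less continuous_intros)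
  hence "eventually (%q. q : {q. abs (alpha*q) < e & abs (beta*q) < e}) (nhds 0)" using e by (intro eventually_nhds_in_open) auto
  thus ?thesis by (rule eventually_mono) (use min in \<open>auto simp: Z_def intro!: power_mono\<close>)
 qed
 ultimately have "-(2*Re (cnj (Z' 0)*Z' 0 + cnj (Z 0)*Z'')) <= 0" by (rule second_derivative_nonpos_at_max(2))
 moreover have "Z' 0 = 0" using balance by (simp add: Z'_def)
 moreover have "Re (cnj (Z 0)*Z'') = alpha^2*Re (cnj (g u - g v)*d2 g u) - beta^2*Re (cnj (g u - g v)*d2 g v)"
  by (simp add: Z_def Z''_def power2_eq_square algebra_simps)
 ultimately show ?thesis by (simp del: times_complex.simps)
qed

lemma Re_d2_along_normal:
 assumes g: "c2loop g" and z: "Re (cnj (tangent g w)*z) = 0"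
 shows "Re (cnj z*d2 g w) = Im (cnj (tangent g w)*z)*((cmod (d1 g w))^2*curv1 g w)"
proof -
 have "cnj (d1 g w)*d2 g w = of_real (cmod (d1 g w))*(cnj (tangent g w)*d2 g w)" by (simp add: tangent_def)
 moreover have "Im (of_real r*x) = r*Im x" for r x by simp
 ultimately have "Im (cnj (d1 g w)*d2 g w) = cmod (d1 g w)*Im (cnj (tangent g w)*d2 g w)" by metis
 hence "Im (cnj (tangent g w)*d2 g w) = (cmod (d1 g w))^2*curv1 g w"
  using c2loopD(4)[OF g, of w] unfolding curv1_def by (simp add: power2_eq_square power3_eq_cube)
 thus ?thesis unfolding Re_cnj_mult_in_frame[OF tangent_unit(1)[OF g, of w], of z] using z by simp
qed

text \<open>At a local minimum of the chord length the two tangents are parallel and the curvatures, measured towards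
 each other, are ordered; hence the flow does not shorten the chord.\<close>

lemma chord_min_conditions:
 assumes g: "c2loop g" and e: "e > 0" and ne: "g u ~= g v"
  and min: "!!a b. abs (a-u) < e ==> abs (b-v) < e ==> cmod (g u - g v) <= cmod (g a - g b)"
 defines "z \<equiv> g u - g v"
 shows "Re (cnj (tangent g u)*z) = 0" "Re (cnj (tangent g v)*z) = 0"
  "EX sig. sig* sig = 1 & tangent g v = of_real sig*tangent g u"
  "Im (cnj (tangent g v)*z)*curv1 g v <= Im (cnj (tangent g u)*z)*curv1 g u"
proof -
 note cd = c2loopD[OF g]
 note tu = tangent_unit[OF g]
 show Tu: "Re (cnj (tangent g u)*z) = 0" unfolding z_def by (rule nearest_point_orthogonal[OF g e]) (use min in auto)
 have "Re (cnj (tangent g v)*(g v - g u)) = 0"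
  by (rule nearest_point_orthogonal[OF g e]) (use min in \<open>auto simp: norm_minus_commute[of "g v"] norm_minus_commute[of _ "g u"]\<close>)
 thus Tv: "Re (cnj (tangent g v)*z) = 0" by (simp add: z_def algebra_simps)
 define cu cv sig where "cu = Im (cnj (tangent g u)*z)" and "cv = Im (cnj (tangent g v)*z)" and "sig = cu/cv"
 have z: "z = \<i> * of_real c*T" if "cmod T = 1" "Re (cnj T*z) = 0" "c = Im (cnj T*z)" for T c
 proof -
  have "cnj T*z = \<i> * of_real c" using that by (simp add: complex_eq_iff)
  hence "T*cnj T*z = \<i> * of_real c*T" by simp
  thus ?thesis using that(1) by (simp only: complex_norm_square[symmetric]) simp
 qed
 note zu = z[OF tu(1) Tu cu_def] and zv = z[OF tu(1) Tv cv_def]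
 have c: "abs cu = cmod z" "abs cv = cmod z" using arg_cong[OF zu, of cmod] arg_cong[OF zv, of cmod] tu(1) by (simp_all add: norm_mult)
 moreover have "cmod z ~= 0" using ne by (simp add: z_def)
 ultimately have cv: "cv ~= 0" by linarith
 have "abs sig = 1" using cv unfolding sig_def abs_divide c by (simp flip: c(2))
 hence sig: "sig * sig = 1" by (metis abs_mult_self_eq mult_1)
 have TT: "tangent g v = of_real sig*tangent g u" using zu zv cv by (simp add: sig_def field_simps)
 thus "EX sig. sig * sig = 1 & tangent g v = of_real sig*tangent g u" using sig by blast
 define a b where "a = cmod (d1 g u)" and "b = cmod (d1 g v)"
 have "of_real (sig/b)*d1 g v = of_real sig*tangent g v" by (simp add: tangent_def b_def)
 also have "... = of_real (sig* sig)*tangent g u" unfolding TT by simp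
 finally have "of_real (1/a)*d1 g u = of_real (sig/b)*d1 g v" unfolding sig by (simp add: tangent_def a_def)
 from chord_second_variation[OF g e min this]
 have "(sig/b)^2*Re (cnj z*d2 g v) <= (1/a)^2*Re (cnj z*d2 g u)" unfolding z_def by simp
 thus "Im (cnj (tangent g v)*z)*curv1 g v <= Im (cnj (tangent g u)*z)*curv1 g u"
  using cd(10) sig unfolding Re_d2_along_normal[OF g Tu] Re_d2_along_normal[OF g Tv] by (simp add: power2_eq_square a_def b_def)
qed

text \<open>Nonnegative exactly when u \<le> v \<le> u+1 and both arcs between the two points have length at least 1/M.\<close>

definition arc_margin :: "real => (real => real => complex) => real \<times> real \<times> real => real" where
 "arc_margin M gam = (%(u,v,t). min (min (v-u) (u+1-v))
  (min (M*arclen (slice gam t) u v - 1) (M*arclen (slice gam t) v (u+1) - 1)))"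

context
 fixes A :: "real => real" and gam :: "real => real => complex" and tau M eta :: real
 assumes fl: "is_flow A gam {0..tau}" and per: "!!theta. A (theta+pi/2) = A theta" and A_nonneg: "!!theta. A theta >= 0"
  and k: "!!t u. t : {0..tau} ==> abs (curv gam t u) <= M" and M: "M > 0" and eta: "2*M*eta <= 1"
begin

lemma chord_min_time_derivative:
 assumes t: "t : {0..tau}" "t > 0" and e: "e > 0" and ne: "gam u t ~= gam v t"
  and min: "!!a b. abs (a-u) < e ==> abs (b-v) < e ==> cmod (gam u t - gam v t) <= cmod (gam a t - gam b t)"
 obtains d where "((%s. (cmod (gam u s - gam v s))^2) has_field_derivative d) (at t within {0..tau})" "d >= 0"
proof -
 define g z where "g = slice gam t" and "z = g u - g v"
 have g: "c2loop g" using is_flow_c2loop[OF fl t(1)] by (simp add: g_def)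
 have gam: "gam w t = g w" for w by (simp add: g_def slice_def)
 note cond = chord_min_conditions[of g e u v, OF g e ne[unfolded gam] min[unfolded gam], folded z_def]
 obtain sig where sig: "sig * sig = 1" "tangent g v = of_real sig*tangent g u" using cond(3) by blast
 obtain wu wv where w: "((%s. gam u s) has_vector_derivative wu) (at t within {0..tau})"
  "Im (cnj (tangent g u)*wu) = A (Arg (d1 g u))*curv1 g u"
  "((%s. gam v s) has_vector_derivative wv) (at t within {0..tau})"
  "Im (cnj (tangent g v)*wv) = A (Arg (d1 g v))*curv1 g v"
  using flow_normal_velocity[OF fl t] unfolding curv_def g_def by metis
 have "d1 g v = of_real (cmod (d1 g v)* sig/cmod (d1 g u))*(d1 g u*Complex 1 0)"
  using tangent_unit(2)[OF g, of v] unfolding sig(2) by (simp add: complex_eq_iff tangent_def mult.assoc)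
 moreover have "cmod (d1 g v)* sig/cmod (d1 g u) ~= 0" using sig(1) c2loopD(4)[OF g] by auto
 ultimately have "A (Arg (d1 g v)) = A (Arg (d1 g u) + arctan 0)" using Arg_direction_periodic[where A=A, OF per] c2loopD(4)[OF g] by blast
 hence "Re (cnj z*(wu-wv)) = A (Arg (d1 g u))*(Im (cnj (tangent g u)*z)*curv1 g u - Im (cnj (tangent g v)*z)*curv1 g v)"
  using Re_cnj_mult_in_frame[OF tangent_unit(1)[OF g], of z wu u] Re_cnj_mult_in_frame[OF tangent_unit(1)[OF g], of z wv v]
   cond(1,2) w(2,4) by (simp add: right_diff_distrib del: times_complex.simps)
 hence "0 <= 2*Re (cnj z*(wu-wv))" using cond(4) A_nonneg by simp
 moreover have "((%s. (cmod (gam u s - gam v s))^2) has_field_derivative 2*Re (cnj z*(wu-wv))) (at t within {0..tau})"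
  using norm_sq_has_real_derivative[OF has_vector_derivative_diff[OF w(1,3)], of 0] by (simp add: z_def gam)
 ultimately show thesis using that by blast
qed

lemma arc_margin_continuous: "continuous_on (UNIV \<times> UNIV \<times> {0..tau}) (arc_margin M gam)"
proof -
 have "continuous_on (UNIV \<times> UNIV \<times> {0..tau}) (%x. (%(u,v,t). arclen (slice gam t) u v) (fst (snd x), fst x + 1, snd (snd x)))"
  by (rule continuous_on_compose2[OF arclen_continuous[OF fl]]) (auto intro!: continuous_intros)
 with arclen_continuous[OF fl] show ?thesis unfolding arc_margin_def case_prod_beta fst_conv snd_conv by (intro continuous_intros)
qed

lemma short_chord_arc_margin_pos:
 assumes t: "t : {0..tau}" and margin: "0 <= arc_margin M gam (u,v,t)" and short: "cmod (gam v t - gam u t) < eta"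
 shows "0 < arc_margin M gam (u,v,t)"
proof -
 define g where "g = slice gam t"
 have g: "c2loop g" and kg: "!!u. abs (curv1 g u) <= M" using is_flow_c2loop[OF fl t] k[OF t] by (auto simp: g_def curv_def)
 have strict: "M*arclen g a b ~= 1" if "cmod (g b - g a) < eta" for a b
 proof
  assume unit: "M*arclen g a b = 1"
  hence pos: "arclen g a b > 0" using M zero_less_mult_pos[of M "arclen g a b"] by linarith
  have "abs (Re (tcoord g a (g b))) <= cmod (g b - g a)"
   using abs_Re_le_cmod[of "tcoord g a (g b)"] tangent_unit(1)[OF g] by (simp add: coord_def norm_mult)
  moreover have "abs (arclen g a b)/2 <= abs (Re (tcoord g a (g b)))" by (rule arc_advance_ge(1)[OF g kg]) (use unit pos in simp)
  ultimately have "M*arclen g a b < M*(2*eta)" using that M by (intro mult_strict_left_mono) auto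
  thus False using unit eta by simp
 qed
 have "cmod (g v - g u) < eta" "cmod (g (u+1) - g v) < eta"
  using short c2loopD(6)[OF g, of u] by (auto simp: g_def slice_def norm_minus_commute)
 with strict have "M*arclen g u v ~= 1" "M*arclen g v (u+1) ~= 1" by auto
 hence arcs: "1 < M*arclen g u v" "1 < M*arclen g v (u+1)" using margin by (auto simp: arc_margin_def g_def)
 hence "0 < arclen g u v" "0 < arclen g v (u+1)"
  using zero_less_mult_pos[of M "arclen g u v"] zero_less_mult_pos[of M "arclen g v (u+1)"] M by linarith+
 thus ?thesis using arcs by (simp add: arc_margin_def g_def[symmetric] arclen_pos_iff[OF g])
qed

lemma arc_margin_shift:
 assumes "t : {0..tau}" shows "arc_margin M gam (u + of_int n, v + of_int n, t) = arc_margin M gam (u,v,t)"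
 using arclen_shift[OF is_flow_c2loop[OF fl assms], of u n v] arclen_shift[OF is_flow_c2loop[OF fl assms], of v n "u+1"]
 by (simp add: arc_margin_def add.commute add.left_commute)

lemma penalized_chord_min:
 assumes t1: "t1 : {0..tau}" and m1: "0 <= arc_margin M gam (u1,v1,t1)"
 obtains u v t where "t : {0..t1}" "0 <= arc_margin M gam (u,v,t)"
  "(cmod (gam v t - gam u t))^2 + e*t <= (cmod (gam v1 t1 - gam u1 t1))^2 + e*t1"
  "!!a b s. s : {0..t1} ==> 0 <= arc_margin M gam (a,b,s)
   ==> (cmod (gam v t - gam u t))^2 + e*t <= (cmod (gam b s - gam a s))^2 + e * s"
proof -
 define S where "S = {-1..2 :: real} \<times> {-1..3 :: real} \<times> {0..t1}"
 define Xi where "Xi = (%(u,v,t). (cmod (gam v t - gam u t))^2 + e*t)"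
 have tauS: "S <= UNIV \<times> UNIV \<times> {0..tau}" using t1 by (auto simp: S_def)
 have gam: "gam (u + of_int n) t = gam u t" if "t : {0..tau}" for u t n
  using periodic_int[of "slice gam t" u n] c2loopD(6)[OF is_flow_c2loop[OF fl that]] by (simp add: slice_def)
 have normal: "EX u' v'. (u',v',t) : S \<inter> {x. 0 <= arc_margin M gam x} & Xi (u',v',t) = Xi (u,v,t)"
  if t: "t : {0..t1}" and m: "0 <= arc_margin M gam (u,v,t)" for u v t
 proof -
  define u' v' where "u' = u + of_int (-\<lfloor>u\<rfloor>)" and "v' = v + of_int (-\<lfloor>u\<rfloor>)"
  have t': "t : {0..tau}" using t t1 by auto
  have "0 <= u'" "u' < 1" "u' <= v'" "v' <= u'+1" using m unfolding u'_def v'_def arc_margin_def by auto linarith+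
  hence "(u',v',t) : S" using t by (auto simp: S_def)
  thus ?thesis using m arc_margin_shift[OF t', of u "-\<lfloor>u\<rfloor>" v] gam[OF t', of _ "-\<lfloor>u\<rfloor>"]
   unfolding Xi_def u'_def v'_def
   by (intro exI[of _ "u + of_int (-\<lfloor>u\<rfloor>)"] exI[of _ "v + of_int (-\<lfloor>u\<rfloor>)"]) simp
 qed
 have cgam: "continuous_on S (%x. gam (f x) (snd (snd x)))" if "continuous_on S f" for f
  using continuous_on_compose2[OF is_flow_continuous(1)[OF fl subset_refl] continuous_on_Pair[OF that], of "%x. snd (snd x)"] tauS
  by (force intro!: continuous_intros)
 have S: "compact S" by (auto simp: S_def intro!: compact_Times)
 have "closed (S \<inter> arc_margin M gam -` {0..})"
  by (intro continuous_closed_preimage continuous_on_subset[OF arc_margin_continuous tauS] compact_imp_closed[OF S] closed_atLeast)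
 from compact_Int_closed[OF S this] have "compact (S \<inter> {x. 0 <= arc_margin M gam x})" by (simp add: vimage_def)
 moreover have "continuous_on (S \<inter> {x. 0 <= arc_margin M gam x}) Xi" unfolding Xi_def case_prod_beta
  by (rule continuous_on_subset[of S]) (auto intro!: continuous_intros cgam)
 moreover have "S \<inter> {x. 0 <= arc_margin M gam x} ~= {}" using normal[OF _ m1] t1 by auto
 ultimately obtain m where m: "m : S \<inter> {x. 0 <= arc_margin M gam x}" "ALL y : S \<inter> {x. 0 <= arc_margin M gam x}. Xi m <= Xi y"
  using continuous_attains_inf by metis
 have min: "Xi m <= Xi (a,b,s)" if "s : {0..t1}" "0 <= arc_margin M gam (a,b,s)" for a b s using normal[OF that] m(2) by metis
 obtain u v t where "m = (u,v,t)" by (cases m)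
 with m(1) min min[of t1 u1 v1] m1 t1 that[of t u v] show thesis by (auto simp: Xi_def S_def)
qed

lemma no_penalized_local_min:
 assumes t: "0 < t" "t <= t1" "t1 <= tau" and r: "r > 0" and e: "e > 0" and ne: "gam u t ~= gam v t"
  and near: "!!a b s. abs (a-u) < r ==> abs (b-v) < r ==> abs (s-t) < r ==> s : {0..t1}
   ==> (cmod (gam v t - gam u t))^2 + e*t <= (cmod (gam b s - gam a s))^2 + e * s"
 shows False
proof -
 have "cmod (gam u t - gam v t) <= cmod (gam a t - gam b t)" if "abs (a-u) < r" "abs (b-v) < r" for a b
 proof (rule power2_le_imp_le)
  show "(cmod (gam u t - gam v t))^2 <= (cmod (gam a t - gam b t))^2"
   using near[of a b t] that t by (simp add: norm_minus_commute[of "gam u t"] norm_minus_commute[of "gam a t"])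
 qed simp
 then obtain D where D: "((%s. (cmod (gam u s - gam v s))^2) has_field_derivative D) (at t within {0..tau})" "D >= 0"
  using chord_min_time_derivative[OF _ t(1) r ne] t by auto
 define t2 where "t2 = max 0 (t-r/2)"
 have t2: "0 <= t2" "t2 < t" using r t(1) by (auto simp: t2_def)
 have "((%s. -((cmod (gam u s - gam v s))^2 + e * s)) has_field_derivative -(D+e)) (at t within {t2..t1})"
  by (rule has_field_derivative_subset[OF DERIV_minus[OF DERIV_add[OF D(1) DERIV_cmult_Id]]]) (use t2 t in auto)
 hence "0 <= -(D+e)"
 proof (rule left_derivative_nonneg_at_max[OF _ t2(2)])
  show "-((cmod (gam u s - gam v s))^2 + e * s) <= -((cmod (gam u t - gam v t))^2 + e*t)" if "t2 <= s" "s < t" for s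
   using near[of u v s] that t by (simp add: t2_def norm_minus_commute[of "gam u s"] norm_minus_commute[of "gam u t"])
 qed (use t in simp)
 thus False using D(2) e by simp
qed

lemma flow_noncollapsed:
 assumes init: "!!u v. 0 <= arc_margin M gam (u,v,0) ==> eta <= cmod (gam v 0 - gam u 0)" and t1: "t1 : {0..tau}"
 shows "noncollapsed M eta (slice gam t1)"
proof (rule ccontr)
 assume "~ ?thesis"
 then obtain u1 v1 where uv1: "0 <= arc_margin M gam (u1,v1,t1)" "cmod (gam v1 t1 - gam u1 t1) < eta"
  unfolding noncollapsed_def arc_margin_def slice_def by fastforce
 define e where "e = (eta^2 - (cmod (gam v1 t1 - gam u1 t1))^2)/(2*(t1+1))"
 have gap: "(cmod (gam v1 t1 - gam u1 t1))^2 < eta^2" using uv1(2) by (intro power_strict_mono) auto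
 have e: "e > 0" using gap t1 by (simp add: e_def)
 have "e*(2*(t1+1)) = eta^2 - (cmod (gam v1 t1 - gam u1 t1))^2" using t1 by (simp add: e_def)
 moreover have "0 <= e*t1" using e t1 by simp
 ultimately have e_small: "(cmod (gam v1 t1 - gam u1 t1))^2 + e*t1 < eta^2" using e by (simp add: algebra_simps)
 obtain u v t where t: "t : {0..t1}" and uv: "0 <= arc_margin M gam (u,v,t)"
  "(cmod (gam v t - gam u t))^2 + e*t <= (cmod (gam v1 t1 - gam u1 t1))^2 + e*t1"
  and min: "!!a b s. s : {0..t1} ==> 0 <= arc_margin M gam (a,b,s)
   ==> (cmod (gam v t - gam u t))^2 + e*t <= (cmod (gam b s - gam a s))^2 + e * s"
  by (rule penalized_chord_min[OF t1 uv1(1), of e]) blast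
 have t': "t : {0..tau}" using t t1 by auto
 have "0 <= e*t" using e t by simp
 hence "(cmod (gam v t - gam u t))^2 < eta^2" using uv(2) e_small by linarith
 hence short: "cmod (gam v t - gam u t) < eta" using uv1(2) norm_ge_zero[of "gam v1 t1 - gam u1 t1"] by (elim power2_less_imp_less) linarith
 have "t ~= 0" using init[of u v] uv(1) short by auto
 hence t0: "t > 0" using t by auto
 have "openin (top_of_set (UNIV \<times> UNIV \<times> {0..tau})) ((UNIV \<times> UNIV \<times> {0..tau}) \<inter> arc_margin M gam -` {0<..})"
  by (rule continuous_openin_preimage_gen[OF arc_margin_continuous open_greaterThan])
 then obtain d where d: "d > 0" "ball (u,v,t) d \<inter> (UNIV \<times> UNIV \<times> {0..tau}) <= arc_margin M gam -` {0<..}"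
  using short_chord_arc_margin_pos[OF t' uv(1) short] t' unfolding openin_contains_ball by force
 define r where "r = d/3"
 have r: "r > 0" using d by (simp add: r_def)
 have near: "(cmod (gam v t - gam u t))^2 + e*t <= (cmod (gam b s - gam a s))^2 + e * s"
  if "abs (a-u) < r" "abs (b-v) < r" "abs (s-t) < r" "s : {0..t1}" for a b s
 proof (rule min[OF that(4)])
  have "dist (u,v,t) (a,b,s) <= dist u a + (dist v b + dist t s)"
   unfolding dist_Pair_Pair by (intro order_trans[OF sqrt_sum_squares_le_sum] add_left_mono) auto
  hence "(a,b,s) : ball (u,v,t) d" using that by (auto simp: r_def dist_real_def abs_minus_commute)
  thus "0 <= arc_margin M gam (a,b,s)" using d(2) that(4) t1 by fastforce
 qed
 have "gam u t ~= gam v t"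
 proof
  assume "gam u t = gam v t"
  then obtain n :: int where "v = u + of_int n"
   using jordan_loop_eqE[OF c2loopD(1)[OF is_flow_c2loop[OF fl t']], of u v] by (auto simp: slice_def)
  thus False using short_chord_arc_margin_pos[OF t' uv(1) short] by (auto simp: arc_margin_def)
 qed
 thus False using no_penalized_local_min[OF t0 _ _ r e _ near] t t1 by auto
qed

end

lemma lipschitz_of_derivative:
 fixes f f' :: "real => real"
 assumes "!!x. abs x < r ==> DERIV f x :> f' x" "!!x. abs x < r ==> abs (f' x) <= K" "abs x < r" "abs y < r"
 shows "abs (f x - f y) <= K*abs (x-y)"
 using field_differentiable_bound[of "{-r<..<r}" f f' K x y] assms has_field_derivative_at_within by (force simp: abs_less_iff)

lemma arctan_lipschitz: "abs (arctan x - arctan y) <= abs (x-y)"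
 using field_differentiable_bound[of UNIV arctan "%z. inverse (1+z^2)" 1 x y] DERIV_arctan by (simp add: inverse_le_1_iff)

lemma inverse_one_plus_square_lipschitz: "abs (1/(1+x^2) - 1/(1+y^2)) <= abs (x-y)" for x y :: real
proof -
 have pos: "1+z^2 > 0" for z :: real by (simp add: add_pos_nonneg)
 have "DERIV (%z. 1/(1+z^2)) z :> -(2*z)/(1+z^2)^2" for z :: real
  using pos[of z] by (auto intro!: derivative_eq_intros simp: power2_eq_square)
 moreover have "abs (-(2*z)/(1+z^2)^2) <= 1" for z :: real
 proof -
  have "2*abs z <= 1+z^2" using zero_le_power2[of "abs z - 1"] by (simp add: power2_diff)
  also have "... <= (1+z^2)^2" by (intro self_le_power) auto
  finally show ?thesis using pos[of z] by simp
 qed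
 ultimately show ?thesis using field_differentiable_bound[of UNIV "%z. 1/(1+z^2)" "%z. -(2*z)/(1+z^2)^2" 1 x y] by simp
qed

definition graph_coeff :: "(real => real) => real => real => real" where
 "graph_coeff A alpha q = A (alpha + arctan q)/(1+q^2)"

lemma graph_coeff_bounds:
 assumes A: "!!theta. l <= A theta & A theta <= 1" and q: "abs q <= 1/2" and l: "l > 0"
 shows "4/5*l <= graph_coeff A alpha q" "graph_coeff A alpha q <= 1"
proof -
 have "(abs q)^2 <= (1/2)^2" using q by (intro power_mono) auto
 hence q2: "q^2 <= 1/4" "0 <= q^2" by (auto simp: power_divide)
 have pos: "1+q^2 > 0" using q2(2) by linarith
 have "4/5*l*(1+q^2) <= 4/5*l*(5/4)" using q2 l by (intro mult_left_mono) auto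
 also have "... <= A (alpha + arctan q)" using A by simp
 finally show "4/5*l <= graph_coeff A alpha q" unfolding graph_coeff_def using pos by (simp add: pos_le_divide_eq)
 have "A (alpha + arctan q) <= 1+q^2" using A[of "alpha + arctan q"] q2 by linarith
 thus "graph_coeff A alpha q <= 1" unfolding graph_coeff_def using pos by simp
qed

lemma graph_coeff_lipschitz:
 assumes lip: "!!theta theta'. abs (A theta - B theta') <= C*abs (theta-theta') + e" and B: "!!theta. 0 <= B theta & B theta <= 1" and C:
  "C >= 0"
 shows "abs (graph_coeff A alpha q - graph_coeff B alpha q') <= (C+1)*abs (q-q') + e"
proof -
 define a b where "a = A (alpha + arctan q)" and "b = B (alpha + arctan q')"
 have "abs (a-b) <= C*abs ((alpha + arctan q) - (alpha + arctan q')) + e" unfolding a_def b_def by (rule lip)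
 also have "C*abs ((alpha + arctan q) - (alpha + arctan q')) <= C*abs (q-q')"
  using arctan_lipschitz[of q q'] C by (intro mult_left_mono) auto
 finally have ab: "abs (a-b) <= C*abs (q-q') + e" by simp
 have "graph_coeff A alpha q - graph_coeff B alpha q' = (a-b)/(1+q^2) + b*(1/(1+q^2) - 1/(1+q'^2))"
  by (simp add: graph_coeff_def a_def b_def diff_divide_distrib right_diff_distrib)
 also have "abs (...) <= abs (a-b)/(1+q^2) + abs b*abs (1/(1+q^2) - 1/(1+q'^2))"
  using abs_triangle_ineq[of "(a-b)/(1+q^2)" "b*(1/(1+q^2) - 1/(1+q'^2))"] by (simp add: abs_mult)
 also have "... <= abs (a-b) + 1*abs (q-q')"
 proof (intro add_mono mult_mono inverse_one_plus_square_lipschitz)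
  show "abs (a-b)/(1+q^2) <= abs (a-b)" using frac_le[of "abs (a-b)" "abs (a-b)" 1 "1+q^2"] by simp
 qed (use B in \<open>auto simp: b_def\<close>)
 finally show ?thesis using ab by (simp add: distrib_right)
qed

text \<open>A graphical solution of \<open>f_t = H(f_x) f_xx\<close> is only twice differentiable in space, so the two-point
 estimate is applied to its difference quotients in time, which solve a linear equation and are uniformly
 close to the velocity.\<close>

locale graph_evolution =
 fixes R a b l C M :: real and f f1 f2 :: "real => real => real" and H :: "real => real"
 assumes ab: "a < b" and l: "l > 0" and C: "C > 0" and M: "M > 0"
  and cont: "continuous_on ({-R<..<R} \<times> {a..b}) (%(x,t). f x t)"
  and cont_F: "continuous_on ({-R<..<R} \<times> {a..b}) (%(x,t). H (f1 x t)*f2 x t)"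
  and dx: "!!x t. abs x < R ==> t : {a..b} ==> DERIV (%y. f y t) x :> f1 x t"
  and dxx: "!!x t. abs x < R ==> t : {a..b} ==> DERIV (%y. f1 y t) x :> f2 x t"
  and dt: "!!x t. abs x < R ==> t : {a<..b} ==> (f x has_field_derivative H (f1 x t)*f2 x t) (at t within {a..b})"
  and H: "!!q. abs q <= 1/2 ==> l <= H q & H q <= 1"
  and H_lip: "!!q q'. abs q <= 1/2 ==> abs q' <= 1/2 ==> abs (H q - H q') <= C*abs (q-q')"
  and f1: "!!x t. abs x < R ==> t : {a..b} ==> abs (f1 x t) <= 1/2"
  and f2: "!!x t. abs x < R ==> t : {a..b} ==> abs (f2 x t) <= 2*M"
begin

definition velocity :: "real => real => real" where "velocity x t = H (f1 x t)*f2 x t"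

lemma abs_velocity_le:
 assumes "abs x < R" "t : {a..b}" shows "abs (velocity x t) <= 2*M"
proof -
 have "abs (H (f1 x t))*abs (f2 x t) <= 1*(2*M)" using H[OF f1[OF assms]] f2[OF assms] l by (intro mult_mono) auto
 thus ?thesis by (simp add: velocity_def abs_mult)
qed

lemma coeff_f1_lipschitz:
 assumes x: "abs x < R" and y: "abs y < R" and t: "t : {a..b}"
 shows "abs (H (f1 x t) - H (f1 y t)) <= 2*M*C*abs (x-y)"
proof -
 have "abs (f1 x t - f1 y t) <= 2*M*abs (x-y)" by (rule lipschitz_of_derivative[where r=R and f'= "%x. f2 x t"]) (use dxx f2 x y t in auto)
 hence "C*abs (f1 x t - f1 y t) <= C*(2*M*abs (x-y))" using C by (intro mult_left_mono) auto
 thus ?thesis using H_lip[OF f1[OF x t] f1[OF y t]] by (simp add: mult_ac)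
qed

lemma quotient_eq_velocity:
 assumes x: "abs x < R" and st: "a <= s" "s < t" "t <= b"
 obtains z where "s < z" "z < t" "(f x t - f x s)/(t-s) = velocity x z"
proof -
 have "continuous_on {s..t} (%t. (%(x,t). f x t) (x,t))"
  by (rule continuous_on_compose2[OF cont]) (use x st in \<open>auto intro!: continuous_intros\<close>)
 moreover have "(f x has_derivative (%y. velocity x z*y)) (at z)" if z: "s < z" "z < t" for z
 proof -
  have "(f x has_field_derivative velocity x z) (at z within {a..b})" using dt[of x z] x z st by (auto simp: velocity_def)
  moreover have "at z within {a..b} = at z" using z st by (intro at_within_interior) auto
  ultimately show ?thesis by (simp add: has_field_derivative_def)
 qed
 ultimately obtain z where "s < z" "z < t" "f x t - f x s = velocity x z*(t-s)" using mvt[OF st(2), of "f x" "%z y. velocity x z*y"] by auto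
 thus thesis using that by simp
qed

lemma quotient_close_to_velocity:
 assumes h: "0 < h" and s: "a <= s" "s + h <= b" and t: "t : {s..s+h}" and x: "abs x < R"
  and unif: "!!t t'. t : {a..b} ==> t' : {a..b} ==> abs (t-t') <= h ==> abs (velocity x t - velocity x t') <= e"
 shows "abs ((f x (s+h) - f x s)/h - velocity x t) <= e"
proof -
 obtain z where z: "s < z" "z < s+h" "(f x (s+h) - f x s)/h = velocity x z"
  by (rule quotient_eq_velocity[OF x, of s "s+h"]) (use h s in auto)
 thus ?thesis using unif[of z t] s t by auto
qed

lemma quotient_comparison:
 assumes r: "0 < r" "r < R" and h: "0 < h" "h < b-a" and small: "8*M*C*r <= l"
  and N: "N = 4*M/r^2" and N2: "N2 >= 0" and e: "e >= 0"
  and L: "L >= 0" "L*l/(2*r) > 4*N + 8*M*C*N*r + N2"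
  and init: "!!x y. abs x <= r ==> abs y <= r
   ==> (f x (a+h) - f x a)/h - (f y (a+h) - f y a)/h <= 3/4*L*abs (x-y) + N2*(b-h-a) + e"
 shows "two_point_comparison r a (b-h) (2*M*C) 1 0 (%x s. (f x (s+h) - f x s)/h) (%x s. (f1 x (s+h) - f1 x s)/h)
  (%x s. (f2 x (s+h) - f2 x s)/h) (%x s. (velocity x (s+h) - velocity x s)/h) (%x s. H (f1 x (s+h))) l (2*M) L N N2 e"
proof
 have "continuous_on ({-r..r} \<times> {a..b-h}) (%y. (%(x,t). f x t) (fst y, snd y + c))" if "c : {0,h}" for c
  by (rule continuous_on_compose2[OF cont]) (use r h that in \<open>auto intro!: continuous_intros\<close>)
 from this[of h] this[of 0] show "continuous_on ({-r..r} \<times> {a..b-h}) (%(x,s). (f x (s+h) - f x s)/h)"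
  unfolding case_prod_beta using h by (auto intro!: continuous_intros)
next
 fix x s assume x: "abs x < r" and s: "a < s" "s <= b-h"
 have xR: "abs x < R" using x r by simp
 have sI: "s : {a<..b}" "s+h : {a<..b}" "s : {a..b}" "s+h : {a..b}" using s h by auto
 show "DERIV (%y. (f y (s+h) - f y s)/h) x :> (f1 x (s+h) - f1 x s)/h"
  "DERIV (%y. (f1 y (s+h) - f1 y s)/h) x :> (f2 x (s+h) - f2 x s)/h"
  by (intro DERIV_cdivide DERIV_diff dx dxx xR sI)+
 have "(f x has_field_derivative velocity x (h+s)) (at (h+s) within (+) h ` {a..b-h})"
  using dt[OF xR sI(2)] h by (auto simp: velocity_def add.commute intro: has_field_derivative_subset)
 hence "((%s. f x (h+s)) has_field_derivative velocity x (h+s)) (at s within {a..b-h})" by (simp only: DERIV_at_within_shift)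
 moreover have "(f x has_field_derivative velocity x s) (at s within {a..b-h})"
  using has_field_derivative_subset[OF dt[OF xR sI(1)]] h by (simp add: velocity_def)
 ultimately show "((%s. (f x (s+h) - f x s)/h) has_field_derivative (velocity x (s+h) - velocity x s)/h) (at s within {a..b-h})"
  by (intro DERIV_cdivide DERIV_diff) (simp_all add: add.commute)
 have "(velocity x (s+h) - velocity x s)/h - H (f1 x (s+h))*((f2 x (s+h) - f2 x s)/h) = (H (f1 x (s+h)) - H (f1 x s))*f2 x s/h"
  unfolding velocity_def using h by (simp add: field_simps)
 also have "abs (...) <= C*abs (f1 x (s+h) - f1 x s)*(2*M)/h"
  unfolding abs_divide abs_mult using H_lip[OF f1[OF xR sI(4)] f1[OF xR sI(3)]] f2[OF xR sI(3)] h by (simp add: divide_right_mono mult_mono)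
 finally show "abs ((velocity x (s+h) - velocity x s)/h - H (f1 x (s+h))*((f2 x (s+h) - f2 x s)/h))
   <= 2*M*C*abs ((f1 x (s+h) - f1 x s)/h) + 0"
  using h by (simp add: mult_ac)
 show "l <= H (f1 x (s+h))" "0 <= H (f1 x (s+h)) & H (f1 x (s+h)) <= 1" using H[OF f1[OF xR sI(4)]] l by auto
next
 fix x s assume x: "abs x <= r" and s: "a <= s" "s <= b-h"
 have "abs x < R" using x r by simp
 moreover obtain z where "s < z" "z < s+h" "(f x (s+h) - f x s)/h = velocity x z"
  by (rule quotient_eq_velocity[of x s "s+h"]) (use \<open>abs x < R\<close> h s in auto)
 ultimately show "abs ((f x (s+h) - f x s)/h) <= 2*M" using abs_velocity_le[of x z] s by auto
qed (use r h l C M small N N2 L e init in \<open>auto simp: mult_ac\<close>)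

lemma velocity_lipschitz:
 assumes r: "0 < r" "r < R" and small: "8*M*C*r <= l" and N: "N = 4*M/r^2" and N2: "N2 >= 0"
  and L: "L >= 0" "L*l/(2*r) > 4*N + 8*M*C*N*r + N2"
  and init: "!!x y. abs x <= r ==> abs y <= r ==> velocity x a - velocity y a <= 3/4*L*abs (x-y) + N2*((b-a)/2)"
  and x: "abs x <= r"
 shows "abs (velocity x b - velocity 0 b) <= (L+N*r)*abs x"
proof (rule field_le_epsilon)
 fix e :: real assume e: "e > 0"
 have "continuous_on ({-r..r} \<times> {a..b}) (%(x,t). velocity x t)"
  using cont_F unfolding velocity_def by (rule continuous_on_subset) (use r in auto)
 hence "uniformly_continuous_on ({-r..r} \<times> {a..b}) (%(x,t). velocity x t)"
  by (intro compact_uniformly_continuous compact_Times compact_Icc)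
 then obtain d where d: "d > 0" "!!p p'. p : {-r..r} \<times> {a..b} ==> p' : {-r..r} \<times> {a..b} ==> dist p' p < d
   ==> dist ((%(x,t). velocity x t) p') ((%(x,t). velocity x t) p) < e/6"
  unfolding uniformly_continuous_on_def using e by (metis divide_pos_pos zero_less_numeral)
 define h where "h = min (d/2) ((b-a)/2)"
 have h: "0 < h" "h < d" "h <= (b-a)/2" using d(1) ab min.cobounded2[of "d/2" "(b-a)/2"] by (auto simp: h_def)
 have unif: "abs (velocity x t - velocity x t') <= e/6"
  if "abs x <= r" "t : {a..b}" "t' : {a..b}" "abs (t-t') <= h" for x t t'
  using d(2)[of "(x,t')" "(x,t)"] that h by (auto simp: dist_Pair_Pair dist_real_def abs_le_iff)
 have xR: "abs x < R" if "abs x <= r" for x using that r by simp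
 note close = quotient_close_to_velocity[OF h(1) _ _ _ xR unif]
 have init': "(f x (a+h) - f x a)/h - (f y (a+h) - f y a)/h <= 3/4*L*abs (x-y) + N2*(b-h-a) + e/3"
  if xy: "abs x <= r" "abs y <= r" for x y
 proof -
  have "N2*((b-a)/2) <= N2*(b-h-a)" using N2 h by (intro mult_left_mono) auto
  moreover have "abs ((f x (a+h) - f x a)/h - velocity x a) <= e/6" "abs ((f y (a+h) - f y a)/h - velocity y a) <= e/6"
   using close[of a a x] close[of a a y] xy h by auto
  ultimately show ?thesis using init[OF xy] by linarith
 qed
 have "h < b-a" "e/3 >= 0" using h e by auto
 then interpret two_point_comparison r a "b-h" "2*M*C" 1 0 "%x s. (f x (s+h) - f x s)/h" "%x s. (f1 x (s+h) - f1 x s)/h"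
  "%x s. (f2 x (s+h) - f2 x s)/h" "%x s. (velocity x (s+h) - velocity x s)/h" "%x s. H (f1 x (s+h))" l "2*M" L N N2 "e/3"
  by (intro quotient_comparison r h small N N2 L init')
 have "abs ((f x b - f x (b-h))/h - velocity x b) <= e/6" "abs ((f 0 b - f 0 (b-h))/h - velocity 0 b) <= e/6"
  using close[of "b-h" b x] close[of "b-h" b 0] x h by auto
 moreover have "abs ((f x b - f x (b-h))/h - (f 0 b - f 0 (b-h))/h) <= (L+N*r)*abs x + e/3" using difference_bound[OF x] by simp
 ultimately show "abs (velocity x b - velocity 0 b) <= (L+N*r)*abs x + e" by linarith
qed

lemma velocity_le_of_f2_lipschitz:
 assumes f2_lip: "abs (f2 x t - f2 y t) <= L*abs (x-y)" and x: "abs x < R" and y: "abs y < R" and t: "t : {a..b}"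
 shows "velocity x t - velocity y t <= (L + 4*M^2*C)*abs (x-y)"
proof -
 have "velocity x t - velocity y t = H (f1 x t)*(f2 x t - f2 y t) + (H (f1 x t) - H (f1 y t))*f2 y t"
  by (simp add: velocity_def algebra_simps)
 also have "... <= abs (H (f1 x t))*abs (f2 x t - f2 y t) + abs (H (f1 x t) - H (f1 y t))*abs (f2 y t)"
  by (metis abs_ge_self abs_mult add_mono)
 also have "... <= 1*(L*abs (x-y)) + (2*M*C*abs (x-y))*(2*M)"
  using H[OF f1[OF x t]] l f2_lip coeff_f1_lipschitz[OF x y t] f2[OF y t] C by (intro add_mono mult_mono) auto
 finally show ?thesis by (simp add: power2_eq_square algebra_simps)
qed

lemma f2_lipschitz_of_velocity:
 assumes v: "abs (velocity x t - velocity y t) <= L*abs (x-y)" and x: "abs x < R" and y: "abs y < R" and t: "t : {a..b}"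
 shows "abs (f2 x t - f2 y t) <= (L + 4*M^2*C)/l*abs (x-y)"
proof -
 have "H (f1 x t)*(f2 x t - f2 y t) = (velocity x t - velocity y t) - (H (f1 x t) - H (f1 y t))*f2 y t"
  by (simp add: velocity_def algebra_simps)
 hence "abs (H (f1 x t))*abs (f2 x t - f2 y t) <= abs (velocity x t - velocity y t) + abs (H (f1 x t) - H (f1 y t))*abs (f2 y t)"
  by (metis abs_mult abs_triangle_ineq4)
 also have "... <= L*abs (x-y) + (2*M*C*abs (x-y))*(2*M)"
  using v coeff_f1_lipschitz[OF x y t] f2[OF y t] C by (intro add_mono mult_mono) auto
 also have "... = (L + 4*M^2*C)*abs (x-y)" by (simp add: power2_eq_square algebra_simps)
 finally have "abs (H (f1 x t))*abs (f2 x t - f2 y t) <= (L + 4*M^2*C)*abs (x-y)" .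
 moreover have "l <= abs (H (f1 x t))" using H[OF f1[OF x t]] by linarith
 ultimately have "l*abs (f2 x t - f2 y t) <= (L + 4*M^2*C)*abs (x-y)"
  using mult_right_mono[of l "abs (H (f1 x t))" "abs (f2 x t - f2 y t)"] by linarith
 thus ?thesis using l by (simp add: field_simps)
qed

end

lemma graph_evolution_f2_lipschitz:
 assumes l: "l > 0" and C: "C > 0" and M: "M > 0" and R: "R > 0" and d: "d > 0" and L0: "L0 >= 0"
 obtains K r where "K >= 0" "0 < r" "r <= R"
  "!!a b f f1 f2 H x. graph_evolution R a b l C M f f1 f2 H
   ==> b-a >= d | (ALL x y. abs x < R --> abs y < R --> abs (f2 x a - f2 y a) <= L0*abs (x-y))
   ==> abs x <= r ==> abs (f2 x b - f2 0 b) <= K*abs x"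
proof -
 define r N N2 Q where "r = min (R/2) (l/(8*M*C))" and "N = 4*M/r^2" and "N2 = 8*M/d" and "Q = 4*N + 8*M*C*N*r + N2"
 define L K where "L = 4/3*(L0 + 4*M^2*C) + 2*r/l*(Q+1)" and "K = (L + N*r + 4*M^2*C)/l"
 have r: "0 < r" "r < R" "8*M*C*r <= l" using R l M C by (auto simp: r_def min_def field_simps)
 have N: "N >= 0" "N2 >= 0" "N2*(d/2) = 4*M" using M d by (auto simp: N_def N2_def)
 have LF: "L0 + 4*M^2*C >= 0" using L0 C by simp
 have "2*r/l*(Q+1) >= 0" using r l N M C by (simp add: Q_def)
 moreover have "3/4*L = L0 + 4*M^2*C + 3/4*(2*r/l*(Q+1))" by (simp add: L_def)
 ultimately have "L0 + 4*M^2*C <= 3/4*L" by simp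
 hence L: "L >= 0" "L0 + 4*M^2*C <= 3/4*L" using LF by linarith+
 have "2*r/l*(Q+1)*l/(2*r) <= L*l/(2*r)" using LF l r by (intro divide_right_mono mult_right_mono) (auto simp: L_def)
 hence LQ: "L*l/(2*r) > Q" using l r by simp
 show thesis
 proof (rule that[of K r])
  show "K >= 0" using L N r C l by (simp add: K_def)
  fix a b f f1 f2 H x
  assume ge: "graph_evolution R a b l C M f f1 f2 H" and x: "abs x <= r"
   and init: "b-a >= d | (ALL x y. abs x < R --> abs y < R --> abs (f2 x a - f2 y a) <= L0*abs (x-y))"
  interpret graph_evolution R a b l C M f f1 f2 H by (rule ge)
  have F0: "velocity x a - velocity y a <= 3/4*L*abs (x-y) + N2*((b-a)/2)" if xy: "abs x <= r" "abs y <= r" for x y using init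
  proof
   assume "b-a >= d"
   hence "4*M <= N2*((b-a)/2)" unfolding N(3)[symmetric] using N(2) by (intro mult_left_mono) auto
   moreover have "velocity x a - velocity y a <= 4*M" using abs_velocity_le[of x a] abs_velocity_le[of y a] xy r ab by auto
   moreover have "0 <= 3/4*L*abs (x-y)" using L by simp
   ultimately show ?thesis by linarith
  next
   assume "ALL x y. abs x < R --> abs y < R --> abs (f2 x a - f2 y a) <= L0*abs (x-y)"
   hence "velocity x a - velocity y a <= (L0 + 4*M^2*C)*abs (x-y)" using xy r ab by (intro velocity_le_of_f2_lipschitz) auto
   also have "... <= 3/4*L*abs (x-y)" using L(2) by (intro mult_right_mono) auto
   finally show ?thesis using N(2) ab by (simp add: add_increasing2)
  qed
  have "abs (velocity x b - velocity 0 b) <= (L+N*r)*abs (x-0)"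
   using velocity_lipschitz[OF r N_def N(2) L(1) LQ[unfolded Q_def] F0 x] by simp
  from f2_lipschitz_of_velocity[OF this] show "abs (f2 x b - f2 0 b) <= K*abs x" using x r ab unfolding K_def by simp
 qed (use r in auto)
qed

definition near_curve :: "real => (real => complex) => (real => complex) => bool" where
 "near_curve d g h \<longleftrightarrow> (ALL u. EX v. cmod (h v - g u) <= d)"

lemma near_curve_trans:
 assumes "near_curve d f g" "near_curve e g h" shows "near_curve (d+e) f h"
 unfolding near_curve_def
proof
 fix u
 obtain v w where "cmod (g v - f u) <= d" "cmod (h w - g v) <= e" using assms unfolding near_curve_def by metis
 thus "EX w. cmod (h w - f u) <= d+e" using norm_triangle_ineq[of "g v - f u" "h w - g v"] by (intro exI[of _ w]) simp
qed

lemma near_curve_mono: "near_curve d g h ==> d <= e ==> near_curve e g h" unfolding near_curve_def by (meson order_trans)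

lemma near_curve_nonneg: "near_curve d g h ==> d >= 0" unfolding near_curve_def using norm_ge_zero by (metis order_trans)

lemma near_curve_greatest_lower_bound:
 assumes c: "c2loop h" and near: "!!d. d : D ==> near_curve d g h" and e: "!!x. (!!d. d : D ==> x <= d) ==> x <= e"
 shows "near_curve e g h"
 unfolding near_curve_def
proof
 fix u
 have "continuous_on UNIV (%v. cmod (h v - g u))" using c2loopD(8)[OF c] by (intro continuous_intros)
 moreover have "cmod (h (v+1) - g u) = cmod (h v - g u)" for v using c2loopD(6)[OF c, of v] by simp
 ultimately obtain v0 where "!!v. cmod (h v0 - g u) <= cmod (h v - g u)" by (rule periodic_attains_inf) blast
 thus "EX v. cmod (h v - g u) <= e" using near e unfolding near_curve_def by (metis order_trans)
qed

lemma near_curve_0_iff: "near_curve 0 g h \<longleftrightarrow> range g <= range h"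
 unfolding near_curve_def by (auto simp: image_subset_iff image_iff) metis+

definition admissible_flow :: "real => real => real => real => real => (real => real) => (real => real => complex) => bool" where
 "admissible_flow l C M eta tau A gam \<longleftrightarrow> is_flow A gam {0..tau} & (ALL theta. A (theta+pi/2) = A theta) & (ALL theta. l <= A theta & A theta <= 1)
  & (ALL theta theta'. abs (A theta - A theta') <= C*abs (theta-theta')) & (ALL t : {0..tau}. ALL u. abs (curv gam t u) <= M)
  & (ALL t : {0..tau}. hugs_tangents M eta (slice gam t))"

lemma admissible_flowD:
 assumes "admissible_flow l C M eta tau A gam"
 shows "is_flow A gam {0..tau}" "!!theta. A (theta+pi/2) = A theta" "!!theta. l <= A theta & A theta <= 1"
  "!!theta theta'. abs (A theta - A theta') <= C*abs (theta-theta')" "!!t u. t : {0..tau} ==> abs (curv1 (slice gam t) u) <= M"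
  "!!t. t : {0..tau} ==> hugs_tangents M eta (slice gam t)" "!!t. t : {0..tau} ==> c2loop (slice gam t)"
 using assms is_flow_c2loop unfolding admissible_flow_def curv_def by blast+

lemma admissible_flow_box_graph:
 assumes g: "admissible_flow l C M eta tau A g" and h: "admissible_flow l C M eta tau B h" and t: "t0 : {0..tau}" "t : {0..tau}"
  and r: "r > 0" "1000*M*r <= 1" "8*r <= eta" and near: "near_curve (r/100) (slice g t0) (slice h t)"
 shows "box_graph (g u t0) (tangent (slice g t0) u) (r/2) (slice h t)"
 using box_graph_of_close[OF admissible_flowD(7)[OF g t(1)] admissible_flowD(5)[OF g t(1)] admissible_flowD(7)[OF h t(2)]
  admissible_flowD(5)[OF h t(2)] admissible_flowD(6)[OF h t(2)] r, of u] near by (auto simp: near_curve_def slice_def)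

lemma admissible_flow_speed:
 assumes g: "admissible_flow l C M eta tau A gam" and l: "l > 0" and s: "s : {0..tau}" and t: "t : {0..tau}"
 shows "near_curve (M*abs (t-s)) (slice gam s) (slice gam t)"
 unfolding near_curve_def slice_def
proof
 fix u
 show "EX v. cmod (gam v t - gam u s) <= M*abs (t-s)"
 proof (rule flow_speed[OF admissible_flowD(1)[OF g] _ s t])
  fix t u assume "t : {0..tau}"
  hence "abs (A (Arg (d1 (slice gam t) u)))*abs (curv gam t u) <= 1*M"
   using admissible_flowD(5)[OF g, of t u] admissible_flowD(3)[OF g, of "Arg (d1 (slice gam t) u)"] l
   by (intro mult_mono) (auto simp: curv_def)
  thus "abs (A (Arg (d1 (slice gam t) u))*curv gam t u) <= M" by (simp add: abs_mult)
 qed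
qed

lemma admissible_flow_graph:
 assumes g: "admissible_flow l C M eta tau A gam" and T: "cmod T = 1" and J: "J <= {0..tau}"
  and b: "!!t. t : J ==> box_graph p T r (slice gam t)" and t: "t : J" and x: "abs x < r"
 shows "DERIV (gval p T r (slice gam t)) x :> gslope p T r (slice gam t) x"
  "DERIV (gslope p T r (slice gam t)) x :> gsecond p T r (slice gam t) x"
  "abs (gslope p T r (slice gam t) x) <= 1/2" "abs (gsecond p T r (slice gam t) x) <= 2*M"
  "t > 0 ==> ((%s. gval p T r (slice gam s) x) has_field_derivative
   graph_coeff A (Arg T) (gslope p T r (slice gam t) x)*gsecond p T r (slice gam t) x) (at t within J)"
proof -
 have tI: "t : {0..tau}" using t J by auto
 note bc = b[OF t] T admissible_flowD(7)[OF g tI]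
 show "DERIV (gval p T r (slice gam t)) x :> gslope p T r (slice gam t) x"
  "DERIV (gslope p T r (slice gam t)) x :> gsecond p T r (slice gam t) x"
  "abs (gslope p T r (slice gam t) x) <= 1/2" "abs (gsecond p T r (slice gam t) x) <= 2*M"
  using gval_derivative[OF bc x] gslope_derivative[OF bc x] abs_gslope_le[OF bc less_imp_le[OF x]]
   abs_gsecond_le[OF bc less_imp_le[OF x] admissible_flowD(5)[OF g tI]] by auto
 show "((%s. gval p T r (slice gam s) x) has_field_derivative
   graph_coeff A (Arg T) (gslope p T r (slice gam t) x)*gsecond p T r (slice gam t) x) (at t within J)" if "t > 0"
  using flow_graph_time_derivative[OF admissible_flowD(1)[OF g] T J b admissible_flowD(2)[OF g] t that x] by (simp add: graph_coeff_def)
qed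

lemma graph_coeff_lipschitz_pair:
 assumes g: "admissible_flow l C M eta tau A gam" and h: "admissible_flow l C M eta tau B gam'" and l: "l > 0" and C: "C >= 0"
  and AB: "!!theta. abs (A theta - B theta) <= e"
 shows "abs (graph_coeff A alpha q - graph_coeff B alpha q') <= (C+1)*abs (q-q') + e"
proof (rule graph_coeff_lipschitz[OF _ _ C])
 show "abs (A theta - B theta') <= C*abs (theta-theta') + e" for theta theta'
  using admissible_flowD(4)[OF g, of theta theta'] AB[of theta'] by linarith
 show "0 <= B theta & B theta <= 1" for theta using admissible_flowD(3)[OF h, of theta] l by auto
qed

lemma admissible_flow_graph_evolution:
 assumes g: "admissible_flow l C M eta tau A gam" and l: "l > 0" and C: "C >= 0" and M: "M > 0"
  and T: "cmod T = 1" and ab: "0 <= a" "a < b" "b <= tau" and y: "abs y + R <= r"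
  and box: "!!s. s : {a..b} ==> box_graph p T r (slice gam s)"
 shows "graph_evolution R a b (4/5*l) (C+1) M (%z s. gval p T r (slice gam s) (y+z))
  (%z s. gslope p T r (slice gam s) (y+z)) (%z s. gsecond p T r (slice gam s) (y+z)) (graph_coeff A (Arg T))"
proof
 have J: "{a..b} <= {0..tau}" using ab by auto
 note G = admissible_flow_graph[where J="{a..b}" and p=p and r=r, OF g T J box]
 note fc = flow_graph_continuous[OF admissible_flowD(1)[OF g] T J box]
 have yz: "abs (y+z) < r" if "abs z < R" for z using that y by linarith
 have shift: "continuous_on ({-R<..<R} \<times> {a..b}) (%(z,s). h (y+z) s)"
  if "continuous_on ({-r..r} \<times> {a..b}) (%(z,s). h z s)" for h :: "real => real => real"
 proof -
  have "continuous_on ({-R<..<R} \<times> {a..b}) (%w. (%(z,s). h z s) (y + fst w, snd w))"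
   by (rule continuous_on_compose2[OF that]) (use yz in \<open>force intro!: continuous_intros simp: abs_less_iff\<close>)+
  thus ?thesis by (simp add: case_prod_beta)
 qed
 show H_lip: "abs (graph_coeff A (Arg T) q - graph_coeff A (Arg T) q') <= (C+1)*abs (q-q')" for q q'
  using graph_coeff_lipschitz_pair[OF g g l C, of 0] by simp
 have "continuous_on UNIV (graph_coeff A (Arg T))"
  by (rule lipschitz_on_continuous_on[OF lipschitz_onI, of _ _ "C+1"]) (use H_lip C in \<open>auto simp: dist_real_def\<close>)
 hence "continuous_on ({-r..r} \<times> {a..b}) (%x. graph_coeff A (Arg T) ((%(z,s). gslope p T r (slice gam s) z) x))"
  by (rule continuous_on_compose2[OF _ fc(2)]) auto
 hence "continuous_on ({-r..r} \<times> {a..b}) (%(z,s). graph_coeff A (Arg T) (gslope p T r (slice gam s) z)*gsecond p T r (slice gam s) z)"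
  using fc(3) unfolding case_prod_beta by (intro continuous_intros)
 from shift[OF this] shift[OF fc(1)]
 show "continuous_on ({-R<..<R} \<times> {a..b}) (%(z,s). graph_coeff A (Arg T) (gslope p T r (slice gam s) (y+z))*gsecond p T r (slice gam s) (y+z))"
  "continuous_on ({-R<..<R} \<times> {a..b}) (%(z,s). gval p T r (slice gam s) (y+z))" .
 fix z s assume z: "abs z < R"
 show "DERIV (%z. gval p T r (slice gam s) (y+z)) z :> gslope p T r (slice gam s) (y+z)"
  "DERIV (%z. gslope p T r (slice gam s) (y+z)) z :> gsecond p T r (slice gam s) (y+z)"
  "abs (gslope p T r (slice gam s) (y+z)) <= 1/2" "abs (gsecond p T r (slice gam s) (y+z)) <= 2*M" if "s : {a..b}"
  using G(1-4)[of s "z+y"] that yz[OF z] by (simp_all add: DERIV_shift add.commute[of y])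
 show "((%s. gval p T r (slice gam s) (y+z)) has_field_derivative
   graph_coeff A (Arg T) (gslope p T r (slice gam s) (y+z))*gsecond p T r (slice gam s) (y+z)) (at s within {a..b})" if "s : {a<..b}"
  using G(5)[of s "y+z"] yz[OF z] that ab by auto
qed (use graph_coeff_bounds[OF admissible_flowD(3)[OF g] _ l] l C M ab in auto)

lemma gsecond_lipschitz:
 assumes l: "l > 0" and C: "C >= 0" and M: "M > 0" and r: "r > 0" and d: "d > 0" and L0: "L0 >= 0"
 obtains L where "L >= 0" "!!A gam eta tau p T t0 t x y. admissible_flow l C M eta tau A gam ==> cmod T = 1
  ==> (!!s. s : {0..tau} ==> abs (s-t0) <= 2*d ==> box_graph p T r (slice gam s))
  ==> (abs t0 <= 2*d ==> ALL x y. abs x < r --> abs y < r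
   --> abs (gsecond p T r (slice gam 0) x - gsecond p T r (slice gam 0) y) <= L0*abs (x-y))
  ==> t : {0..tau} ==> abs (t-t0) <= d ==> abs x <= r/2 ==> abs y <= r/2
  ==> abs (gsecond p T r (slice gam t) x - gsecond p T r (slice gam t) y) <= L*abs (x-y)"
proof -
 have "4/5*l > 0" "C+1 > 0" "r/2 > 0" using l C r by auto
 then obtain K q where K: "K >= 0" "0 < q" "q <= r/2"
  "!!a b f f1 f2 H x. graph_evolution (r/2) a b (4/5*l) (C+1) M f f1 f2 H
   ==> b-a >= d | (ALL x y. abs x < r/2 --> abs y < r/2 --> abs (f2 x a - f2 y a) <= L0*abs (x-y))
   ==> abs x <= q ==> abs (f2 x b - f2 0 b) <= K*abs x"
  using graph_evolution_f2_lipschitz[OF _ _ M _ d L0, of "4/5*l" "C+1" "r/2"] by metis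
 show thesis
 proof (rule that[of "max L0 (max K (4*M/q))"])
  fix A gam eta tau p T t0 t x y
  assume g: "admissible_flow l C M eta tau A gam" and T: "cmod T = 1"
   and b: "!!s. s : {0..tau} ==> abs (s-t0) <= 2*d ==> box_graph p T r (slice gam s)"
   and init: "abs t0 <= 2*d ==> ALL x y. abs x < r --> abs y < r
    --> abs (gsecond p T r (slice gam 0) x - gsecond p T r (slice gam 0) y) <= L0*abs (x-y)"
   and t: "t : {0..tau}" "abs (t-t0) <= d" and x: "abs x <= r/2" and y: "abs y <= r/2"
  define f where "f = gsecond p T r (slice gam t)"
  consider "t = 0" | "t > 0" "abs (x-y) <= q" | "abs (x-y) > q" using t by fastforce
  hence "abs (f x - f y) <= L0*abs (x-y) | abs (f x - f y) <= K*abs (x-y) | abs (f x - f y) <= 4*M/q*abs (x-y)"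
  proof cases
   case 1
   thus ?thesis using init t x y r by (simp add: f_def)
  next
   case 2
   define a where "a = (if t >= d then t-d else 0)"
   have a: "0 <= a" "a < t" "t-a <= d" using 2 d by (auto simp: a_def)
   have box: "box_graph p T r (slice gam s)" if "s : {a..t}" for s using that a t by (intro b) auto
   have init': "t-a >= d | (ALL z z'. abs z < r/2 --> abs z' < r/2
     --> abs (gsecond p T r (slice gam a) (y+z) - gsecond p T r (slice gam a) (y+z')) <= L0*abs (z-z'))"
   proof (cases "t >= d")
    case False
    hence "a = 0" "abs t0 <= 2*d" using t by (auto simp: a_def)
    moreover have "abs (y+z) < r" if "abs z < r/2" for z using that y by linarith
    ultimately show ?thesis using init by (metis add_diff_cancel_left)
   qed (simp add: a_def)
   have "graph_evolution (r/2) a t (4/5*l) (C+1) M (%z s. gval p T r (slice gam s) (y+z))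
     (%z s. gslope p T r (slice gam s) (y+z)) (%z s. gsecond p T r (slice gam s) (y+z)) (graph_coeff A (Arg T))"
    by (rule admissible_flow_graph_evolution[OF g l C M T a(1,2) _ _ box]) (use t y in auto)
   from K(4)[OF this init' 2(2)] show ?thesis by (simp add: f_def)
  next
   case 3
   have "abs (f x) <= 2*M" "abs (f y) <= 2*M" using b t admissible_flow_graph(4)[OF g T, of "{t}" p r t] x y r by (auto simp: f_def)
   moreover have "4*M <= 4*M/q*abs (x-y)" using 3 M K(2) by (simp add: field_simps)
   ultimately show ?thesis by linarith
  qed
  moreover have "L0*abs (x-y) <= max L0 (max K (4*M/q))*abs (x-y)" "K*abs (x-y) <= max L0 (max K (4*M/q))*abs (x-y)"
   "4*M/q*abs (x-y) <= max L0 (max K (4*M/q))*abs (x-y)" by (intro mult_right_mono; simp)+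
  ultimately show "abs (gsecond p T r (slice gam t) x - gsecond p T r (slice gam t) y) <= max L0 (max K (4*M/q))*abs (x-y)"
   unfolding f_def by linarith
 qed (use L0 in simp)
qed

lemma gval_center:
 assumes "box_graph (g u) T r g" "cmod T = 1" "c2loop g" "r >= 0" shows "gval (g u) T r g 0 = 0"
 using gval_unique[OF assms(1-3), of u] assms(4) by (simp add: in_box_def)

lemma gval_close:
 assumes b1: "box_graph p T r g" "c2loop g" and b2: "box_graph p T r h" "c2loop h" and T: "cmod T = 1"
  and near: "near_curve d g h" and x: "abs x + d < r" and d: "d <= r/2"
 shows "abs (gval p T r g x - gval p T r h x) <= 2*d"
proof -
 have xr: "abs x < r" using x near_curve_nonneg[OF near] by linarith
 note gp = gpar_props[OF b1(1) T b1(2) less_imp_le[OF xr]]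
 obtain v where v: "cmod (h v - g (gpar p T r g x)) <= d" using near unfolding near_curve_def by blast
 define c where "c = coord p T (h v)"
 have "c - coord p T (g (gpar p T r g x)) = cnj T * (h v - g (gpar p T r g x))" by (simp add: c_def coord_def algebra_simps)
 hence "cmod (c - Complex x (gval p T r g x)) <= d" unfolding gp(2) using v T by (simp add: norm_mult)
 hence c: "abs (Re c - x) <= d" "abs (Im c - gval p T r g x) <= d"
  using abs_Re_le_cmod[of "c - Complex x (gval p T r g x)"] abs_Im_le_cmod[of "c - Complex x (gval p T r g x)"] by auto
 have "gval p T r h (Re c) = Im c" using c(2) gp(3) d
  unfolding c_def using c(1) x by (intro gval_unique[OF b2(1) T b2(2)]) (auto simp: in_box_def c_def)
 moreover have "abs (gval p T r h (Re c) - gval p T r h x) <= 1/2*abs (Re c - x)"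
  by (rule lipschitz_of_derivative[where r = r and f' = "gslope p T r h"])
   (use gval_derivative[OF b2(1) T b2(2)] abs_gslope_le[OF b2(1) T b2(2)] c(1) x in auto)
 ultimately have "abs (Im c - gval p T r h x) <= d" using c(1) near_curve_nonneg[OF near] by simp
 thus ?thesis using c(2) by linarith
qed

lemma graph_difference_parabolic:
 assumes g: "admissible_flow l C M eta tau A g" and h: "admissible_flow l C M eta tau B h" and l: "l > 0" and C: "C >= 0" and M: "M > 0"
  and AB: "!!theta. abs (A theta - B theta) <= e" and T: "cmod T = 1" and st: "0 <= s" "s < t" "t <= tau" and rho: "0 < rho" "rho < r"
  and box: "!!q. q : {s..t} ==> box_graph p T r (slice g q)" "!!q. q : {s..t} ==> box_graph p T r (slice h q)"
 shows "parabolic_inequality rho s t (2*M*(C+1)) 1 (2*M*e)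
  (%x q. gval p T r (slice g q) x - gval p T r (slice h q) x)
  (%x q. gslope p T r (slice g q) x - gslope p T r (slice h q) x)
  (%x q. gsecond p T r (slice g q) x - gsecond p T r (slice h q) x)
  (%x q. graph_coeff A (Arg T) (gslope p T r (slice g q) x)*gsecond p T r (slice g q) x
   - graph_coeff B (Arg T) (gslope p T r (slice h q) x)*gsecond p T r (slice h q) x)
  (%x q. graph_coeff A (Arg T) (gslope p T r (slice g q) x))"
proof
 have J: "{s..t} <= {0..tau}" using st by auto
 have "continuous_on ({-rho..rho} \<times> {s..t}) (%(x,q). gval p T r (slice g q) x)"
  by (rule continuous_on_subset[OF flow_graph_continuous(1)[OF admissible_flowD(1)[OF g] T J box(1)]]) (use rho in auto)
 moreover have "continuous_on ({-rho..rho} \<times> {s..t}) (%(x,q). gval p T r (slice h q) x)"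
  by (rule continuous_on_subset[OF flow_graph_continuous(1)[OF admissible_flowD(1)[OF h] T J box(2)]]) (use rho in auto)
 ultimately show "continuous_on ({-rho..rho} \<times> {s..t}) (%(x,q). gval p T r (slice g q) x - gval p T r (slice h q) x)"
  using continuous_on_diff by fastforce
 show "2*M*(C+1) >= 0" "2*M*e >= 0" using M C AB[of 0] by auto
 fix x q assume x: "abs x < rho" and q: "s < q" "q <= t"
 have xr: "abs x < r" and qI: "q : {s..t}" "q > 0" using x q rho st by auto
 note G = admissible_flow_graph[where J="{s..t}" and p=p and r=r, OF g T J box(1) qI(1) xr]
 note H = admissible_flow_graph[where J="{s..t}" and p=p and r=r, OF h T J box(2) qI(1) xr]
 show "DERIV (%x. gval p T r (slice g q) x - gval p T r (slice h q) x) x :> gslope p T r (slice g q) x - gslope p T r (slice h q) x"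
  "DERIV (%x. gslope p T r (slice g q) x - gslope p T r (slice h q) x) x :> gsecond p T r (slice g q) x - gsecond p T r (slice h q) x"
  "((%q. gval p T r (slice g q) x - gval p T r (slice h q) x) has_field_derivative
   graph_coeff A (Arg T) (gslope p T r (slice g q) x)*gsecond p T r (slice g q) x
    - graph_coeff B (Arg T) (gslope p T r (slice h q) x)*gsecond p T r (slice h q) x) (at q within {s..t})"
  by (rule DERIV_diff[OF G(1) H(1)] DERIV_diff[OF G(2) H(2)] DERIV_diff[OF G(5)[OF _ qI(2)] H(5)[OF _ qI(2)]] | assumption)+
 define a b where "a = gslope p T r (slice g q) x" and "b = gslope p T r (slice h q) x"
 define a' b' where "a' = gsecond p T r (slice g q) x" and "b' = gsecond p T r (slice h q) x"
 have "abs (graph_coeff A (Arg T) a - graph_coeff B (Arg T) b)*abs b' <= ((C+1)*abs (a-b) + e)*(2*M)"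
  using graph_coeff_lipschitz_pair[OF g h l C AB, of "Arg T" a b] H(4) by (intro mult_mono) (auto simp: b'_def)
 moreover have "graph_coeff A (Arg T) a*a' - graph_coeff B (Arg T) b*b' - graph_coeff A (Arg T) a*(a'-b')
   = (graph_coeff A (Arg T) a - graph_coeff B (Arg T) b)*b'" by (simp add: algebra_simps)
 moreover have "((C+1)*abs (a-b) + e)*(2*M) = 2*M*(C+1)*abs (a-b) + 2*M*e" by (simp add: algebra_simps)
 ultimately show "abs (graph_coeff A (Arg T) (gslope p T r (slice g q) x)*gsecond p T r (slice g q) x
    - graph_coeff B (Arg T) (gslope p T r (slice h q) x)*gsecond p T r (slice h q) x
    - graph_coeff A (Arg T) (gslope p T r (slice g q) x)*(gsecond p T r (slice g q) x - gsecond p T r (slice h q) x))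
   <= 2*M*(C+1)*abs (gslope p T r (slice g q) x - gslope p T r (slice h q) x) + 2*M*e"
  unfolding a_def[symmetric] b_def[symmetric] a'_def[symmetric] b'_def[symmetric] by (simp only: abs_mult)
 show "0 <= graph_coeff A (Arg T) (gslope p T r (slice g q) x) & graph_coeff A (Arg T) (gslope p T r (slice g q) x) <= 1"
  using graph_coeff_bounds[OF admissible_flowD(3)[OF g] G(3) l] l by (auto intro: order_trans[of 0 "4/5*l"])
qed (use rho st in auto)

text \<open>If the second flow stays within d of the first one over a short time, then by the local maximum
 principle it stays within d/2 up to the initial distance and the distance of the anisotropies. Iterating
 this improvement removes d altogether.\<close>

context
 fixes l C M eta tau e r delta :: real and A B :: "real => real" and g h :: "real => real => complex"
 assumes g: "admissible_flow l C M eta tau A g" and h: "admissible_flow l C M eta tau B h"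
  and l: "l > 0" and C: "C >= 0" and M: "M > 0" and AB: "!!theta. abs (A theta - B theta) <= e"
  and r: "r > 0" "1000*M*r <= 1" "8*r <= eta"
  and delta: "delta > 0" "600*M*delta <= r" "delta*(4*(1+2*M*(C+1)*(r/4))/(r/4)^2) <= 1/2"
begin

lemma near_curve_improves:
 assumes st: "0 <= s" "s < t" "t <= tau" and t: "t <= s+delta"
  and m: "near_curve m (slice g s) (slice h s)" and md: "m <= d" and d: "M*delta + d <= r/100"
  and near: "!!q. q : {s..t} ==> near_curve d (slice g q) (slice h q)"
 shows "near_curve (2*m + 2*M*delta*e + d/2) (slice g t) (slice h t)"
 unfolding near_curve_def
proof
 fix u
 have d0: "0 <= m" "0 <= d" using near_curve_nonneg[OF m] md by auto
 have tI: "t : {0..tau}" using st by auto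
 define p T where "p = g u t" and "T = tangent (slice g t) u"
 have T: "cmod T = 1" unfolding T_def by (rule tangent_unit(1)[OF admissible_flowD(7)[OF g tI]])
 have near_t: "near_curve (M*delta) (slice g t) (slice g q)" if q: "q : {s..t}" for q
  by (rule near_curve_mono[OF admissible_flow_speed[OF g l tI]]) (use q t st M in \<open>auto intro!: mult_left_mono\<close>)
 have box: "box_graph p T (r/2) (slice g q)" "box_graph p T (r/2) (slice h q)" if q: "q : {s..t}" for q unfolding p_def T_def
  using near_curve_mono[OF near_t[OF q], of "r/100"] near_curve_mono[OF near_curve_trans[OF near_t[OF q] near[OF q]], of "r/100"]
   q st d d0 by (auto intro!: admissible_flow_box_graph[OF g g tI _ r] admissible_flow_box_graph[OF g h tI _ r])
 define f where "f x q = gval p T (r/2) (slice g q) x - gval p T (r/2) (slice h q) x" for x q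
 have close: "abs (f x q) <= 2*d'"
  if q: "q : {s..t}" and x: "abs x <= r/4" and d': "near_curve d' (slice g q) (slice h q)" "d' <= d" for q x d'
  using d d' mult_pos_pos[OF M delta(1)] q st x unfolding f_def
  by (intro gval_close[OF box(1)[OF q] admissible_flowD(7)[OF g] box(2)[OF q] admissible_flowD(7)[OF h] T d'(1)]) auto
 have init: "abs (f x s) <= 2*m" if "abs x <= r/4" for x by (rule close[OF _ that m md]) (use st in auto)
 have later: "abs (f x q) <= 2*d" if "abs x <= r/4" "s <= q" "q <= t" for x q by (rule close[OF _ that(1) near]) (use that in auto)
 define Q where "Q = (1+2*M*(C+1)*(r/4))/(r/4)^2"
 have "0 < r/4" "r/4 < r/2" using r by auto
 note parab = graph_difference_parabolic[OF g h l C M AB T st this box, folded f_def]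
 have "f 0 t <= 2*m + (t-s)*(2*M*e + 2*(2*d)*Q)"
  using parabolic_inequality.upper_bound_at_center[OF parab, of "2*d" "2*m"] later init d0 unfolding Q_def abs_le_iff by auto
 moreover have "-f 0 t <= 2*m + (t-s)*(2*M*e + 2*(2*d)*Q)"
  using parabolic_inequality.upper_bound_at_center[OF parabolic_inequality.negated[OF parab], of "2*d" "2*m"]
   later init d0 unfolding Q_def abs_le_iff by auto
 moreover have "(t-s)*(2*M*e) <= delta*(2*M*e)" using t M AB[of 0] by (intro mult_right_mono) auto
 moreover have "Q >= 0" using M C r by (simp add: Q_def)
 hence "(t-s)*(4*Q)*d <= delta*(4*Q)*d" using t d0 by (intro mult_right_mono) auto
 moreover have "delta*(4*Q)*d <= 1/2*d" using delta(3) d0 unfolding Q_def by (intro mult_right_mono) auto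
 ultimately have K: "abs (f 0 t) <= 2*m + 2*M*delta*e + d/2" by (simp add: algebra_simps)
 have "gval p T (r/2) (slice g t) 0 = 0"
  using gval_center[of "slice g t" u T "r/2"] box(1)[of t] T admissible_flowD(7)[OF g tI] r st by (simp add: p_def slice_def)
 moreover have "box_graph p T (r/2) (slice h t)" using box(2) st by auto
 from gpar_props(2)[OF this T admissible_flowD(7)[OF h tI], of 0]
 obtain v where "coord p T (slice h t v) = Complex 0 (gval p T (r/2) (slice h t) 0)" using r by auto
 hence "cmod (coord p T (slice h t v)) = abs (gval p T (r/2) (slice h t) 0)" by (simp add: cmod_def)
 ultimately have "cmod (slice h t v - slice g t u) = abs (f 0 t)" using T by (simp add: f_def coord_def norm_mult p_def slice_def)
 thus "EX v. cmod (slice h t v - slice g t u) <= 2*m + 2*M*delta*e + d/2" using K by metis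
qed

lemma near_curve_short_time:
 assumes s: "s : {0..tau}" and m: "near_curve m (slice g s) (slice h s)" "m <= r/200" and t: "t : {s..s+delta}" "t <= tau"
 shows "near_curve (4*m + 4*M*delta*e) (slice g t) (slice h t)"
proof -
 define D where "D = {d. m <= d & (ALL t : {s..s+delta}. t <= tau --> near_curve d (slice g t) (slice h t))}"
 have "near_curve (m + 2*M*delta) (slice g t) (slice h t)" if t: "t : {s..s+delta}" "t <= tau" for t
 proof -
  have tI: "t : {0..tau}" using t s by auto
  have "near_curve (M*delta) (slice g t) (slice g s)" "near_curve (M*delta) (slice h s) (slice h t)"
   using t M by (auto intro!: near_curve_mono[OF admissible_flow_speed[OF g l tI s]] near_curve_mono[OF admissible_flow_speed[OF h l s tI]])
  from near_curve_trans[OF near_curve_trans[OF this(1) m(1)] this(2)] show ?thesis by (simp add: ac_simps)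
 qed
 hence D0: "m + 2*M*delta : D" using M delta by (simp add: D_def)
 have bdd: "bdd_below D" unfolding D_def by (rule bdd_belowI[of _ m]) auto
 have near: "near_curve (Inf D) (slice g t) (slice h t)" if t: "t : {s..s+delta}" "t <= tau" for t
 proof (rule near_curve_greatest_lower_bound[where D=D])
  show "c2loop (slice h t)" using admissible_flowD(7)[OF h] t s by auto
  show "near_curve d (slice g t) (slice h t)" if "d : D" for d using that t by (simp add: D_def)
  show "x <= Inf D" if "!!d. d : D ==> x <= d" for x using cInf_greatest[of D x] D0 that by blast
 qed
 have mD: "m <= Inf D" by (rule cInf_greatest) (use D0 in blast, simp add: D_def)
 have MD: "M*delta + Inf D <= r/100" using cInf_lower[OF D0 bdd] delta m(2) by linarith
 define d where "d = 2*m + 2*M*delta*e + Inf D/2"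
 have d: "m <= d" using M delta AB[of 0] near_curve_nonneg[OF m(1)] mD by (simp add: d_def)
 have "near_curve d (slice g t) (slice h t)" if t: "t : {s..s+delta}" "t <= tau" for t
 proof (cases "t = s")
  case False
  thus ?thesis unfolding d_def using t s near by (intro near_curve_improves[OF _ _ _ _ m(1) mD MD]) auto
 qed (use near_curve_mono[OF m(1) d] in simp)
 hence "d : D" using d by (simp add: D_def)
 hence "Inf D <= d" by (rule cInf_lower[OF _ bdd])
 hence "Inf D <= 4*m + 4*M*delta*e" by (simp add: d_def)
 thus ?thesis using near_curve_mono[OF near[OF t]] by blast
qed

lemma near_curve_iterated:
 assumes init: "range (slice g 0) <= range (slice h 0)" and c: "c = 4/3*M*delta*e" and small: "4^J*c <= r/200"
  and j: "j <= J" and t: "t : {0..tau}" "t <= real j*delta"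
 shows "near_curve ((4^j-1)*c) (slice g t) (slice h t)"
 using j t
proof (induction j arbitrary: t)
 case 0
 hence "t = 0" by auto
 thus ?case using init by (simp add: near_curve_0_iff)
next
 case (Suc j)
 have c0: "c >= 0" using M delta AB[of 0] unfolding c by (intro mult_nonneg_nonneg) auto
 show ?case
 proof (cases "t <= real j*delta")
  case True
  have "(4^j-1)*c <= (4^Suc j-1)*c" using c0 by (intro mult_right_mono) auto
  thus ?thesis using near_curve_mono[OF Suc.IH] Suc.prems True by fastforce
 next
  case False
  define s where "s = real j*delta"
  have s: "s : {0..tau}" "t : {s..s+delta}" using False Suc.prems by (auto simp: s_def algebra_simps)
  have "(4 :: real)^j <= 4^J" using Suc.prems by (intro power_increasing) auto
  hence "(4 :: real)^j - 1 <= 4^J" by linarith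
  hence "(4^j-1)*c <= 4^J*c" using c0 by (rule mult_right_mono)
  hence "near_curve (4*((4^j-1)*c) + 4*M*delta*e) (slice g t) (slice h t)"
   using Suc.prems s small Suc.IH[of s] by (intro near_curve_short_time[of s]) (auto simp: s_def)
  moreover have "4*((4^j-1)*c) + 4*M*delta*e = (4^Suc j-1)*c" unfolding c by (simp add: field_simps)
  ultimately show ?thesis by metis
 qed
qed

end

theorem flow_stability:
 assumes l: "l > 0" and C: "C >= 0" and M: "M > 0" and eta: "eta > 0" and d: "d > 0"
 obtains e where "e > 0" "!!A B g h t. admissible_flow l C M eta tau A g ==> admissible_flow l C M eta tau B h
  ==> (!!theta. abs (A theta - B theta) <= e) ==> range (slice g 0) <= range (slice h 0) ==> t : {0..tau}
  ==> near_curve d (slice g t) (slice h t)"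
proof -
 define r where "r = min (1/(1000*M)) (eta/8)"
 have r: "r > 0" "1000*M*r <= 1" "8*r <= eta" using M eta by (auto simp: r_def min_def field_simps)
 define Q where "Q = 4*(1+2*M*(C+1)*(r/4))/(r/4)^2"
 have Q: "Q > 0" unfolding Q_def using M C r by (intro divide_pos_pos mult_pos_pos add_pos_nonneg) auto
 define delta where "delta = min (r/(600*M)) (1/(2*Q))"
 have "delta <= r/(600*M)" "delta <= 1/(2*Q)" by (auto simp: delta_def)
 moreover have "delta > 0" using M r Q by (simp add: delta_def)
 ultimately have delta: "delta > 0" "600*M*delta <= r" "delta*Q <= 1/2" using M Q by (auto simp: field_simps)
 define J where "J = nat \<lceil>tau/delta\<rceil>"
 have "tau/delta <= real J" unfolding J_def by (rule real_nat_ceiling_ge)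
 hence J: "tau <= real J*delta" using delta by (simp add: field_simps)
 define c e where "c = 4/3*M*delta" and "e = min d (r/200)/(4^J*c)"
 have c: "c > 0" using M delta by (simp add: c_def)
 have e: "e > 0" "4^J*(c*e) <= d" "4^J*(c*e) <= r/200" using d r c by (auto simp: e_def)
 show thesis
 proof (rule that[OF e(1)])
  fix A B g h t
  assume flows: "admissible_flow l C M eta tau A g" "admissible_flow l C M eta tau B h" and AB: "!!theta. abs (A theta - B theta) <= e"
   and init: "range (slice g 0) <= range (slice h 0)" and t: "t : {0..tau}"
  have "near_curve ((4^J-1)*(c*e)) (slice g t) (slice h t)"
   using near_curve_iterated[OF flows l C M AB r delta(1,2) _ init _ e(3), of J t] delta(3) t J unfolding Q_def c_def by auto
  moreover have "(4^J-1)*(c*e) <= 4^J*(c*e)" using c e by (intro mult_right_mono) auto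
  ultimately show "near_curve d (slice g t) (slice h t)" using e(2) near_curve_mono by meson
 qed
qed

lemma flow_range_unique:
 assumes l: "l > 0" and C: "C >= 0" and M: "M > 0" and eta: "eta > 0"
  and g: "admissible_flow l C M eta tau A g" "admissible_flow l C M eta tau A h"
  and init: "range (slice g 0) <= range (slice h 0)" and t: "t : {0..tau}"
 shows "range (slice g t) <= range (slice h t)"
proof -
 have "near_curve d (slice g t) (slice h t)" if d: "d > 0" for d
 proof (rule flow_stability[OF l C M eta d, of tau], goal_cases)
  case stable: (1 e)
  show ?case by (rule stable(2)[OF g _ init t]) (use stable(1) in auto)
 qed
 hence "near_curve 0 (slice g t) (slice h t)"
  by (rule near_curve_greatest_lower_bound[OF admissible_flowD(7)[OF g(2) t], of "{0<..}"]) (auto intro: dense_ge)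
 thus ?thesis by (simp add: near_curve_0_iff)
qed

lemma hugs_tangents_parallel:
 assumes g: "c2loop g" "hugs_tangents M eta g" "eta > 0" and h: "c2loop h" "range h <= range g" and e: "h v = g u"
 shows "Im (cnj (tangent g u)*d1 h v) = 0"
proof -
 define F where "F s = cnj (tangent g u)*(h s - g u)" for s
 have D: "DERIV (%s. Re (F s)) v :> Re (cnj (tangent g u)*d1 h v)" "DERIV (%s. Im (F s)) v :> Im (cnj (tangent g u)*d1 h v)"
  unfolding F_def[abs_def] unfolding has_vector_derivative_complex_iff by (rule derivative_eq_intros c2loopD(2)[OF h(1)] refl | simp)+
 have F0: "F v = 0" by (simp add: F_def e)
 have "isCont h v" using c2loopD(8)[OF h(1)] by (simp add: continuous_on_eq_continuous_at)
 then obtain d where d: "d > 0" "!!s. dist s v < d ==> dist (h s) (h v) < eta" using g(3) unfolding continuous_at_eps_delta by blast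
 have bound: "abs (Im (F s)) <= 2*M*(Re (F s))^2" if "dist s v < d" for s
 proof -
  obtain w where w: "h s = g w" using h(2) by auto
  hence "cmod (g w - g u) < eta" using d(2)[OF that] e by (simp add: dist_norm)
  thus ?thesis using g(2) w unfolding hugs_tangents_def coord_def F_def by auto
 qed
 have "DERIV (%s. Im (F s) - 2*M*(Re (F s))^2) v :> Im (cnj (tangent g u)*d1 h v)" by (rule derivative_eq_intros D refl | simp add: F0)+
 thus ?thesis by (rule DERIV_local_max[OF _ d(1)]) (use bound F0 in \<open>auto simp: dist_real_def abs_minus_commute abs_le_iff\<close>)
qed

lemma box_graph_same_range:
 assumes g: "c2loop g" "hugs_tangents M eta g" "eta > 0" and h: "c2loop h" "range h = range g" and b: "box_graph p T r g"
 shows "box_graph p T r h"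
 unfolding box_graph_def
proof (intro conjI allI impI)
 have hg: "EX v. h v = g u" for u using h(2) by (metis rangeE rangeI)
 fix x :: real assume "abs x <= r"
 then obtain u where "Re (coord p T (g u)) = x & abs (Im (coord p T (g u))) <= r/2" using b unfolding box_graph_def by blast
 thus "EX u. Re (coord p T (h u)) = x & abs (Im (coord p T (h u))) <= r/2" using hg[of u] by metis
next
 have gh: "EX v. g v = h u" for u using h(2) by (metis rangeE rangeI)
 fix u v assume "in_box p T r (h u)" "in_box p T r (h v)" "Re (coord p T (h u)) = Re (coord p T (h v))"
 moreover obtain u' v' where "g u' = h u" "g v' = h v" using gh by blast
 ultimately show "h u = h v" using b unfolding box_graph_def by metis
next
 fix v assume ib: "in_box p T r (h v)"
 obtain u where u: "g u = h v" using h(2) by (metis rangeE rangeI)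
 have gu: "abs (Im (coord p T (g u))) <= r/2" "2*abs (Im (cnj T*d1 g u)) <= abs (Re (cnj T*d1 g u))"
  using b ib unfolding u[symmetric] box_graph_def by blast+
 thus "abs (Im (coord p T (h v))) <= r/2" by (simp add: u)
 define c where "c = Re (cnj (tangent g u)*d1 h v)/cmod (d1 g u)"
 have "Im (cnj (tangent g u)*d1 h v) = 0" by (rule hugs_tangents_parallel[OF g h(1)]) (use h(2) u in auto)
 hence "cnj (tangent g u)*d1 h v = of_real (c*cmod (d1 g u))" using c2loopD(4)[OF g(1)] by (simp add: complex_eq_iff c_def)
 hence "tangent g u*cnj (tangent g u)*d1 h v = of_real c*(of_real (cmod (d1 g u))*tangent g u)" by simp
 hence "d1 h v = of_real c*d1 g u" using tangent_unit[OF g(1), of u] by (simp add: complex_norm_square[symmetric])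
 hence "cnj T*d1 h v = of_real c*(cnj T*d1 g u)" by simp
 moreover have "Im (of_real k*w) = k*Im w" "Re (of_real k*w) = k*Re w" for k w by auto
 ultimately have "Im (cnj T*d1 h v) = c*Im (cnj T*d1 g u)" "Re (cnj T*d1 h v) = c*Re (cnj T*d1 g u)" by metis+
 thus "2*abs (Im (cnj T*d1 h v)) <= abs (Re (cnj T*d1 h v))" using mult_left_mono[OF gu(2), of "abs c"] by (simp only: abs_mult) simp
qed

lemma gval_same_range:
 assumes "range h = range g" shows "gval p T r h = gval p T r g"
proof
 fix x
 have "(EX u. coord p T (f u) = c) \<longleftrightarrow> c : coord p T ` range f" for c and f :: "real => complex" by auto
 hence "(EX u. coord p T (h u) = c) \<longleftrightarrow> (EX u. coord p T (g u) = c)" for c by (simp only: assms)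
 thus "gval p T r h x = gval p T r g x" by (simp add: gval_def)
qed

lemma gsecond_same_range:
 assumes g: "box_graph p T r g" "c2loop g" and h: "box_graph p T r h" "c2loop h" and R: "range h = range g"
  and T: "cmod T = 1" and x: "abs x < r"
 shows "gsecond p T r h x = gsecond p T r g x"
proof -
 have "gslope p T r h y = gslope p T r g y" if "abs y < r" for y
  using DERIV_unique[OF gval_derivative[OF h(1) T h(2) that]] gval_derivative[OF g(1) T g(2) that] unfolding gval_same_range[OF R] by simp
 moreover have "eventually (%y. y : {-r<..<r}) (nhds x)" using x by (intro eventually_nhds_in_open) auto
 ultimately have "eventually (%y. gslope p T r h y = gslope p T r g y) (nhds x)" by (auto elim: eventually_mono)
 hence "DERIV (gslope p T r h) x :> gsecond p T r g x" using gslope_derivative[OF g(1) T g(2) x] by (subst DERIV_cong_ev[OF refl _ refl])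
 thus ?thesis using DERIV_unique[OF gslope_derivative[OF h(1) T h(2) x]] by simp
qed

lemma has_real_derivative_uniform_limit:
 fixes f f' :: "nat => real => real"
 assumes S: "convex S" and d: "!!n x. n >= N ==> x : S ==> (f n has_field_derivative f' n x) (at x within S)"
  and f': "uniform_limit S f' G sequentially" and f: "!!x. x : S ==> (%n. f n x) \<longlonglongrightarrow> F x" and x: "x : S"
 shows "(F has_field_derivative G x) (at x within S)"
proof -
 have shift: "(%n. f (n+N) y) \<longlonglongrightarrow> F y" if "y : S" for y by (rule LIMSEQ_ignore_initial_segment[OF f[OF that]])
 have "EX g. ALL y : S. (%n. f (n+N) y) \<longlonglongrightarrow> g y & (g has_derivative (%h. G y*h)) (at y within S)"
 proof (rule has_derivative_sequence[OF S, where f'= "%n y h. f' (n+N) y*h"])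
  show "(f (n+N) has_derivative (%h. f' (n+N) y*h)) (at y within S)" if "y : S" for n y
   using d[of "n+N" y] that by (simp add: has_field_derivative_def)
  fix e :: real assume "e > 0"
  hence "eventually (%n. ALL y : S. dist (f' (n+N) y) (G y) < e) sequentially"
   using f' eventually_sequentially_seg[of "%n. ALL y : S. dist (f' n y) (G y) < e" N] by (simp add: uniform_limit_iff)
  thus "eventually (%n. ALL y : S. ALL h. norm (f' (n+N) y*h - G y*h) <= e*norm h) sequentially"
   by (rule eventually_mono) (auto simp: left_diff_distrib[symmetric] abs_mult dist_real_def intro!: mult_right_mono)
 qed (use x shift in auto)
 then obtain g where g: "!!y. y : S ==> (%n. f (n+N) y) \<longlonglongrightarrow> g y" "(g has_derivative (%h. G x*h)) (at x within S)"
  using x by blast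
 have "g y = F y" if "y : S" for y using LIMSEQ_unique[OF g(1)[OF that] shift[OF that]] .
 hence "(F has_derivative (%h. G x*h)) (at x within S)" using has_derivative_transform[OF x _ g(2)] by auto
 thus ?thesis by (simp add: has_field_derivative_def)
qed

lemma uniform_limit_lim:
 fixes f :: "nat => 'a => real"
 assumes "!!e. e > 0 ==> EX N. ALL n >= N. ALL m >= N. ALL x : S. abs (f n x - f m x) <= e"
 shows "uniform_limit S f (%x. lim (%n. f n x)) sequentially"
proof -
 have "uniformly_Cauchy_on S f" unfolding uniformly_Cauchy_on_def
 proof (intro allI impI)
  fix e :: real assume e: "e > 0"
  then obtain N where "ALL n >= N. ALL m >= N. ALL x : S. abs (f n x - f m x) <= e/2" using assms[of "e/2"] by auto
  thus "EX M. ALL x : S. ALL m >= M. ALL n >= M. dist (f m x) (f n x) < e" using e by (intro exI[of _ N]) (fastforce simp: dist_real_def)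
 qed
 thus ?thesis using Cauchy_uniformly_convergent uniformly_convergent_uniform_limit_iff by blast
qed

lemma anis_bounds: "1/4 <= anis theta" "anis theta <= 1/2" "anis (theta+pi/2) = anis theta"
proof -
 have "(abs (cos theta) + abs (sin theta))^2 = (cos theta)^2 + (sin theta)^2 + 2*(abs (cos theta)*abs (sin theta))" by (simp add: power2_sum)
 moreover have "2*(abs (cos theta)*abs (sin theta)) <= 1" using sum_squares_bound[of "abs (cos theta)" "abs (sin theta)"] by simp
 ultimately have X: "1 <= (abs (cos theta) + abs (sin theta))^2" "(abs (cos theta) + abs (sin theta))^2 <= 2" by simp_all
 have "1/4 <= 1/(2*X) & 1/(2*X) <= 1/2" if "1 <= X" "X <= 2" for X :: real using that by simp
 from this[OF X] show "1/4 <= anis theta" "anis theta <= 1/2" unfolding anis_def by simp_all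
 show "anis (theta+pi/2) = anis theta" unfolding anis_def by (simp add: sin_add cos_add)
qed

lemma coord_inverse: "cmod T = 1 ==> p + T*coord p T z = z" by (simp add: coord_def mult.assoc[symmetric] complex_norm_square[symmetric])

lemma coord_chart: "cmod T = 1 ==> coord p T (p + T*w) = w" by (simp add: coord_def complex_norm_square[symmetric] mult.commute[of "cnj T"])

locale approximating_flows =
 fixes P :: "nat => real => real => complex" and A :: "nat => real => real" and l C M eta tau L0 r delta :: real
 assumes l: "l > 0" and C: "C >= 0" and M: "M > 0" and eta: "eta > 0" and tau: "tau > 0" and L0: "L0 >= 0"
  and r: "r > 0" "2000*M*r <= 1" "16*r <= eta" and delta: "delta > 0" "M*(2*delta) <= r/100"
  and flows: "!!n. admissible_flow l C M eta tau (A n) (P n)"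
  and cauchy: "!!d. d > 0 ==> EX N. ALL n >= N. ALL m >= N. ALL t : {0..tau}. near_curve d (slice (P n) t) (slice (P m) t)"
  and near: "!!n m t. t : {0..tau} ==> near_curve (r/100) (slice (P n) t) (slice (P m) t)"
  and anis_limit: "uniform_limit UNIV A anis sequentially"
  and init: "!!n p T x y. cmod T = 1 ==> box_graph p T r (slice (P n) 0) ==> abs x < r ==> abs y < r
   ==> abs (gsecond p T r (slice (P n) 0) x - gsecond p T r (slice (P n) 0) y) <= L0*abs (x-y)"
begin

abbreviation curve :: "nat => real => real => complex" where "curve n t \<equiv> slice (P n) t"

definition frame :: "complex => complex => real => bool" where
 "frame p T s \<longleftrightarrow> s : {0..tau} & (EX n u. p = P n u s & T = tangent (curve n s) u)"

definition window :: "real => real set" where "window s = {t : {0..tau}. abs (t-s) <= delta}"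

definition glim :: "(complex => complex => real => (real => complex) => real => real) => complex => complex => real => real => real" where
 "glim F p T x t = lim (%n. F p T r (curve n t) x)"

definition limit_curve :: "real => complex set" where
 "limit_curve t = {z. ALL d > 0. EX N. ALL n >= N. near_curve d (%_. z) (curve n t)}"

lemma curve_c2loop: "t : {0..tau} ==> c2loop (curve n t)" using admissible_flowD(7)[OF flows] .

lemma frame_unit: "frame p T s ==> cmod T = 1" unfolding frame_def using tangent_unit(1)[OF curve_c2loop] by blast

lemma windowD: "t : window s ==> t : {0..tau}" "t : window s ==> abs (t-s) <= 2*delta" "window s <= {0..tau}" unfolding window_def by auto

lemma convex_window: "convex (window s)"
proof -
 have "window s = {0..tau} \<inter> {s-delta..s+delta}" by (auto simp: window_def)
 thus ?thesis by simp
qed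

lemma near_later:
 assumes s: "s : {0..tau}" and t: "t : {0..tau}" "abs (t-s) <= 2*delta"
 shows "near_curve (r/50) (curve m s) (curve n t)"
proof -
 have "M*abs (t-s) <= M*(2*delta)" using t(2) M by (intro mult_left_mono) auto
 thus ?thesis using delta(2) by (intro near_curve_mono[OF near_curve_trans[OF admissible_flow_speed[OF flows l s t(1)] near[OF t(1)]]]) simp
qed

lemma frame_box:
 assumes "frame p T s" "t : {0..tau}" "abs (t-s) <= 2*delta"
 shows "box_graph p T r (curve n t)"
proof -
 obtain m u where s: "s : {0..tau}" "p = P m u s" "T = tangent (curve m s) u" using assms(1) by (auto simp: frame_def)
 show ?thesis unfolding s(2,3)
  using admissible_flow_box_graph[OF flows flows s(1) assms(2), where r="2*r" and u=u] near_later[OF s(1) assms(2,3)] r by auto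
qed

lemma window_box: "frame p T s ==> t : window s ==> box_graph p T r (curve n t)" using frame_box windowD by blast

lemma frame_graph:
 assumes fr: "frame p T s" and t: "t : window s" and x: "abs x < r"
 shows "DERIV (gval p T r (curve n t)) x :> gslope p T r (curve n t) x"
  "DERIV (gslope p T r (curve n t)) x :> gsecond p T r (curve n t) x"
  "abs (gval p T r (curve n t) x) <= r/2" "abs (gslope p T r (curve n t) x) <= 1/2" "abs (gsecond p T r (curve n t) x) <= 2*M"
 using admissible_flow_graph(1-4)[OF flows frame_unit[OF fr], where J="{t}" and p=p and r=r and t=t] window_box[OF fr t] windowD(1)[OF t] x
  gpar_props(3)[OF window_box[OF fr t] frame_unit[OF fr] curve_c2loop[OF windowD(1)[OF t]] less_imp_le[OF x]] by auto

lemma gval_cauchy: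
 assumes fr: "frame p T s" and d: "d > 0"
 obtains N where "!!n m x t. n >= N ==> m >= N ==> abs x <= r/2 ==> t : window s
  ==> abs (gval p T r (curve n t) x - gval p T r (curve m t) x) <= d"
proof -
 define d' where "d' = min (d/2) (r/4)"
 have d': "d' > 0" "d' <= r/4" "2*d' <= d" using d r by (auto simp: d'_def)
 obtain N where N: "ALL n >= N. ALL m >= N. ALL t : {0..tau}. near_curve d' (curve n t) (curve m t)" using cauchy[OF d'(1)] by blast
 show thesis
 proof (rule that[of N])
  fix n m x t assume nm: "n >= N" "m >= N" and x: "abs x <= r/2" and t: "t : window s"
  have "abs (gval p T r (curve n t) x - gval p T r (curve m t) x) <= 2*d'"
   by (rule gval_close[OF window_box[OF fr t] curve_c2loop window_box[OF fr t] curve_c2loop frame_unit[OF fr]])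
    (use N nm windowD(1)[OF t] x d' in auto)
  thus "abs (gval p T r (curve n t) x - gval p T r (curve m t) x) <= d" using d' by linarith
 qed
qed

lemma cauchy_of_interpolation:
 assumes fr: "frame p T s" and K: "K >= 0" and c: "!!h. h > 0 ==> c h > 0"
  and interp: "!!n m x t h d. t : window s ==> abs x <= r/4 ==> h > 0 ==> h <= r/4
   ==> (!!y. abs (y-x) <= h ==> abs (gval p T r (curve n t) y - gval p T r (curve m t) y) <= d)
   ==> abs (F p T r (curve n t) x - F p T r (curve m t) x) <= c h*d + K*h"
 shows "uniform_limit ({-(r/4)..r/4} \<times> window s) (%n y. F p T r (curve n (snd y)) (fst y)) (%y. glim F p T (fst y) (snd y)) sequentially"
 unfolding glim_def
proof (rule uniform_limit_lim)
 fix e :: real assume e: "e > 0"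
 define h where "h = min (r/4) (e/(2*(K+1)))"
 have "h <= r/4" "h <= e/(2*(K+1))" unfolding h_def by (rule min.cobounded1, rule min.cobounded2)
 moreover have "h > 0" using r(1) e K by (simp add: h_def)
 ultimately have h: "h > 0" "h <= r/4" "h <= e/(2*(K+1))" by blast+
 have "h*(2*(K+1)) <= e" by (subst pos_le_divide_eq[symmetric]) (use h(3) K in auto)
 hence "K*h <= e/2" using h(1) by (simp add: algebra_simps)
 moreover define d where "d = e/(2*c h)"
 have d: "d > 0" "c h*d = e/2" using c[OF h(1)] e by (auto simp: d_def)
 ultimately have sum: "c h*d + K*h <= e" by linarith
 obtain N where N: "!!n m x t. n >= N ==> m >= N ==> abs x <= r/2 ==> t : window s
   ==> abs (gval p T r (curve n t) x - gval p T r (curve m t) x) <= d"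
  using gval_cauchy[OF fr d(1)] by blast
 have "abs (F p T r (curve n t) x - F p T r (curve m t) x) <= e"
  if "n >= N" "m >= N" "abs x <= r/4" "t : window s" for n m x t
 proof -
  have "abs (F p T r (curve n t) x - F p T r (curve m t) x) <= c h*d + K*h" using that h by (intro interp N) auto
  thus ?thesis using sum by linarith
 qed
 thus "EX N. ALL n >= N. ALL m >= N. ALL y : {-(r/4)..r/4} \<times> window s.
   abs (F p T r (curve n (snd y)) (fst y) - F p T r (curve m (snd y)) (fst y)) <= e"
  by (intro exI[of _ N]) auto
qed

lemma gsecond_equilipschitz:
 obtains L where "L >= 0" "!!p T s n t x y. frame p T s ==> t : window s ==> abs x <= r/2 ==> abs y <= r/2
  ==> abs (gsecond p T r (curve n t) x - gsecond p T r (curve n t) y) <= L*abs (x-y)"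
proof (rule gsecond_lipschitz[OF l C M r(1) delta(1) L0], goal_cases)
 case lip: (1 L)
 show thesis
 proof (rule that[OF lip(2)])
  fix p T s n t x y assume fr: "frame p T s" and t: "t : window s" and xy: "abs x <= r/2" "abs y <= r/2"
  show "abs (gsecond p T r (curve n t) x - gsecond p T r (curve n t) y) <= L*abs (x-y)"
   using frame_box[OF fr, of 0] tau t
    by (intro lip(3)[OF flows frame_unit[OF fr] frame_box[OF fr] _ _ _ xy] allI impI init[OF frame_unit[OF fr]])
    (auto simp: window_def)
 qed
qed

lemma glim_uniform:
 assumes fr: "frame p T s" and F: "F : {gval, gslope, gsecond}"
 shows "uniform_limit ({-(r/4)..r/4} \<times> window s) (%n y. F p T r (curve n (snd y)) (fst y)) (%y. glim F p T (fst y) (snd y)) sequentially"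
proof -
 obtain L where L: "L >= 0" "!!p T s n t x y. frame p T s ==> t : window s ==> abs x <= r/2 ==> abs y <= r/2
   ==> abs (gsecond p T r (curve n t) x - gsecond p T r (curve n t) y) <= L*abs (x-y)"
  by (rule gsecond_equilipschitz) blast
 have D: "DERIV (%y. gval p T r (curve n t) y - gval p T r (curve m t) y) y :> gslope p T r (curve n t) y - gslope p T r (curve m t) y"
  "DERIV (%y. gslope p T r (curve n t) y - gslope p T r (curve m t) y) y :> gsecond p T r (curve n t) y - gsecond p T r (curve m t) y"
  "abs (gsecond p T r (curve n t) y - gsecond p T r (curve m t) y) <= 4*M" "abs y <= r/2" "abs x <= r/2"
  if "t : window s" "abs x <= r/4" "h <= r/4" "abs (y-x) <= h" for n m t x y h
 proof -
  show "abs y <= r/2" "abs x <= r/2" using that by linarith+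
  hence y: "abs y < r" using r by linarith
  show "DERIV (%y. gval p T r (curve n t) y - gval p T r (curve m t) y) y :> gslope p T r (curve n t) y - gslope p T r (curve m t) y"
   "DERIV (%y. gslope p T r (curve n t) y - gslope p T r (curve m t) y) y :> gsecond p T r (curve n t) y - gsecond p T r (curve m t) y"
   by (intro DERIV_diff frame_graph[OF fr that(1) y])+
  show "abs (gsecond p T r (curve n t) y - gsecond p T r (curve m t) y) <= 4*M"
   using frame_graph(5)[OF fr that(1) y, of n] frame_graph(5)[OF fr that(1) y, of m] by linarith
 qed
 have "uniform_limit ({-(r/4)..r/4} \<times> window s) (%n y. gval p T r (curve n (snd y)) (fst y)) (%y. glim gval p T (fst y) (snd y)) sequentially"
  by (rule cauchy_of_interpolation[OF fr, of 0 "%_. 1"]) (use in fastforce)+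
 moreover have "uniform_limit ({-(r/4)..r/4} \<times> window s) (%n y. gslope p T r (curve n (snd y)) (fst y)) (%y. glim gslope p T (fst y) (snd y)) sequentially"
 proof (rule cauchy_of_interpolation[OF fr, of "4*M" "%h. 2/h"])
  fix n m x t h d assume a: "t : window s" "abs x <= r/4" "h > 0" "h <= r/4"
   and d: "!!y. abs (y-x) <= h ==> abs (gval p T r (curve n t) y - gval p T r (curve m t) y) <= d"
  show "abs (gslope p T r (curve n t) x - gslope p T r (curve m t) x) <= 2/h*d + 4*M*h"
   using first_derivative_interpolation[where x = x and h = h, OF a(3) D(1)[OF a(1, 2, 4)] D(2)[OF a(1, 2, 4)] d D(3)[OF a(1, 2, 4)]]
   by simp
 qed (use M in auto)
 moreover have "uniform_limit ({-(r/4)..r/4} \<times> window s) (%n y. gsecond p T r (curve n (snd y)) (fst y)) (%y. glim gsecond p T (fst y) (snd y)) sequentially"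
 proof (rule cauchy_of_interpolation[OF fr, of "2*L" "%h. 4/h^2"])
  fix n m x t h d assume a: "t : window s" "abs x <= r/4" "h > 0" "h <= r/4"
   and d: "!!y. abs (y-x) <= h ==> abs (gval p T r (curve n t) y - gval p T r (curve m t) y) <= d"
  have "abs (gsecond p T r (curve n t) y - gsecond p T r (curve m t) y - (gsecond p T r (curve n t) x - gsecond p T r (curve m t) x))
    <= 2*L*abs (y-x)" if "abs (y-x) <= h" for y
   using L(2)[OF fr a(1) D(4,5)[OF a(1,2,4) that], of n] L(2)[OF fr a(1) D(4,5)[OF a(1,2,4) that], of m] by linarith
  hence "abs (gsecond p T r (curve n t) x - gsecond p T r (curve m t) x) <= 4*d/h^2 + (2*L)*h"
   by (intro second_derivative_interpolation[where x=x and h=h, OF a(3) D(1,2)[OF a(1,2,4)] d]) (use L in auto)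
  thus "abs (gsecond p T r (curve n t) x - gsecond p T r (curve m t) x) <= 4/h^2*d + 2*L*h" by simp
 qed (use L in auto)
 ultimately show ?thesis using F by auto
qed

lemma glim_tendsto:
 assumes "frame p T s" "t : window s" "abs x <= r/4" "F : {gval, gslope, gsecond}"
 shows "(%n. F p T r (curve n t) x) \<longlonglongrightarrow> glim F p T x t"
proof -
 have "(x,t) : {-(r/4)..r/4} \<times> window s" using assms(2,3) by auto
 from tendsto_uniform_limitI[OF glim_uniform[OF assms(1,4)] this] show ?thesis by simp
qed

lemma glim_bounds:
 assumes fr: "frame p T s" and t: "t : window s" and x: "abs x <= r/4"
 shows "abs (glim gval p T x t) <= r/2" "abs (glim gslope p T x t) <= 1/2" "abs (glim gsecond p T x t) <= 2*M"
proof -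
 have "abs x < r" using x r by linarith
 note G = frame_graph(3-5)[OF fr t this]
 have bound: "abs (glim F p T x t) <= b" if "F : {gval, gslope, gsecond}" "!!n. abs (F p T r (curve n t) x) <= b" for F b
  by (rule tendsto_upperbound[OF tendsto_rabs[OF glim_tendsto[OF fr t x that(1)]]]) (use that in auto)
 show "abs (glim gval p T x t) <= r/2" "abs (glim gslope p T x t) <= 1/2" "abs (glim gsecond p T x t) <= 2*M"
  using bound[of gval "r/2"] bound[of gslope "1/2"] bound[of gsecond "2*M"] G by simp_all
qed

lemma glim_continuous:
 assumes fr: "frame p T s" and F: "F : {gval, gslope, gsecond}"
 shows "continuous_on ({-(r/4)..r/4} \<times> window s) (%y. glim F p T (fst y) (snd y))"
proof (rule uniform_limit_theorem[OF _ glim_uniform[OF fr F]])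
 have sub: "{-(r/4)..r/4} \<times> window s <= {-r..r} \<times> window s" by auto
 note fc = flow_graph_continuous[OF admissible_flowD(1)[OF flows] frame_unit[OF fr] windowD(3) window_box[OF fr]]
 show "eventually (%n. continuous_on ({-(r/4)..r/4} \<times> window s) (%y. F p T r (curve n (snd y)) (fst y))) sequentially"
  using fc[THEN continuous_on_subset[OF _ sub]] F by (auto simp: case_prod_beta)
qed simp

lemma glim_space_derivatives:
 assumes fr: "frame p T s" and t: "t : window s" and x: "abs x < r/4"
 shows "DERIV (%x. glim gval p T x t) x :> glim gslope p T x t" "DERIV (%x. glim gslope p T x t) x :> glim gsecond p T x t"
proof -
 have der: "DERIV (%x. glim F p T x t) x :> glim F' p T x t"
  if F: "F : {gval, gslope, gsecond}" "F' : {gval, gslope, gsecond}"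
   and d: "!!n y. abs y < r ==> DERIV (F p T r (curve n t)) y :> F' p T r (curve n t) y" for F F'
 proof -
  have "((%x. glim F p T x t) has_field_derivative glim F' p T x t) (at x within {-(r/4)..r/4})"
  proof (rule has_real_derivative_uniform_limit[where f= "%n. F p T r (curve n t)" and f'= "%n. F' p T r (curve n t)" and N=0])
   show "uniform_limit {-(r/4)..r/4} (%n. F' p T r (curve n t)) (%x. glim F' p T x t) sequentially"
    using uniform_limit_compose'[OF glim_uniform[OF fr F(2)], of "%x. (x,t)" "{-(r/4)..r/4}"] t by auto
   show "(F p T r (curve n t) has_field_derivative F' p T r (curve n t) y) (at y within {-(r/4)..r/4})" if "y : {-(r/4)..r/4}" for n y
    using that r by (intro has_field_derivative_at_within[OF d]) auto
  qed (use x glim_tendsto[OF fr t _ F(1)] in \<open>auto simp: abs_le_iff\<close>)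
  moreover have "at x within {-(r/4)..r/4} = at x" using x by (intro at_within_interior) auto
  ultimately show ?thesis by simp
 qed
 show "DERIV (%x. glim gval p T x t) x :> glim gslope p T x t" "DERIV (%x. glim gslope p T x t) x :> glim gsecond p T x t"
  by (rule der; simp add: frame_graph[OF fr t])+
qed

lemma graph_coeff_uniform_limit:
 assumes q: "uniform_limit S q q' sequentially"
 shows "uniform_limit S (%n t. graph_coeff (A n) alpha (q n t)) (%t. graph_coeff anis alpha (q' t)) sequentially"
 unfolding uniform_limit_iff
proof (intro allI impI)
 fix e :: real assume e: "e > 0"
 have "eventually (%n. ALL theta. dist (A n theta) (anis theta) < e/2) sequentially" using uniform_limitD[OF anis_limit, of "e/2"] e by simp
 moreover have "eventually (%n. ALL t : S. dist (q n t) (q' t) < e/(2*(C+1))) sequentially" using q e C unfolding uniform_limit_iff by simp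
 ultimately show "eventually (%n. ALL t : S. dist (graph_coeff (A n) alpha (q n t)) (graph_coeff anis alpha (q' t)) < e) sequentially"
 proof eventually_elim
  case (elim n)
  show ?case
  proof
   fix t assume t: "t : S"
   have "abs (A n theta - anis theta') <= C*abs (theta-theta') + e/2" for theta theta'
    using admissible_flowD(4)[OF flows, of n theta theta'] elim(1)[rule_format, of theta'] unfolding dist_real_def by linarith
   hence "abs (graph_coeff (A n) alpha (q n t) - graph_coeff anis alpha (q' t)) <= (C+1)*abs (q n t - q' t) + e/2"
    using order_trans[OF _ anis_bounds(1)] order_trans[OF anis_bounds(2)] by (intro graph_coeff_lipschitz[OF _ _ C]) auto
   moreover have "(C+1)*abs (q n t - q' t) < (C+1)*(e/(2*(C+1)))"
    using elim(2) t C by (intro mult_strict_left_mono) (auto simp: dist_real_def)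
   moreover have "(C+1)*(e/(2*(C+1))) = e/2" using C by (simp add: divide_simps)
   ultimately show "dist (graph_coeff (A n) alpha (q n t)) (graph_coeff anis alpha (q' t)) < e" by (simp add: dist_real_def)
  qed
 qed
qed

lemma abs_graph_coeff_anis_le: "abs (graph_coeff anis alpha q) <= 1"
proof -
 have "1/2/(1+q^2) <= 1/2/1" by (intro divide_left_mono) (auto intro: add_pos_nonneg)
 moreover have "anis (alpha + arctan q)/(1+q^2) <= 1/2/(1+q^2)" using anis_bounds(2) by (intro divide_right_mono) auto
 ultimately have "graph_coeff anis alpha q <= 1" unfolding graph_coeff_def by linarith
 thus ?thesis unfolding graph_coeff_def using order_trans[OF _ anis_bounds(1)] by simp
qed

lemma glim_time_derivative:
 assumes fr: "frame p T s" and t: "t : window s" "t > 0" and x: "abs x < r/4"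
 shows "(glim gval p T x has_field_derivative graph_coeff anis (Arg T) (glim gslope p T x t)*glim gsecond p T x t) (at t within window s)"
proof -
 define S where "S = window s \<inter> {t/2..}"
 have S: "S <= window s" by (simp add: S_def)
 have xs: "abs x <= r/4" "abs x < r" using x by auto
 have lim: "uniform_limit S (%n y. F p T r (curve n y) x) (glim F p T x) sequentially" if "F : {gval, gslope, gsecond}" for F
 proof -
  have "(%y. (x,y)) : S \<rightarrow> {-(r/4)..r/4} \<times> window s" using S xs(1) by auto
  from uniform_limit_compose'[OF glim_uniform[OF fr that] this] show ?thesis by simp
 qed
 have "(glim gval p T x has_field_derivative graph_coeff anis (Arg T) (glim gslope p T x t)*glim gsecond p T x t) (at t within S)"
 proof (rule has_real_derivative_uniform_limit[where N=0 and f= "%n t. gval p T r (curve n t) x"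
    and f'= "%n t. graph_coeff (A n) (Arg T) (gslope p T r (curve n t) x)*gsecond p T r (curve n t) x"
    and G= "%t. graph_coeff anis (Arg T) (glim gslope p T x t)*glim gsecond p T x t"])
  show "convex S" unfolding S_def by (intro convex_Int convex_window) auto
  show "((%t. gval p T r (curve n t) x) has_field_derivative
    graph_coeff (A n) (Arg T) (gslope p T r (curve n y) x)*gsecond p T r (curve n y) x) (at y within S)" if "y : S" for n y
   by (rule has_field_derivative_subset[OF admissible_flow_graph(5)[OF flows frame_unit[OF fr] windowD(3) window_box[OF fr]] S])
    (use that t xs in \<open>auto simp: S_def\<close>)
  have "bounded ((%t. graph_coeff anis (Arg T) (glim gslope p T x t)) ` S)" "bounded (glim gsecond p T x ` S)"
   using abs_graph_coeff_anis_le glim_bounds(3)[OF fr _ xs(1)] S unfolding bounded_iff by fastforce+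
  thus "uniform_limit S (%n t. graph_coeff (A n) (Arg T) (gslope p T r (curve n t) x)*gsecond p T r (curve n t) x)
    (%t. graph_coeff anis (Arg T) (glim gslope p T x t)*glim gsecond p T x t) sequentially"
   by (intro uniform_lim_mult graph_coeff_uniform_limit lim) auto
 qed (use t glim_tendsto[OF fr _ xs(1)] in \<open>auto simp: S_def\<close>)
 moreover have "at t within S = at t within window s" by (rule at_within_nhd[of t "{t/2<..}"]) (use t in \<open>auto simp: S_def\<close>)
 ultimately show ?thesis by simp
qed

lemma graph_in_limit_curve:
 assumes fr: "frame p T s" and t: "t : window s" and x: "abs x <= r/4"
 shows "p + T*Complex x (glim gval p T x t) : limit_curve t"
 unfolding limit_curve_def
proof (intro CollectI allI impI)
 fix d :: real assume "d > 0"
 then obtain N where N: "!!n. n >= N ==> dist (gval p T r (curve n t) x) (glim gval p T x t) < d"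
  using glim_tendsto[OF fr t x, of gval] unfolding lim_sequentially by auto
 note T = frame_unit[OF fr]
 have xr: "abs x <= r" using x by simp
 have "near_curve d (%_. p + T*Complex x (glim gval p T x t)) (curve n t)" if n: "n >= N" for n
 proof -
  define v where "v = gpar p T r (curve n t) x"
  have "cmod (curve n t v - (p + T*Complex x (glim gval p T x t))) = cmod (Complex x (gval p T r (curve n t) x) - Complex x (glim gval p T x t))"
   using gpar_props(2)[OF window_box[OF fr t] T curve_c2loop[OF windowD(1)[OF t]] xr]
    norm_coord_diff[OF T, of p "curve n t v" "p + T*Complex x (glim gval p T x t)"] by (simp add: v_def coord_chart[OF T])
  also have "... <= d" using N[OF n] by (simp add: cmod_def dist_real_def)
  finally show ?thesis unfolding near_curve_def by blast
 qed
 thus "EX N. ALL n >= N. near_curve d (%_. p + T*Complex x (glim gval p T x t)) (curve n t)" by blast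
qed

lemma limit_curve_in_graph:
 assumes fr: "frame p T s" and t: "t : window s" and z: "z : limit_curve t"
  and x: "abs (Re (coord p T z)) <= r/4" and y: "abs (Im (coord p T z)) <= 3/4*r"
 shows "Im (coord p T z) = glim gval p T (Re (coord p T z)) t"
proof -
 note T = frame_unit[OF fr]
 define w where "w = coord p T z"
 have "abs (Im w - glim gval p T (Re w) t) <= 0 + d" if d: "d > 0" for d
 proof -
  define d' where "d' = min (d/3) (r/8)"
  have d': "d' > 0" "3*d' <= d" "d' <= r/8" unfolding d'_def using d r by auto
  obtain N1 where N1: "!!n. n >= N1 ==> near_curve d' (%_. z) (curve n t)" using z d'(1) unfolding limit_curve_def by blast
  obtain N2 where N2: "!!n. n >= N2 ==> dist (gval p T r (curve n t) (Re w)) (glim gval p T (Re w) t) < d'"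
   using glim_tendsto[OF fr t x, of gval] d'(1) unfolding lim_sequentially w_def by auto
  define n where "n = max N1 N2"
  obtain v where "cmod (curve n t v - z) <= d'" using N1[of n] by (auto simp: n_def near_curve_def)
  moreover define c where "c = coord p T (curve n t v)"
  ultimately have "cmod (c-w) <= d'" unfolding c_def w_def norm_coord_diff[OF T] by simp
  hence cw: "abs (Re c - Re w) <= d'" "abs (Im c - Im w) <= d'" using abs_Re_le_cmod[of "c-w"] abs_Im_le_cmod[of "c-w"] by auto
  have cr: "abs (Re c) < r" "abs (Im c) <= r" "abs (Re w) < r" using cw x y d' unfolding w_def by linarith+
  have "gval p T r (curve n t) (Re c) = Im c"
   using gval_unique[OF window_box[OF fr t] T curve_c2loop[OF windowD(1)[OF t]], of n v] cr by (simp add: c_def in_box_def)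
  moreover have "abs (gval p T r (curve n t) (Re c) - gval p T r (curve n t) (Re w)) <= 1/2*abs (Re c - Re w)"
   by (rule lipschitz_of_derivative[where f'= "gslope p T r (curve n t)" and r=r]) (use frame_graph[OF fr t] cr in auto)
  moreover have "abs (gval p T r (curve n t) (Re w) - glim gval p T (Re w) t) <= d'" using N2[of n] by (simp add: n_def dist_real_def)
  moreover have "1/2*abs (Re c - Re w) <= d'" using cw(1) by simp
  ultimately show ?thesis using cw(2) d' by linarith
 qed
 from field_le_epsilon[OF this] show ?thesis by (simp add: w_def)
qed

lemma limit_curve_uniform:
 assumes "d > 0"
 obtains N where "!!n t z. n >= N ==> t : {0..tau} ==> z : limit_curve t ==> near_curve d (%_. z) (curve n t)"
proof -
 have d2: "d/2 > 0" using assms by simp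
 obtain N where N: "ALL n >= N. ALL m >= N. ALL t : {0..tau}. near_curve (d/2) (curve n t) (curve m t)" using cauchy[OF d2] by blast
 show thesis
 proof (rule that[of N])
  fix n t z assume n: "n >= N" and t: "t : {0..tau}" and z: "z : limit_curve t"
  obtain k where "ALL m >= k. near_curve (d/2) (%_. z) (curve m t)" using z d2 unfolding limit_curve_def by blast
  then obtain m where "m >= N" "near_curve (d/2) (%_. z) (curve m t)" by (meson max.cobounded1 max.cobounded2)
  thus "near_curve d (%_. z) (curve n t)" using near_curve_trans[of "d/2" "%_. z" "curve m t" "d/2"] N n t by fastforce
 qed
qed

lemma limit_curve_closed:
 assumes zs: "!!k. z k : limit_curve (t k)" "!!k. t k : {0..tau}" and lim: "z \<longlonglongrightarrow> z0"
  "t \<longlonglongrightarrow> t0" and t0: "t0 : {0..tau}"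
 shows "z0 : limit_curve t0"
 unfolding limit_curve_def
proof (intro CollectI allI impI)
 fix d :: real assume d: "d > 0"
 obtain N where N: "!!n t z. n >= N ==> t : {0..tau} ==> z : limit_curve t ==> near_curve (d/3) (%_. z) (curve n t)"
  using limit_curve_uniform[of "d/3"] d by auto
 have "eventually (%k. dist (z k) z0 < d/3 & dist (t k) t0 < d/(3*M)) sequentially"
  using tendstoD[OF lim(1), of "d/3"] tendstoD[OF lim(2), of "d/(3*M)"] d M by (simp add: eventually_conj)
 then obtain k where k: "dist (z k) z0 < d/3" "dist (t k) t0 < d/(3*M)" unfolding eventually_sequentially by auto
 have "M*abs (t0 - t k) <= d/3" using k(2) M by (simp add: dist_real_def abs_minus_commute field_simps)
 moreover have "near_curve (d/3) (%_. z0) (%_. z k)" using k(1) by (simp add: near_curve_def dist_norm)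
 ultimately have "near_curve d (%_. z0) (curve n t0)" if "n >= N" for n
  by (intro near_curve_mono[OF near_curve_trans[OF near_curve_trans[OF _ N[OF that zs(2) zs(1)]]
    admissible_flow_speed[OF flows l zs(2) t0]]]) auto
 thus "EX N. ALL n >= N. near_curve d (%_. z0) (curve n t0)" by blast
qed

lemma glim_gval_center:
 assumes s: "s : {0..tau}" and t: "t : window s"
 shows "abs (glim gval (P m u s) (tangent (curve m s) u) 0 t) <= r/25"
proof -
 define p T where "p = P m u s" and "T = tangent (curve m s) u"
 have fr: "frame p T s" using s by (auto simp: frame_def p_def T_def)
 note T1 = frame_unit[OF fr]
 have b: "box_graph p T r (curve m s)" by (rule frame_box[OF fr s]) (use delta in auto)
 have "gval p T r (curve m s) 0 = 0" using gval_center[of "curve m s" u T r] b T1 curve_c2loop[OF s] r by (simp add: p_def slice_def)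
 moreover have "abs (gval p T r (curve m s) 0 - gval p T r (curve n t) 0) <= 2*(r/50)" for n
  using r by (intro gval_close[OF b curve_c2loop[OF s] window_box[OF fr t] curve_c2loop[OF windowD(1)[OF t]] T1]
    near_later[OF s windowD(1,2)[OF t]]) auto
 ultimately have "abs (gval p T r (curve n t) 0) <= r/25" for n by simp
 thus ?thesis using r glim_tendsto[OF fr t, of 0 gval] unfolding p_def[symmetric] T_def[symmetric]
  by (intro tendsto_upperbound[OF tendsto_rabs]) auto
qed

lemma limit_curve_near:
 assumes s: "s : {0..tau}" and t: "t : window s" and z: "z : limit_curve t"
 obtains v where "cmod (curve m s v - z) <= r/40"
proof -
 have "r/200 > 0" using r by simp
 then obtain n where "near_curve (r/200) (%_. z) (curve n t)" using z unfolding limit_curve_def by blast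
 moreover have "near_curve (r/50) (curve n t) (curve m s)" using windowD(2)[OF t] by (intro near_later[OF windowD(1)[OF t] s]) simp
 ultimately have "near_curve (r/200 + r/50) (%_. z) (curve m s)" by (rule near_curve_trans)
 thus thesis using that by (fastforce simp: near_curve_def)
qed

end

text \<open>Each point of the limit curve near a base curve lies on exactly one line through a base point orthogonal to a
 smooth direction field that is almost tangent to the base curve. Parametrizing the limit curve by the foot of that
 line gives a curve as smooth as the local graphs.\<close>

locale transversal_fibration = approximating_flows +
 fixes N :: nat and sig :: "real => real" and W :: "real set" and D D1 D2 :: "real => real => complex"
 assumes W: "W <= {0..tau}" and sig_continuous: "continuous_on W sig"
  and sig: "!!t. t : W ==> sig t : {0..tau}" "!!t. t : W ==> abs (sig t - t) <= delta/2"
  and D_derivative: "!!u t. t : W ==> ((%u. D u t) has_vector_derivative D1 u t) (at u)"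
  and D1_derivative: "!!u t. t : W ==> ((%u. D1 u t) has_vector_derivative D2 u t) (at u)"
  and D_continuous: "continuous_on (UNIV \<times> W) (%(u,t). D u t)" "continuous_on (UNIV \<times> W) (%(u,t). D1 u t)"
   "continuous_on (UNIV \<times> W) (%(u,t). D2 u t)"
  and D_periodic: "!!u t. t : W ==> D (u+1) t = D u t"
  and D_close: "!!u t. t : W ==> cmod (D u t - d1 (slice (P N) (sig t)) u) <= cmod (d1 (slice (P N) (sig t)) u)/100"
  and D_turn: "!!u t. t : W ==> abs (Im (cnj (D u t)*D1 u t)) <= 2*M*(cmod (d1 (slice (P N) (sig t)) u))^3"
begin

abbreviation base :: "real => real => complex" where "base t \<equiv> curve N (sig t)"

definition gam :: "real => real => complex" where
 "gam u t = (THE z. z : limit_curve t & cmod (z - base t u) <= r/8 & Re (cnj (D u t)*(z - base t u)) = 0)"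

lemma W_window: "t : W ==> t : window (sig t)" "t : W ==> t : {0..tau}" using W sig delta by (force simp: window_def abs_minus_commute)+

lemma base_c2loop: "t : W ==> c2loop (base t)" using curve_c2loop sig by blast

lemma base_curvature: "t : W ==> abs (curv1 (base t) u) <= M" using admissible_flowD(5)[OF flows] sig by blast

lemma base_frame: "t : W ==> frame (base t u) (tangent (base t) u) (sig t)" unfolding frame_def slice_def using sig by blast

definition tilt :: "real => real => complex" where
 "tilt u t = cnj (tangent (base t) u)*D u t/of_real (cmod (d1 (base t) u))"

lemma tilt:
 assumes t: "t : W"
 shows "D u t = of_real (cmod (d1 (base t) u))*tangent (base t) u*tilt u t" "cmod (tilt u t - 1) <= 1/100"
  "99/100 <= Re (tilt u t)" "abs (Im (tilt u t)) <= 1/100" "99/100 <= cmod (tilt u t)" "cmod (tilt u t) <= 101/100" "D u t ~= 0"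
proof -
 define m T where "m = cmod (d1 (base t) u)" and "T = tangent (base t) u"
 have m: "m > 0" using c2loopD(10)[OF base_c2loop[OF t]] by (simp add: m_def)
 have T: "cmod T = 1" "d1 (base t) u = of_real m*T" unfolding T_def m_def using tangent_unit[OF base_c2loop[OF t]] by auto
 have D: "D u t = of_real m*T*tilt u t" using T(1) m unfolding tilt_def T_def[symmetric] m_def[symmetric]
  by (simp add: complex_norm_square[symmetric])
 thus "D u t = of_real (cmod (d1 (base t) u))*tangent (base t) u*tilt u t" by (simp add: m_def T_def)
 have "D u t - d1 (base t) u = of_real m*T*(tilt u t - 1)" unfolding D T(2) by (simp add: algebra_simps)
 hence "m*cmod (tilt u t - 1) <= m*(1/100)" using D_close[OF t, of u] T(1) by (simp add: norm_mult m_def)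
 thus c: "cmod (tilt u t - 1) <= 1/100" using m by simp
 show re: "99/100 <= Re (tilt u t)" and "abs (Im (tilt u t)) <= 1/100"
  using abs_Re_le_cmod[of "tilt u t - 1"] abs_Im_le_cmod[of "tilt u t - 1"] c by auto
 show n: "99/100 <= cmod (tilt u t)" using re complex_Re_le_cmod[of "tilt u t"] by linarith
 show "cmod (tilt u t) <= 101/100" using norm_triangle_ineq[of "tilt u t - 1" 1] c by simp
 show "D u t ~= 0" unfolding D using m T(1) n by auto
qed

lemma base_continuous:
 "continuous_on (UNIV \<times> W) (%(u,t). base t u)" "continuous_on (UNIV \<times> W) (%(u,t). d1 (base t) u)"
 "continuous_on (UNIV \<times> W) (%(u,t). d2 (base t) u)"
proof -
 have reparam: "continuous_on (UNIV \<times> W) (%(u,t). h u (sig t))" if "continuous_on (UNIV \<times> {0..tau}) (%(u,t). h u t)"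
  for h :: "real => real => complex"
 proof -
  have "continuous_on (UNIV \<times> W) (%y. sig (snd y))" by (rule continuous_on_compose2[OF sig_continuous continuous_on_snd]) auto
  hence "continuous_on (UNIV \<times> W) (%y. (%(u,t). h u t) (fst y, sig (snd y)))"
   by (intro continuous_on_compose2[OF that]) (use sig in \<open>auto intro!: continuous_intros\<close>)
  thus ?thesis by (simp add: case_prod_beta)
 qed
 show "continuous_on (UNIV \<times> W) (%(u,t). base t u)" "continuous_on (UNIV \<times> W) (%(u,t). d1 (base t) u)"
  "continuous_on (UNIV \<times> W) (%(u,t). d2 (base t) u)"
  using is_flow_continuous[OF admissible_flowD(1)[OF flows, of N] subset_refl] by (auto simp: slice_def intro!: reparam)
qed

lemma limit_curve_graph_near_base:
 assumes t: "t : W" and z: "z : limit_curve t" "cmod (z - base t u) <= r/8"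
 defines "w \<equiv> tcoord (base t) u z"
 shows "abs (Re w) < r/4" "Im w = glim gval (base t u) (tangent (base t) u) (Re w) t"
proof -
 note fr = base_frame[OF t, of u]
 have "cmod w <= r/8" using z(2) frame_unit[OF fr] by (simp add: w_def coord_def norm_mult)
 hence w: "abs (Re w) <= r/8" "abs (Im w) <= r/8" using abs_Re_le_cmod[of w] abs_Im_le_cmod[of w] by linarith+
 thus "abs (Re w) < r/4" using r by linarith
 show "Im w = glim gval (base t u) (tangent (base t) u) (Re w) t"
  unfolding w_def by (rule limit_curve_in_graph[OF fr W_window(1)[OF t] z(1)]) (use w r in \<open>auto simp: w_def\<close>)
qed

lemma glim_gval_lipschitz:
 assumes "frame p T s" "t : window s" "abs x < r/4" "abs y < r/4"
 shows "abs (glim gval p T x t - glim gval p T y t) <= 1/2*abs (x-y)"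
 by (rule lipschitz_of_derivative[where f'= "%x. glim gslope p T x t" and r= "r/4"])
  (use glim_space_derivatives(1)[OF assms(1,2)] glim_bounds(2)[OF assms(1,2)] assms(3,4) in auto)

lemma fibre_equation:
 assumes t: "t : W"
 shows "Re (cnj (D u t)*(z - base t u)) = 0
  \<longleftrightarrow> Re (tilt u t)*Re (tcoord (base t) u z) + Im (tilt u t)*Im (tcoord (base t) u z) = 0"
proof -
 have "cnj (D u t)*(z - base t u) = of_real (cmod (d1 (base t) u))*(cnj (tilt u t)*tcoord (base t) u z)"
  unfolding tilt(1)[OF t] coord_def by simp
 moreover have "Re (of_real m*(cnj c * w)) = m*(Re c*Re w + Im c*Im w)" for m c w by simp
 ultimately have "Re (cnj (D u t)*(z - base t u))
   = cmod (d1 (base t) u)*(Re (tilt u t)*Re (tcoord (base t) u z) + Im (tilt u t)*Im (tcoord (base t) u z))" by metis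
 thus ?thesis using c2loopD(4)[OF base_c2loop[OF t], of u] by simp
qed

lemma fibre_point_unique:
 assumes t: "t : W" and z: "z : limit_curve t" "cmod (z - base t u) <= r/8" "Re (cnj (D u t)*(z - base t u)) = 0"
  and z': "z' : limit_curve t" "cmod (z' - base t u) <= r/8" "Re (cnj (D u t)*(z' - base t u)) = 0"
 shows "z = z'"
proof -
 define p T c where "p = base t u" and "T = tangent (base t) u" and "c = tilt u t"
 note fr = base_frame[OF t, of u, folded p_def T_def]
 define f where "f x = glim gval p T x t" for x
 define x y where "x = Re (coord p T z)" and "y = Re (coord p T z')"
 note gz = limit_curve_graph_near_base[OF t z(1,2), folded p_def T_def x_def f_def]
 note gz' = limit_curve_graph_near_base[OF t z'(1,2), folded p_def T_def y_def f_def]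
 have "Re c*(x-y) = -(Im c*(f x - f y))" using iffD1[OF fibre_equation[OF t] z(3)] iffD1[OF fibre_equation[OF t] z'(3)]
  unfolding p_def[symmetric] T_def[symmetric] gz(2) gz'(2) x_def[symmetric] y_def[symmetric] c_def[symmetric] f_def
  by (simp add: algebra_simps)
 hence "abs (Re c)*abs (x-y) = abs (Im c)*abs (f x - f y)" by (metis abs_minus_cancel abs_mult)
 also have "... <= 1/100*(1/2*abs (x-y))"
  using tilt(4)[OF t, of u] glim_gval_lipschitz[OF fr W_window(1)[OF t] gz(1) gz'(1)] by (intro mult_mono) (auto simp: c_def f_def)
 finally have "abs (Re c)*abs (x-y) <= 1/200*abs (x-y)" by simp
 moreover have "99/100*abs (x-y) <= abs (Re c)*abs (x-y)" using tilt(3)[OF t, of u] by (intro mult_right_mono) (auto simp: c_def)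
 ultimately have "99/100*abs (x-y) <= 1/200*abs (x-y)" by linarith
 hence "abs (x-y) <= 0" by simp
 hence "x = y" by simp
 hence "coord p T z = coord p T z'" using gz(2) gz'(2) by (simp add: complex_eq_iff x_def y_def)
 thus ?thesis using coord_inj[OF frame_unit[OF fr]] by blast
qed

lemma fibre_point_exists:
 assumes t: "t : W"
 obtains z where "z : limit_curve t" "cmod (z - base t u) <= r/16" "Re (cnj (D u t)*(z - base t u)) = 0"
proof -
 define p T c x0 where "p = base t u" and "T = tangent (base t) u" and "c = tilt u t" and "x0 = r/100"
 note fr = base_frame[OF t, of u, folded p_def T_def]
 note T = frame_unit[OF fr]
 define f h where "f x = glim gval p T x t" and "h x = Re c*x + Im c*f x" for x
 note tw = W_window(1)[OF t]
 have x0: "0 < x0" "x0 < r/4" using r by (auto simp: x0_def)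
 have "abs (f 0) <= r/25" using glim_gval_center[OF sig(1)[OF t] tw, of N u] by (simp add: f_def p_def T_def slice_def)
 moreover have f0: "abs (f x - f 0) <= 1/2*abs x" if "abs x <= x0" for x
  using glim_gval_lipschitz[OF fr tw, of x 0] that x0 unfolding f_def by auto
 ultimately have f: "abs (f x) <= 45/1000*r" if "abs x <= x0" for x using f0[OF that] that unfolding x0_def by linarith
 have If: "abs (Im c*f x) <= 45/100000*r" if "abs x <= x0" for x
  using mult_mono[OF tilt(4)[OF t, of u] f[OF that]] by (simp add: abs_mult c_def)
 have Rc: "Re c*x0 >= 99/100*x0" using tilt(3)[OF t, of u] x0 by (intro mult_right_mono) (auto simp: c_def)
 have "r = 100*x0" by (simp add: x0_def)
 hence "h (-x0) <= 0" "0 <= h x0" using Rc If[of x0] If[of "-x0"] x0(1) unfolding h_def by linarith+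
 moreover have "continuous_on {-x0..x0} h" unfolding h_def f_def using x0
  by (intro continuous_intros continuous_at_imp_continuous_on ballI DERIV_isCont[OF glim_space_derivatives(1)[OF fr tw]]) auto
 ultimately obtain x where "-x0 <= x" "x <= x0" "h x = 0" using IVT'[of h "-x0" 0 x0] x0 by auto
 hence x: "abs x <= x0" "h x = 0" by auto
 define z where "z = p + T*Complex x (f x)"
 have "z : limit_curve t" unfolding z_def f_def by (rule graph_in_limit_curve[OF fr tw]) (use x x0 in auto)
 moreover have "cmod (z-p) <= abs x + abs (f x)" using cmod_le[of "Complex x (f x)"] T by (simp add: z_def norm_mult)
 hence "cmod (z - base t u) <= r/16" using x f[OF x(1)] unfolding x0_def p_def by linarith
 moreover have "Re (cnj (D u t)*(z - base t u)) = 0" by (rule iffD2[OF fibre_equation[OF t]])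
   (use x(2) in \<open>simp add: p_def[symmetric] T_def[symmetric] z_def coord_chart[OF T] h_def c_def\<close>)
 ultimately show thesis by (rule that)
qed

lemma gam_props:
 assumes t: "t : W"
 shows "gam u t : limit_curve t" "cmod (gam u t - base t u) <= r/16" "Re (cnj (D u t)*(gam u t - base t u)) = 0"
  "z : limit_curve t ==> cmod (z - base t u) <= r/8 ==> Re (cnj (D u t)*(z - base t u)) = 0 ==> z = gam u t"
proof -
 obtain z0 where z0: "z0 : limit_curve t" "cmod (z0 - base t u) <= r/16" "Re (cnj (D u t)*(z0 - base t u)) = 0"
  using fibre_point_exists[OF t] by blast
 have z08: "cmod (z0 - base t u) <= r/8" using z0(2) r by linarith
 have g: "gam u t = z0" unfolding gam_def by (rule the_equality) (use z0 z08 fibre_point_unique[OF t, of _ u z0] in blast)+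
 show "gam u t : limit_curve t" "cmod (gam u t - base t u) <= r/16" "Re (cnj (D u t)*(gam u t - base t u)) = 0" unfolding g by (rule z0)+
 show "z : limit_curve t ==> cmod (z - base t u) <= r/8 ==> Re (cnj (D u t)*(z - base t u)) = 0 ==> z = gam u t"
  unfolding g using fibre_point_unique[OF t] z0 z08 by blast
qed

lemma gam_continuous: "continuous_on (UNIV \<times> W) (%(u,t). gam u t)" unfolding continuous_on_sequentially
proof (intro allI ballI impI)
 fix y :: "nat => real \<times> real" and a
 assume a: "a : UNIV \<times> W" and "(ALL n. y n : UNIV \<times> W) & y \<longlonglongrightarrow> a"
 hence y: "!!n. y n : UNIV \<times> W" "y \<longlonglongrightarrow> a" by auto
 have aW: "snd a : W" "!!n. snd (y n) : W" using a y(1) by (auto simp: mem_Times_iff)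
 define x b d where "x n = gam (fst (y n)) (snd (y n))" and "b n = base (snd (y n)) (fst (y n))"
  and "d n = D (fst (y n)) (snd (y n))" for n
 have lim: "b \<longlonglongrightarrow> base (snd a) (fst a)" "d \<longlonglongrightarrow> D (fst a) (snd a)"
  using continuous_on_tendsto_compose[OF base_continuous(1) y(2) a] continuous_on_tendsto_compose[OF D_continuous(1) y(2) a] y(1)
  unfolding b_def[abs_def] d_def[abs_def] by (auto simp: case_prod_beta)
 note x = gam_props[OF aW(2), of "fst (y n)" n for n, folded x_def b_def d_def]
 obtain K where K: "!!n. cmod (b n) <= K" using convergent_imp_bounded[OF lim(1)] unfolding bounded_iff by auto
 have "x \<longlonglongrightarrow> gam (fst a) (snd a)"
 proof (rule tendsto_of_compact_subsequences[where K= "cball 0 (K+r)" and x=x])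
  show "x n : cball 0 (K+r)" for n using x(2)[of n] K[of n] norm_triangle_ineq[of "x n - b n" "b n"] r(1) by simp
  fix q l assume q: "strict_mono q" and l: "(x \<circ> q) \<longlonglongrightarrow> l"
  have lims: "(y \<circ> q) \<longlonglongrightarrow> a" "(b \<circ> q) \<longlonglongrightarrow> base (snd a) (fst a)"
   "(d \<circ> q) \<longlonglongrightarrow> D (fst a) (snd a)"
   using LIMSEQ_subseq_LIMSEQ[OF _ q] y(2) lim by blast+
  have "l = gam (fst a) (snd a)"
  proof (rule gam_props(4)[OF aW(1)])
   show "l : limit_curve (snd a)"
    by (rule limit_curve_closed[where z= "x \<circ> q" and t= "%n. snd ((y \<circ> q) n)", OF _ _ l tendsto_snd[OF lims(1)]])
     (use x(1) aW W_window in auto)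
   have "cmod (l - base (snd a) (fst a)) <= r/16"
    by (rule tendsto_upperbound[OF tendsto_norm[OF tendsto_diff[OF l lims(2)]]]) (use x(2) in auto)
   thus "cmod (l - base (snd a) (fst a)) <= r/8" using r by linarith
   have "(%n. Re (cnj ((d \<circ> q) n)*((x \<circ> q) n - (b \<circ> q) n))) \<longlonglongrightarrow> Re (cnj (D (fst a) (snd a))*(l - base (snd a) (fst a)))"
    by (intro tendsto_intros lims l)
   thus "Re (cnj (D (fst a) (snd a))*(l - base (snd a) (fst a))) = 0" using x(3) by (simp only: o_def LIMSEQ_const_iff)
  qed
  thus "(x \<circ> q) \<longlonglongrightarrow> gam (fst a) (snd a)" using l by simp
 qed simp
 thus "((%(u,t). gam u t) \<circ> y) \<longlonglongrightarrow> (%(u,t). gam u t) a" unfolding x_def[abs_def] by (simp add: o_def case_prod_beta)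
qed

lemma gam_periodic: "t : W ==> gam (u+1) t = gam u t" unfolding gam_def using c2loopD(6)[OF base_c2loop, of t u] D_periodic by simp

definition fibre_position :: "complex => real => real => real" where
 "fibre_position z t w = Re (cnj (D w t/of_real (cmod (D w t)))*(z - base t w))"

lemma fibre_position_eq: "fibre_position z t w = Re (cnj (D w t)*(z - base t w))/cmod (D w t)"
 unfolding fibre_position_def complex_cnj_divide complex_cnj_complex_of_real times_divide_eq_left by (rule Re_divide_of_real)

lemma fibre_position_derivative:
 assumes t: "t : W" and z: "cmod (z - base t w) <= r/2"
 obtains E where "DERIV (fibre_position z t) w :> E" "E <= -(9/10)*cmod (d1 (base t) w)"
proof -
 define m T c d where "m = cmod (d1 (base t) w)" and "T = tangent (base t) w" and "c = tilt w t" and "d = D w t"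
 have m: "m > 0" using c2loopD(10)[OF base_c2loop[OF t]] by (simp add: m_def)
 have T: "cmod T = 1" "d1 (base t) w = of_real m*T" unfolding T_def m_def using tangent_unit[OF base_c2loop[OF t]] by auto
 note ti = tilt[OF t, of w, folded m_def T_def c_def d_def]
 have dm: "cmod d = m*cmod c" using T(1) m by (simp add: ti(1) norm_mult)
 have d: "cmod d >= m*(99/100)" unfolding dm using ti(5) m by (intro mult_left_mono) auto
 define k where "k = Im (cnj d*D1 w t)/(cmod d)^3"
 define E where "E = Re (cnj (\<i> * of_real k*d)*(z - base t w) + cnj (d/of_real (cmod d))*(0 - d1 (base t) w))"
 have "((%w. D w t/of_real (cmod (D w t))) has_vector_derivative \<i> * of_real k*d) (at w)"
  using unit_has_vector_derivative[OF D_derivative[OF t] ti(7)[unfolded d_def]] by (simp add: k_def d_def)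
 hence DE: "DERIV (fibre_position z t) w :> E" unfolding fibre_position_def[abs_def] E_def d_def
  by (intro Re_Im_cnj_mult_derivative(1) has_vector_derivative_diff has_vector_derivative_const c2loopD(2)[OF base_c2loop[OF t]])
 have "cmod (\<i> * of_real k*d) <= 3*M*m"
 proof -
  have "cmod (\<i> * of_real k*d) = abs k*cmod d" by (simp add: norm_mult)
  also have "... = abs (Im (cnj d*D1 w t))/(cmod d)^2" unfolding k_def by (simp add: power2_eq_square power3_eq_cube)
  also have "... <= 2*M*m^3/(m*(99/100))^2" using D_turn[OF t, of w] d m unfolding d_def[symmetric] m_def[symmetric] by (intro frac_le) auto
  also have "... = M*m*(2*(100/99)^2)" by (simp add: power2_eq_square power3_eq_cube)
  also have "... <= M*m*3" using m M by (intro mult_left_mono) (auto simp: power2_eq_square)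
  finally show ?thesis by simp
 qed
 hence "cmod (cnj (\<i> * of_real k*d)*(z - base t w)) <= 3*M*m*(r/2)"
  unfolding norm_mult[of "cnj _"] complex_mod_cnj using z m M by (intro mult_mono) auto
 also have "... = M*r*(3/2*m)" by simp
 also have "... <= 1/2000*(3/2*m)" using r m by (intro mult_right_mono) auto
 finally have "Re (cnj (\<i> * of_real k*d)*(z - base t w)) <= 1/1000*m"
  using complex_Re_le_cmod[of "cnj (\<i> * of_real k*d)*(z - base t w)"] m by linarith
 moreover have "cnj (d/of_real (cmod d))*d1 (base t) w = of_real (m/cmod c)*(T*cnj T)*cnj c" unfolding dm T(2) by (simp add: ti(1))
 hence "cnj (d/of_real (cmod d))*d1 (base t) w = of_real (m/cmod c)*cnj c" using T(1) by (simp add: complex_norm_square[symmetric])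
 hence "Re (cnj (d/of_real (cmod d))*d1 (base t) w) = m*(Re c/cmod c)" by simp
 moreover have "98/100 <= Re c/cmod c" using ti(3,5,6) by (subst le_divide_eq) auto
 hence "m*(98/100) <= m*(Re c/cmod c)" using m by (intro mult_left_mono) auto
 ultimately have "E <= -(9/10)*m" unfolding E_def using m by simp
 with DE show thesis using that by (simp add: m_def)
qed

lemma fibre_position_decreasing:
 assumes t: "t : W" and le: "a <= b" and z: "!!w. a <= w ==> w <= b ==> cmod (z - base t w) <= r/2"
 shows "fibre_position z t b + 9/10*arclen (base t) a b <= fibre_position z t a"
proof -
 have "fibre_position z t b + 9/10*arclen (base t) a b <= fibre_position z t a + 9/10*arclen (base t) a a"
 proof (rule DERIV_nonpos_imp_nonincreasing[OF le])
  fix w assume "a <= w" "w <= b"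
  then obtain E where E: "DERIV (fibre_position z t) w :> E" "E <= -(9/10)*cmod (d1 (base t) w)"
   using fibre_position_derivative[OF t z] by blast
  have "DERIV (%w. fibre_position z t w + 9/10*arclen (base t) a w) w :> E + 9/10*cmod (d1 (base t) w)"
   by (intro DERIV_add E(1) DERIV_cmult DERIV_arclen base_c2loop t)
  thus "EX y. DERIV (%w. fibre_position z t w + 9/10*arclen (base t) a w) w :> y & y <= 0" using E(2) by (intro exI) auto
 qed
 thus ?thesis by simp
qed

lemma gam_inj:
 assumes t: "t : W" and eq: "gam u t = gam v t"
 obtains n :: int where "v = u + of_int n"
proof -
 define g z where "g = base t" and "z = gam u t"
 note cg = base_c2loop[OF t, folded g_def] and kg = base_curvature[OF t, folded g_def]
 note fr = base_frame[OF t, of u, folded g_def]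
 have zu: "cmod (z - g u) <= r/16" "cmod (z - g v) <= r/16"
  using gam_props(2)[OF t, of u] gam_props(2)[OF t, of v] eq by (simp_all add: z_def g_def)
 hence "cmod (g v - g u) <= r/8" using norm_triangle_ineq[of "g v - z" "z - g u"] norm_minus_commute[of z "g v"] by simp
 hence "cmod (tcoord g u (g v)) <= r/8" using tangent_unit(1)[OF cg] by (simp add: coord_def norm_mult)
 hence tv: "abs (Re (tcoord g u (g v))) <= r/8" "abs (Im (tcoord g u (g v))) <= r/8"
  using abs_Re_le_cmod[of "tcoord g u (g v)"] abs_Im_le_cmod[of "tcoord g u (g v)"] by linarith+
 have "M*(r/4) <= 1" using r by simp
 then obtain w where w: "abs (arclen g u w) <= r/4" "Re (tcoord g u (g w)) = Re (tcoord g u (g v))"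
  using arc_reaches_tangent_abscissa[OF cg kg, of "r/4" "Re (tcoord g u (g v))" u] tv(1) by auto
 have arc: "cmod (g y - g u) <= r/4" if "abs (arclen g u y) <= r/4" for y using chord_le_arclen[OF cg, of y u] that by linarith
 have "abs (Im (tcoord g u (g w))) <= r/4"
  using abs_Im_le_cmod[of "tcoord g u (g w)"] arc[OF w(1)] tangent_unit(1)[OF cg] by (simp add: coord_def norm_mult)
 hence "in_box (g u) (tangent g u) r (g w)" "in_box (g u) (tangent g u) r (g v)" using w(2) tv unfolding in_box_def by linarith+
 moreover have "box_graph (g u) (tangent g u) r g" using frame_box[OF fr sig(1)[OF t], of N] delta by (simp add: g_def)
 ultimately have "g w = g v" using w(2) unfolding box_graph_def by blast
 then obtain n :: int where n: "v = w + of_int n" by (rule jordan_loop_eqE[OF c2loopD(1)[OF cg]])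
 have "gam v t = gam w t" unfolding n by (rule periodic_int) (rule gam_periodic[OF t])
 hence gw: "gam w t = z" using eq by (simp add: z_def)
 define a b where "a = min u w" and "b = max u w"
 have "fibre_position z t b + 9/10*arclen g a b <= fibre_position z t a" unfolding g_def
 proof (rule fibre_position_decreasing[OF t])
  fix y assume "a <= y" "y <= b"
  hence "abs (arclen g u y) <= r/4" using abs_arclen_between[OF cg, of u w y] w(1) unfolding a_def b_def by linarith
  thus "cmod (z - base t y) <= r/2"
   using arc[of y] norm_triangle_ineq[of "z - g u" "g u - g y"] zu(1) norm_minus_commute[of "g u" "g y"] by (simp add: g_def)
 qed (simp add: a_def b_def)
 moreover have "fibre_position z t u = 0" "fibre_position z t w = 0"
  using gam_props(3)[OF t, of u] gam_props(3)[OF t, of w] gw by (simp_all add: fibre_position_eq z_def)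
 ultimately have "arclen g a b <= 0" by (auto simp: a_def b_def)
 hence "b <= a" using arclen_pos_iff[OF cg, of a b] by linarith
 hence "w = u" by (auto simp: a_def b_def)
 thus thesis using n that by blast
qed

lemma gam_range:
 assumes t: "t : W" shows "range (%u. gam u t) = limit_curve t"
proof
 show "range (%u. gam u t) <= limit_curve t" using gam_props(1)[OF t] by auto
 show "limit_curve t <= range (%u. gam u t)"
 proof
  fix z assume z: "z : limit_curve t"
  define g where "g = base t"
  note cg = base_c2loop[OF t, folded g_def]
  obtain v where "cmod (g v - z) <= r/40" using limit_curve_near[OF sig(1)[OF t] W_window(1)[OF t] z] unfolding g_def by blast
  hence v: "cmod (z - g v) <= r/40" by (simp add: norm_minus_commute)
  obtain a b where ab: "arclen g v a = -(r/10)" "arclen g v b = r/10" using arclen_surj[OF cg] by metis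
  have order: "a <= v" "v <= b" using arclen_le_iff[OF cg, of v] ab r
   by (metis arclen_refl neg_le_0_iff_le divide_nonneg_pos less_imp_le zero_less_numeral)+
  have near: "cmod (z - g w) <= r/8" if "a <= w" "w <= b" for w
   using that ab arclen_le_iff[OF cg, of v w b] arclen_le_iff[OF cg, of v a w] chord_le_arclen[OF cg, of w v]
    norm_triangle_ineq[of "z - g v" "g v - g w"] v norm_minus_commute[of "g v" "g w"] by simp
  have "abs (fibre_position z t v) <= cmod (cnj (D v t/of_real (cmod (D v t)))*(z - g v))"
   unfolding fibre_position_def g_def by (rule abs_Re_le_cmod)
  hence "abs (fibre_position z t v) <= r/40" using v tilt(7)[OF t, of v] by (simp add: norm_mult norm_divide)
  moreover have "fibre_position z t b + 9/10*arclen g v b <= fibre_position z t v"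
   "fibre_position z t v + 9/10*arclen g a v <= fibre_position z t a"
  proof -
   have "cmod (z - base t w) <= r/2" if "a <= w" "w <= b" for w using near[OF that] r(1) by (simp add: g_def)
   thus "fibre_position z t b + 9/10*arclen g v b <= fibre_position z t v"
    "fibre_position z t v + 9/10*arclen g a v <= fibre_position z t a"
    unfolding g_def using order by (rule_tac [!] fibre_position_decreasing[OF t]; simp)+
  qed
  ultimately have "fibre_position z t b <= 0" "0 <= fibre_position z t a" using ab arclen_commute[OF cg, of a v] by auto
  moreover have "continuous_on {a..b} (fibre_position z t)"
  proof (intro continuous_at_imp_continuous_on ballI)
   fix w assume "w : {a..b}"
   hence "cmod (z - base t w) <= r/2" using near[of w] r by (simp add: g_def)
   from fibre_position_derivative[OF t this] show "isCont (fibre_position z t) w" by (metis DERIV_isCont)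
  qed
  ultimately obtain u where u: "a <= u" "u <= b" "fibre_position z t u = 0" using IVT2'[of "fibre_position z t" b 0 a] order by auto
  hence "Re (cnj (D u t)*(z - base t u)) = 0" using tilt(7)[OF t, of u] by (simp add: fibre_position_eq)
  hence "z = gam u t" using gam_props(4)[OF t z] near[OF u(1,2)] by (simp add: g_def)
  thus "z : range (%u. gam u t)" by blast
 qed
qed

lemma gam_jordan:
 assumes t: "t : W" shows "jordan_loop (slice gam t)"
 unfolding jordan_loop_def slice_def
proof
 show "ALL u. gam (u+1) t = gam u t" using gam_periodic[OF t] by blast
 show "inj_on (%u. gam u t) {0..<1}"
 proof (rule inj_onI)
  fix u v :: real assume uv: "u : {0..<1}" "v : {0..<1}" "gam u t = gam v t"
  obtain n :: int where n: "v = u + of_int n" using gam_inj[OF t uv(3)] .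
  hence "abs (real_of_int n) < 1" using uv(1,2) by auto
  thus "u = v" using n by simp
 qed
qed

lemma transversality:
 assumes t: "t : W"
 shows "Re (cnj (D u t)*d1 (base t) u) - Re (cnj (D1 u t)*(gam u t - base t u)) > 0"
proof -
 define z where "z = gam u t"
 have "cmod (z - base t u) <= r/2" using gam_props(2)[OF t, of u] r by (simp add: z_def)
 then obtain E where E: "DERIV (fibre_position z t) u :> E" "E <= -(9/10)*cmod (d1 (base t) u)" by (rule fibre_position_derivative[OF t])
 have "cmod (d1 (base t) u) > 0" by (rule c2loopD(10)[OF base_c2loop[OF t]])
 hence "E < 0" using E(2) by linarith
 have d: "D u t ~= 0" by (rule tilt[OF t])
 have "DERIV (%w. cmod (D w t)) u :> Re (cnj (D u t)*D1 u t)/cmod (D u t)" by (rule norm_has_real_derivative[OF D_derivative[OF t] d])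
 from DERIV_mult[OF this E(1)] have "DERIV (%w. cmod (D w t)*fibre_position z t w) u :> E*cmod (D u t)"
  using gam_props(3)[OF t, of u] by (simp add: fibre_position_eq z_def)
 moreover have "cmod (D w t)*fibre_position z t w = Re (cnj (D w t)*(z - base t w))" for w by (simp add: fibre_position_eq)
 moreover have "DERIV (%w. Re (cnj (D w t)*(z - base t w))) u :> Re (cnj (D1 u t)*(z - base t u) + cnj (D u t)*(0 - d1 (base t) u))"
  by (intro Re_Im_cnj_mult_derivative(1) D_derivative t has_vector_derivative_diff has_vector_derivative_const c2loopD(2) base_c2loop)
 ultimately have "Re (cnj (D1 u t)*(z - base t u) + cnj (D u t)*(0 - d1 (base t) u)) = E*cmod (D u t)" by (simp only: DERIV_unique)
 moreover have "E*cmod (D u t) < 0" using \<open>E < 0\<close> d by (simp add: mult_neg_pos)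
 moreover have "Re (a + b*(0-c)) = Re a - Re (b*c)" for a b c by simp
 ultimately show ?thesis unfolding z_def by (metis diff_gt_0_iff_gt less_iff_diff_less_0)
qed

end

lemma has_vector_derivative_Complex:
 assumes "(g has_field_derivative g') (at s within S)" "(h has_field_derivative h') (at s within S)"
 shows "((%s. p + T*Complex (g s) (h s)) has_vector_derivative T*Complex g' h') (at s within S)"
proof -
 have "((%s. Complex (g s) (h s)) has_vector_derivative Complex g' h') (at s within S)"
  unfolding has_vector_derivative_complex_iff using assms by simp
 from has_vector_derivative_add[OF has_vector_derivative_const has_vector_derivative_mult_right[OF this]] show ?thesis by simp
qed

locale fibration_chart = transversal_fibration +
 fixes p T :: complex and s :: real and U J :: "real set"
 assumes fr: "frame p T s" and U: "open U" and J: "J <= W"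
  and J_window: "!!t. t : J ==> t : window s"
  and abscissa_bound: "!!u t. u : U ==> t : J ==> abs (Re (coord p T (gam u t))) < r/4"
  and gam_graph: "!!u t. u : U ==> t : J ==> Im (coord p T (gam u t)) = glim gval p T (Re (coord p T (gam u t))) t"
  and graph_transversal: "!!u t. u : U ==> t : J ==> 0 < Re (cnj (D u t)*(T*Complex 1 (glim gslope p T (Re (coord p T (gam u t))) t)))"
begin

definition x :: "real => real => real" where "x u t = Re (coord p T (gam u t))"
definition Z :: "real => real => complex" where "Z y t = p + T*Complex y (glim gval p T y t)"
definition Z1 :: "real => real => complex" where "Z1 y t = T*Complex 1 (glim gslope p T y t)"
definition Z2 :: "real => real => complex" where "Z2 y t = T*Complex 0 (glim gsecond p T y t)"
definition den :: "real => real => real" where "den u t = Re (cnj (D u t)*Z1 (x u t) t)"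
definition num :: "real => real => real" where
 "num u t = Re (cnj (D u t)*d1 (base t) u) - Re (cnj (D1 u t)*(gam u t - base t u))"
definition x1 :: "real => real => real" where "x1 u t = num u t/den u t"
definition G1 :: "real => real => complex" where "G1 u t = of_real (x1 u t)*Z1 (x u t) t"
definition den1 :: "real => real => real" where
 "den1 u t = Re (cnj (D1 u t)*Z1 (x u t) t + cnj (D u t)*(of_real (x1 u t)*Z2 (x u t) t))"
definition num1 :: "real => real => real" where
 "num1 u t = Re (cnj (D1 u t)*d1 (base t) u + cnj (D u t)*d2 (base t) u)
  - Re (cnj (D2 u t)*(gam u t - base t u) + cnj (D1 u t)*(G1 u t - d1 (base t) u))"
definition x2 :: "real => real => real" where "x2 u t = (num1 u t*den u t - num u t*den1 u t)/(den u t*den u t)"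
definition G2 :: "real => real => complex" where
 "G2 u t = of_real (x1 u t)*(of_real (x1 u t)*Z2 (x u t) t) + of_real (x2 u t)*Z1 (x u t) t"

lemma T: "cmod T = 1" "cnj T*T = 1" using frame_unit[OF fr] by (simp_all add: complex_norm_square[symmetric] mult.commute)

lemma gam_eq_Z: "u : U ==> t : J ==> gam u t = Z (x u t) t"
 using coord_inverse[OF T(1), of p "gam u t"] gam_graph by (metis Z_def complex_surj x_def)

lemma x_bound: "u : U ==> t : J ==> abs (x u t) < r/4" unfolding x_def by (rule abscissa_bound)

lemma den_pos: "u : U ==> t : J ==> den u t > 0" unfolding den_def Z1_def x_def by (rule graph_transversal)

lemma x1_pos: "u : U ==> t : J ==> x1 u t > 0" unfolding x1_def num_def using transversality J den_pos by (intro divide_pos_pos) auto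

lemma Z_derivatives:
 assumes "t : J" "abs y < r/4"
 shows "((%y. Z y t) has_vector_derivative Z1 y t) (at y)" "((%y. Z1 y t) has_vector_derivative Z2 y t) (at y)"
 unfolding Z_def Z1_def Z2_def
 using has_vector_derivative_Complex[OF DERIV_ident glim_space_derivatives(1)[OF fr J_window[OF assms(1)] assms(2)], of p T]
  has_vector_derivative_Complex[OF DERIV_const glim_space_derivatives(2)[OF fr J_window[OF assms(1)] assms(2)], of 0 T 1] by simp_all

lemma chart_continuous:
 "continuous_on (U \<times> J) (%y. x (fst y) (snd y))" "continuous_on (U \<times> J) (%y. Z1 (x (fst y) (snd y)) (snd y))"
 "continuous_on (U \<times> J) (%y. x1 (fst y) (snd y))" "continuous_on (U \<times> J) (%y. G1 (fst y) (snd y))"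
 "continuous_on (U \<times> J) (%y. G2 (fst y) (snd y))"
proof -
 have UJ: "U \<times> J <= UNIV \<times> W" using J by auto
 note c = base_continuous[THEN continuous_on_subset[OF _ UJ], unfolded case_prod_beta]
  D_continuous[THEN continuous_on_subset[OF _ UJ], unfolded case_prod_beta] gam_continuous[THEN continuous_on_subset[OF _ UJ], unfolded case_prod_beta]
 show x: "continuous_on (U \<times> J) (%y. x (fst y) (snd y))" unfolding x_def coord_def by (intro continuous_intros c)
 have lim: "continuous_on (U \<times> J) (%y. glim F p T (x (fst y) (snd y)) (snd y))" if F: "F : {gval, gslope, gsecond}" for F
 proof -
  have "(x (fst y) (snd y), snd y) : {-(r/4)..r/4} \<times> window s" if "y : U \<times> J" for y
   using that J_window x_bound[of "fst y" "snd y"] by auto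
  hence "continuous_on (U \<times> J) (%y. (%y. glim F p T (fst y) (snd y)) (x (fst y) (snd y), snd y))"
   by (intro continuous_on_compose2[OF glim_continuous[OF fr F]] continuous_intros x) auto
  thus ?thesis by simp
 qed
 have Z: "continuous_on (U \<times> J) (%y. T*Complex a (f y))" if "continuous_on (U \<times> J) f" for a f
  by (intro continuous_intros that)
 show Z1: "continuous_on (U \<times> J) (%y. Z1 (x (fst y) (snd y)) (snd y))" unfolding Z1_def by (intro Z lim) simp
 have Z2: "continuous_on (U \<times> J) (%y. Z2 (x (fst y) (snd y)) (snd y))" unfolding Z2_def by (intro Z lim) simp
 have den: "continuous_on (U \<times> J) (%y. den (fst y) (snd y))" unfolding den_def by (intro continuous_intros Z1 c)
 have num: "continuous_on (U \<times> J) (%y. num (fst y) (snd y))" unfolding num_def by (intro continuous_intros c)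
 have nz: "den (fst y) (snd y) ~= 0" if "y : U \<times> J" for y using den_pos[of "fst y" "snd y"] that by auto
 show x1: "continuous_on (U \<times> J) (%y. x1 (fst y) (snd y))" unfolding x1_def by (intro continuous_intros num den) (use nz in auto)
 show G1: "continuous_on (U \<times> J) (%y. G1 (fst y) (snd y))" unfolding G1_def by (intro continuous_intros x1 Z1)
 have "continuous_on (U \<times> J) (%y. x2 (fst y) (snd y))" unfolding x2_def num1_def den1_def
  by (intro continuous_intros num den c G1 Z1 Z2 x1) (use nz in auto)
 thus "continuous_on (U \<times> J) (%y. G2 (fst y) (snd y))" unfolding G2_def by (intro continuous_intros x1 Z1 Z2)
qed

lemma x_derivative:
 assumes u: "u : U" and t: "t : J" shows "DERIV (%u. x u t) u :> x1 u t"
proof -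
 have tW: "t : W" using t J by blast
 let ?B = "{-(r/4)<..<r/4}"
 have x: "x u t : ?B" using x_bound[OF u t] by auto
 have cx: "continuous_on U (%u. x u t)"
  using continuous_on_compose2[OF chart_continuous(1), of U "%u. (u,t)"] t by (force intro!: continuous_intros)
 have "((%u. x u t) has_field_derivative -(-num u t)/den u t) (at u within U)" unfolding den_def
 proof (rule implicit_derivative[where F= "%u y. Re (cnj (D u t)*(Z y t - base t u))" and ?F1.0= "%u y. Re (cnj (D u t)*Z1 y t)"
    and X= "%u. x u t", OF u x])
  show "DERIV (%y. Re (cnj (D v t)*(Z y t - base t v))) y :> Re (cnj (D v t)*Z1 y t)" if "y : ?B" for v y
   using Re_Im_cnj_mult_derivative(1)[OF has_vector_derivative_const has_vector_derivative_diff[OF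
     Z_derivatives(1)[OF t] has_vector_derivative_const], of y "D v t" "base t v"] that by auto
  have "continuous_on (U \<times> ?B) (%y. D (fst y) t)"
   using continuous_on_compose2[OF D_continuous(1), of "U \<times> ?B" "%y. (fst y, t)"] tW by (force intro!: continuous_intros)
  moreover have "continuous_on ?B (%y. Z1 y t)"
   by (intro continuous_at_imp_continuous_on ballI has_vector_derivative_continuous[OF Z_derivatives(2)[OF t]]) auto
  hence "continuous_on (U \<times> ?B) (%y. Z1 (snd y) t)" by (rule continuous_on_compose2) (auto intro!: continuous_intros)
  ultimately show "continuous_on (U \<times> ?B) (%(u,y). Re (cnj (D u t)*Z1 y t))" unfolding case_prod_beta by (intro continuous_intros)
  show "((%u. x u t) \<longlongrightarrow> x u t) (at u within U)" using cx u by (simp add: continuous_on)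
  show "Re (cnj (D v t)*(Z (x v t) t - base t v)) = 0" if "v : U" for v using gam_props(3)[OF tW, of v] by (simp only: gam_eq_Z[OF that t])
  show "((%v. Re (cnj (D v t)*(Z (x u t) t - base t v))) has_field_derivative -num u t) (at u within U)"
  proof (rule has_field_derivative_at_within)
   have "DERIV (%v. Re (cnj (D v t)*(Z (x u t) t - base t v))) u
     :> Re (cnj (D1 u t)*(Z (x u t) t - base t u) + cnj (D u t)*(0 - d1 (base t) u))"
    by (intro Re_Im_cnj_mult_derivative(1) D_derivative tW has_vector_derivative_diff has_vector_derivative_const c2loopD(2) base_c2loop)
   thus "DERIV (%v. Re (cnj (D v t)*(Z (x u t) t - base t v))) u :> -num u t" unfolding gam_eq_Z[OF u t, symmetric] num_def by simp
  qed
  show "Re (cnj (D u t)*Z1 (x u t) t) ~= 0" using den_pos[OF u t] unfolding den_def by linarith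
 qed
 thus ?thesis using at_within_open[OF u U] by (simp add: x1_def)
qed

lemma gam_derivatives_chart:
 assumes u: "u : U" and t: "t : J"
 shows "(slice gam t has_vector_derivative G1 u t) (at u)" "((%u. G1 u t) has_vector_derivative G2 u t) (at u)" "G1 u t ~= 0"
proof -
 have tW: "t : W" using t J by blast
 have dZ: "((%u. Z (x u t) t) has_vector_derivative G1 u t) (at u)"
  "((%u. Z1 (x u t) t) has_vector_derivative of_real (x1 u t)*Z2 (x u t) t) (at u)"
  using vector_diff_chain_at[OF x_derivative[OF u t, unfolded has_real_derivative_iff_has_vector_derivative] Z_derivatives(1)[OF t x_bound[OF u t]]]
   vector_diff_chain_at[OF x_derivative[OF u t, unfolded has_real_derivative_iff_has_vector_derivative] Z_derivatives(2)[OF t x_bound[OF u t]]]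
  by (simp_all add: o_def G1_def scaleR_conv_of_real)
 show "(slice gam t has_vector_derivative G1 u t) (at u)"
  by (rule has_vector_derivative_transform_within_open[OF dZ(1) U u]) (use gam_eq_Z t in \<open>auto simp: slice_def\<close>)
 hence gd': "((%u. gam u t) has_vector_derivative G1 u t) (at u)" by (simp add: slice_def)
 note bd = c2loopD(2,3)[OF base_c2loop[OF tW]]
 have "DERIV (%u. den u t) u :> den1 u t" unfolding den_def den1_def by (rule Re_Im_cnj_mult_derivative(1)[OF D_derivative[OF tW] dZ(2)])
 moreover have "DERIV (%u. num u t) u :> num1 u t" unfolding num_def num1_def
  by (intro DERIV_diff Re_Im_cnj_mult_derivative(1) D_derivative D1_derivative tW bd has_vector_derivative_diff gd')
 ultimately have "DERIV (%u. x1 u t) u :> x2 u t" unfolding x1_def x2_def using den_pos[OF u t] by (intro DERIV_divide) auto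
 from has_vector_derivative_mult[OF has_vector_derivative_of_real[OF this] dZ(2)]
 show "((%u. G1 u t) has_vector_derivative G2 u t) (at u)" by (simp add: G1_def[abs_def] G2_def)
 have "Complex 1 q ~= 0" "T ~= 0" for q using T by (auto simp: complex_eq_iff)
 thus "G1 u t ~= 0" using x1_pos[OF u t] by (simp add: G1_def Z1_def)
qed

lemma d1_gam: "u : U ==> t : J ==> d1 (slice gam t) u = G1 u t" unfolding d1_def by (rule vector_derivative_at[OF gam_derivatives_chart(1)])

lemma d1_gam_derivative:
 assumes u: "u : U" and t: "t : J" shows "(d1 (slice gam t) has_vector_derivative G2 u t) (at u)"
 by (rule has_vector_derivative_transform_within_open[OF gam_derivatives_chart(2)[OF u t] U u]) (use d1_gam t in auto)

lemma d2_gam: "u : U ==> t : J ==> d2 (slice gam t) u = G2 u t" unfolding d2_def by (rule vector_derivative_at[OF d1_gam_derivative])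

lemma chart_slope_continuous: "continuous_on (J \<times> {-(r/4)<..<r/4}) (%(s,y). glim gslope p T y s)"
proof -
 have "continuous_on (J \<times> {-(r/4)<..<r/4}) (%y. (%y. glim gslope p T (fst y) (snd y)) (snd y, fst y))"
  by (intro continuous_on_compose2[OF glim_continuous[OF fr]] continuous_intros) (use J_window in auto)
 thus ?thesis by (simp add: case_prod_beta)
qed

lemma x_time_derivative:
 assumes u: "u : U" and t: "t : J" "t > 0"
  and B: "((%s. base s u) has_vector_derivative b) (at t within J)" and D: "((%s. D u s) has_vector_derivative d) (at t within J)"
 obtains v where "((%s. x u s) has_field_derivative v) (at t within J)"
proof -
 let ?B = "{-(r/4)<..<r/4}"
 have x: "x u t : ?B" using x_bound[OF u t(1)] by auto
 have pair: "continuous_on J (%s. h (u,s))" if "continuous_on (U \<times> J) h" for h :: "real \<times> real => 'a :: topological_space"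
  by (rule continuous_on_compose2[OF that]) (use u in \<open>auto intro!: continuous_intros\<close>)
 define f' where "f' = graph_coeff anis (Arg T) (glim gslope p T (x u t) t)*glim gsecond p T (x u t) t"
 have "((%s. glim gval p T (x u t) s) has_field_derivative f') (at t within J)" unfolding f'_def using J_window
  by (intro has_field_derivative_subset[OF glim_time_derivative[OF fr J_window[OF t(1)] t(2) x_bound[OF u t(1)]]]) auto
 from has_vector_derivative_Complex[OF DERIV_const this]
 have Zt: "((%s. Z (x u t) s) has_vector_derivative T*Complex 0 f') (at t within J)" unfolding Z_def .
 define e where "e = Re (cnj d*(Z (x u t) t - base t u) + cnj (D u t)*(T*Complex 0 f' - b))"
 have "((%s. x u s) has_field_derivative -e/Re (cnj (D u t)*Z1 (x u t) t)) (at t within J)"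
 proof (rule implicit_derivative[where F= "%s y. Re (cnj (D u s)*(Z y s - base s u))" and ?F1.0= "%s y. Re (cnj (D u s)*Z1 y s)"
    and X= "%s. x u s", OF t(1) x])
  show "DERIV (%y. Re (cnj (D u s)*(Z y s - base s u))) y :> Re (cnj (D u s)*Z1 y s)" if "s : J" "y : ?B" for s y
   using Re_Im_cnj_mult_derivative(1)[OF has_vector_derivative_const has_vector_derivative_diff[OF
     Z_derivatives(1)[OF that(1)] has_vector_derivative_const], of y "D u s" "base s u"] that(2) by auto
  have "continuous_on J (%s. D u s)"
   using continuous_on_compose2[OF D_continuous(1), of J "%s. (u,s)"] J by (force intro!: continuous_intros)
  hence "continuous_on (J \<times> ?B) (%y. D u (fst y))" by (rule continuous_on_compose2) (auto intro!: continuous_intros)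
  with chart_slope_continuous show "continuous_on (J \<times> ?B) (%(s,y). Re (cnj (D u s)*Z1 y s))"
   unfolding case_prod_beta Z1_def by (intro continuous_intros) simp_all
  show "((%s. x u s) \<longlongrightarrow> x u t) (at t within J)" using pair[OF chart_continuous(1)] t by (simp add: continuous_on)
  show "Re (cnj (D u s)*(Z (x u s) s - base s u)) = 0" if "s : J" for s
   using gam_props(3)[of s u] that J by (simp only: gam_eq_Z[OF u that, symmetric]) blast
  show "((%s. Re (cnj (D u s)*(Z (x u t) s - base s u))) has_field_derivative e) (at t within J)"
   unfolding e_def by (rule Re_Im_cnj_mult_derivative(1)[OF D has_vector_derivative_diff[OF Zt B]])
  show "Re (cnj (D u t)*Z1 (x u t) t) ~= 0" using den_pos[OF u t(1)] unfolding den_def by linarith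
 qed
 thus thesis by (rule that)
qed

lemma gam_time_derivative_chart:
 assumes u: "u : U" and t: "t : J" "t > 0"
  and "((%s. base s u) has_vector_derivative b) (at t within J)" and "((%s. D u s) has_vector_derivative d) (at t within J)"
 obtains v where "((%s. gam u s) has_vector_derivative v) (at t within J)"
  "Re (cnj v * (\<i>*G1 u t/of_real (cmod (G1 u t)))) = anis (Arg (G1 u t))*(Im (cnj (G1 u t)*G2 u t)/(cmod (G1 u t))^3)"
proof -
 obtain x' where x': "((%s. x u s) has_field_derivative x') (at t within J)" using x_time_derivative[OF assms] .
 define q f2 y where "q = glim gslope p T (x u t) t" and "f2 = glim gsecond p T (x u t) t" and "y = x1 u t"
 define f' where "f' = graph_coeff anis (Arg T) q*f2"
 have "((%s. glim gval p T (x u s) s) has_field_derivative f' + q*x') (at t within J)" unfolding q_def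
 proof (rule composite_derivative[where F= "%s y. glim gval p T y s" and ?F1.0= "%s y. glim gslope p T y s" and X=
  "%s. x u s", OF t(1) _ _ chart_slope_continuous])
  show "DERIV (%y. glim gval p T y s) y :> glim gslope p T y s" if "s : J" "y : {-(r/4)<..<r/4}" for s y
   by (rule glim_space_derivatives(1)[OF fr J_window[OF that(1)]]) (use that(2) in auto)
  show "((%s. glim gval p T (x u t) s) has_field_derivative f') (at t within J)" unfolding f'_def q_def f2_def using J_window
   by (intro has_field_derivative_subset[OF glim_time_derivative[OF fr J_window[OF t(1)] t(2) x_bound[OF u t(1)]]]) auto
 qed (use x' x_bound[OF u t(1)] in auto)
 from has_vector_derivative_Complex[OF x' this, of p T]
 have vd: "((%s. gam u s) has_vector_derivative T*Complex x' (f' + q*x')) (at t within J)"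
  by (rule has_vector_derivative_transform[OF t(1), rotated]) (use gam_eq_Z[OF u] in \<open>auto simp: Z_def\<close>)
 define n where "n = sqrt (1+q^2)"
 have n: "n > 0" "n^2 = 1+q^2" by (auto simp: n_def add_pos_nonneg)
 have y: "y > 0" using x1_pos[OF u t(1)] by (simp add: y_def)
 have G1: "G1 u t = of_real y*(T*Complex 1 q)" by (simp add: G1_def Z1_def y_def q_def)
 have G1_norm: "cmod (G1 u t) = y*n" unfolding G1 norm_mult using T(1) y by (simp add: cmod_def n_def)
 have Arg: "anis (Arg (G1 u t)) = anis (Arg T + arctan q)"
  using Arg_direction_periodic[where A=anis, OF anis_bounds(3) _ _ G1] y T by fastforce
 have T_frame: "Im (cnj T*(T * w)) = Im w" "Re (cnj T*(T * w)) = Re w" for w using T(2) by (simp_all add: mult.assoc[symmetric])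
 define v where "v = T*Complex x' (f' + q*x')"
 have "Re (cnj v * (\<i>*G1 u t/of_real (cmod (G1 u t)))) = Im (cnj (G1 u t) * v)/(y*n)" unfolding G1_norm by simp
 also have "... = f'/n" using y unfolding G1 Im_cnj_mult_slope v_def T_frame by simp
 finally have "Re (cnj v * (\<i>*G1 u t/of_real (cmod (G1 u t)))) = f'/n" .
 moreover have "G2 u t = T*Complex (x2 u t) (y*y*f2 + x2 u t*q)"
  by (simp add: G2_def Z1_def Z2_def q_def y_def f2_def complex_eq_iff algebra_simps)
 hence "Im (cnj (G1 u t)*G2 u t) = y^3*f2" unfolding G1 Im_cnj_mult_slope by (simp only: T_frame) (simp add: power3_eq_cube)
 hence "Im (cnj (G1 u t)*G2 u t)/(cmod (G1 u t))^3 = f2/n^3" unfolding G1_norm power_mult_distrib using y by simp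
 moreover have "anis (Arg T + arctan q)*(f2/n^3) = f'/n"
  unfolding f'_def graph_coeff_def n(2)[symmetric] by (simp add: power2_eq_square power3_eq_cube)
 ultimately have "Re (cnj v * (\<i>*G1 u t/of_real (cmod (G1 u t))))
   = anis (Arg (G1 u t))*(Im (cnj (G1 u t)*G2 u t)/(cmod (G1 u t))^3)" unfolding Arg by metis
 thus thesis using that vd[folded v_def] by blast
qed

end

context transversal_fibration
begin

lemma D_steep:
 assumes t: "t : W"
 shows "abs (Im (cnj (D u t)*tangent (base t) u)) < Re (cnj (D u t)*tangent (base t) u)"
proof -
 define m T where "m = cmod (d1 (base t) u)" and "T = tangent (base t) u"
 have "cnj (D u t)*T = of_real m*((T*cnj T)*cnj (tilt u t))" unfolding tilt(1)[OF t, of u] T_def m_def by simp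
 also have "T*cnj T = 1" unfolding T_def using frame_unit[OF base_frame[OF t]] by (simp add: complex_norm_square[symmetric])
 finally have "Re (cnj (D u t)*T) = m*Re (tilt u t)" "Im (cnj (D u t)*T) = -(m*Im (tilt u t))" by simp_all
 moreover have "m > 0" using c2loopD(10)[OF base_c2loop[OF t]] by (simp add: m_def)
 ultimately show ?thesis using tilt(3,4)[OF t, of u] unfolding T_def by (simp add: abs_mult)
qed

lemma chart_exists:
 assumes t0: "t0 : W"
 obtains rho p T s where "rho > 0" "fibration_chart P A l C M eta tau L0 r delta N sig W D D1 D2 p T s (ball u0 rho) (W \<inter> ball t0 rho)"
proof -
 define p T s where "p = base t0 u0" and "T = tangent (base t0) u0" and "s = sig t0"
 note fr = base_frame[OF t0, of u0, folded p_def T_def s_def]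
 note T = frame_unit[OF fr]
 define Q where "Q y = Re (cnj (D (fst y) (snd y))*T) - abs (Im (cnj (D (fst y) (snd y))*T))" for y
 have Q0: "Q (u0,t0) > 0" using D_steep[OF t0, of u0] by (simp add: Q_def T_def)
 have "continuous_on (UNIV \<times> W) Q" unfolding Q_def using D_continuous(1) unfolding case_prod_beta by (intro continuous_intros)
 then obtain a where a: "a > 0" "!!y. y : UNIV \<times> W ==> dist y (u0,t0) < a ==> dist (Q y) (Q (u0,t0)) < Q (u0,t0)"
  unfolding continuous_on_iff using t0 Q0 by blast
 have "r/16 > 0" using r by simp
 then obtain b where b: "b > 0" "!!y. y : UNIV \<times> W ==> dist y (u0,t0) < b ==> dist (case_prod gam y) (case_prod gam (u0,t0)) < r/16"
  using gam_continuous t0 unfolding continuous_on_iff by blast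
 define rho where "rho = min (min a b/2) (delta/2)"
 have rho: "rho > 0" "2*rho <= a" "2*rho <= b" "rho <= delta/2" using a(1) b(1) delta by (auto simp: rho_def)
 have near: "dist (u,t) (u0,t0) < 2*rho" if "u : ball u0 rho" "t : W \<inter> ball t0 rho" for u t
  using sqrt_sum_squares_le_sum_abs[of "u-u0" "t-t0"] that
  by (simp add: dist_Pair_Pair dist_real_def abs_minus_commute[of u0] abs_minus_commute[of t0])
 have win: "t : window s" if "t : W \<inter> ball t0 rho" for t
 proof -
  have "abs (t0 - t) < rho" using that by (simp add: dist_real_def)
  hence "abs (t - sig t0) <= delta" using rho(4) sig(2)[OF t0] by linarith
  thus ?thesis using W that by (auto simp: window_def s_def)
 qed
 have chart: "abs (Re (coord p T (gam u t))) < r/4" "Im (coord p T (gam u t)) = glim gval p T (Re (coord p T (gam u t))) t"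
  "0 < Re (cnj (D u t)*(T*Complex 1 (glim gslope p T (Re (coord p T (gam u t))) t)))"
  if ut: "u : ball u0 rho" "t : W \<inter> ball t0 rho" for u t
 proof -
  have "cmod (coord p T (gam u t)) <= r/8"
   using b(2)[of "(u,t)"] near[OF ut] rho ut gam_props(2)[OF t0, of u0] norm_triangle_ineq[of "gam u t - gam u0 t0" "gam u0 t0 - p"]
   using T by (simp add: dist_norm p_def coord_def norm_mult)
  hence w: "abs (Re (coord p T (gam u t))) <= r/8" "abs (Im (coord p T (gam u t))) <= r/8"
   using abs_Re_le_cmod[of "coord p T (gam u t)"] abs_Im_le_cmod[of "coord p T (gam u t)"] by linarith+
  show x: "abs (Re (coord p T (gam u t))) < r/4" using w r by linarith
  show "Im (coord p T (gam u t)) = glim gval p T (Re (coord p T (gam u t))) t"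
   by (rule limit_curve_in_graph[OF fr win[OF ut(2)] gam_props(1)]) (use w r ut in auto)
  define q where "q = glim gslope p T (Re (coord p T (gam u t))) t"
  have q: "abs q <= 1/2" unfolding q_def using x by (intro glim_bounds(2)[OF fr win[OF ut(2)]]) simp
  have "Q (u,t) > 0" using a(2)[of "(u,t)"] near[OF ut] rho ut by (auto simp: dist_real_def)
  moreover have "abs (Im (cnj (D u t)*T)*q) <= abs (Im (cnj (D u t)*T))*1" unfolding abs_mult using q by (intro mult_left_mono) auto
  moreover have "Re (w*(T*Complex 1 q)) = Re (w*T) - Im (w*T)*q" for w by (simp add: algebra_simps)
  hence "Re (cnj (D u t)*(T*Complex 1 q)) = Re (cnj (D u t)*T) - Im (cnj (D u t)*T)*q" .
  ultimately show "0 < Re (cnj (D u t)*(T*Complex 1 q))" unfolding Q_def fst_conv snd_conv by linarith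
 qed
 have "fibration_chart P A l C M eta tau L0 r delta N sig W D D1 D2 p T s (ball u0 rho) (W \<inter> ball t0 rho)"
  by (intro fibration_chart.intro transversal_fibration_axioms fibration_chart_axioms.intro) (use fr win chart in auto)
 with rho(1) show thesis by (rule that)
qed

lemma gam_derivatives:
 assumes t: "t : W"
 shows "slice gam t differentiable (at u)" "d1 (slice gam t) differentiable (at u)" "d1 (slice gam t) u ~= 0"
  "t > 0 ==> ((%s. base s u) has_vector_derivative b) (at t within W) ==> ((%s. D u s) has_vector_derivative d) (at t within W)
   ==> EX v. curvature_velocity anis gam W t u v"
proof -
 obtain rho p T s where rho: "rho > 0" and ch:
  "fibration_chart P A l C M eta tau L0 r delta N sig W D D1 D2 p T s (ball u rho) (W \<inter> ball t rho)"
  using chart_exists[OF t, of u] .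
 interpret fibration_chart P A l C M eta tau L0 r delta N sig W D D1 D2 p T s "ball u rho" "W \<inter> ball t rho" by (rule ch)
 have ut: "u : ball u rho" "t : W \<inter> ball t rho" using rho t by auto
 show "slice gam t differentiable (at u)" "d1 (slice gam t) differentiable (at u)"
  by (rule differentiableI_vector[OF gam_derivatives_chart(1)[OF ut]], rule differentiableI_vector[OF d1_gam_derivative[OF ut]])
 show "d1 (slice gam t) u ~= 0" unfolding d1_gam[OF ut] by (rule gam_derivatives_chart(3)[OF ut])
 assume "t > 0" and B: "((%s. base s u) has_vector_derivative b) (at t within W)" and D: "((%s. D u s) has_vector_derivative d) (at t within W)"
 then obtain v where "((%s. gam u s) has_vector_derivative v) (at t within W \<inter> ball t rho)"
  "Re (cnj v * (\<i>*G1 u t/of_real (cmod (G1 u t)))) = anis (Arg (G1 u t))*(Im (cnj (G1 u t)*G2 u t)/(cmod (G1 u t))^3)"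
  using gam_time_derivative_chart[OF ut _ has_vector_derivative_within_subset[OF B Int_lower1]
    has_vector_derivative_within_subset[OF D Int_lower1]] by blast
 moreover have "at t within W \<inter> ball t rho = at t within W" by (rule at_within_nhd[of t "ball t rho"]) (use rho in auto)
 ultimately show "EX v. curvature_velocity anis gam W t u v" unfolding curv_def curv1_def d1_gam[OF ut] d2_gam[OF ut] by auto
qed

lemma gam_derivatives_continuous:
 "continuous_on (UNIV \<times> W) (%(u,t). d1 (slice gam t) u)" "continuous_on (UNIV \<times> W) (%(u,t). d2 (slice gam t) u)"
proof -
 have "continuous (at y within UNIV \<times> W) (%(u,t). d1 (slice gam t) u)"
  "continuous (at y within UNIV \<times> W) (%(u,t). d2 (slice gam t) u)"
  if y: "y : UNIV \<times> W" for y
 proof -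
  have t: "snd y : W" using y by auto
  obtain rho p T s where rho: "rho > 0"
   and ch: "fibration_chart P A l C M eta tau L0 r delta N sig W D D1 D2 p T s (ball (fst y) rho) (W \<inter> ball (snd y) rho)"
   using chart_exists[OF t, of "fst y"] .
  interpret fibration_chart P A l C M eta tau L0 r delta N sig W D D1 D2 p T s "ball (fst y) rho" "W \<inter> ball (snd y) rho" by (rule ch)
  have "continuous_on (ball (fst y) rho \<times> (W \<inter> ball (snd y) rho)) (%(u,t). d1 (slice gam t) u)"
   "continuous_on (ball (fst y) rho \<times> (W \<inter> ball (snd y) rho)) (%(u,t). d2 (slice gam t) u)"
   by (rule continuous_on_eq[OF chart_continuous(4)], use d1_gam in auto, rule continuous_on_eq[OF chart_continuous(5)], use d2_gam in auto)
  moreover have "y : ball (fst y) rho \<times> (W \<inter> ball (snd y) rho)" using rho t by (simp add: mem_Times_iff)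
  moreover have "at y within ball (fst y) rho \<times> (W \<inter> ball (snd y) rho) = at y within UNIV \<times> W"
   by (rule at_within_nhd[of y "ball (fst y) rho \<times> ball (snd y) rho"]) (use rho in \<open>auto simp: open_Times mem_Times_iff\<close>)
  ultimately show "continuous (at y within UNIV \<times> W) (%(u,t). d1 (slice gam t) u)"
   "continuous (at y within UNIV \<times> W) (%(u,t). d2 (slice gam t) u)"
   unfolding continuous_on_eq_continuous_within by metis+
 qed
 thus "continuous_on (UNIV \<times> W) (%(u,t). d1 (slice gam t) u)" "continuous_on (UNIV \<times> W) (%(u,t). d2 (slice gam t) u)"
  unfolding continuous_on_eq_continuous_within by blast+
qed

lemma gam_c2loop:
 assumes t: "t : W" shows "c2loop (slice gam t)"
 unfolding c2loop_def
proof (intro conjI allI gam_jordan t gam_derivatives)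
 have "continuous_on UNIV (%u. (%(u,t). d2 (slice gam t) u) (u,t))"
  by (rule continuous_on_compose2[OF gam_derivatives_continuous(2)]) (use t in \<open>auto intro!: continuous_intros\<close>)
 thus "continuous_on UNIV (d2 (slice gam t))" by simp
qed

lemma gam_is_flow:
 assumes "!!t. t : W ==> ccw (slice gam t)"
  and "!!u t. t : W ==> t > 0 ==> EX b. ((%s. base s u) has_vector_derivative b) (at t within W)"
  and "!!u t. t : W ==> t > 0 ==> EX d. ((%s. D u s) has_vector_derivative d) (at t within W)"
 shows "is_flow anis gam W"
 unfolding is_flow_def
proof (intro conjI ballI impI allI)
 fix t u assume "t : W" "t > 0"
 thus "EX v. curvature_velocity anis gam W t u v" using gam_derivatives(4) assms(2,3) by blast
qed (use assms(1) gam_c2loop gam_derivatives(1-3) gam_continuous gam_derivatives_continuous in \<open>auto simp: c2loop_def\<close>)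

lemma gam_transversal:
 assumes t: "t : W" shows "Re (cnj (D u t)*d1 (slice gam t) u) > 0"
proof -
 have gd: "((%u. gam u t) has_vector_derivative d1 (slice gam t) u) (at u)"
  using c2loopD(2)[OF gam_c2loop[OF t], of u] by (simp add: slice_def)
 have "DERIV (%u. Re (cnj (D u t)*(gam u t - base t u))) u
   :> Re (cnj (D1 u t)*(gam u t - base t u) + cnj (D u t)*(d1 (slice gam t) u - d1 (base t) u))"
  by (intro Re_Im_cnj_mult_derivative(1) D_derivative t has_vector_derivative_diff gd c2loopD(2) base_c2loop)
 moreover have "DERIV (%u. Re (cnj (D u t)*(gam u t - base t u))) u :> 0" unfolding gam_props(3)[OF t] by simp
 ultimately have "Re (cnj (D1 u t)*(gam u t - base t u) + cnj (D u t)*(d1 (slice gam t) u - d1 (base t) u)) = 0" by (rule DERIV_unique)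
 moreover have "Re (a + b*(c-d)) = Re a + Re (b*c) - Re (b*d)" for a b c d by (simp add: algebra_simps)
 ultimately show ?thesis using transversality[OF t, of u] by (simp del: times_complex.simps)
qed

end

lemma c2loop_path:
 assumes c: "c2loop g"
 shows "valid_path g" "path g" "pathfinish g = pathstart g" "path_image g = range g" "simple_path g"
proof -
 note cd = c2loopD[OF c]
 have "g C1_differentiable_on {0..1}" unfolding C1_differentiable_on_def using cd(2,9) continuous_on_subset by blast
 thus "valid_path g" by (simp add: C1_differentiable_imp_piecewise valid_path_def)
 thus p: "path g" by (rule valid_path_imp_path)
 show "pathfinish g = pathstart g" using cd(6)[of 0] by (simp add: pathfinish_def pathstart_def)
 show "path_image g = range g" using periodic_range[of g, OF cd(6)] by (simp add: path_image_def)
 show "simple_path g" unfolding simple_path_def loop_free_def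
 proof (intro conjI p ballI impI)
  fix x y :: real assume "x : {0..1}" "y : {0..1}" and eq: "g x = g y"
  moreover obtain n :: int where "y = x + of_int n" by (rule jordan_loop_eqE[OF cd(1) eq])
  ultimately show "x = y | x = 0 & y = 1 | x = 1 & y = 0" by auto
 qed
qed

lemma c2loop_compact: "c2loop g ==> compact (range g)" using compact_path_image c2loop_path(2,4) by metis

lemma c2loop_winding:
 assumes c: "c2loop g"
 shows "(ALL z : inside (range g). winding_number g z = 1) | (ALL z : inside (range g). winding_number g z = -1)"
  "z ~: range g ==> z ~: inside (range g) ==> winding_number g z = 0"
  "inside (range g) ~= {}"
proof -
 note cp = c2loop_path[OF c]
 show "(ALL z : inside (range g). winding_number g z = 1) | (ALL z : inside (range g). winding_number g z = -1)"
  using simple_closed_path_winding_number_inside[OF cp(5)] cp(3,4) by metis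
 show "inside (range g) ~= {}" using Jordan_inside_outside[OF cp(5,3)] by (simp add: cp(4))
 assume "z ~: range g" "z ~: inside (range g)"
 hence "z : outside (path_image g)" using inside_Un_outside[of "range g"] unfolding cp(4) by blast
 thus "winding_number g z = 0" by (rule winding_number_zero_in_outside[OF cp(2,3)])
qed

lemma c2loop_winding_integral:
 assumes c: "c2loop g" and z: "z ~: range g"
 shows "winding_number g z = 1/(2*pi*\<i>)*integral {0..1} (%u. d1 g u/(g u - z))"
  "(%u. d1 g u/(g u - z)) integrable_on {0..1}"
proof -
 have "contour_integral g (%w. 1/(w-z)) = integral {0..1} (%u. d1 g u/(g u - z))" unfolding contour_integral_integral d1_def by simp
 thus "winding_number g z = 1/(2*pi*\<i>)*integral {0..1} (%u. d1 g u/(g u - z))"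
  using winding_number_valid_path[OF c2loop_path(1)[OF c], of z] z by (simp add: c2loop_path(4)[OF c])
 show "(%u. d1 g u/(g u - z)) integrable_on {0..1}" using z
  by (intro integrable_continuous_real continuous_intros c2loopD(8,9)[OF c, THEN continuous_on_subset]) auto
qed

lemma log_derivative_integral_clockwise_turn:
 fixes f q :: "real => complex"
 assumes fd: "!!u. u : {0..1} ==> (f has_vector_derivative f u*q u) (at u)"
  and ends: "f 0 = -1" "f 1 = -1" and slit: "!!u. 0 < u ==> u < 1 ==> f u ~: \<real>\<^sub>\<le>\<^sub>0"
  and delta: "delta > 0" "!!u. 0 < u ==> u < delta ==> Im (f u) > 0" "!!u. 1-delta < u ==> u < 1 ==> Im (f u) < 0"
 shows "(q has_integral -(2*pi*\<i>)) {0..1}"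
proof -
 define F where "F u = (if u = 0 then \<i>*pi else if u = 1 then -(\<i>*pi) else Ln (f u))" for u
 have f0: "f u ~= 0" if "u : {0..1}" for u using slit[of u] that ends by (cases "u = 0 | u = 1") auto
 have fc: "continuous (at u within {0..1}) f" if "u : {0..1}" for u
  using has_vector_derivative_continuous[OF fd[OF that]] by (rule continuous_at_imp_continuous_within)
 have Lnc: "continuous (at u within {0..1}) (%u. Ln (-f u))" if "u = 0 | u = 1" for u
  using that ends by (intro continuous_within_compose3[OF continuous_at_Ln] continuous_minus fc) auto
 have F0: "continuous (at 0 within {0..1}) F"
 proof (rule continuous_transform_within[OF _ delta(1)])
  show "continuous (at 0 within {0..1}) (%u. Ln (-f u) + \<i>*pi)" by (intro continuous_intros Lnc) auto
  show "Ln (-f u) + \<i>*pi = F u" if "u : {0..1}" "dist u 0 < delta" for u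
   using Ln_minus[of "-f u"] delta(2)[of u] f0[of u] that ends by (cases "u = 0") (auto simp: F_def)
 qed auto
 have F1: "continuous (at 1 within {0..1}) F"
 proof (rule continuous_transform_within[OF _ delta(1)])
  show "continuous (at 1 within {0..1}) (%u. Ln (-f u) - \<i>*pi)" by (intro continuous_intros Lnc) auto
  show "Ln (-f u) - \<i>*pi = F u" if "u : {0..1}" "dist u 1 < delta" for u
   using Ln_minus[of "-f u"] delta(3)[of u] f0[of u] that ends by (cases "u = 1") (auto simp: F_def dist_real_def)
 qed auto
 have Fd: "(F has_vector_derivative q u) (at u)" if u: "u : {0<..<1}" for u
 proof (rule has_vector_derivative_transform_within_open[of _ _ _ "{0<..<1}"])
  have "f u*q u*inverse (f u) = q u" "f u ~: \<real>\<^sub>\<le>\<^sub>0" using f0[of u] slit[of u] u by auto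
  thus "((%u. Ln (f u)) has_vector_derivative q u) (at u)"
   using field_vector_diff_chain_at[OF fd has_field_derivative_Ln, of u] u by (simp only: o_def) auto
 qed (use u in \<open>auto simp: F_def\<close>)
 have "continuous_on {0..1} F" unfolding continuous_on_eq_continuous_within
 proof
  fix u :: real assume "u : {0..1}"
  then consider "u = 0" | "u = 1" | "u : {0<..<1}" by force
  thus "continuous (at u within {0..1}) F"
   by cases (use F0 F1 has_vector_derivative_continuous[OF Fd] continuous_at_imp_continuous_within in auto)
 qed
 from fundamental_theorem_of_calculus_interior[OF _ this Fd]
 have "(q has_integral F 1 - F 0) {0..1}" by simp
 moreover have "F 1 - F 0 = -(2*pi*\<i>)" by (simp add: F_def)
 ultimately show ?thesis by simp
qed

lemma crossing_quotient:
 assumes eps: "eps > 0" and ne: "w + \<i> * of_real eps ~= 0" "w - \<i> * of_real eps ~= 0"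
 defines "f \<equiv> (w - \<i> * of_real eps)/(w + \<i> * of_real eps)"
 shows "Re w > 0 ==> Im f < 0" "Re w < 0 ==> Im f > 0" "cmod w > eps ==> Re f > 0"
proof -
 define n where "n = (cmod (w + \<i> * of_real eps))^2"
 have "f = (w - \<i> * of_real eps)*cnj (w + \<i> * of_real eps)/of_real n" unfolding f_def n_def by (rule complex_div_cnj)
 moreover have "(w - \<i> * of_real eps)*cnj (w + \<i> * of_real eps) = Complex ((cmod w)^2 - eps^2) (-(2*eps*Re w))"
  unfolding cmod_power2 by (rule complex_eqI) (simp_all add: algebra_simps power2_eq_square)
 ultimately have f: "Re f = ((cmod w)^2 - eps^2)/n" "Im f = -(2*eps*Re w)/n" by simp_all
 show "Re w > 0 ==> Im f < 0" "Re w < 0 ==> Im f > 0" unfolding f using ne eps by (auto simp: divide_less_0_iff mult_pos_neg n_def)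
 show "Re f > 0" if "cmod w > eps" unfolding f using ne power_strict_mono[OF that, of 2] eps by (simp add: n_def)
qed

lemma winding_number_jump:
 assumes c: "c2loop g" and delta: "0 < delta" "delta < 1"
  and left: "!!u. 0 < u ==> u < delta ==> Re (g u) < Re (g 0)"
  and right: "!!u. 1-delta < u ==> u < 1 ==> Re (g u) > Re (g 0)"
  and far: "!!u. delta <= u ==> u <= 1-delta ==> eps < cmod (g u - g 0)" and eps: "eps > 0"
 defines "z \<equiv> g 0 - \<i>*eps" and "z' \<equiv> g 0 + \<i>*eps"
 shows "z ~: range g" "z' ~: range g" "winding_number g z' = winding_number g z - 1"
proof -
 note cd = c2loopD[OF c]
 have wz: "g u - z = g u - g 0 + \<i>*eps" "g u - z' = g u - g 0 - \<i>*eps" for u by (auto simp: z_def z'_def)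
 have pos: "Re (g u) < Re (g 0) & u < 1 | Re (g u) > Re (g 0) & u > 0 | eps < cmod (g u - g 0) & 0 < u & u < 1 | u = 0 | u = 1"
  if "u : {0..1}" for u
  using that left[of u] right[of u] far[of u] by force
 have g1: "g 1 = g 0" using cd(6)[of 0] by simp
 have ne: "g u ~= z & g u ~= z'" if "u : {0..1}" for u using pos[OF that] eps g1 by (auto simp: z_def z'_def norm_mult)
 show zo: "z ~: range g" "z' ~: range g" using ne unfolding periodic_range[of g, OF cd(6)] by blast+
 hence ne: "g u - z ~= 0" "g u - z' ~= 0" for u by auto
 define f where "f u = (g u - z')/(g u - z)" for u
 note q = crossing_quotient[OF eps ne[unfolded wz], folded wz f_def, simplified]
 have "((%u. d1 g u/(g u - z') - d1 g u/(g u - z)) has_integral -(2*pi*\<i>)) {0..1}"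
 proof (rule log_derivative_integral_clockwise_turn[where f = f and delta = delta])
  show "(f has_vector_derivative f u*(d1 g u/(g u - z') - d1 g u/(g u - z))) (at u)" for u
  proof -
   have "DERIV (%x. (x-z')/(x-z)) (g u) :> ((g u - z) - (g u - z'))/((g u - z)*(g u - z))"
    using ne[of u] by (auto intro!: derivative_eq_intros)
   from field_vector_diff_chain_at[OF cd(2) this] show ?thesis unfolding o_def f_def
   proof (rule has_vector_derivative_eq_rhs)
    have "d*((X-Y)/(X*X)) = Y/X*(d/Y - d/X)" if "X ~= 0" "Y ~= 0" for d X Y :: complex using that by (simp add: field_simps)
    from this[OF ne] show "d1 g u*((g u - z - (g u - z'))/((g u - z)*(g u - z)))
     = (g u - z')/(g u - z)*(d1 g u/(g u - z') - d1 g u/(g u - z))" .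
   qed
  qed
  show "f 0 = -1" "f 1 = -1" using eps by (simp_all add: f_def z_def z'_def g1)
  fix u :: real
  show "f u ~: \<real>\<^sub>\<le>\<^sub>0" if "0 < u" "u < 1" using pos[of u] q[of u] that by (force simp: complex_nonpos_Reals_iff)
  show "Im (f u) > 0" if "0 < u" "u < delta" using left[OF that] q(2)[of u] by simp
  show "Im (f u) < 0" if "1-delta < u" "u < 1" using right[OF that] q(1)[of u] by simp
 qed (rule delta)
 moreover note wi = c2loop_winding_integral[OF c zo(1)] c2loop_winding_integral[OF c zo(2)]
 ultimately have "integral {0..1} (%u. d1 g u/(g u - z')) = integral {0..1} (%u. d1 g u/(g u - z)) - 2*pi*\<i>"
  using integral_diff[OF wi(4,2)] by (simp add: integral_unique algebra_simps)
 thus "winding_number g z' = winding_number g z - 1" unfolding wi(1,3) by (simp add: field_simps)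
qed

text \<open>If the curve ran leftwards through its lowest point, the winding number would drop from 0 to -1 on entering
 the curve from below.\<close>
lemma ccw_direction_at_lowest_point:
 assumes c: "c2loop g" and ccw: "ccw g" and low: "!!u. Im (g 0) <= Im (g u)"
 shows "Im (d1 g 0) = 0" "Re (d1 g 0) > 0"
proof -
 note cd = c2loopD[OF c]
 have dR: "DERIV (%u. Re (g u)) u :> Re (d1 g u)" and dI: "DERIV (%u. Im (g u)) u :> Im (d1 g u)" for u
  using cd(2)[of u] unfolding has_vector_derivative_complex_iff by blast+
 show I0: "Im (d1 g 0) = 0" by (rule DERIV_local_min[OF dI[of 0], of 1]) (use low in auto)
 show "Re (d1 g 0) > 0"
 proof (rule ccontr)
  assume "~Re (d1 g 0) > 0"
  hence neg: "Re (d1 g 0) < 0" using cd(4)[of 0] I0 by (simp add: complex_eq_iff)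
  obtain delta1 where delta1: "delta1 > 0" "!!h. h > 0 ==> h < delta1 ==> Re (g (0+h)) < Re (g 0)"
   using DERIV_neg_dec_right[OF dR[of 0] neg] by auto
  obtain delta2 where delta2: "delta2 > 0" "!!h. h > 0 ==> h < delta2 ==> Re (g 0) < Re (g (0-h))"
   using DERIV_neg_dec_left[OF dR[of 0] neg] by auto
  define delta where "delta = min (1/4) (min delta1 delta2)"
  have delta: "delta > 0" "delta <= 1/4" "delta <= delta1" "delta <= delta2" using delta1(1) delta2(1) by (auto simp: delta_def)
  obtain u0 where u0: "u0 : {delta..1-delta}" "!!u. u : {delta..1-delta} ==> cmod (g u0 - g 0) <= cmod (g u - g 0)"
  proof -
   have "continuous_on {delta..1-delta} (%u. cmod (g u - g 0))" by (intro continuous_intros continuous_on_subset[OF cd(8)]) auto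
   thus thesis using continuous_attains_inf[of "{delta..1-delta}" "%u. cmod (g u - g 0)"] delta that by auto
  qed
  define eps where "eps = cmod (g u0 - g 0)/2"
  have "g u0 ~= g 0" using inj_onD[OF cd(7), of u0 0] u0(1) delta by auto
  hence eps: "0 < eps" "eps < cmod (g u0 - g 0)" by (simp_all add: eps_def)
  define z z' where "z = g 0 - \<i>*eps" and "z' = g 0 + \<i>*eps"
  have jump: "z ~: range g" "z' ~: range g" "winding_number g z' = winding_number g z - 1"
  proof -
   have "Re (g 0) < Re (g u)" if "1-delta < u" "u < 1" for u using delta2(2)[of "1-u"] cd(6)[of "u-1"] that delta by simp
   note winding_number_jump[OF c delta(1) _ _ this, of eps, folded z_def z'_def]
   thus "z ~: range g" "z' ~: range g" "winding_number g z' = winding_number g z - 1" using delta delta1(2) u0(2) eps by force+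
  qed
  have "winding_number g z = 0"
  proof (rule winding_number_zero_outside)
   show "convex {x. Im x >= Im (g 0)}" by (rule convex_halfspace_Im_ge)
  qed (use c2loop_path[OF c] low eps in \<open>auto simp: z_def\<close>)
  hence "winding_number g z' = -1" using jump(3) by simp
  moreover from this have "z' : inside (range g)" using c2loop_winding(2)[OF c jump(2)] by auto
  ultimately show False using ccw unfolding ccw_def by auto
 qed
qed

lemma log_difference_constant:
 fixes h k :: "real => complex"
 assumes h: "continuous_on {0..1} h" and k: "continuous_on {0..1} k"
  and eq: "!!t. t : {0..1} ==> exp (h t) = exp (k t)"
 shows "h 1 - h 0 = k 1 - k 0"
proof -
 have e: "exp (h t) = exp (k t + (h 0 - k 0))" if "t : {0..1}" for t using eq[OF that] eq[of 0] by (simp add: exp_add exp_diff)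
 have "h 1 = k 1 + (h 0 - k 0)"
  by (rule covering_space_lift_unique[OF covering_space_exp_punctured_plane, where T = "{0..1}" and a = 0 and ?g1.0 = h and ?g2.0 =
   "%t. k t + (h 0 - k 0)" and f = "%t. exp (h t)"]) (intro continuous_intros h k | simp; fail | rule e)+
 thus ?thesis by simp
qed

lemma upper_half_plane_turn:
 fixes h :: "real => complex"
 assumes h: "continuous_on {0..1} h" and up: "!!t. t : {0..1} ==> Im (exp (h t)) >= 0"
  and ends: "exp (h 0) = of_real a" "a > 0" "exp (h 1) = of_real b" "b < 0"
 shows "Im (h 1 - h 0) = pi"
proof -
 define k where "k t = Ln (-\<i>*exp (h t)) + \<i>*pi/2" for t
 have slit: "-\<i>*exp (h t) ~: \<real>\<^sub>\<le>\<^sub>0" if "t : {0..1}" for t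
  using up[OF that] exp_not_eq_zero[of "h t"] by (auto simp: complex_nonpos_Reals_iff complex_eq_iff)
 have "h 1 - h 0 = k 1 - k 0"
 proof (rule log_difference_constant[OF h])
  show "continuous_on {0..1} k" unfolding k_def by (intro continuous_intros h) (use slit in auto)
  have "exp (\<i>*pi/2) = \<i>" using cis_pi_half by (simp add: cis_conv_exp)
  moreover have "exp (h t) = -\<i>*exp (h t)*\<i>" for t by (simp add: mult.assoc mult.commute[of "exp (h t)"])
  ultimately show "exp (h t) = exp (k t)" for t unfolding k_def exp_add by simp
 qed
 moreover have "Ln (-\<i> * of_real a) = Ln (of_real a) - \<i> * of_real pi/2"
  using Ln_times_ii[of "-of_real a"] ends Ln_minus[of "of_real a"] by simp
 moreover have "Ln (-\<i> * of_real b) = Ln (of_real (-b)) + \<i> * of_real pi/2" using Ln_times_ii[of "of_real (-b)"] ends by simp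
 moreover have "Im (Ln (-complex_of_real b)) = 0" using Ln_of_real[of "-b"] ends(4) by simp
 ultimately show ?thesis using ends unfolding k_def by simp
qed

definition mean_velocity :: "(real => complex) => real => real => complex" where
 "mean_velocity g s t = integral {0..1} (%q. d1 g (s + q*(t-s)))"

lemma mean_velocity_props:
 assumes c: "c2loop g"
 shows "of_real (t-s)*mean_velocity g s t = g t - g s" "mean_velocity g s s = d1 g s"
  "continuous_on UNIV (%(s,t). mean_velocity g s t)"
proof -
 note cd = c2loopD[OF c]
 have "((%q. of_real (t-s)*d1 g (s + q*(t-s))) has_integral g (s + 1*(t-s)) - g (s + 0*(t-s))) {0..1}"
 proof (rule fundamental_theorem_of_calculus)
  fix q :: real
  have "((%q. s + q*(t-s)) has_vector_derivative (t-s)) (at q)" by (auto intro!: derivative_eq_intros)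
  from vector_diff_chain_at[OF this cd(2)]
  show "((%q. g (s + q*(t-s))) has_vector_derivative of_real (t-s)*d1 g (s + q*(t-s))) (at q within {0..1})"
   by (auto simp: o_def scaleR_conv_of_real intro: has_vector_derivative_at_within)
 qed simp
 hence "integral {0..1} (%q. of_real (t-s)*d1 g (s + q*(t-s))) = g t - g s" by (subst integral_unique) simp_all
 thus "of_real (t-s)*mean_velocity g s t = g t - g s" unfolding mean_velocity_def by simp
 show "mean_velocity g s s = d1 g s" by (simp add: mean_velocity_def)
 have "continuous_on UNIV (%x :: real \<times> real. integral (cbox 0 1) (%q. d1 g (fst x + q*(snd x - fst x))))"
  by (rule integral_continuous_on_param)
   (auto simp: case_prod_beta intro!: continuous_on_compose2[OF cd(9)] continuous_intros)
 thus "continuous_on UNIV (%(s,t). mean_velocity g s t)" by (simp add: mean_velocity_def case_prod_beta)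
qed

text \<open>The secant from parameter s to s + h, divided by h (1 - h) so that it extends continuously and without zeros
 to h = 0 and h = 1.\<close>
definition hopf_secant :: "(real => complex) => real \<times> real => complex" where
 "hopf_secant g x = (if snd x <= 1/2 then mean_velocity g (fst x) (fst x + snd x)/of_real (1 - snd x)
  else -mean_velocity g (fst x + snd x) (fst x + 1)/of_real (snd x))"

lemma hopf_secant_props:
 assumes c: "c2loop g"
 shows "of_real (h*(1-h))*hopf_secant g (s,h) = g (s+h) - g s" "hopf_secant g (s,0) = d1 g s" "hopf_secant g (s,1) = -d1 g s"
  "h : {0..1} ==> hopf_secant g (s,h) ~= 0" "continuous_on (UNIV \<times> {0..1}) (hopf_secant g)"
proof -
 note cd = c2loopD[OF c] and mv = mean_velocity_props[OF c]
 note m1 = mv(1)[of "s+h" s for s h, simplified]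
 have m2: "of_real (1-h)*mean_velocity g (s+h) (s+1) = g s - g (s+h)" for s h using mv(1)[of "s+1" "s+h"] cd(6) by simp
 show sec: "of_real (h*(1-h))*hopf_secant g (s,h) = g (s+h) - g s" for s h
 proof (cases "h <= 1/2")
  case True
  hence "of_real (1-h)*hopf_secant g (s,h) = mean_velocity g s (s+h)" by (simp add: hopf_secant_def)
  thus ?thesis using m1[of h s] by (simp only: of_real_mult mult.assoc)
 next
  case False
  hence "of_real h*hopf_secant g (s,h) = -mean_velocity g (s+h) (s+1)" by (simp add: hopf_secant_def)
  hence "of_real (1-h)*(of_real h*hopf_secant g (s,h)) = g (s+h) - g s" using m2[of h s] by simp
  thus ?thesis by (simp only: of_real_mult mult.assoc mult.left_commute)
 qed
 show e: "hopf_secant g (s,0) = d1 g s" "hopf_secant g (s,1) = -d1 g s" for s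
  using c2loop_periodic(1)[OF c] by (simp_all add: hopf_secant_def mv(2))
 show "hopf_secant g (s,h) ~= 0" if "h : {0..1}"
 proof (cases "h = 0 | h = 1")
  case False
  have "g (s+h) ~= g s"
  proof
   assume "g (s+h) = g s"
   then obtain n :: int where "s = s + h + of_int n" using jordan_loop_eqE[OF cd(1)] by metis
   hence "h = of_int (-n)" by simp
   thus False using False that by auto
  qed
  thus ?thesis using sec[of h s] by auto
 qed (use e cd(4) in auto)
 have mc: "continuous_on A (%x. mean_velocity g (a x) (b x))"
  if "continuous_on A a" "continuous_on A b" for A :: "(real \<times> real) set" and a b
  using continuous_on_compose2[OF mv(3) continuous_on_Pair[OF that]] by simp
 have split: "UNIV \<times> {0..1} = UNIV \<times> {0..1/2 :: real} \<union> UNIV \<times> {1/2..1}" by auto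
 have half: "snd x : {0..1/2} & ~snd x <= 1/2 | snd x : {1/2..1} & snd x <= 1/2
   ==> mean_velocity g (fst x) (fst x + snd x)/of_real (1 - snd x) = -mean_velocity g (fst x + snd x) (fst x + 1)/of_real (snd x)" for x
 proof -
  assume "snd x : {0..1/2} & ~snd x <= 1/2 | snd x : {1/2..1} & snd x <= 1/2"
  hence "snd x = 1/2" by auto
  thus ?thesis using m1[of "1/2" "fst x"] m2[of "1/2" "fst x"] by (simp only: \<open>snd x = 1/2\<close>) simp
 qed
 show "continuous_on (UNIV \<times> {0..1}) (hopf_secant g)" unfolding hopf_secant_def[abs_def] split by (rule continuous_on_cases)
   (use half in \<open>auto intro!: closed_Times continuous_intros mc simp del: of_real_diff of_real_add\<close>)
qed

text \<open>Hopf's argument: on the triangle of chords based at the lowest point, the secant direction has a logarithm, and its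
 turning along the diagonal (the tangent direction) equals its turning along the two legs, each of which stays in a
 half plane.\<close>
lemma umlaufsatz_lowest:
 assumes c: "c2loop g" and low: "!!u. Im (g 0) <= Im (g u)" and dir: "Im (d1 g 0) = 0" "Re (d1 g 0) > 0"
  and k: "continuous_on {0..1} k" "!!t. t : {0..1} ==> d1 g t = exp (k t)"
 shows "Im (k 1 - k 0) = 2*pi"
proof -
 note hs = hopf_secant_props[OF c]
 define Q where "Q = {0..1 :: real} \<times> {0..1 :: real}"
 have d0: "d1 g 0 = of_real (Re (d1 g 0))" "d1 g 1 = d1 g 0" using dir c2loop_periodic(1)[OF c, of 0] by (simp_all add: complex_eq_iff)
 have "continuous_on Q (hopf_secant g)" using hs(5) by (rule continuous_on_subset) (auto simp: Q_def)
 moreover have "contractible Q" unfolding Q_def by (intro convex_imp_contractible convex_Times) auto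
 ultimately obtain psi where psi: "continuous_on Q psi" "!!x. x : Q ==> hopf_secant g x = exp (psi x)"
  using continuous_logarithm_on_contractible[of Q "hopf_secant g"] hs(4) unfolding Q_def by (metis SigmaE)
 have psic: "continuous_on {0..1} (%t. psi (a t, b t))"
  if "continuous_on {0..1} a" "continuous_on {0..1} b" "!!t. t : {0..1} ==> (a t, b t) : Q" for a b :: "real => real"
  by (rule continuous_on_compose2[OF psi(1) continuous_on_Pair[OF that(1,2)]]) (use that(3) in auto)
 have Im_secant: "h*(1-h)*Im (hopf_secant g (s,h)) = Im (g (s+h)) - Im (g s)" for s h using arg_cong[OF hs(1)[of h s], of Im]
  by (simp only: times_complex.simps Re_complex_of_real Im_complex_of_real minus_complex.simps)
 have up: "Im (hopf_secant g (0,h)) >= 0" and down: "Im (hopf_secant g (1-h,h)) <= 0" if "0 < h" "h < 1" for h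
 proof -
  have "0 < h*(1-h)" "Im (g 1) = Im (g 0)" using that c2loopD(6)[OF c, of 0] by simp_all
  moreover from this have "0 <= h*(1-h)*Im (hopf_secant g (0,h))" "h*(1-h)*Im (hopf_secant g (1-h,h)) <= 0"
   unfolding Im_secant using low by simp_all
  ultimately show "Im (hopf_secant g (0,h)) >= 0" "Im (hopf_secant g (1-h,h)) <= 0"
   using mult_pos_neg[of "h*(1-h)"] mult_pos_pos[of "h*(1-h)"] by (meson not_le)+
 qed
 have corners: "exp (psi (0,0)) = d1 g 0" "exp (psi (0,1)) = -d1 g 0" "exp (psi (1,0)) = d1 g 0"
  using psi(2)[of "(0,0)"] psi(2)[of "(0,1)"] psi(2)[of "(1,0)"] hs(2,3) d0(2) by (simp_all add: Q_def)
 have diagonal: "k 1 - k 0 = psi (1,0) - psi (0,0)"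
 proof (rule log_difference_constant[OF k(1)])
  show "continuous_on {0..1} (%t. psi (t,0))" by (rule psic) (auto simp: Q_def)
  show "exp (k t) = exp (psi (t,0))" if "t : {0..1}" for t using psi(2)[of "(t,0)"] k(2)[OF that] hs(2) that by (auto simp: Q_def)
 qed
 have leg: "Im (psi (0,1) - psi (0,0)) = pi"
 proof (rule upper_half_plane_turn[of "%t. psi (0,t)" "Re (d1 g 0)" "-Re (d1 g 0)"])
  show "continuous_on {0..1} (%t. psi (0,t))" by (rule psic) (auto simp: Q_def)
  fix t :: real assume t: "t : {0..1}"
  show "Im (exp (psi (0,t))) >= 0" using psi(2)[of "(0,t)"] up[of t] t corners dir by (cases "t = 0 | t = 1") (auto simp: Q_def)
 qed (use corners d0(1) dir in auto)
 have "Im ((psi (1,1-1) + \<i>*pi) - (psi (0,1-0) + \<i>*pi)) = pi"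
 proof (rule upper_half_plane_turn[of "%t. psi (t,1-t) + \<i>*pi" "Re (d1 g 0)" "-Re (d1 g 0)"])
  show "continuous_on {0..1} (%t. psi (t,1-t) + \<i>*pi)" by (intro continuous_intros psic) (auto simp: Q_def)
  fix t :: real assume t: "t : {0..1}"
  have "exp (psi (t,1-t) + \<i>*pi) = -exp (psi (t,1-t))" by (simp add: exp_add)
  thus "Im (exp (psi (t,1-t) + \<i>*pi)) >= 0"
   using psi(2)[of "(t,1-t)"] down[of "1-t"] t corners dir by (cases "t = 0 | t = 1") (auto simp: Q_def)
 qed (use corners d0(1) dir in \<open>auto simp: exp_add\<close>)
 thus ?thesis using diagonal leg by simp
qed

lemma c2loop_shift:
 assumes c: "c2loop g"
 shows "c2loop (%u. g (u+a))" "d1 (%u. g (u+a)) u = d1 g (u+a)" "range (%u. g (u+a)) = range g"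
proof -
 note cd = c2loopD[OF c]
 note der = has_vector_derivative_shift[OF cd(2)] has_vector_derivative_shift[OF cd(3)]
 have e1: "d1 (%u. g (u+a)) = (%u. d1 g (u+a))" unfolding d1_def[of "%u. g (u+a)"] by (intro ext vector_derivative_at der)
 have e2: "d2 (%u. g (u+a)) = (%u. d2 g (u+a))" unfolding d2_def[of "%u. g (u+a)"] e1 by (intro ext vector_derivative_at der)
 show "d1 (%u. g (u+a)) u = d1 g (u+a)" by (simp add: e1)
 have "g u : range (%u. g (u+a))" for u by (rule range_eqI[of _ _ "u-a"]) simp
 thus "range (%u. g (u+a)) = range g" by auto
 have "inj_on (%u. g (u+a)) {0..<1}"
 proof (rule inj_onI)
  fix u v assume uv: "u : {0..<1 :: real}" "v : {0..<1}" "g (u+a) = g (v+a)"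
  obtain n :: int where "v + a = u + a + of_int n" by (rule jordan_loop_eqE[OF cd(1) uv(3)])
  thus "u = v" using uv by auto
 qed
 moreover have "g (u+1+a) = g (u+a)" for u using cd(6)[of "u+a"] by (simp add: ac_simps)
 ultimately have "jordan_loop (%u. g (u+a))" by (simp add: jordan_loop_def)
 moreover have "(%u. g (u+a)) differentiable (at u)" "(%u. d1 g (u+a)) differentiable (at u)" for u
  by (rule differentiableI_vector[OF der(1)], rule differentiableI_vector[OF der(2)])
 moreover have "continuous_on UNIV (%u. d2 g (u+a))" by (rule continuous_on_compose2[OF cd(5)]) (auto intro!: continuous_intros)
 ultimately show "c2loop (%u. g (u+a))" unfolding c2loop_def e1 e2 using cd(4) by auto
qed

lemma ccw_shift:
 assumes c: "c2loop g" and ccw: "ccw g" and a: "a : {0..1}"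
 shows "ccw (%u. g (u+a))"
 unfolding ccw_def c2loop_shift(3)[OF c]
proof
 fix z assume z: "z : inside (range g)"
 hence zi: "z ~: path_image g" using inside_no_overlap[of "range g"] unfolding c2loop_path(4)[OF c] by blast
 have "shiftpath a g = (%u. g (u+a))" using c2loopD(6)[OF c, of "a + u - 1" for u] by (auto simp: shiftpath_def add.commute)
 hence "winding_number (%u. g (u+a)) z = winding_number g z"
  using winding_number_shiftpath[OF c2loop_path(2)[OF c] zi c2loop_path(3)[OF c] a] by simp
 thus "winding_number (%u. g (u+a)) z = 1" using ccw z unfolding ccw_def by simp
qed

lemma tangent_angle:
 assumes c: "c2loop g"
 obtains theta where "!!u. DERIV theta u :> curv1 g u*cmod (d1 g u)" "!!u. tangent g u = cis (theta u)"
proof -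
 note cd = c2loopD[OF c]
 have "continuous_on UNIV (%u. curv1 g u*cmod (d1 g u))" unfolding curv1_def by (intro continuous_intros cd(5,9)) (use cd(4) in auto)
 then obtain H where H: "!!u. DERIV H u :> curv1 g u*cmod (d1 g u)" using continuous_antiderivative by blast
 define theta where "theta u = H u - H 0 + Arg (d1 g 0)" for u
 have theta: "DERIV theta u :> curv1 g u*cmod (d1 g u)" for u unfolding theta_def by (rule derivative_eq_intros H refl | simp)+
 have "((%u. tangent g u*cis (-theta u)) has_vector_derivative 0) (at u)" for u
 proof -
  have "(cis has_vector_derivative \<i>*cis (-theta u)) (at (-theta u))"
   unfolding has_vector_derivative_complex_iff by (auto intro!: derivative_eq_intros)
  from vector_diff_chain_at[where f = "%u. -theta u" and f' = "-(curv1 g u*cmod (d1 g u))" and g = cis, OF _ this]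
  have "((%u. cis (-theta u)) has_vector_derivative (-(curv1 g u*cmod (d1 g u)))*\<^sub>R (\<i>*cis (-theta u))) (at u)"
   using DERIV_minus[OF theta[of u]] by (simp add: o_def has_real_derivative_iff_has_vector_derivative)
  from has_vector_derivative_mult[OF tangent_has_vector_derivative[OF c, of u] this]
  show ?thesis
  proof (rule has_vector_derivative_eq_rhs)
   have "T*((-(k*n))*\<^sub>R (\<i>*z)) + \<i> * of_real k*(of_real n*T)*z = 0" for T z :: complex and k n :: real
    by (simp add: scaleR_conv_of_real)
   from this[of "tangent g u" "curv1 g u" "cmod (d1 g u)" "cis (-theta u)"]
   show "tangent g u*((-(curv1 g u*cmod (d1 g u)))*\<^sub>R (\<i>*cis (-theta u))) + \<i>*curv1 g u*d1 g u*cis (-theta u) = 0"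
    unfolding tangent_unit(2)[OF c, of u, symmetric] .
  qed
 qed
 hence "tangent g u*cis (-theta u) = tangent g 0*cis (-theta 0)" for u
  using has_vector_derivative_zero_constant[of UNIV "%u. tangent g u*cis (-theta u)"] by (metis UNIV_I convex_UNIV)
 moreover have "tangent g 0 = cis (theta 0)" using cis_Arg[OF cd(4)[of 0]] by (simp add: theta_def tangent_def sgn_eq)
 ultimately have "tangent g u*cis (-theta u) = 1" for u by (simp add: cis_mult)
 hence "tangent g u*(cis (-theta u)*cis (theta u)) = cis (theta u)" for u by (simp only: mult.assoc[symmetric] mult_1_left)
 hence "tangent g u = cis (theta u)" for u by (simp only: cis_mult) simp
 thus thesis using that theta by blast
qed

lemma total_curvature:
 assumes c: "c2loop g" and ccw: "ccw g" and theta: "!!u. DERIV theta u :> curv1 g u*cmod (d1 g u)" "!!u. tangent g u = cis (theta u)"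
 shows "theta (u+1) = theta u + 2*pi"
proof -
 note cd = c2loopD[OF c]
 obtain a where a: "a : {0..1}" "!!u. Im (g a) <= Im (g u)"
  using periodic_attains_inf[of "%u. Im (g u)"] cd(6,8) by (metis continuous_on_Im)
 define gs where "gs u = g (u+a)" for u
 note sh = c2loop_shift[OF c, of a, folded gs_def]
 have ccws: "ccw gs" using ccw_shift[OF c ccw a(1)] by (simp add: gs_def[abs_def])
 have low: "Im (gs 0) <= Im (gs u)" for u using a(2)[of "u+a"] by (simp add: gs_def)
 define h where "h t = of_real (ln (cmod (d1 g (t+a)))) + \<i> * of_real (theta (t+a))" for t
 have "Im (h 1 - h 0) = 2*pi"
 proof (rule umlaufsatz_lowest[OF sh(1) low ccw_direction_at_lowest_point[OF sh(1) ccws low]])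
  have "continuous_on UNIV theta" using DERIV_isCont[OF theta(1)] by (simp add: continuous_at_imp_continuous_on)
  thus "continuous_on {0..1} h" unfolding h_def
   by (intro continuous_intros continuous_on_compose2[OF cd(9)] continuous_on_compose2[of UNIV theta "{0..1}"]) (use cd(4) in auto)
  show "d1 gs t = exp (h t)" for t unfolding sh(2) h_def exp_add cis_conv_exp[symmetric] theta(2)[symmetric]
   using tangent_unit(2)[OF c, of "t+a"] cd(4)[of "t+a"] by (simp add: exp_of_real)
 qed
 hence "theta (a+1) - theta a = 2*pi" by (simp add: h_def add.commute)
 moreover have "DERIV (%u. theta (u+1) - theta u) u :> 0" for u
  using DERIV_diff[OF _ theta(1)[of u], of "%u. theta (u+1)" "curv1 g u*cmod (d1 g u)"] theta(1)[of "u+1"] c2loop_periodic[OF c]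
  by (simp add: DERIV_shift)
 ultimately show ?thesis using DERIV_isconst_all[of "%u. theta (u+1) - theta u" u a] by simp
qed

lemma anis_continuous: "continuous_on S anis"
proof -
 have "abs (cos x) + abs (sin x) ~= 0" for x :: real using sin_cos_squared_add[of x]
  by (auto simp: add_nonneg_eq_0_iff simp del: sin_cos_squared_add)
 thus ?thesis unfolding anis_def[abs_def] by (auto intro!: continuous_intros)
qed

lemma anis_antiderivative_first_quadrant:
 assumes "x : {0..pi/2}"
 shows "DERIV (%x. sin x/(2*(sin x + cos x))) x :> anis x"
proof -
 have nn: "sin x >= 0" "cos x >= 0" using assms by (auto intro!: sin_ge_zero cos_ge_zero)
 have one: "sin x * sin x + cos x*cos x = 1" by (simp add: add.commute)
 hence p: "sin x + cos x ~= 0" using nn by (auto simp: add_nonneg_eq_0_iff)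
 have num: "cos x*(2*(sin x + cos x)) - sin x*(2*(cos x + -sin x)) = 2" using one by algebra
 have "DERIV (%x. 2*(sin x + cos x)) x :> 2*(cos x + -sin x)" by (intro DERIV_cmult DERIV_add DERIV_sin DERIV_cos)
 from DERIV_divide[OF DERIV_sin this]
 have "DERIV (%x. sin x/(2*(sin x + cos x))) x :> 2/(2*(sin x + cos x)*(2*(sin x + cos x)))" unfolding num using p by simp
 moreover have "2/(2*N*(2*N)) = 1/(2*N^2)" for N :: real by (simp add: power2_eq_square)
 ultimately show ?thesis unfolding anis_def abs_of_nonneg[OF nn(1)] abs_of_nonneg[OF nn(2)] by (simp only: add.commute[of "cos x"])
qed

lemma anis_antiderivative_period:
 assumes F: "!!x. DERIV F x :> anis x"
 shows "F (x + 2*pi) - F x = 2"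
proof -
 define S where "S x = sin x/(2*(sin x + cos x))" for x :: real
 have "(anis has_integral (F (pi/2) - F 0)) {0..pi/2}" by (rule fundamental_theorem_of_calculus)
   (use F in \<open>auto simp: has_real_derivative_iff_has_vector_derivative[symmetric] intro: DERIV_subset\<close>)
 moreover have "(anis has_integral (S (pi/2) - S 0)) {0..pi/2}" unfolding S_def
  by (rule fundamental_theorem_of_calculus) (use anis_antiderivative_first_quadrant in
   \<open>auto simp: has_real_derivative_iff_has_vector_derivative[symmetric] intro: DERIV_subset\<close>)
 ultimately have "F (pi/2) - F 0 = S (pi/2) - S 0" by (rule has_integral_unique)
 hence quarter: "F (0+pi/2) - F 0 = 1/2" by (simp add: S_def)
 have "DERIV (%x. F (x+pi/2) - F x) x :> 0" for x
  using DERIV_diff[OF _ F[of x], of "%x. F (x+pi/2)" "anis x"] F[of "x+pi/2"] by (simp add: DERIV_shift anis_bounds(3))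
 hence q: "F (x+pi/2) = F x + 1/2" for x using DERIV_isconst_all[of "%x. F (x+pi/2) - F x" x 0] quarter by simp
 have "x + 2*pi = x + pi/2 + pi/2 + pi/2 + pi/2" by simp
 thus ?thesis by (simp only: q)
qed

lemma total_anisotropic_curvature:
 assumes c: "c2loop g" and ccw: "ccw g"
 shows "integral {0..1} (%u. anis (Arg (d1 g u))*curv1 g u*cmod (d1 g u)) = 2"
proof -
 obtain theta where theta: "!!u. DERIV theta u :> curv1 g u*cmod (d1 g u)" "!!u. tangent g u = cis (theta u)"
  by (rule tangent_angle[OF c]) blast
 obtain F where F: "!!x. DERIV F x :> anis x" using continuous_antiderivative anis_continuous by blast
 have angle: "anis (Arg (d1 g u)) = anis (theta u)" for u
  using cis_Arg[OF c2loopD(4)[OF c, of u]] theta(2)[of u] by (simp add: tangent_def anis_def complex_eq_iff)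
 have "((%u. anis (Arg (d1 g u))*curv1 g u*cmod (d1 g u)) has_integral F (theta 1) - F (theta 0)) {0..1}"
 proof (rule fundamental_theorem_of_calculus)
  fix u :: real
  show "((%u. F (theta u)) has_vector_derivative anis (Arg (d1 g u))*curv1 g u*cmod (d1 g u)) (at u within {0..1})"
   using DERIV_chain2[OF F theta(1)]
   unfolding angle by (auto simp: has_real_derivative_iff_has_vector_derivative[symmetric] mult.assoc intro: DERIV_subset)
 qed simp
 thus ?thesis using anis_antiderivative_period[OF F, of "theta 0"] total_curvature[OF c ccw theta, of 0] by (simp add: integral_unique)
qed

abbreviation plane :: "(real \<times> real) measure" where "plane \<equiv> lborel \<Otimes>\<^sub>M lborel"

lemma lborel_complex: "(lborel :: complex measure) = distr plane borel (%p. Complex (snd p) (fst p))"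
proof (rule lborel_eqI)
 have m: "(%p. Complex (snd p) (fst p)) : borel_measurable plane"
  unfolding lborel_prod measurable_lborel2 by (intro borel_measurable_continuous_onI continuous_intros)
 fix l u :: complex assume "!!b. b : Basis ==> l \<bullet> b <= u \<bullet> b"
 from this[of 1] this[of \<i>] have le: "Re l <= Re u" "Im l <= Im u" by auto
 have pre: "(%p. Complex (snd p) (fst p)) -` box l u \<inter> space plane = {Im l<..<Im u} \<times> {Re l<..<Re u}"
  by (auto simp: in_box_complex_iff space_pair_measure)
 have "emeasure (distr plane borel (%p. Complex (snd p) (fst p))) (box l u)
  = emeasure plane ({Im l<..<Im u} \<times> {Re l<..<Re u})"
  by (subst emeasure_distr[OF m]) (simp_all only: pre borel_open[OF open_box])
 also have "... = ennreal (Im u - Im l)*ennreal (Re u - Re l)" by (subst lborel.emeasure_pair_measure_Times) (use le in auto)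
 finally show "emeasure (distr plane borel (%p. Complex (snd p) (fst p))) (box l u) = (\<Prod> b \<in> Basis. (u-l) \<bullet> b)"
  using le by (simp add: Basis_complex_def ennreal_mult[symmetric])
qed simp

lemma inverse_sqrt_nn_integral_finite:
 fixes c :: real assumes c: "c >= 0"
 shows "(\<integral>\<^sup>+w. ennreal (indicator {-c..c} w*abs w powr (-1/2)) \<partial>lborel) < \<infinity>"
proof -
 have right: "((%w. abs w powr (-1/2)) has_integral (c powr (-1/2 + 1)/(-1/2 + 1))) {0..c}"
  by (rule has_integral_eq[OF _ has_integral_powr_from_0]) (use c in auto)
 hence left: "((%w. abs w powr (-1/2)) has_integral (c powr (-1/2 + 1)/(-1/2 + 1))) {-c..-0}"
  using has_integral_reflect_real[of "%w. abs w powr (-1/2)" _ c 0] by simp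
 have "((%w. abs w powr (-1/2)) has_integral (c powr (-1/2 + 1)/(-1/2 + 1) + c powr (-1/2 + 1)/(-1/2 + 1))) {-c..c}"
  by (rule has_integral_combine[of _ 0]) (use left right c in auto)
 from nn_integral_has_integral_lebesgue[OF _ this] show ?thesis by simp
qed

lemma cauchy_kernel_bound:
 assumes d: "cmod d <= m" and w: "Re w ~= 0" "Im w ~= 0"
 shows "cmod (d/w) <= m*abs (Re w) powr (-1/2)*abs (Im w) powr (-1/2)"
proof -
 define s where "s = sqrt (abs (Re w)*abs (Im w))"
 have s: "s > 0" using w by (simp add: s_def)
 have "2*(abs (Re w)*abs (Im w)) <= (abs (Re w))^2 + (abs (Im w))^2" using sum_squares_bound[of "abs (Re w)" "abs (Im w)"] by simp
 moreover have "0 <= abs (Re w)*abs (Im w)" by simp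
 ultimately have "abs (Re w)*abs (Im w) <= (cmod w)^2" unfolding cmod_power2 power2_abs by linarith
 hence "s <= cmod w" unfolding s_def by (rule real_le_lsqrt[OF norm_ge_zero])
 hence "cmod d/cmod w <= m/s" using d s order_trans[OF norm_ge_zero d] by (intro frac_le) auto
 moreover have "abs (Re w) powr (-1/2)*abs (Im w) powr (-1/2) = 1/s" by (simp add: s_def powr_minus_divide powr_half_sqrt real_sqrt_mult)
 ultimately show ?thesis by (simp add: norm_divide mult.assoc)
qed

lemma Ln_difference_bound:
 assumes w: "cmod w <= r" and n: "2*r <= n" and r: "r > 0"
 shows "cmod (Ln (n+w) - Ln (n-w)) <= 4*r/n"
proof -
 define S where "S = {z. Re z >= n/2}"
 have "cmod (Ln (n+w) - Ln (n-w)) <= 2/n*cmod ((n+w) - (n-w))"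
 proof (rule field_differentiable_bound)
  show "convex S" unfolding S_def by (rule convex_halfspace_Re_ge)
  show "n + w : S" "n - w : S" using abs_Re_le_cmod[of w] w n by (simp_all add: S_def)
  fix z assume "z : S"
  hence z: "n/2 <= Re z" by (simp add: S_def)
  hence "z ~: \<real>\<^sub>\<le>\<^sub>0" using n r by (auto simp: complex_nonpos_Reals_iff)
  thus "(Ln has_field_derivative inverse z) (at z within S)" by (rule has_field_derivative_at_within[OF has_field_derivative_Ln])
  show "cmod (inverse z) <= 2/n" using z complex_Re_le_cmod[of z] le_imp_inverse_le[of "n/2" "cmod z"] n r unfolding norm_inverse by simp
 qed
 also have "(n+w) - (n-w) = 2*w" by simp
 also have "2/n*cmod (2*w) <= 4*r/n" using w n r by (simp add: divide_right_mono)
 finally show ?thesis .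
qed

lemma cauchy_kernel_row:
 assumes b: "Im w ~= 0" and d: "cmod d <= m" and w: "cmod w <= r" and n: "2*r <= n" "r > 0"
 shows "abs ((\<integral>x. indicator {-n..n} x*Im (d/(w-x)) \<partial>lborel) + pi * sgn (Im w)*Re d) <= 4*m*r/n"
proof -
 define F where "F x = Im (-d*Ln (w - of_real x))" for x
 have slit: "w - of_real x ~: \<real>\<^sub>\<le>\<^sub>0" for x using b by (simp add: complex_nonpos_Reals_iff)
 have "(\<integral>x. indicator {-n..n} x*\<^sub>R Im (d/(w-x)) \<partial>lborel) = F n - F (-n)"
 proof (rule integral_FTC_atLeastAtMost)
  fix x :: real
  have "((%x. w - of_real x) has_vector_derivative -1) (at x)" by (auto intro!: derivative_eq_intros)
  from field_vector_diff_chain_at[OF this has_field_derivative_Ln[OF slit]]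
  have "((%x. -d*Ln (w - of_real x)) has_vector_derivative d/(w - of_real x)) (at x)"
   by (auto intro!: derivative_eq_intros simp: o_def divide_inverse)
  thus "(F has_vector_derivative Im (d/(w-x))) (at x within {-n..n})" unfolding F_def
   by (auto simp: has_vector_derivative_complex_iff has_real_derivative_iff_has_vector_derivative[symmetric] intro: DERIV_subset)
  show "continuous_on {-n..n} (%x. Im (d/(w-x)))" using b by (intro continuous_intros) auto
 qed (use n in simp)
 moreover have "Ln (w-n) = Ln (n-w) + \<i>*pi * sgn (Im w)" using Ln_minus[of "n-w"] b by (cases "w = of_real n") auto
 ultimately have "(\<integral>x. indicator {-n..n} x*Im (d/(w-x)) \<partial>lborel) + pi * sgn (Im w)*Re d
  = Im (d*(Ln (n+w) - Ln (n-w)))" by (simp add: F_def algebra_simps)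
 also have "abs ... <= cmod d*cmod (Ln (n+w) - Ln (n-w))" using abs_Im_le_cmod by (metis norm_mult)
 also have "... <= m*(4*r/n)" using Ln_difference_bound[OF w n] d order_trans[OF norm_ge_zero d] by (intro mult_mono) auto
 finally show ?thesis by (simp add: mult.left_commute mult.assoc)
qed

lemma periodic_bounded:
 fixes f :: "real => 'a :: real_normed_vector"
 assumes "continuous_on UNIV f" "!!u. f (u+1) = f u"
 obtains K where "K > 0" "!!u. norm (f u) <= K"
proof -
 have "compact (f ` {0..1})" by (intro compact_continuous_image continuous_on_subset[OF assms(1)]) auto
 thus thesis using that compact_imp_bounded[of "range f"] unfolding periodic_range[of f, OF assms(2), symmetric] bounded_pos by blast
qed

abbreviation enclosed_area :: "(real => complex) => real" where "enclosed_area g \<equiv> measure lebesgue (inside (range g))"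

text \<open>The area is the integral of the winding number over the plane. After exchanging the order of integration, the Cauchy
 kernel is integrated row by row; over long rows it tends to a multiple of the signed height above the row.\<close>
context
 fixes g :: "real => complex" and R m n :: real
 assumes c: "c2loop g" and ccw: "ccw g" and R: "R > 0" "!!u. cmod (g u) <= R"
  and m: "!!u. cmod (d1 g u) <= m" and n: "4*R <= n"
begin

definition strip_kernel :: "real => real \<times> real => real" where
 "strip_kernel u w
  = indicator {0..1} u*(indicator {-R..R} (fst w)*(indicator {-n..n} (snd w)*Im (d1 g u/(g u - Complex (snd w) (fst w)))))"

interpretation F: pair_sigma_finite "lborel :: real measure" plane
 unfolding lborel_prod by (rule lborel_pair.pair_sigma_finite_axioms)

lemma strip_kernel_measurable:
 shows "(%w. strip_kernel (fst w) (snd w)) : borel_measurable (lborel \<Otimes>\<^sub>M plane)"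
  "strip_kernel u : borel_measurable plane"
  "(%x. strip_kernel u (y,x)) : borel_measurable borel"
proof -
 have [measurable]: "g : borel_measurable borel" "d1 g : borel_measurable borel"
  by (intro borel_measurable_continuous_onI c2loopD(8,9)[OF c])+
 show "(%w. strip_kernel (fst w) (snd w)) : borel_measurable (lborel \<Otimes>\<^sub>M plane)"
  "strip_kernel u : borel_measurable plane"
  "(%x. strip_kernel u (y,x)) : borel_measurable borel"
  unfolding strip_kernel_def[abs_def] Complex_eq snd_conv by measurable
qed

lemma strip_kernel_nn_integral:
 obtains K where "K < \<infinity>" "!!u. (\<integral>\<^sup>+w. ennreal (norm (strip_kernel u w)) \<partial>plane) <= K"
proof -
 note [measurable] = strip_kernel_measurable
 define h where "h w = indicator {-(2*n)..2*n} w*abs w powr (-1/2)" for w :: real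
 define H where "H = (\<integral>\<^sup>+w. ennreal (h w) \<partial>lborel)"
 have H: "H < \<infinity>" unfolding H_def h_def by (rule inverse_sqrt_nn_integral_finite) (use n R in simp)
 have [measurable]: "h : borel_measurable borel" unfolding h_def by measurable
 have h0: "h w >= 0" for w unfolding h_def by simp
 have m0: "0 <= m" using order_trans[OF norm_ge_zero m] .
 have shift: "(\<integral>\<^sup>+x. ennreal (h (a-x)) \<partial>lborel) = H" for a
  unfolding H_def using nn_integral_real_affine[of "%w. ennreal (h w)" "-1" a] by simp
 have bound: "abs (strip_kernel u (y,x)) <= m*h (Im (g u) - y)*h (Re (g u) - x)" if "y ~= Im (g u)" "x ~= Re (g u)" for u y x
 proof (cases "u : {0..1} & y : {-R..R} & x : {-n..n}")
  case True
  have "Im (g u) - y : {-(2*n)..2*n}" "Re (g u) - x : {-(2*n)..2*n}"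
   using True abs_Re_le_cmod[of "g u"] abs_Im_le_cmod[of "g u"] R(2)[of u] n by auto
  hence "m*h (Im (g u) - y)*h (Re (g u) - x) = m*abs (Re (g u) - x) powr (-1/2)*abs (Im (g u) - y) powr (-1/2)" by (simp add: h_def)
  moreover have "cmod (d1 g u/(g u - Complex x y)) <= m*abs (Re (g u) - x) powr (-1/2)*abs (Im (g u) - y) powr (-1/2)"
   using cauchy_kernel_bound[OF m, of "g u - Complex x y"] that by simp
  moreover have "strip_kernel u (y,x) = Im (d1 g u/(g u - Complex x y))" using True by (simp add: strip_kernel_def)
  ultimately show ?thesis using abs_Im_le_cmod[of "d1 g u/(g u - Complex x y)"] by linarith
 qed (use h0 m0 in \<open>auto simp: strip_kernel_def\<close>)
 have "(\<integral>\<^sup>+w. ennreal (norm (strip_kernel u w)) \<partial>plane) <= ennreal m*H*H" for u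
 proof -
  have "(\<integral>\<^sup>+w. ennreal (norm (strip_kernel u w)) \<partial>plane)
   = (\<integral>\<^sup>+y. \<integral>\<^sup>+x. ennreal (abs (strip_kernel u (y,x))) \<partial>lborel \<partial>lborel)"
   by (subst lborel.nn_integral_fst[symmetric]) auto
  also have "... <= (\<integral>\<^sup>+y. ennreal m*H*ennreal (h (Im (g u) - y)) \<partial>lborel)"
  proof (rule nn_integral_mono_AE, rule eventually_mono[OF AE_lborel_singleton[of "Im (g u)"]])
   fix y assume y: "y ~= Im (g u)"
   have "(\<integral>\<^sup>+x. ennreal (abs (strip_kernel u (y,x))) \<partial>lborel)
    <= (\<integral>\<^sup>+x. ennreal (m*h (Im (g u) - y))*ennreal (h (Re (g u) - x)) \<partial>lborel)"
    by (rule nn_integral_mono_AE, rule eventually_mono[OF AE_lborel_singleton[of "Re (g u)"]])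
     (use bound[OF y] h0 m0 in \<open>simp add: ennreal_mult[symmetric] ennreal_leI\<close>)
   also have "... = ennreal m*H*ennreal (h (Im (g u) - y))" using h0 m0 by (simp add: nn_integral_cmult shift ennreal_mult ac_simps)
   finally show "(\<integral>\<^sup>+x. ennreal (abs (strip_kernel u (y,x))) \<partial>lborel) <= ennreal m*H*ennreal (h (Im (g u) - y))" .
  qed
  also have "... = ennreal m*H*H" by (simp add: nn_integral_cmult shift)
  finally show ?thesis .
 qed
 thus thesis using that[of "ennreal m*H*H"] H by (simp add: ennreal_mult_less_top)
qed

lemma strip_kernel_integrable:
 shows "integrable (lborel \<Otimes>\<^sub>M plane) (case_prod strip_kernel)"
  "integrable plane (strip_kernel u)"
proof -
 note [measurable] = strip_kernel_measurable
 obtain K where K: "K < \<infinity>" "!!u. (\<integral>\<^sup>+w. ennreal (norm (strip_kernel u w)) \<partial>plane) <= K"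
  by (rule strip_kernel_nn_integral) blast
 show "integrable plane (strip_kernel u)" by (rule integrableI_bounded[OF strip_kernel_measurable(2) le_less_trans[OF K(2,1)]])
 show "integrable (lborel \<Otimes>\<^sub>M plane) (case_prod strip_kernel)"
 proof (rule integrableI_bounded)
  show "case_prod strip_kernel : borel_measurable (lborel \<Otimes>\<^sub>M plane)" by simp
  have "(\<integral>\<^sup>+v. ennreal (norm (case v of (u,w) => strip_kernel u w)) \<partial>(lborel \<Otimes>\<^sub>M plane))
   = (\<integral>\<^sup>+u. \<integral>\<^sup>+w. ennreal (norm (strip_kernel u w)) \<partial>plane \<partial>lborel)"
   by (subst lborel_pair.P.nn_integral_fst[symmetric]) auto
  also have "... <= (\<integral>\<^sup>+u. K*indicator {0..1 :: real} u \<partial>lborel)"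
  proof (rule nn_integral_mono)
   fix u :: real
   show "(\<integral>\<^sup>+w. ennreal (norm (strip_kernel u w)) \<partial>plane) <= K*indicator {0..1} u"
    using K(2)[of u] by (cases "u : {0..1}") (simp_all add: strip_kernel_def)
  qed
  also have "... = K" by (simp add: nn_integral_cmult_indicator)
  finally show "(\<integral>\<^sup>+v. ennreal (norm (case v of (u,w) => strip_kernel u w)) \<partial>(lborel \<Otimes>\<^sub>M plane)) < \<infinity>"
   using K(1) by simp
 qed
qed

lemma strip_kernel_winding:
 assumes z: "Complex x y ~: range g"
 shows "(\<integral>u. strip_kernel u (y,x) \<partial>lborel) = 2*pi*indicator (inside (range g)) (Complex x y)"
proof -
 let ?z = "Complex x y" and ?S = "inside (range g)"
 have "g u ~= ?z" for u using z by (metis rangeI)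
 hence "continuous_on {0..1} (%u. Im (d1 g u/(g u - ?z)))"
  by (intro continuous_intros continuous_on_subset[OF c2loopD(8)[OF c]] continuous_on_subset[OF c2loopD(9)[OF c]]) auto
 hence "(LINT u : {0..1} | lborel. Im (d1 g u/(g u - ?z))) = integral {0..1} (%u. Im (d1 g u/(g u - ?z)))"
  by (intro set_borel_integral_eq_integral borel_integrable_atLeastAtMost')
 also have "... = Im (integral {0..1} (%u. d1 g u/(g u - ?z)))"
  using integral_linear[OF c2loop_winding_integral(2)[OF c z] bounded_linear_Im] by (simp add: o_def)
 also have "integral {0..1} (%u. d1 g u/(g u - ?z)) = 2*pi*\<i>*winding_number g ?z" using c2loop_winding_integral(1)[OF c z] by simp
 also have "winding_number g ?z = indicator ?S ?z" using ccw c2loop_winding(2)[OF c z] by (auto simp: ccw_def indicator_def)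
 finally have wind: "(\<integral>u. indicator {0..1} u*Im (d1 g u/(g u - ?z)) \<partial>lborel) = 2*pi*indicator ?S ?z"
  by (simp add: set_lebesgue_integral_def indicator_def)
 have "(\<integral>u. strip_kernel u (y,x) \<partial>lborel)
  = (\<integral>u. (indicator {-R..R} y*indicator {-n..n} x)*(indicator {0..1} u*Im (d1 g u/(g u - ?z))) \<partial>lborel)"
  unfolding strip_kernel_def by (simp add: ac_simps)
 also have "... = (indicator {-R..R} y*indicator {-n..n} x)*(2*pi*indicator ?S ?z)"
  unfolding wind[symmetric] by (rule integral_mult_right_zero)
 also have "... = 2*pi*indicator ?S ?z"
 proof (cases "?z : ?S")
  case True
  have "range g <= cball 0 R" using R(2) by auto
  hence "?z ~: -cball 0 R" using True outside_subset_convex[OF convex_cball] inside_Int_outside[of "range g"] by blast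
  hence "abs y <= R" "abs x <= R" using abs_Re_le_cmod[of ?z] abs_Im_le_cmod[of ?z] by auto
  thus ?thesis using n by (auto simp: abs_le_iff)
 qed simp
 finally show ?thesis .
qed

lemma area_eq_strip_integral:
 "2*pi*enclosed_area g
  = (\<integral>u. (\<integral>w. strip_kernel u w \<partial>plane) \<partial>lborel)"
proof -
 let ?S = "inside (range g)"
 have S: "open ?S" by (rule open_inside[OF compact_imp_closed[OF c2loop_compact[OF c]]])
 have zM[measurable]: "(%w. Complex (snd w) (fst w)) : borel_measurable plane"
  unfolding lborel_prod measurable_lborel2 by (intro borel_measurable_continuous_onI continuous_intros)
 have "measure lebesgue ?S = (\<integral>z. indicator ?S z \<partial>lborel)" using S by simp
 also have "... = (\<integral>w. indicator ?S (Complex (snd w) (fst w)) \<partial>plane)"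
  unfolding lborel_complex by (rule integral_distr[OF zM]) (use S in auto)
 finally have "2*pi*measure lebesgue ?S = (\<integral>w. 2*pi*indicator ?S (Complex (snd w) (fst w)) \<partial>plane)" by simp
 also have "... = (\<integral>w. (\<integral>u. strip_kernel u w \<partial>lborel) \<partial>plane)"
 proof (rule integral_cong_AE)
  show "(%w. 2*pi*indicator ?S (Complex (snd w) (fst w))) : borel_measurable plane" using S by (intro measurable_compose[OF zM]) auto
  show "(%w. \<integral>u. strip_kernel u w \<partial>lborel) : borel_measurable plane"
   using F.integrable_snd[OF strip_kernel_integrable(1)] by (rule borel_measurable_integrable)
  have "negligible (range g)" by (rule negligible_differentiable_image_lowdim)
    (use c2loopD(2)[OF c] in \<open>auto simp: differentiable_on_def intro: differentiableI_vector\<close>)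
  hence "AE z in lborel. z ~: range g" using AE_not_in[of "range g" lebesgue] by (simp add: AE_completion_iff negligible_iff_null_sets)
  hence "AE w in plane. Complex (snd w) (fst w) ~: range g" unfolding lborel_complex
   by (subst (asm) AE_distr_iff[OF zM])
    (use borel_compact[OF c2loop_compact[OF c]] in \<open>auto simp: Collect_neg_eq intro!: borel_comp\<close>)
  thus "AE w in plane. 2*pi*indicator ?S (Complex (snd w) (fst w)) = (\<integral>u. strip_kernel u w \<partial>lborel)"
   by (rule eventually_mono) (auto simp: strip_kernel_winding)
 qed
 also have "... = (\<integral>u. (\<integral>w. strip_kernel u w \<partial>plane) \<partial>lborel)"
  by (rule F.Fubini_integral[OF strip_kernel_integrable(1)])
 finally show ?thesis .
qed

lemma strip_kernel_plane_integral:
 assumes u: "u : {0..1}"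
 shows "abs ((\<integral>w. strip_kernel u w \<partial>plane) + 2*pi*(Re (d1 g u)*Im (g u))) <= 16*m*R*R/n"
proof -
 define I where "I y = (\<integral>x. strip_kernel u (y,x) \<partial>lborel)" for y
 define s where "s y = indicator {-R..R} y * sgn (Im (g u) - y)" for y
 let ?q = "pi*Re (d1 g u)"
 have Iint: "integrable lborel I" "(\<integral>w. strip_kernel u w \<partial>plane) = (\<integral>y. I y \<partial>lborel)"
  unfolding I_def using lborel_pair.integrable_fst'[OF strip_kernel_integrable(2)] lborel_pair.integral_fst'[OF strip_kernel_integrable(2)]
   by simp_all
 have seq: "s = (%y. indicator {-R..Im (g u)} y - indicator {Im (g u)..R} y)"
  using abs_Im_le_cmod[of "g u"] R(2)[of u] by (auto simp: s_def fun_eq_iff indicator_def)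
 have sint: "integrable lborel s" "(\<integral>y. s y \<partial>lborel) = 2*Im (g u)"
  unfolding seq using abs_Im_le_cmod[of "g u"] R(2)[of u] by (subst Bochner_Integration.integral_diff | simp add: abs_le_iff)+
 have int': "integrable lborel (%y. I y + ?q * s y)" using Iint(1) sint(1) by simp
 have "(\<integral>y. I y + ?q * s y \<partial>lborel) = (\<integral>w. strip_kernel u w \<partial>plane) + 2*pi*(Re (d1 g u)*Im (g u))"
  using Iint sint by simp
 moreover have "abs (\<integral>y. I y + ?q * s y \<partial>lborel) <= (\<integral>y. abs (I y + ?q * s y) \<partial>lborel)" by simp
 moreover have "(\<integral>y. abs (I y + ?q * s y) \<partial>lborel) <= (\<integral>y. indicator {-R..R} y*(8*m*R/n) \<partial>lborel)"
 proof (rule integral_mono_AE)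
  show "integrable lborel (%y. indicator {-R..R} y*(8*m*R/n))" by (simp add: emeasure_lborel_Icc_eq)
  show "AE y in lborel. abs (I y + ?q * s y) <= indicator {-R..R} y*(8*m*R/n)"
  proof (rule eventually_mono[OF AE_lborel_singleton[of "Im (g u)"]])
   fix y assume y: "y ~= Im (g u)"
   show "abs (I y + ?q * s y) <= indicator {-R..R} y*(8*m*R/n)"
   proof (cases "y : {-R..R}")
    case True
    have "cmod (g u - \<i>*y) <= 2*R" using norm_triangle_ineq4[of "g u" "\<i>*y"] using R(2)[of u] True by (auto simp: norm_mult)
    from cauchy_kernel_row[OF _ m this, of n u] y n R(1)
    have row: "abs ((\<integral>x. indicator {-n..n} x*Im (d1 g u/(g u - \<i>*y - x)) \<partial>lborel) + ?q * sgn (Im (g u) - y)) <= 8*m*R/n"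
     by (simp add: ac_simps)
    have z: "g u - Complex x y = g u - \<i>*y - x" for x by (simp add: Complex_eq)
    show ?thesis unfolding I_def strip_kernel_def fst_conv z using True u row by (simp add: s_def)
   qed (simp add: I_def s_def strip_kernel_def)
  qed
 qed (use int' in simp)
 moreover have "(\<integral>y. indicator {-R..R} y*(8*m*R/n) \<partial>lborel) = 16*m*R*R/n" using R(1) by simp
 ultimately show ?thesis by linarith
qed

lemma area_approximation:
 "abs (enclosed_area g + integral {0..1} (%u. Re (d1 g u)*Im (g u))) <= 16*m*R*R/n"
proof -
 define J where "J u = (\<integral>w. strip_kernel u w \<partial>plane)" for u
 define K where "K u = indicator {0..1} u*(2*pi*(Re (d1 g u)*Im (g u)))" for u :: real
 have J: "integrable lborel J" unfolding J_def using F.integrable_fst[OF strip_kernel_integrable(1)] by simp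
 have si: "set_integrable lborel {0..1} (%u. 2*pi*(Re (d1 g u)*Im (g u)))" by (intro borel_integrable_atLeastAtMost' continuous_intros
   continuous_on_subset[OF c2loopD(8)[OF c]] continuous_on_subset[OF c2loopD(9)[OF c]]) auto
 have K: "integrable lborel K" "(\<integral>u. K u \<partial>lborel) = 2*pi*integral {0..1} (%u. Re (d1 g u)*Im (g u))"
  using si set_borel_integral_eq_integral(2)[OF si] unfolding set_integrable_def set_lebesgue_integral_def K_def by simp_all
 have bound: "abs (J u + K u) <= indicator {0..1} u*(16*m*R*R/n)" for u
  using strip_kernel_plane_integral[of u] by (cases "u : {0..1}") (auto simp: J_def K_def strip_kernel_def)
 have "2*pi*(enclosed_area g + integral {0..1} (%u. Re (d1 g u)*Im (g u))) = (\<integral>u. J u + K u \<partial>lborel)"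
  using J K by (simp add: area_eq_strip_integral distrib_left J_def[abs_def])
 also have "abs ... <= (\<integral>u. abs (J u + K u) \<partial>lborel)" by simp
 also have "... <= (\<integral>u. indicator {0..1 :: real} u*(16*m*R*R/n) \<partial>lborel)"
  by (rule integral_mono) (use J K bound in \<open>auto simp: emeasure_lborel_Icc_eq\<close>)
 also have "... = 16*m*R*R/n" by simp
 finally have "2*pi*abs (enclosed_area g + integral {0..1} (%u. Re (d1 g u)*Im (g u))) <= 16*m*R*R/n" by simp
 moreover have "1*abs x <= 2*pi*abs x" for x using pi_gt3 by (intro mult_right_mono) auto
 ultimately show ?thesis by (smt (verit))
qed

end

lemma green_area:
 assumes c: "c2loop g" and ccw: "ccw g"
 shows "enclosed_area g = -integral {0..1} (%u. Re (d1 g u)*Im (g u))"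
proof -
 obtain R where R: "R > 0" "!!u. cmod (g u) <= R" by (rule periodic_bounded[OF c2loopD(8,6)[OF c]]) blast
 obtain m where m: "!!u. cmod (d1 g u) <= m" by (rule periodic_bounded[OF c2loopD(9)[OF c] c2loop_periodic(1)[OF c]]) blast
 have "abs (enclosed_area g + integral {0..1} (%u. Re (d1 g u)*Im (g u))) <= 0"
 proof (rule tendsto_lowerbound)
  show "((%n. 16*m*R*R/n) \<longlongrightarrow> 0) at_top" by (rule real_tendsto_divide_at_top[OF tendsto_const filterlim_ident])
  show "\<forall>\<^sub>F n in at_top. abs (enclosed_area g + integral {0..1} (%u. Re (d1 g u)*Im (g u))) <= 16*m*R*R/n"
   using eventually_ge_at_top[of "4*R"] by eventually_elim (rule area_approximation[OF c ccw R m])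
 qed simp
 thus ?thesis by simp
qed

lemma loop_area_difference:
 assumes a: "c2loop a" "ccw a" and b: "c2loop b" "ccw b"
 shows "enclosed_area b - enclosed_area a
  = integral {0..1} (%u. Im (cnj (b u - a u)*(d1 a u + d1 b u))/2)"
proof -
 note ad = c2loopD[OF a(1)] and bd = c2loopD[OF b(1)]
 define F where "F u = (Re (b u)*Im (b u) - Re (a u)*Im (a u) + Re (b u)*Im (a u) - Re (a u)*Im (b u))/2" for u
 define h where "h u = Im (cnj (b u - a u)*(d1 a u + d1 b u))/2" for u
 have der: "DERIV (%u. Re (a u)) u :> Re (d1 a u)" "DERIV (%u. Im (a u)) u :> Im (d1 a u)"
  "DERIV (%u. Re (b u)) u :> Re (d1 b u)" "DERIV (%u. Im (b u)) u :> Im (d1 b u)" for u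
  using ad(2)[of u] bd(2)[of u] unfolding has_vector_derivative_complex_iff by blast+
 have "((%u. h u + (Re (d1 b u)*Im (b u) - Re (d1 a u)*Im (a u))) has_integral F 1 - F 0) {0..1}"
 proof (rule fundamental_theorem_of_calculus)
  fix u :: real
  have "DERIV F u :> h u + (Re (d1 b u)*Im (b u) - Re (d1 a u)*Im (a u))" unfolding F_def h_def
   by (rule derivative_eq_intros der refl | (simp; fail))+ (simp add: field_simps)
  thus "(F has_vector_derivative h u + (Re (d1 b u)*Im (b u) - Re (d1 a u)*Im (a u))) (at u within {0..1})"
   by (auto simp: has_real_derivative_iff_has_vector_derivative[symmetric] intro: DERIV_subset)
 qed simp
 moreover have "F 1 = F 0" using ad(6)[of 0] bd(6)[of 0] by (simp add: F_def)
 moreover note [intro] = continuous_on_subset[OF ad(8)] continuous_on_subset[OF ad(9)]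
  continuous_on_subset[OF bd(8)] continuous_on_subset[OF bd(9)]
 have "h integrable_on {0..1}" "(%u. Re (d1 b u)*Im (b u)) integrable_on {0..1}" "(%u. Re (d1 a u)*Im (a u)) integrable_on {0..1}"
  unfolding h_def by (intro integrable_continuous_real continuous_intros; auto)+
 hence "integral {0..1} (%u. h u + (Re (d1 b u)*Im (b u) - Re (d1 a u)*Im (a u)))
  = integral {0..1} h + (integral {0..1} (%u. Re (d1 b u)*Im (b u)) - integral {0..1} (%u. Re (d1 a u)*Im (a u)))"
  by (simp add: integral_add Henstock_Kurzweil_Integration.integral_diff integrable_diff)
 ultimately show ?thesis using green_area[OF a] green_area[OF b] unfolding h_def[symmetric] by (simp add: integral_unique)
qed

lemma vector_difference_quotient_tendsto:
 fixes f :: "real => complex"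
 assumes f: "(f has_vector_derivative v) (at t within S)" and s: "!!i. s i : S" "!!i. s i ~= t" "s \<longlonglongrightarrow> t"
 shows "(%i. (f (s i) - f t)/of_real (s i - t)) \<longlonglongrightarrow> v"
proof -
 show ?thesis using f s unfolding has_vector_derivative_complex_iff has_field_derivative_iff tendsto_at_iff_sequentially
  unfolding tendsto_complex_iff by (simp add: o_def)
qed

lemma area_has_derivative:
 assumes c: "!!t. t : W ==> c2loop (slice gam t)" "!!t. t : W ==> ccw (slice gam t)" and t0: "t0 : W"
  and d1c: "continuous_on (UNIV \<times> W) (%(u,t). d1 (slice gam t) u)" and m: "!!u t. t : W ==> cmod (d1 (slice gam t) u) <= m"
  and C: "!!u t. u : {0..1} ==> t : W ==> cmod (gam u t - gam u t0) <= C*abs (t-t0)"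
  and v: "!!u. EX v. curvature_velocity anis gam W t0 u v"
 shows "((%t. enclosed_area (slice gam t)) has_field_derivative -2) (at t0 within W)"
 unfolding has_field_derivative_iff tendsto_at_iff_sequentially
proof (intro allI impI)
 fix T :: "nat => real" assume T: "ALL i. T i : W - {t0}" and lim: "T \<longlonglongrightarrow> t0"
 have TW: "T i : W" "T i ~= t0" for i using T by auto
 define g where "g t = slice gam t" for t
 note g0 = c2loopD[OF c(1)[OF t0], folded g_def]
 obtain V where V: "!!u. curvature_velocity anis gam W t0 u (V u)" using v by metis
 define Q where "Q i u = (g (T i) u - g t0 u)/of_real (T i - t0)" for i u
 define f where "f i u = Im (cnj (Q i u)*(d1 (g t0) u + d1 (g (T i)) u))/2" for i u
 define w where "w u = -(anis (Arg (d1 (g t0) u))*curv1 (g t0) u*cmod (d1 (g t0) u))" for u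
 have quot: "(enclosed_area (g (T i)) - enclosed_area (g t0))/(T i - t0) = integral {0..1} (f i)" for i
 proof -
  show ?thesis unfolding f_def Q_def unfolding g_def loop_area_difference[OF c[OF t0] c[OF TW(1)]] by simp
 qed
 have "(%i. integral {0..1} (f i)) \<longlonglongrightarrow> integral {0..1} w"
 proof (rule dominated_convergence(2)[where h = "%u. abs C*(m+m)"])
  show "f i integrable_on {0..1}" for i
  proof -
   note gi = c2loopD[OF c(1)[OF TW(1)[of i]], folded g_def]
   show ?thesis unfolding f_def Q_def using TW(2)
    by (intro integrable_continuous_real continuous_intros g0(8,9)[THEN continuous_on_subset] gi(8,9)[THEN continuous_on_subset]) auto
  qed
  show "norm (f i u) <= abs C*(m+m)" if u: "u : {0..1}" for i u
  proof -
   have "cmod (Q i u) <= abs C" using order_trans[OF C[OF u TW(1)] mult_right_mono[OF abs_ge_self abs_ge_zero]]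
    unfolding Q_def norm_divide norm_of_real by (simp add: g_def slice_def divide_le_eq)
   hence "cmod (cnj (Q i u)*(d1 (g t0) u + d1 (g (T i)) u)) <= abs C*(m+m)" unfolding norm_mult g_def
    using norm_triangle_mono[OF m[OF t0] m[OF TW(1)]] by (intro mult_mono) auto
   thus ?thesis using abs_Im_le_cmod[of "cnj (Q i u)*(d1 (g t0) u + d1 (g (T i)) u)"] unfolding f_def real_norm_def by linarith
  qed
  show "(%i. f i u) \<longlonglongrightarrow> w u" for u
  proof -
   have q: "(%i. Q i u) \<longlonglongrightarrow> V u" unfolding Q_def g_def slice_def
    by (rule vector_difference_quotient_tendsto[OF conjunct1[OF V[of u]] TW lim])
   have d: "(%i. d1 (g (T i)) u) \<longlonglongrightarrow> d1 (g t0) u" unfolding g_def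
    using continuous_on_tendsto_compose[OF d1c tendsto_Pair[OF tendsto_const lim], of u] t0 TW(1) by auto
   have n: "cmod (d1 (g t0) u) > 0" using g0(10) .
   have "Im (cnj (V u)*(d1 (g t0) u + d1 (g t0) u))/2 = w u" using V[of u] n unfolding w_def g_def curv_def by (simp add: field_simps)
   moreover have "(%i. f i u) \<longlonglongrightarrow> Im (cnj (V u)*(d1 (g t0) u + d1 (g t0) u))/2" unfolding f_def
    by (intro tendsto_intros q d) simp
   ultimately show ?thesis by simp
  qed
 qed (rule integrable_const_ivl)
 moreover have "integral {0..1} w = -2" unfolding w_def g_def using total_anisotropic_curvature[OF c[OF t0]] by simp
 ultimately show "((%t. (enclosed_area (slice gam t) - enclosed_area (slice gam t0))/(t-t0)) \<circ> T) \<longlonglongrightarrow> -2"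
  unfolding g_def[symmetric] by (simp add: o_def quot)
qed

lemma c2loop_noncollapsed:
 assumes c: "c2loop g"
 obtains eta where "eta > 0" "noncollapsed M eta g"
proof -
 note cd = c2loopD[OF c]
 obtain H where H: "!!u. DERIV H u :> cmod (d1 g u)" "!!u v. arclen g u v = H v - H u" by (rule arclen_position[OF c]) blast
 have "continuous_on UNIV H" using DERIV_isCont[OF H(1)] by (simp add: continuous_at_imp_continuous_on)
 note Hc = continuous_on_compose2[OF this]
 define S where "S = {0..1} \<times> {0..2} \<inter> {x. fst x <= snd x & snd x <= fst x + 1
  & 1 <= M*(H (snd x) - H (fst x)) & 1 <= M*(H (fst x + 1) - H (snd x))}"
 have "compact S" unfolding S_def
  by (intro compact_Int_closed compact_Times closed_Collect_conj closed_Collect_le continuous_intros Hc) auto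
 have pos: "cmod (g (snd x) - g (fst x)) > 0" if x: "x : S" for x
 proof (rule ccontr)
  assume "~?thesis"
  then obtain n :: int where n: "snd x = fst x + of_int n" using jordan_loop_eqE[OF cd(1), of "fst x" "snd x"] by auto
  hence "n = 0 | n = 1" using x by (auto simp: S_def)
  thus False using n x by (auto simp: S_def)
 qed
 obtain eta where eta: "eta > 0" "!!x. x : S ==> eta <= cmod (g (snd x) - g (fst x))"
 proof (cases "S = {}")
  case False
  have "continuous_on S (%x. cmod (g (snd x) - g (fst x)))" by (intro continuous_intros continuous_on_compose2[OF cd(8)]) auto
  from continuous_attains_inf[OF \<open>compact S\<close> False this] show thesis using that pos by blast
 qed (use that[of 1] in auto)
 have "noncollapsed M eta g" unfolding noncollapsed_def
 proof (intro allI impI, rule ccontr)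
  fix u v assume uv: "u <= v" "v <= u+1" "cmod (g v - g u) < eta" and long: "~(M*arclen g u v <= 1 | M*arclen g v (u+1) <= 1)"
  define k where "k = -\<lfloor>u\<rfloor>"
  have "arclen g (u + of_int k) (v + of_int k) = arclen g u v" "arclen g (v + of_int k) (u + of_int k + 1) = arclen g v (u+1)"
   using arclen_shift[OF c, of u k v] arclen_shift[OF c, of v k "u+1"] by (simp_all add: ac_simps)
  moreover have "0 <= u + of_int k" "u + of_int k <= 1" unfolding k_def by linarith+
  ultimately have "(u + of_int k, v + of_int k) : S" using uv(1,2) long unfolding S_def by (simp add: H(2)[symmetric])
  moreover have "g (x + of_int k) = g x" for x by (rule periodic_int) (rule cd(6))
  ultimately show False using eta(2) uv(3) by fastforce
 qed
 thus thesis using that eta(1) by blast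
qed

lemma unit_parallel:
 assumes "cmod a = 1" "cmod b = 1" "Im (cnj a*b) = 0"
 shows "b = a | b = -a"
proof -
 have "cmod (cnj a*b) = 1" using assms by (simp add: norm_mult)
 hence "abs (Re (cnj a*b)) = 1" using assms(3) by (simp add: cmod_def del: times_complex.simps)
 hence "cnj a*b = 1 | cnj a*b = -1" using assms(3) by (auto simp: complex_eq_iff)
 moreover have "a*(cnj a*b) = b" using assms(1) by (simp add: complex_norm_square[symmetric])
 ultimately show ?thesis by (metis mult.right_neutral mult_minus_right)
qed

lemma hugs_tangents_same_range:
 assumes g: "c2loop g" "hugs_tangents M eta g" "eta > 0" and h: "c2loop h" "range h = range g"
 shows "hugs_tangents M eta h"
 unfolding hugs_tangents_def
proof (intro allI impI)
 fix u v assume near: "cmod (h v - h u) < eta"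
 obtain a b where ab: "h u = g a" "h v = g b" using h(2) by (metis rangeE rangeI)
 have "Im (cnj (tangent g a)*d1 h u) = 0" by (rule hugs_tangents_parallel[OF g h(1) _ ab(1)]) (use h(2) in simp)
 hence "Im (cnj (tangent g a)*tangent h u) = 0" by (simp only: tangent_def[of h] times_divide_eq_right Im_divide_of_real)
 hence "tangent h u = tangent g a | tangent h u = -tangent g a" by (rule unit_parallel[OF tangent_unit(1)[OF g(1)] tangent_unit(1)[OF h(1)]])
 moreover have "abs (Im (tcoord g a (g b))) <= 2*M*(Re (tcoord g a (g b)))^2" using g(2) near unfolding hugs_tangents_def ab by blast
 ultimately show "abs (Im (tcoord h u (h v))) <= 2*M*(Re (tcoord h u (h v)))^2"
  unfolding ab coord_def by (auto simp del: times_complex.simps)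
qed

lemma hugs_tangents_chord_lower_bound:
 assumes c: "c2loop h" and k: "!!u. abs (curv1 h u) <= M" and hug: "hugs_tangents M eta h" and M: "M > 0"
  and e: "e > 0" "1000*M*e <= 1" "8*e <= eta" and long: "1 <= M*arclen h u v" "1 <= M*arclen h v (u+1)"
 shows "e/4 <= cmod (h v - h u)"
proof (rule ccontr)
 assume "~?thesis"
 hence "cmod (tcoord h u (h v)) < e/4" using norm_coord_diff[OF tangent_unit(1)[OF c], of "h u" u "h v" "h u"] by simp
 hence v: "abs (Re (tcoord h u (h v))) < e/4" "abs (Im (tcoord h u (h v))) < e/4"
  using abs_Re_le_cmod abs_Im_le_cmod le_less_trans by blast+
 obtain w where w: "abs (arclen h u w) <= e/2" "Re (tcoord h u (h w)) = Re (tcoord h u (h v))"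
  by (rule arc_reaches_tangent_abscissa[OF c k, of "e/2" "Re (tcoord h u (h v))" u]) (use e(2) v(1) in auto)
 have "cmod (tcoord h u (h w)) <= e/2"
  using norm_coord_diff[OF tangent_unit(1)[OF c], of "h u" u "h w" "h u"] chord_le_arclen[OF c, of w u] w(1) by simp
 hence "in_box (h u) (tangent h u) (e/2) (h w)" unfolding in_box_def using abs_Re_le_cmod abs_Im_le_cmod order_trans by blast
 moreover have "in_box (h u) (tangent h u) (e/2) (h v)" using v e(1) by (simp add: in_box_def)
 moreover have "box_graph (h u) (tangent h u) (e/2) h"
  by (rule box_graph_of_close[OF c k c k hug e])
   (use e(1) in \<open>metis diff_self norm_zero divide_nonneg_nonneg less_imp_le zero_le_numeral\<close>)
 ultimately have "h v = h w" using w(2) unfolding box_graph_def by metis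
 then obtain n :: int where n: "w = v + of_int n" by (rule jordan_loop_eqE[OF c2loopD(1)[OF c]])
 have "arclen h u v <= e/2 | arclen h v (u+1) <= e/2"
 proof (cases "n >= 0")
  case True
  hence "arclen h u v <= arclen h u w" using n by (simp add: arclen_le_iff[OF c])
  thus ?thesis using w(1) by linarith
 next
  case False
  hence "w <= v - 1" using n by simp
  hence "arclen h u w <= arclen h u (v-1)" by (simp add: arclen_le_iff[OF c])
  moreover have "arclen h (v-1) u = arclen h v (u+1)" using arclen_shift[OF c, of "v-1" 1 u] by simp
  ultimately show ?thesis using w(1) arclen_commute[OF c, of "v-1" u] by linarith
 qed
 hence "M*arclen h u v <= M*(e/2) | M*arclen h v (u+1) <= M*(e/2)" using M by simp
 thus False using long e(2) by linarith
qed

lemma flows_admissible: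
 assumes c: "c2loop h" and k: "!!u. abs (curv1 h u) <= M" and M: "M > 0"
 obtains eta where "eta > 0" "!!l C tau A gam. is_flow A gam {0..tau} ==> (!!theta. A (theta+pi/2) = A theta) ==> l > 0
  ==> (!!theta. l <= A theta & A theta <= 1) ==> (!!theta theta'. abs (A theta - A theta') <= C*abs (theta-theta'))
  ==> (!!t u. t : {0..tau} ==> abs (curv gam t u) <= M) ==> range (slice gam 0) = range h
  ==> admissible_flow l C M eta tau A gam"
proof -
 obtain eta where eta: "eta > 0" "noncollapsed M eta h" by (rule c2loop_noncollapsed[OF c])
 define e where "e = min (1/(1000*M)) (eta/8)"
 have e: "e > 0" "8*e <= eta" "1000*M*e <= 1" using M eta(1) by (auto simp: e_def field_simps min_def)
 show thesis
 proof (rule that[of "e/4"])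
  fix l C tau A gam
  assume fl: "is_flow A gam {0..tau}" and per: "!!theta. A (theta+pi/2) = A theta" and l: "l > 0" and A: "!!theta. l <= A theta & A theta <= 1"
   and lip: "!!theta theta'. abs (A theta - A theta') <= C*abs (theta-theta')" and kg: "!!t u. t : {0..tau} ==> abs (curv gam t u) <= M"
   and R: "range (slice gam 0) = range h"
  have A0: "A theta >= 0" for theta using A[of theta] l by linarith
  have "hugs_tangents M (e/4) (slice gam t)" if t: "t : {0..tau}" for t
  proof (rule noncollapsed_imp_hugs_tangents[OF is_flow_c2loop[OF fl t]])
   show "abs (curv1 (slice gam t) u) <= M" for u using kg[OF t] by (simp add: curv_def)
   have z: "0 : {0..tau}" using t by auto
   note g = is_flow_c2loop[OF fl z] kg[OF z, unfolded curv_def]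
   show "noncollapsed M (e/4) (slice gam t)"
   proof (rule flow_noncollapsed[OF fl per A0 kg M _ _ t])
    show "2*M*(e/4) <= 1" using e(3) by simp
    show "e/4 <= cmod (gam v 0 - gam u 0)" if "0 <= arc_margin M gam (u,v,0)" for u v
     using hugs_tangents_chord_lower_bound[OF g hugs_tangents_same_range[OF c noncollapsed_imp_hugs_tangents[OF c k eta(2)] eta(1) g(1) R] M e(1,3,2), of u v] that by (simp add: slice_def arc_margin_def)
   qed
  qed
  thus "admissible_flow l C M (e/4) tau A gam" unfolding admissible_flow_def using fl per A lip kg by blast
 qed (use e in simp)
qed

lemma periodic_jointly_bounded:
 fixes F :: "real => real => 'a :: real_normed_vector"
 assumes c: "continuous_on (UNIV \<times> W) (%(u,t). F u t)" and W: "compact W" and per: "!!u t. t : W ==> F (u+1) t = F u t"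
 obtains m where "m > 0" "!!u t. t : W ==> norm (F u t) <= m"
proof -
 have "compact ((%(u,t). F u t) ` ({0..1} \<times> W))" by (intro compact_continuous_image compact_Times W continuous_on_subset[OF c]) auto
 then obtain m where m: "m > 0" "!!x. x : {0..1} \<times> W ==> norm (case x of (u,t) => F u t) <= m"
  using compact_imp_bounded bounded_pos by (metis imageI)
 have "norm (F u t) <= m" if t: "t : W" for u t
  using m(2)[of "(frac u,t)"] periodic_frac[of "%u. F u t" u, OF per[OF t]] t frac_lt_1[of u] by simp
 thus thesis using that m(1) by blast
qed

lemma periodic_uniformly_continuous:
 fixes F :: "real => real => 'a :: real_normed_vector"
 assumes c: "continuous_on (UNIV \<times> W) (%(u,t). F u t)" and W: "compact W" and per: "!!u t. t : W ==> F (u+1) t = F u t"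
  and e: "e > 0"
 obtains d where "d > 0" "!!u x t. t : W ==> abs (x-u) < d ==> norm (F x t - F u t) <= e"
proof -
 have "uniformly_continuous_on ({-1..2} \<times> W) (%(u,t). F u t)"
  by (rule compact_uniformly_continuous) (auto intro!: compact_Times W continuous_on_subset[OF c])
 then obtain d where d: "d > 0" "!!x y. x : {-1..2} \<times> W ==> y : {-1..2} \<times> W ==> dist y x < d
   ==> dist (case y of (u,t) => F u t) (case x of (u,t) => F u t) < e"
  unfolding uniformly_continuous_on_def using e by metis
 have "norm (F x t - F u t) <= e" if t: "t : W" and x: "abs (x-u) < min d 1" for u x t
 proof -
  define n where "n = -\<lfloor>u\<rfloor>"
  have "0 <= u + of_int n" "u + of_int n <= 1" unfolding n_def by linarith+
  hence "norm (F (x + of_int n) t - F (u + of_int n) t) < e"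
   using d(2)[of "(u + of_int n,t)" "(x + of_int n,t)"] t x by (auto simp: dist_norm abs_less_iff)
  thus ?thesis using periodic_int[of "%u. F u t", OF per[OF t]] by simp
 qed
 thus thesis using that[of "min d 1"] d(1) by auto
qed

lemma continuous_on_compact_image:
 fixes Phi :: "'a :: metric_space => 'b :: metric_space" and kappa :: "'b => 'c :: topological_space"
 assumes K: "compact K" and Phi: "continuous_on K Phi" and kappa: "continuous_on K (kappa \<circ> Phi)"
 shows "continuous_on (Phi ` K) kappa"
proof (subst continuous_on_closed_vimage[OF compact_imp_closed[OF compact_continuous_image[OF Phi K]]], intro allI impI)
 fix B :: "'c set" assume "closed B"
 hence "compact ((kappa \<circ> Phi) -` B \<inter> K)"
  using continuous_on_closed_vimage[OF compact_imp_closed[OF K]] kappa K by (metis compact_Int_closed inf.absorb_iff2 inf_le2)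
 hence "compact (Phi ` ((kappa \<circ> Phi) -` B \<inter> K))" by (intro compact_continuous_image continuous_on_subset[OF Phi]) auto
 moreover have "kappa -` B \<inter> Phi ` K = Phi ` ((kappa \<circ> Phi) -` B \<inter> K)" by auto
 ultimately show "closed (kappa -` B \<inter> Phi ` K)" by (simp add: compact_imp_closed)
qed

lemma flow_curv_continuous:
 assumes fl: "is_flow A gam I"
 shows "continuous_on (UNIV \<times> I) (%(u,t). curv gam t u)"
proof -
 note c = is_flow_continuous[OF fl subset_refl, unfolded case_prod_beta]
 have "d1 (slice gam t) u ~= 0" if "t : I" for t u using c2loopD(4)[OF is_flow_c2loop[OF fl that]] .
 thus ?thesis unfolding curv_def curv1_def case_prod_beta by (intro continuous_intros c) auto
qed

lemma flow_curv_periodic: "is_flow A gam I ==> t : I ==> curv gam t (u+1) = curv gam t u"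
 unfolding curv_def by (rule c2loop_periodic(3)[OF is_flow_c2loop])

lemma flow_curv_bounded:
 assumes fl: "is_flow A gam {0..tau}"
 obtains M where "M > 0" "!!t u. t : {0..tau} ==> abs (curv gam t u) <= M"
proof -
 obtain M where "M > 0" "!!u t. t : {0..tau} ==> norm (curv gam t u) <= M"
  by (rule periodic_jointly_bounded[OF flow_curv_continuous[OF fl] compact_Icc flow_curv_periodic[OF fl]]) blast+
 thus thesis using that[of M] by simp
qed

lemma flow_curv_pt:
 assumes fl: "is_flow A gam I" and t: "t : I"
 shows "curv_pt gam t (gam u t) = curv gam t u"
proof -
 note c = is_flow_c2loop[OF fl t]
 define w where "w = (SOME w. w : {0..<1} & gam w t = gam u t)"
 have fr: "gam (frac u) t = gam u t" using periodic_frac[of "slice gam t" u, OF c2loopD(6)[OF c]] by (simp add: slice_def)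
 have "w : {0..<1} & gam w t = gam u t" unfolding w_def by (rule someI[of _ "frac u"]) (simp add: frac_lt_1 fr)
 hence "slice gam t w = slice gam t u" by (simp add: slice_def)
 hence "curv1 (slice gam t) w = curv1 (slice gam t) u" by (rule periodic_jordan_eq[OF c2loopD(1)[OF c]]) (rule c2loop_periodic(3)[OF c])
 thus ?thesis unfolding curv_pt_def w_def[symmetric] by (simp add: curv_def)
qed

lemma flow_curvature_equicontinuous:
 assumes fl: "is_flow A gam {0..tau}" and e: "e > 0"
 obtains d where "d > 0" "!!t t' p p'. t : {0..tau} ==> t' : {0..tau} ==> p : range (slice gam t) ==> p' : range (slice gam t')
  ==> abs (t-t') <= d ==> cmod (p-p') <= d ==> abs (curv_pt gam t p - curv_pt gam t' p') <= e"
proof -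
 define K where "K = {0..1 :: real} \<times> {0..tau}"
 define Phi where "Phi x = (snd x, gam (fst x) (snd x))" for x
 define kappa where "kappa y = curv_pt gam (fst y) (snd y)" for y
 have K: "compact K" unfolding K_def by (intro compact_Times compact_Icc)
 have sub: "K <= UNIV \<times> {0..tau}" by (auto simp: K_def)
 note c = flow_curv_continuous[OF fl, THEN continuous_on_subset, OF sub]
  is_flow_continuous(1)[OF fl subset_refl, THEN continuous_on_subset, OF sub]
 have Phi: "continuous_on K Phi" unfolding Phi_def using c(2) by (intro continuous_intros) (simp add: case_prod_beta)
 have "continuous_on K (kappa \<circ> Phi)" by (rule continuous_on_eq[OF c(1)]) (auto simp: K_def kappa_def Phi_def flow_curv_pt[OF fl])
 from continuous_on_compact_image[OF K Phi this]
 have "uniformly_continuous_on (Phi ` K) kappa" by (rule compact_uniformly_continuous[OF _ compact_continuous_image[OF Phi K]])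
 then obtain d where d: "d > 0" "!!y y'. y : Phi ` K ==> y' : Phi ` K ==> dist y' y < d ==> dist (kappa y') (kappa y) < e"
  unfolding uniformly_continuous_on_def using e by metis
 have mem: "(t,p) : Phi ` K" if t: "t : {0..tau}" and p: "p : range (slice gam t)" for t p
 proof -
  obtain u where "u : {0..1}" "p = gam u t"
   using p unfolding periodic_range[of "slice gam t", OF c2loopD(6)[OF is_flow_c2loop[OF fl t]]] by (auto simp: slice_def)
  thus ?thesis using t by (intro image_eqI[of _ _ "(u,t)"]) (auto simp: K_def Phi_def)
 qed
 show thesis
 proof (rule that[of "d/4"])
  fix t t' p p' assume m: "t : {0..tau}" "t' : {0..tau}" "p : range (slice gam t)" "p' : range (slice gam t')"
   and n: "abs (t-t') <= d/4" "cmod (p-p') <= d/4"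
  have "dist (t,p) (t',p') < d" using sqrt_sum_squares_le_sum_abs[of "t-t'" "cmod (p-p')"] unfolding dist_Pair_Pair
   using n d(1) by (simp add: dist_norm)
  from d(2)[OF mem[OF m(2,4)] mem[OF m(1,3)] this]
  show "abs (curv_pt gam t p - curv_pt gam t' p') <= e" by (simp add: kappa_def dist_real_def)
 qed (use d(1) in simp)
qed

lemma flow_unique:
 assumes g: "is_flow anis g {0..tau}" and h: "is_flow anis h {0..tau}" and C: "C >= 0"
  "!!theta theta'. abs (anis theta - anis theta') <= C*abs (theta-theta')"
  and R: "range (slice g 0) = range (slice h 0)" and t: "t : {0..tau}"
 shows "range (slice g t) = range (slice h t)"
proof -
 have z: "0 : {0..tau}" using t by auto
 obtain M1 where M1: "M1 > 0" "!!t u. t : {0..tau} ==> abs (curv g t u) <= M1" by (rule flow_curv_bounded[OF g]) blast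
 obtain M2 where M2: "M2 > 0" "!!t u. t : {0..tau} ==> abs (curv h t u) <= M2" by (rule flow_curv_bounded[OF h]) blast
 define M where "M = max M1 M2"
 have M: "M > 0" "!!t u. t : {0..tau} ==> abs (curv g t u) <= M" "!!t u. t : {0..tau} ==> abs (curv h t u) <= M"
  using M1 M2 by (auto simp: M_def le_max_iff_disj)
 have ab: "1/4 <= anis theta & anis theta <= 1" for theta using anis_bounds[of theta] by linarith
 obtain eta where eta: "eta > 0" "!!gam. is_flow anis gam {0..tau} ==> (!!t u. t : {0..tau} ==> abs (curv gam t u) <= M)
   ==> range (slice gam 0) = range (slice g 0) ==> admissible_flow (1/4) C M eta tau anis gam"
  by (rule flows_admissible[OF is_flow_c2loop[OF g z] M(2)[OF z, unfolded curv_def] M(1)])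
   (use anis_bounds(3) ab C(2) in auto)
 note g' = eta(2)[OF g M(2) refl] and h' = eta(2)[OF h M(3) R[symmetric]]
 show ?thesis using flow_range_unique[OF _ C(1) M(1) eta(1) g' h' _ t] flow_range_unique[OF _ C(1) M(1) eta(1) h' g' _ t] R by auto
qed

lemma is_flow_rescale:
 assumes fl: "is_flow A gam I" and q: "q > 0" and J: "!!t. t : J ==> q*t : I"
 shows "is_flow (%theta. q*A theta) (%u t. gam u (q*t)) J"
 unfolding is_flow_def
proof (intro conjI ballI impI allI)
 have sl: "slice (%u t. gam u (q*t)) t = slice gam (q*t)" for t by (simp add: slice_def)
 { fix t assume "t : J"
  thus "jordan_loop (slice (%u t. gam u (q*t)) t)" "ccw (slice (%u t. gam u (q*t)) t)"
   "slice (%u t. gam u (q*t)) t differentiable at u" "d1 (slice (%u t. gam u (q*t)) t) differentiable at u"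
   "d1 (slice (%u t. gam u (q*t)) t) u ~= 0" for u
   using fl J unfolding sl is_flow_def by blast+ }
 have comp: "continuous_on (UNIV \<times> J) (%(u,t). F u (q*t))"
  if F: "continuous_on (UNIV \<times> I) (%(u,t). F u t)" for F :: "real => real => complex"
 proof -
  have "continuous_on (UNIV \<times> J) (%y. (%(u,t). F u t) (fst y, q * snd y))"
   by (rule continuous_on_compose2[OF F]) (use J in \<open>auto intro!: continuous_intros\<close>)
  thus ?thesis by (simp add: case_prod_beta)
 qed
 show "continuous_on (UNIV \<times> J) (%(u,t). gam u (q*t))" "continuous_on (UNIV \<times> J) (%(u,t). d1 (slice (%u t. gam u (q*t)) t) u)"
  "continuous_on (UNIV \<times> J) (%(u,t). d2 (slice (%u t. gam u (q*t)) t) u)"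
  unfolding sl using comp[of gam] comp[of "%u t. d1 (slice gam t) u"] comp[of "%u t. d2 (slice gam t) u"]
   is_flow_continuous[OF fl subset_refl] by blast+
 fix t u assume t: "t : J" "t > 0"
 obtain v where v: "curvature_velocity A gam I (q*t) u v" using fl J[OF t(1)] t(2) q unfolding is_flow_def by force
 have "((*) q has_vector_derivative q) (at t within J)" by (simp add: has_real_derivative_iff_has_vector_derivative[symmetric])
 moreover have "(gam u has_vector_derivative v) (at (q*t) within (*) q ` J)"
  using v has_vector_derivative_within_subset[of "gam u" v "q*t" I "(*) q ` J"] J by blast
 ultimately have "((%s. gam u (q * s)) has_vector_derivative q*\<^sub>R v) (at t within J)"
  using vector_diff_chain_within[of "(*) q" q t J "gam u" v] by (simp add: o_def)
 moreover have "Re (cnj (q*\<^sub>R v)*w) = q*Re (cnj v * w)" for w by simp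
 ultimately show "EX v. curvature_velocity (%theta. q*A theta) (%u t. gam u (q*t)) J t u v"
  using v unfolding sl curv_def by (intro exI[of _ "q*\<^sub>R v"]) (simp only: mult.assoc)
qed

lemma ccw_nearby:
 assumes a: "c2loop a" and b: "c2loop b" and z: "z : inside (range b)" and near: "!!u. cmod (a u - b u) < cmod (b u - z)"
 shows "ccw a \<longleftrightarrow> ccw b"
proof -
 have ccw_iff: "ccw g \<longleftrightarrow> winding_number g z = 1" if g: "c2loop g" and "z ~: range g" "winding_number g z ~= 0" for g
  using c2loop_winding(1)[OF g] c2loop_winding(2)[OF g that(2)] that(3) unfolding ccw_def by fastforce
 have zb: "z ~: range b" using z inside_no_overlap[of "range b"] by blast
 have "a u ~= z" for u using near[of u] by (auto simp: norm_minus_commute)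
 hence za: "z ~: range a" by blast
 have "winding_number a z = winding_number b z"
  by (rule winding_number_nearby_loops_eq) (use c2loop_path[OF a] c2loop_path[OF b] near in auto)
 moreover have "winding_number b z ~= 0" using c2loop_winding(1)[OF b] z by force
 ultimately show ?thesis using ccw_iff[OF a za] ccw_iff[OF b zb] by simp
qed

lemma loop_inside_distance:
 assumes b: "c2loop b"
 obtains z d where "z : inside (range b)" "d > 0" "!!u. d <= cmod (b u - z)"
proof -
 obtain z where z: "z : inside (range b)" using c2loop_winding(3)[OF b] by blast
 moreover from this have "z ~: range b" using inside_no_overlap[of "range b"] by blast
 then obtain d where "d > 0" "ALL x : range b. d <= dist z x"
  using separate_point_closed[OF compact_imp_closed[OF c2loop_compact[OF b]]] by blast
 ultimately show thesis using that[of z d] by (auto simp: dist_norm norm_minus_commute)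
qed

lemma continuous_on_swap_args:
 assumes "continuous_on (A \<times> B) (%(u,t). F u t)" "C <= A"
 shows "continuous_on (B \<times> C) (%(t,u). F u t)"
proof -
 have "continuous_on (B \<times> C) (%y. (%(u,t). F u t) (snd y, fst y))"
  by (rule continuous_on_compose2[OF assms(1)]) (use assms(2) in \<open>auto intro!: continuous_intros\<close>)
 thus ?thesis by (simp add: case_prod_beta)
qed

lemma ccw_constant_in_time:
 assumes c: "!!t. t : W ==> c2loop (slice gam t)" and g: "continuous_on (UNIV \<times> W) (%(u,t). gam u t)" and W: "connected W"
  and t0: "t0 : W" "ccw (slice gam t0)" and t: "t : W"
 shows "ccw (slice gam t)"
proof (rule connected_induction_simple[OF W t0(1) t, of "%t. ccw (slice gam t)"])
 fix a assume a: "a : W"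
 obtain z d where z: "z : inside (range (slice gam a))" "d > 0" "!!u. d <= cmod (slice gam a u - z)"
  by (rule loop_inside_distance[OF c[OF a]]) blast
 obtain T where T: "a : T" "open T" "ALL t : T \<inter> W. ALL u : {0..1}. dist (gam u t) (gam u a) <= d/2"
  using continuous_on_prod_compactE[OF continuous_on_swap_args[OF g, of "{0..1}"] compact_Icc a, of "d/2"] z(2) by auto
 have eq: "ccw (slice gam s) \<longleftrightarrow> ccw (slice gam a)" if s: "s : W \<inter> T" for s
 proof (rule ccw_nearby[OF c c[OF a] z(1)])
  fix u
  have "slice gam s u = gam (frac u) s" "slice gam a u = gam (frac u) a"
   using periodic_frac[of "slice gam s" u, OF c2loopD(6)[OF c]] periodic_frac[of "slice gam a" u, OF c2loopD(6)[OF c]] s a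
   by (auto simp: slice_def)
  moreover have "frac u : {0..1}" using frac_lt_1[of u] by simp
  hence "dist (gam (frac u) s) (gam (frac u) a) <= d/2" using T(3) s by blast
  ultimately show "cmod (slice gam s u - slice gam a u) < cmod (slice gam a u - z)" using z(2) z(3)[of u] by (simp add: dist_norm)
 qed (use s in auto)
 show "EX T. openin (top_of_set W) T & a : T & (ALL x : T. ALL y : T. ccw (slice gam x) --> ccw (slice gam y))"
 proof (intro exI[of _ "W \<inter> T"] conjI ballI impI)
  show "openin (top_of_set W) (W \<inter> T)" by (rule openin_open_Int[OF T(2)])
  show "ccw (slice gam y)" if "x : W \<inter> T" "y : W \<inter> T" "ccw (slice gam x)" for x y
   using eq[OF that(1)] eq[OF that(2)] that(3) by simp
 qed (use T(1) a in auto)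
qed (rule t0(2))

lemma area_pos:
 assumes c: "c2loop c" shows "enclosed_area c > 0"
proof -
 note comp = c2loop_compact[OF c]
 have o: "open (inside (range c))" by (rule open_inside[OF compact_imp_closed[OF comp]])
 have "inside (range c) : lmeasurable" by (rule lmeasurable_open[OF bounded_inside[OF compact_imp_bounded[OF comp]] o])
 moreover have "~negligible (inside (range c))" by (rule open_not_negligible[OF o c2loop_winding(3)[OF c]])
 ultimately show ?thesis by (auto simp: negligible_iff_measure less_le)
qed

lemma cmod_eq_of_orthogonal:
 assumes ort: "Re (cnj d * v) = 0" and pos: "Re (cnj d*T) > 0"
 shows "cmod v = cmod d*abs (Im (cnj T * v))/Re (cnj d*T)"
proof -
 define s where "s = Im (cnj d * v)"
 have d: "cmod d > 0" using pos by auto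
 have dv: "cnj d * v = \<i> * of_real s" unfolding s_def using ort by (auto simp: complex_eq_iff)
 hence s: "abs s = cmod d*cmod v" by (metis complex_mod_cnj mult_1 norm_ii norm_mult norm_of_real)
 have "of_real ((cmod d)^2)*(cnj T * v) = (cnj T*d)*(cnj d * v)" unfolding complex_norm_square by simp
 also have "... = of_real s*(\<i>*(cnj T*d))" unfolding dv by simp
 finally have eq: "of_real ((cmod d)^2)*(cnj T * v) = of_real s*(\<i>*(cnj T*d))" .
 have "(cmod d)^2*Im (cnj T * v) = s*Re (cnj d*T)" using arg_cong[OF eq, of Im] by simp
 hence "(cmod d)^2*abs (Im (cnj T * v)) = cmod d*cmod v * Re (cnj d*T)" unfolding s[symmetric]
  using pos by (metis abs_mult abs_of_pos abs_power2)
 thus ?thesis using d pos by (simp add: power2_eq_square)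
qed

context transversal_fibration
begin

lemma gam_velocity_orthogonal:
 assumes stationary: "!!s. s : W ==> D u s = D u t" "!!s. s : W ==> base s u = base t u" and t: "t : W" "at t within W ~= bot"
  and v: "(gam u has_vector_derivative v) (at t within W)"
 shows "Re (cnj (D u t) * v) = 0"
proof (rule has_field_derivative_unique[OF _ _ t(2)])
 show "((%s. Re (cnj (D u t)*(gam u s - base t u))) has_field_derivative Re (cnj (D u t) * v)) (at t within W)"
  by (rule derivative_eq_intros v refl | simp)+
 show "((%s. Re (cnj (D u t)*(gam u s - base t u))) has_field_derivative 0) (at t within W)"
 proof (rule has_field_derivative_transform_within[OF DERIV_const[of 0] zero_less_one t(1)])
  show "0 = Re (cnj (D u t)*(gam u s - base t u))" if "s : W" for s
   using gam_props(3)[OF that, of u] stationary(1)[OF that] stationary(2)[OF that] by simp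
 qed
qed

text \<open>With stationary fibres the velocity points along the fibres, so its size is determined by the normal velocity.\<close>
lemma gam_time_lipschitz:
 assumes stationary: "!!u s t. s : W ==> t : W ==> D u s = D u t" "!!u s t. s : W ==> t : W ==> base s u = base t u"
  and W: "compact W" "convex W" "!!t. t : W ==> t > 0" and nt: "!!t. t : W ==> at t within W ~= bot"
 obtains K where "!!u t t'. t : W ==> t' : W ==> cmod (gam u t - gam u t') <= K*abs (t-t')"
proof -
 define F where "F u t = cmod (D u t)*curv gam t u*cmod (d1 (slice gam t) u)/Re (cnj (D u t)*d1 (slice gam t) u)" for u t
 note c = gam_derivatives_continuous[unfolded case_prod_beta] D_continuous(1)[unfolded case_prod_beta]
 have nz: "ALL y : UNIV \<times> W. Re (cnj (D (fst y) (snd y))*d1 (slice gam (snd y)) (fst y)) ~= 0"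
  "ALL y : UNIV \<times> W. cmod (d1 (slice gam (snd y)) (fst y))^3 ~= 0"
  using gam_transversal less_irrefl gam_derivatives(3) by (metis mem_Times_iff, auto)
 have "continuous_on (UNIV \<times> W) (%(u,t). F u t)" unfolding F_def curv_def curv1_def case_prod_beta by (intro continuous_intros c nz)
 moreover have "F (u+1) t = F u t" if "t : W" for u t
  unfolding F_def curv_def using c2loop_periodic(1,3)[OF gam_c2loop[OF that]] D_periodic[OF that] by simp
 ultimately obtain K where K: "K > 0" "!!u t. t : W ==> norm (F u t) <= K" using periodic_jointly_bounded[of W F] W(1) by blast
 define v where "v u t = (SOME v. curvature_velocity anis gam W t u v)" for u t
 have v: "curvature_velocity anis gam W t u (v u t)" if t: "t : W" for u t unfolding v_def
 proof (rule someI_ex, rule gam_derivatives(4)[OF t W(3)[OF t]])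
  show "((%s. base s u) has_vector_derivative 0) (at t within W)"
   by (rule has_vector_derivative_transform[OF t stationary(2)[OF _ t] has_vector_derivative_const])
  show "((%s. D u s) has_vector_derivative 0) (at t within W)"
   by (rule has_vector_derivative_transform[OF t stationary(1)[OF _ t] has_vector_derivative_const])
 qed
 have speed: "cmod (v u t) <= K" if t: "t : W" for u t
 proof -
  define g where "g = d1 (slice gam t) u"
  have pos: "Re (cnj (D u t)*g) > 0" unfolding g_def by (rule gam_transversal[OF t])
  have "Re (cnj (v u t)*(\<i>*g/of_real (cmod g))) = Im (cnj g * v u t)/cmod g" by simp
  with conjunct2[OF v[OF t, of u]] have "Im (cnj g * v u t)/cmod g = anis (Arg g)*curv gam t u" unfolding g_def by (rule subst[rotated])
  hence "Im (cnj g * v u t) = anis (Arg g)*(curv gam t u*cmod g)" using gam_derivatives(3)[OF t] by (simp add: divide_eq_eq g_def)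
  hence "cmod (v u t) = anis (Arg g)*abs (F u t)"
   using cmod_eq_of_orthogonal[OF gam_velocity_orthogonal[OF stationary(1)[OF _ t] stationary(2)[OF _ t] t nt[OF t], of u] pos] v[OF t]
    pos anis_bounds(1)[of "Arg g"] unfolding F_def g_def[symmetric] by (simp add: abs_mult)
  also have "... <= 1*K" using K(2)[OF t, of u] anis_bounds(1,2)[of "Arg g"] by (intro mult_mono) auto
  finally show ?thesis by simp
 qed
 have "norm (gam u t - gam u t') <= K*norm (t-t')" if t: "t : W" "t' : W" for u t t'
 proof (rule differentiable_bound[OF W(2) _ _ t])
  show "(gam u has_derivative (%h. h*\<^sub>R v u x)) (at x within W)" if "x : W" for x
   using v[OF that, of u] by (simp add: has_vector_derivative_def)
  show "onorm (%h. h*\<^sub>R v u x) <= K" if "x : W" for x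
  proof (rule onorm_le)
   show "norm (h*\<^sub>R v u x) <= K*norm h" for h using mult_right_mono[OF speed[OF that, of u], of "abs h"] by (simp add: mult.commute)
  qed
 qed
 thus thesis using that[of K] by simp
qed

end

definition central_difference :: "real => (real => complex) => real => complex" where
 "central_difference e f u = (f (u+e) - f (u-e))/of_real (2*e)"

lemma central_difference_derivative:
 assumes "!!u. (f has_vector_derivative f' u) (at u)"
 shows "(central_difference e f has_vector_derivative central_difference e f' u) (at u)"
 unfolding central_difference_def[abs_def] diff_conv_add_uminus[of _ e]
 by (intro has_vector_derivative_divide has_vector_derivative_diff has_vector_derivative_shift assms)

lemma central_difference_error:
 assumes f: "!!x. (f has_vector_derivative f' x) (at x)" and e: "e > 0" and b: "!!x. abs (x-u) <= e ==> cmod (f' x - f' u) <= d"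
 shows "cmod (central_difference e f u - f' u) <= d"
proof -
 define g where "g x = f x - x*\<^sub>R f' u" for x
 have "cmod (g (u+e) - g (u-e)) <= d*(u+e) - d*(u-e)"
 proof (rule norm_diff_le_of_derivative_bound)
  show "(g has_vector_derivative f' x - f' u) (at x)" for x unfolding g_def by (rule derivative_eq_intros f refl | simp)+
  show "DERIV (%x. d*x) x :> d" for x by simp
 qed (use e b in auto)
 moreover have "g (u+e) - g (u-e) = of_real (2*e)*(central_difference e f u - f' u)"
  using e unfolding g_def central_difference_def by (simp add: scaleR_conv_of_real field_simps)
 hence "cmod (g (u+e) - g (u-e)) = 2*e*cmod (central_difference e f u - f' u)" using e by (simp only: norm_mult norm_of_real)
 moreover have "d*(u+e) - d*(u-e) = 2*e*d" by (simp add: algebra_simps)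
 ultimately show ?thesis using e by simp
qed

lemma Im_cnj_mult_perturbation:
 assumes a: "cmod (a'-a) <= e" and b: "cmod (b'-b) <= e" and e: "e <= 1" and bounds: "cmod a <= S" "cmod b <= S'"
 shows "abs (Im (cnj a'*b') - Im (cnj a*b)) <= e*(S+S'+1)"
proof -
 have "cnj a'*b' - cnj a*b = cnj (a'-a)*b' + cnj a*(b'-b)" by (simp add: algebra_simps)
 hence "cmod (cnj a'*b' - cnj a*b) <= cmod (a'-a)*cmod b' + cmod a*cmod (b'-b)"
  using norm_triangle_ineq[of "cnj (a'-a)*b'" "cnj a*(b'-b)"] by (simp add: norm_mult flip: complex_cnj_diff)
 also have "cmod b' <= S' + 1" using norm_triangle_ineq[of "b'-b" b] b e bounds by simp
 hence "cmod (a'-a)*cmod b' + cmod a*cmod (b'-b) <= e*(S'+1) + S*e"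
  using a b bounds order_trans[OF norm_ge_zero a] order_trans[OF norm_ge_zero bounds(1)] by (intro add_mono mult_mono) auto
 finally show ?thesis using abs_Im_le_cmod[of "cnj a'*b' - cnj a*b"] by (simp add: algebra_simps)
qed

context approximating_flows
begin

definition transversal_step :: "nat => real => bool" where
 "transversal_step N e \<longleftrightarrow> e > 0 & (ALL t : {0..tau}. ALL u.
  cmod (central_difference e (curve N t) u - d1 (curve N t) u) <= cmod (d1 (curve N t) u)/100
  & abs (Im (cnj (central_difference e (curve N t) u)*central_difference e (d1 (curve N t)) u)) <= 2*M*(cmod (d1 (curve N t) u))^3)"

lemma transversal_step_exists: obtains e where "transversal_step N e"
proof -
 note c = is_flow_continuous(2,3)[OF admissible_flowD(1)[OF flows, of N] subset_refl]
 note cl = admissible_flowD(7)[OF flows, of _ N] and per = c2loop_periodic[OF admissible_flowD(7)[OF flows, of _ N]]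
 obtain S1 where S1: "S1 > 0" "!!u t. t : {0..tau} ==> cmod (d1 (curve N t) u) <= S1"
  by (rule periodic_jointly_bounded[OF c(1) compact_Icc per(1)]) blast+
 obtain S2 where S2: "S2 > 0" "!!u t. t : {0..tau} ==> cmod (d2 (curve N t) u) <= S2"
  by (rule periodic_jointly_bounded[OF c(2) compact_Icc per(2)]) blast+
 have "continuous_on (UNIV \<times> {0..tau}) (%(u,t). inverse (d1 (curve N t) u))"
  using c(1) c2loopD(4)[OF cl] unfolding case_prod_beta by (intro continuous_intros) auto
 then obtain S3 where S3: "S3 > 0" "!!u t. t : {0..tau} ==> cmod (inverse (d1 (curve N t) u)) <= S3"
  using periodic_jointly_bounded[OF _ compact_Icc, of 0 tau "%u t. inverse (d1 (curve N t) u)"] per(1) by metis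
 define mu where "mu = 1/S3"
 have mu: "mu > 0" "mu <= cmod (d1 (curve N t) u)" if "t : {0..tau}" for u t
  using S3(1) S3(2)[OF that, of u, unfolded norm_inverse] c2loopD(10)[OF cl[OF that], of u] by (simp_all add: mu_def field_simps)
 define eps where "eps = min (min 1 (mu/100)) (M*mu^3/(S1+S2+1))"
 have "eps > 0" using S3(1) S1(1) S2(1) M by (simp add: mu_def eps_def)
 moreover have "eps <= min 1 (mu/100)" "eps <= M*mu^3/(S1+S2+1)" unfolding eps_def by (rule min.cobounded1, rule min.cobounded2)
 ultimately have eps: "eps > 0" "eps <= 1" "eps <= mu/100" and "eps <= M*mu^3/(S1+S2+1)" by simp_all
 hence eps': "eps*(S1+S2+1) <= M*mu^3" using S1(1) S2(1) by (simp add: pos_le_divide_eq)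
 obtain e1 where e1: "e1 > 0" "!!u x t. t : {0..tau} ==> abs (x-u) < e1 ==> cmod (d1 (curve N t) x - d1 (curve N t) u) <= eps"
  by (rule periodic_uniformly_continuous[OF c(1) compact_Icc per(1) eps(1)]) blast+
 obtain e2 where e2: "e2 > 0" "!!u x t. t : {0..tau} ==> abs (x-u) < e2 ==> cmod (d2 (curve N t) x - d2 (curve N t) u) <= eps"
  by (rule periodic_uniformly_continuous[OF c(2) compact_Icc per(2) eps(1)]) blast+
 define e where "e = min e1 e2/2"
 have e: "e > 0" "e < e1" "e < e2" using e1(1) e2(1) by (auto simp: e_def)
 have "transversal_step N e" unfolding transversal_step_def
 proof (intro conjI ballI allI e(1))
  fix u t assume t: "t : {0..tau}"
  define E E1 f1 f2 where "E = central_difference e (curve N t) u" and "E1 = central_difference e (d1 (curve N t)) u"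
   and "f1 = d1 (curve N t) u" and "f2 = d2 (curve N t) u"
  have err: "cmod (E - f1) <= eps" "cmod (E1 - f2) <= eps" unfolding E_def E1_def f1_def f2_def
   by (rule central_difference_error[OF c2loopD(2)[OF cl[OF t]] e(1) e1(2)[OF t le_less_trans[OF _ e(2)]]], assumption)
    (rule central_difference_error[OF c2loopD(3)[OF cl[OF t]] e(1) e2(2)[OF t le_less_trans[OF _ e(3)]]])
  show "cmod (central_difference e (curve N t) u - d1 (curve N t) u) <= cmod (d1 (curve N t) u)/100"
   using err(1) eps(3) mu(2)[OF t, of u] unfolding E_def f1_def by linarith
  have k: "abs (Im (cnj f1*f2)) <= M*(cmod f1)^3"
   using admissible_flowD(5)[OF flows t, of N u] c2loopD(10)[OF cl[OF t], of u] unfolding f1_def f2_def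
   by (simp add: curv1_def pos_divide_le_eq)
  have "abs (Im (cnj E*E1) - Im (cnj f1*f2)) <= eps*(S1+S2+1)"
   unfolding f1_def f2_def by (rule Im_cnj_mult_perturbation[OF err[unfolded f1_def f2_def] eps(2) S1(2)[OF t] S2(2)[OF t]])
  also have "... <= M*mu^3" by (rule eps')
  also have "... <= M*(cmod f1)^3" using mu[OF t] M unfolding f1_def by (intro mult_left_mono) auto
  finally have "abs (Im (cnj E*E1) - Im (cnj f1*f2)) <= M*(cmod f1)^3" .
  thus "abs (Im (cnj (central_difference e (curve N t) u)*central_difference e (d1 (curve N t)) u)) <= 2*M*(cmod (d1 (curve N t) u))^3"
   using k unfolding E_def[symmetric] E1_def[symmetric] f1_def[symmetric] by linarith
 qed
 thus thesis by (rule that)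
qed

context
 fixes N :: nat and e :: real
 assumes e: "transversal_step N e"
begin

lemma central_fibration:
 assumes W: "W <= {0..tau}" and sig: "continuous_on W sig" "!!t. t : W ==> sig t : {0..tau}" "!!t. t : W ==> abs (sig t - t) <= delta/2"
 shows "transversal_fibration P A l C M eta tau L0 r delta N sig W (%u t. central_difference e (curve N (sig t)) u)
  (%u t. central_difference e (d1 (curve N (sig t))) u) (%u t. central_difference e (d2 (curve N (sig t))) u)"
proof (intro transversal_fibration.intro approximating_flows_axioms transversal_fibration_axioms.intro W sig)
 note fl = admissible_flowD(1)[OF flows, of N] and cl = admissible_flowD(7)[OF flows sig(2), of _ N]
 show "(central_difference e (curve N (sig t)) has_vector_derivative central_difference e (d1 (curve N (sig t))) u) (at u)" if "t : W" for u t
  using central_difference_derivative[of "curve N (sig t)"] c2loopD(2)[OF cl[OF that]] by blast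
 show "(central_difference e (d1 (curve N (sig t))) has_vector_derivative central_difference e (d2 (curve N (sig t))) u) (at u)"
  if "t : W" for u t
  using central_difference_derivative[of "d1 (curve N (sig t))"] c2loopD(3)[OF cl[OF that]] by blast
 have cont: "continuous_on (UNIV \<times> W) (%(u,t). central_difference e (h (sig t)) u)"
  if h: "continuous_on (UNIV \<times> {0..tau}) (%(u,t). h t u)" for h :: "real => real => complex"
 proof -
  have "continuous_on (UNIV \<times> W) (%y. sig (snd y))"
   by (rule continuous_on_compose2[OF sig(1) continuous_on_snd]) (auto intro!: continuous_intros)
  hence "continuous_on (UNIV \<times> W) (%y. (%(u,t). h t u) (fst y + a, sig (snd y)))" for a
   by (intro continuous_on_compose2[OF h]) (use sig(2) in \<open>auto intro!: continuous_intros\<close>)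
  from this[of e] this[of "-e"] show ?thesis
   unfolding central_difference_def case_prod_beta using e by (auto simp: transversal_step_def intro!: continuous_intros)
 qed
 show "continuous_on (UNIV \<times> W) (%(u,t). central_difference e (curve N (sig t)) u)"
  "continuous_on (UNIV \<times> W) (%(u,t). central_difference e (d1 (curve N (sig t))) u)"
  "continuous_on (UNIV \<times> W) (%(u,t). central_difference e (d2 (curve N (sig t))) u)"
  using is_flow_continuous[OF fl subset_refl] by (auto simp: slice_def intro!: cont)
 show "central_difference e (curve N (sig t)) (u+1) = central_difference e (curve N (sig t)) u" if "t : W" for u t
  using c2loopD(6)[OF cl[OF that], of "u+e"] c2loopD(6)[OF cl[OF that], of "u-e"] by (simp add: central_difference_def algebra_simps)
qed (use e sig(2) in \<open>auto simp: transversal_step_def\<close>)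

interpretation a: transversal_fibration P A l C M eta tau L0 r delta N "%t. t" "{0..tau}" "%u t. central_difference e (curve N t) u"
  "%u t. central_difference e (d1 (curve N t)) u" "%u t. central_difference e (d2 (curve N t)) u"
 by (rule central_fibration) (use delta in \<open>auto intro: continuous_intros\<close>)

lemma limit_area_rate:
 assumes ccw: "ccw (slice a.gam t0)" and t0: "0 < t0" "t0 <= tau"
 shows "((%t. measure lebesgue (inside (limit_curve t))) has_field_derivative -2) (at t0 within {0..tau})"
proof -
 define m where "m = min (delta/2) (t0/2)"
 have m: "m > 0" "m <= delta/2" "m <= t0/2" using delta t0 unfolding m_def by auto
 define W where "W = {t0-m..min tau (t0+m)}"
 have W: "W <= {0..tau}" "t0 : W" "!!t. t : W ==> t > 0" "compact W" "convex W" using m t0 by (auto simp: W_def)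

 interpret b: transversal_fibration P A l C M eta tau L0 r delta N "%_. t0" W "%u t. central_difference e (curve N t0) u"
  "%u t. central_difference e (d1 (curve N t0)) u" "%u t. central_difference e (d2 (curve N t0)) u"
 proof (rule central_fibration[OF W(1)])
  show "abs (t0-t) <= delta/2" if "t : W" for t using that m(2) unfolding W_def atLeastAtMost_iff by linarith
 qed (use t0 in auto)
 have nt: "at t within W ~= bot" if "t : W" for t
 proof -
  have "t0 - m : W" "t0 - m ~= t0" using m t0 by (auto simp: W_def)
  hence "t islimpt W" using connected_imp_perfect[OF convex_connected[OF W(5)] that] W(2) by (metis singletonD)
  thus ?thesis by (simp add: trivial_limit_within)
 qed
 have "slice b.gam t0 = slice a.gam t0" unfolding slice_def[of b.gam] slice_def[of a.gam] b.gam_def a.gam_def ..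
 hence ccwb: "ccw (slice b.gam t)" if "t : W" for t
  using ccw_constant_in_time[OF b.gam_c2loop b.gam_continuous convex_connected[OF W(5)] W(2) _ that] ccw by simp
 obtain K where K: "!!u t t'. t : W ==> t' : W ==> cmod (b.gam u t - b.gam u t') <= K*abs (t-t')"
  by (rule b.gam_time_lipschitz[OF refl refl W(4,5,3) nt]) blast+
 obtain m1 where m1: "!!u t. t : W ==> cmod (d1 (slice b.gam t) u) <= m1"
  using periodic_jointly_bounded[OF b.gam_derivatives_continuous(1) W(4)] c2loop_periodic(1)[OF b.gam_c2loop] by metis
 have "((%t. measure lebesgue (inside (range (slice b.gam t)))) has_field_derivative -2) (at t0 within W)"
  by (rule area_has_derivative[OF b.gam_c2loop ccwb W(2) b.gam_derivatives_continuous(1) m1 K[OF _ W(2)]])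
   (use b.gam_derivatives(4)[OF W(2) t0(1) has_vector_derivative_const has_vector_derivative_const] in auto)
 hence "((%t. measure lebesgue (inside (limit_curve t))) has_field_derivative -2) (at t0 within W)"
  by (rule has_field_derivative_transform_within[OF _ zero_less_one W(2)]) (use b.gam_range in \<open>simp add: slice_def\<close>)
 moreover have "at t0 within W = at t0 within {0..tau}"
  by (rule at_within_nhd[of t0 "ball t0 m"]) (use m in \<open>auto simp: W_def dist_real_def\<close>)
 ultimately show ?thesis by simp
qed

lemma limit_area:
 assumes ccw: "!!t. t : {0..tau} ==> ccw (slice a.gam t)" and t: "t : {0..tau}"
 shows "measure lebesgue (inside (limit_curve t)) = measure lebesgue (inside (limit_curve 0)) - 2*t"
proof -
 define a where "a t = measure lebesgue (inside (limit_curve t))" for t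
 have green: "a t = -integral (cbox 0 1) (%u. Re (d1 (slice a.gam t) u)*Im (a.gam u t))" if "t : {0..tau}" for t
  using green_area[OF a.gam_c2loop[OF that] ccw[OF that]] a.gam_range[OF that] by (simp add: a_def slice_def)
 have "continuous_on ({0..tau} \<times> cbox 0 1) (%(t,u). Re (d1 (slice a.gam t) u)*Im (a.gam u t))"
  using continuous_on_swap_args[OF a.gam_derivatives_continuous(1), of "cbox 0 1"]
   continuous_on_swap_args[OF a.gam_continuous, of "cbox 0 1"]
  unfolding case_prod_beta by (auto intro!: continuous_intros)
 hence "continuous_on {0..tau} (%t. -integral (cbox 0 1) (%u. Re (d1 (slice a.gam t) u)*Im (a.gam u t)))"
  by (intro continuous_on_minus integral_continuous_on_param)
 hence "continuous_on {0..tau} a" by (rule continuous_on_eq) (simp add: green)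
 hence "continuous_on {0..tau} (%t. a t + 2*t)" by (intro continuous_intros)
 hence "a t + 2*t = a 0 + 2*0"
 proof (rule DERIV_isconst2[OF tau])
  fix x assume x: "0 < x" "x < tau"
  have "DERIV a x :> -2" using limit_area_rate[OF ccw, of x] x at_within_interior[of x "{0..tau}"] by (simp add: a_def[abs_def])
  from DERIV_add[OF this DERIV_cmult[OF DERIV_ident, of 2]] show "DERIV (%t. a t + 2*t) x :> 0" by simp
 qed (use t in auto)
 thus ?thesis by (simp add: a_def)
qed

lemma limit_flow:
 assumes z: "z : inside (range (curve N 0))" "!!u. r <= cmod (curve N 0 u - z)"
 shows "is_flow anis a.gam {0..tau}" "!!t. t : {0..tau} ==> ccw (slice a.gam t)"
proof -
 have t0: "0 : {0..tau}" using tau by simp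
 note fl = admissible_flowD(1)[OF flows, of N]
 have "ccw (slice a.gam 0)"
 proof (subst ccw_nearby[OF a.gam_c2loop[OF t0] admissible_flowD(7)[OF flows t0] z(1)])
  show "cmod (slice a.gam 0 u - curve N 0 u) < cmod (curve N 0 u - z)" for u
   using a.gam_props(2)[OF t0, of u] z(2)[of u] r(1) unfolding slice_def by simp
  show "ccw (curve N 0)" using fl t0 unfolding is_flow_def by blast
 qed
 thus ccw: "ccw (slice a.gam t)" if "t : {0..tau}" for t
  using ccw_constant_in_time[OF a.gam_c2loop a.gam_continuous connected_Icc t0 _ that] by blast
 have velocity: "EX b. ((%t. curve N t u) has_vector_derivative b) (at t within {0..tau})" if "t : {0..tau}" "t > 0" for u t
  using fl that unfolding is_flow_def slice_def by blast
 show "is_flow anis a.gam {0..tau}"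
 proof (rule a.gam_is_flow[OF ccw velocity])
  fix u t assume t: "t : {0..tau}" "t > 0"
  obtain b c where bc: "((%t. curve N t (u+e)) has_vector_derivative b) (at t within {0..tau})"
   "((%t. curve N t (u-e)) has_vector_derivative c) (at t within {0..tau})" using velocity[OF t] by blast
  show "EX d. ((%t. central_difference e (curve N t) u) has_vector_derivative d) (at t within {0..tau})"
   unfolding central_difference_def by (rule exI, rule has_vector_derivative_divide[OF has_vector_derivative_diff[OF bc]])
 qed
qed

end

lemma limit_curve_initial:
 assumes c: "c2loop c" and R: "!!n. range (curve n 0) = range c"
 shows "limit_curve 0 = range c"
proof (intro equalityI subsetI)
 fix z assume "z : range c"
 hence "EX v. curve n 0 v = z" for n using R by (metis rangeE)
 hence "near_curve 0 (%_. z) (curve n 0)" for n unfolding near_curve_def by (metis diff_self norm_zero order_refl)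
 thus "z : limit_curve 0" unfolding limit_curve_def using near_curve_mono less_imp_le by blast
next
 fix z assume z: "z : limit_curve 0"
 have "EX x : range c. dist x z < d" if "d > 0" for d
 proof -
  obtain n where "ALL m >= n. near_curve (d/2) (%_. z) (curve m 0)" using z half_gt_zero[OF \<open>d > 0\<close>] unfolding limit_curve_def
   by blast
  then obtain v where "cmod (curve n 0 v - z) <= d/2" unfolding near_curve_def by force
  thus ?thesis using R[of n] \<open>d > 0\<close> by (intro bexI[of _ "curve n 0 v"]) (auto simp: dist_norm)
 qed
 hence "z : closure (range c)" by (simp add: closure_approachable)
 thus "z : range c" using compact_imp_closed[OF c2loop_compact[OF c]] by simp
qed

end

lemma gsecond_derivative:
 assumes c: "c2loop c" and f': "!!u. DERIV (%u. Im (cnj (d1 c u)*d2 c u)) u :> f' u"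
  and T: "cmod T = 1" and b: "box_graph p T r c" and x: "abs x < r"
 defines "u \<equiv> gpar p T r c x"
 shows "DERIV (gsecond p T r c) x :> f' u/(Re (cnj T*d1 c u))^4 - 3*Im (cnj (d1 c u)*d2 c u)*Re (cnj T*d2 c u)/(Re (cnj T*d1 c u))^5"
proof -
 define R where "R u = Re (cnj T*d1 c u)" for u
 define f where "f u = Im (cnj (d1 c u)*d2 c u)" for u
 have R: "R u ~= 0" unfolding R_def u_def by (rule box_graph_Re_d1[OF b T c gpar_props(4)[OF b T c less_imp_le[OF x]]])
 have "DERIV R u :> Re (cnj T*d2 c u)"
  using has_vector_derivative_mult_right[OF c2loopD(3)[OF c]] unfolding R_def has_vector_derivative_complex_iff by blast
 from DERIV_power[OF this, of 3] have "DERIV (%u. (R u)^3) u :> 3*(R u)^2*Re (cnj T*d2 c u)" by (simp add: ac_simps)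
 from DERIV_divide[OF f'[folded f_def] this] R
 have "DERIV (%u. f u/(R u)^3) u :> (f' u*(R u)^3 - f u*(3*(R u)^2*Re (cnj T*d2 c u)))/((R u)^3*(R u)^3)" by simp
 from gpar_has_derivative[OF b T c x _ this[unfolded u_def]]
 have "DERIV (gsecond p T r c) x :> (f' u*(R u)^3 - f u*(3*(R u)^2*Re (cnj T*d2 c u)))/((R u)^3*(R u)^3)/R u"
  by (simp add: gsecond_def[abs_def] Let_def f_def R_def u_def c2loop_periodic[OF c])
 moreover have "(f' u*(R u)^3 - f u*(3*(R u)^2*Re (cnj T*d2 c u)))/((R u)^3*(R u)^3)/R u
   = f' u/(R u)^4 - 3*f u*Re (cnj T*d2 c u)/(R u)^5" using R by (simp add: field_simps eval_nat_numeral)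
 ultimately show ?thesis by (simp only: f_def R_def)
qed

lemma gsecond_lipschitz_of_smooth_loop:
 assumes c: "c2loop c" and f': "!!u. DERIV (%u. Im (cnj (d1 c u)*d2 c u)) u :> f' u" and f'c: "continuous_on UNIV f'"
 obtains L0 where "L0 >= 0" "!!p T r x y. cmod T = 1 ==> box_graph p T r c ==> abs x < r ==> abs y < r
  ==> abs (gsecond p T r c x - gsecond p T r c y) <= L0*abs (x-y)"
proof -
 note cd = c2loopD[OF c] and per = c2loop_periodic[OF c]
 define f where "f u = Im (cnj (d1 c u)*d2 c u)" for u
 have f_per: "f (u+1) = f u" for u by (simp add: f_def per)
 have f'_per: "f' (u+1) = f' u" for u
  using DERIV_unique[OF _ f'[folded f_def, of u]] f'[folded f_def, of "u+1"] DERIV_shift[of f "f' (u+1)" u 1] by (simp add: f_per)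
 have "continuous_on UNIV f" unfolding f_def by (intro continuous_intros cd(5,9))
 then obtain F0 where F0: "F0 > 0" "!!u. norm (f u) <= F0" using periodic_bounded f_per by metis
 obtain F1 where F1: "F1 > 0" "!!u. norm (f' u) <= F1" using periodic_bounded[OF f'c f'_per] by metis
 obtain F2 where F2: "F2 > 0" "!!u. cmod (d2 c u) <= F2" using periodic_bounded[OF cd(5) per(2)] by metis
 have "continuous_on UNIV (%u. cmod (d1 c u))" by (intro continuous_intros cd(9))
 then obtain u0 where u0: "!!u. cmod (d1 c u0) <= cmod (d1 c u)" using periodic_attains_inf[of "%u. cmod (d1 c u)"] per(1) by metis
 define rho where "rho = 2/3*cmod (d1 c u0)"
 have rho: "rho > 0" using cd(10) by (simp add: rho_def)
 show thesis
 proof (rule that[of "F1/rho^4 + 3*F0*F2/rho^5"])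
  fix p T r x y assume T: "cmod T = 1" and b: "box_graph p T r c" and xy: "abs x < r" "abs y < r"
  have bound: "abs (f' u/(Re (cnj T*d1 c u))^4 - 3*f u*Re (cnj T*d2 c u)/(Re (cnj T*d1 c u))^5) <= F1/rho^4 + 3*F0*F2/rho^5"
   if x: "abs x < r" and u: "u = gpar p T r c x" for u x
  proof -
   define R where "R = Re (cnj T*d1 c u)"
   have "2*abs (Im (cnj T*d1 c u)) <= abs R" unfolding R_def u by (rule box_graph_Re_d1[OF b T c gpar_props(4)[OF b T c less_imp_le[OF x]]])
   moreover have "cmod (d1 c u0) <= cmod (cnj T*d1 c u)" using u0 T by (simp add: norm_mult)
   ultimately have R: "rho <= abs R" using cmod_le[of "cnj T*d1 c u"] unfolding rho_def R_def by linarith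
   have "abs (Re (cnj T*d2 c u)) <= cmod (cnj T*d2 c u)" by (rule abs_Re_le_cmod)
   hence R': "abs (Re (cnj T*d2 c u)) <= F2" using F2(2)[of u] T by (simp add: norm_mult)
   have "abs (f' u)/abs R^4 <= F1/rho^4" using F1 R rho by (intro frac_le power_mono) auto
   moreover have "abs (3*f u*Re (cnj T*d2 c u)) <= 3*F0*F2" unfolding abs_mult using F0 R' by (intro mult_mono) auto
   hence "abs (3*f u*Re (cnj T*d2 c u))/abs R^5 <= 3*F0*F2/rho^5" using R rho by (intro frac_le) auto
   ultimately show ?thesis using abs_triangle_ineq4[of "f' u/R^4" "3*f u*Re (cnj T*d2 c u)/R^5"]
    unfolding R_def[symmetric] abs_divide power_abs by linarith
  qed
  show "abs (gsecond p T r c x - gsecond p T r c y) <= (F1/rho^4 + 3*F0*F2/rho^5)*abs (x-y)"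
   by (rule lipschitz_of_derivative[OF gsecond_derivative[OF c f' T b] bound[unfolded f_def] xy]) auto
 qed (use F0 F1 F2 rho in simp)
qed

lemma arclength_second_derivative:
 assumes "(d1 c has_vector_derivative d2 c s) (at s)" "!!s. cmod (d1 c s) = 1"
 shows "d2 c s = \<i>*curv1 c s*d1 c s"
proof -
 have "d1 c s ~= 0" using assms(2)[of s] by auto
 from unit_has_vector_derivative[OF assms(1) this]
 have "(d1 c has_vector_derivative \<i>*curv1 c s*d1 c s) (at s)" using assms(2) by (simp add: curv1_def)
 thus ?thesis using vector_derivative_unique_at assms(1) by blast
qed

lemma rescaled_derivatives:
 fixes c :: "real => complex" and L :: real
 assumes d: "!!s. (c has_vector_derivative d1 c s) (at s)" "!!s. (d1 c has_vector_derivative d2 c s) (at s)"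
 defines "c' \<equiv> %u. c (L*u)"
 shows "(c' has_vector_derivative of_real L*d1 c (L*u)) (at u)" "d1 c' = (%u. of_real L*d1 c (L*u))"
  "(d1 c' has_vector_derivative of_real L*(of_real L*d2 c (L*u))) (at u)" "d2 c' = (%u. of_real L*(of_real L*d2 c (L*u)))"
proof -
 have chain: "((%u. f (L*u)) has_vector_derivative of_real L*f') (at u)" if "(f has_vector_derivative f') (at (L*u))"
  for f :: "real => complex" and f' u
 proof -
  have "((*) L has_vector_derivative L) (at u)" by (simp add: has_real_derivative_iff_has_vector_derivative[symmetric])
  from vector_diff_chain_at[OF this that] show ?thesis by (simp add: o_def scaleR_conv_of_real)
 qed
 show D: "(c' has_vector_derivative of_real L*d1 c (L*u)) (at u)" for u unfolding c'_def by (rule chain[OF d(1)])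
 show d1: "d1 c' = (%u. of_real L*d1 c (L*u))" unfolding d1_def[of c'] by (rule ext) (rule vector_derivative_at[OF D])
 show D2: "(d1 c' has_vector_derivative of_real L*(of_real L*d2 c (L*u))) (at u)" for u
  unfolding d1 by (rule has_vector_derivative_mult_right[OF chain[OF d(2)]])
 show "d2 c' = (%u. of_real L*(of_real L*d2 c (L*u)))" unfolding d2_def[of c'] by (rule ext) (rule vector_derivative_at[OF D2])
qed

lemma arclength_loop:
 fixes c0 :: "real => complex"
 assumes L: "L > 0" and per: "!!s. c0 (s+L) = c0 s" and inj: "inj_on c0 {0..<L}"
  and arc: "!!s. c0 differentiable (at s) & d1 c0 differentiable (at s) & cmod (d1 c0 s) = 1" and smooth: "smooth_real (curv1 c0)"
 obtains c f' where "c2loop c" "range c = range c0" "!!u. DERIV (%u. Im (cnj (d1 c u)*d2 c u)) u :> f' u" "continuous_on UNIV f'"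
proof -
 define k where "k = curv1 c0"
 have der: "(c0 has_vector_derivative d1 c0 s) (at s)" "(d1 c0 has_vector_derivative d2 c0 s) (at s)" for s
  using arc[of s] unfolding d1_def[of c0 s] d2_def by (auto simp: vector_derivative_works[symmetric])
 have "(deriv^^n) k differentiable (at s)" for n s using smooth unfolding smooth_real_def k_def by blast
 from this[of 0] this[of 1] have kd: "DERIV k s :> deriv k s" and "deriv k differentiable (at s)" for s
  by (simp_all add: DERIV_deriv_iff_real_differentiable)
 hence cont: "continuous_on UNIV k" "continuous_on UNIV (deriv k)" "continuous_on UNIV (d1 c0)"
  by (auto intro!: continuous_at_imp_continuous_on DERIV_isCont[OF kd] differentiable_imp_continuous_within
   has_vector_derivative_continuous[OF der(2)])
 have d2: "d2 c0 s = \<i> * of_real (k s)*d1 c0 s" for s unfolding k_def using arclength_second_derivative[OF der(2)] arc by blast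
 define c where "c u = c0 (L*u)" for u
 note scaled = rescaled_derivatives[of c0 L, OF der, folded c_def[abs_def]]
 have d1c: "d1 c = (%u. of_real L*d1 c0 (L*u))" and d2c: "d2 c = (%u. of_real L*(of_real L*d2 c0 (L*u)))" using scaled(2,4) by blast+
 note [continuous_intros] = cont[THEN continuous_on_compose2]
 have "c2loop c" unfolding c2loop_def
 proof (intro conjI allI)
  have "inj_on c {0..<1}"
  proof (rule inj_onI)
   fix u v assume uv: "u : {0..<1 :: real}" "v : {0..<1}" "c u = c v"
   show "u = v" using uv L inj_onD[OF inj uv(3)[unfolded c_def]] by simp
  qed
  moreover have "c (u+1) = c u" for u using per[of "L*u"] by (simp add: c_def distrib_left)
  ultimately show "jordan_loop c" by (simp add: jordan_loop_def)
  show "c differentiable at u" "d1 c differentiable at u" for u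
   by (rule differentiableI_vector[OF scaled(1)], rule differentiableI_vector[OF scaled(3)])
  show "d1 c u ~= 0" for u using arc[of "L*u"] L unfolding d1c by auto
  show "continuous_on UNIV (d2 c)" unfolding d2c d2 by (intro continuous_intros) auto
 qed
 moreover have "c0 s : range c" for s using L by (intro range_eqI[of _ _ "s/L"]) (simp add: c_def)
 hence "range c = range c0" by (auto simp: c_def)
 moreover have Im_eq: "Im (cnj (d1 c u)*d2 c u) = L^3*k (L*u)" for u
 proof -
  have "cnj (d1 c u)*d2 c u = of_real (L^3*k (L*u))*\<i>*(cnj (d1 c0 (L*u))*d1 c0 (L*u))" unfolding d1c d2c d2 by (simp add: power3_eq_cube)
  also have "cnj (d1 c0 (L*u))*d1 c0 (L*u) = 1" using arc[of "L*u"] by (simp add: complex_norm_square[symmetric] mult.commute)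
  finally show ?thesis by simp
 qed
 have "DERIV (%u. Im (cnj (d1 c u)*d2 c u)) u :> L^3*(deriv k (L*u)*L)" for u unfolding Im_eq
  by (intro DERIV_cmult DERIV_chain2[OF kd]) auto
 moreover have "continuous_on UNIV (%u. L^3*(deriv k (L*u)*L))" by (intro continuous_intros) auto
 ultimately show thesis by (rule that)
qed

lemma limit_flow_exists:
 fixes P :: "nat => real => real => complex" and A :: "nat => real => real"
 assumes l: "l > 0" and C: "C >= 0" and M: "M > 0" and tau: "tau > 0" and c: "c2loop c"
  and f': "!!u. DERIV (%u. Im (cnj (d1 c u)*d2 c u)) u :> f' u" "continuous_on UNIV f'"
  and fl: "!!n. is_flow (A n) (P n) {0..tau}" and per: "!!n theta. A n (theta+pi/2) = A n theta" and bounds: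
   "!!n theta. l <= A n theta & A n theta <= 1"
  and lip: "!!n theta theta'. abs (A n theta - A n theta') <= C*abs (theta-theta')" and k: "!!n t u. t : {0..tau} ==> abs (curv (P n) t u) <= M"
  and R: "!!n. range (slice (P n) 0) = range c" and conv: "uniform_limit UNIV A anis sequentially"
 obtains gam where "is_flow anis gam {0..tau}" "range (slice gam 0) = range c"
  "!!t. t : {0..tau} ==> enclosed_area (slice gam t) = enclosed_area c - 2*t"
proof -
 have t0: "0 : {0..tau}" using tau by simp
 obtain L0 where L0: "L0 >= 0" "!!p T r x y. cmod T = 1 ==> box_graph p T r c ==> abs x < r ==> abs y < r
  ==> abs (gsecond p T r c x - gsecond p T r c y) <= L0*abs (x-y)" by (rule gsecond_lipschitz_of_smooth_loop[OF c f']) blast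
 obtain eta where eta: "eta > 0" "!!n. admissible_flow l C M eta tau (A n) (P n)"
  by (rule flows_admissible[OF is_flow_c2loop[OF fl t0] k[OF t0, unfolded curv_def] M, of 0])
   (use fl per l bounds lip k R in auto)
 obtain z d where z: "z : inside (range c)" "d > 0" "!!u. d <= cmod (c u - z)" by (rule loop_inside_distance[OF c]) blast
 define r where "r = min (min (1/(2000*M)) (eta/16)) d"
 have "r <= 1/(2000*M)" and r_le: "16*r <= eta" "r <= d" unfolding r_def by simp_all
 hence Mr: "2000*M*r <= 1" using M by (simp add: pos_le_divide_eq mult.commute)
 have r0: "r > 0" using M eta(1) z(2) by (simp add: r_def)
 have cauchy: "EX N. ALL n >= N. ALL m >= N. ALL t : {0..tau}. near_curve d (slice (P n) t) (slice (P m) t)" if d: "d > 0" for d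
 proof (rule flow_stability[OF l C M eta(1) d, of tau], goal_cases)
  case stable: (1 e)
  obtain N where N: "!!n theta. n >= N ==> abs (A n theta - anis theta) < e/2"
   using uniform_limitD[OF conv, of "e/2"] stable(1) unfolding eventually_sequentially dist_real_def by auto
  have "abs (A n theta - A m theta) <= e" if "n >= N" "m >= N" for n m theta using N[OF that(1), of theta] N[OF that(2), of theta] by linarith
  thus ?case using stable(2)[OF eta(2) eta(2)] R by (metis order_refl)
 qed
 obtain N where N: "!!n m t. n >= N ==> m >= N ==> t : {0..tau} ==> near_curve (r/100) (slice (P n) t) (slice (P m) t)"
  using cauchy[of "r/100"] r0 by (auto simp del: atLeastAtMost_iff)
 interpret approximating_flows "%n. P (n+N)" "%n. A (n+N)" l C M eta tau L0 r "r/(200*M)"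
 proof
  show "EX K. ALL n >= K. ALL m >= K. ALL t : {0..tau}. near_curve d (slice (P (n+N)) t) (slice (P (m+N)) t)" if "d > 0" for d
   using cauchy[OF that] by (meson trans_le_add1)
  show "uniform_limit UNIV (%n. A (n+N)) anis sequentially" by (rule filterlim_compose[OF conv filterlim_add_const_nat_at_top])
  fix n p T x y assume T: "cmod T = 1" and b: "box_graph p T r (slice (P (n+N)) 0)" and xy: "abs x < r" "abs y < r"
  note g = admissible_flowD(7,6)[OF eta(2) t0, of "n+N"]
  have bc: "box_graph p T r c" by (rule box_graph_same_range[OF g eta(1) c _ b]) (simp add: R)
  have "gsecond p T r c w = gsecond p T r (slice (P (n+N)) 0) w" if "abs w < r" for w
   by (rule gsecond_same_range[OF b g(1) bc c _ T that]) (simp add: R)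
  thus "abs (gsecond p T r (slice (P (n+N)) 0) x - gsecond p T r (slice (P (n+N)) 0) y) <= L0*abs (x-y)" using L0(2)[OF T bc xy] xy by simp
 qed (use l C M eta tau L0(1) r_le r0 Mr N in auto)
 obtain e where e: "transversal_step 0 e" by (rule transversal_step_exists)
 interpret a: transversal_fibration "%n. P (n+N)" "%n. A (n+N)" l C M eta tau L0 r "r/(200*M)" 0 "%t. t" "{0..tau}"
  "%u t. central_difference e (curve 0 t) u" "%u t. central_difference e (d1 (curve 0 t)) u" "%u t. central_difference e (d2 (curve 0 t)) u"
  by (rule central_fibration[OF e]) (use delta in \<open>auto intro: continuous_intros\<close>)
 have far: "r <= cmod (w - z)" if "w : range c" for w using that z(3) r_le(2) by (auto intro: order_trans)
 have "curve 0 0 u : range c" for u using R[of "0+N"] by blast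
 note flow = limit_flow[OF e, of z, unfolded R, OF z(1) far[OF this]]
 show thesis using that[OF flow(1)] limit_area[OF e flow(2)] a.gam_range t0 limit_curve_initial[OF c R] by (simp add: slice_def)
qed

lemma rescaled_close:
 fixes a b q :: real
 assumes "abs (a-b) <= d" "q < 1" "1 - q <= e" "0 <= a" "a <= 1"
 shows "abs (q*a - b) <= d + e"
proof -
 have "0 <= (1-q)*a" "(1-q)*a <= e*1" using assms by (intro mult_mono mult_nonneg_nonneg; simp)+
 moreover have "q*a - b = (a-b) - (1-q)*a" by (simp add: algebra_simps)
 ultimately show ?thesis using assms(1) by linarith
qed

context
 fixes c0 c :: "real => complex" and f' :: "real => real" and A :: "real => real => real" and G :: "real => real => real => complex"
  and K C :: real
 assumes c: "c2loop c" "range c = range c0"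
  and f': "!!u. DERIV (%u. Im (cnj (d1 c u)*d2 c u)) u :> f' u" "continuous_on UNIV f'"
  and A: "!!omega. omega : {0<..<1} ==> continuous_on UNIV (A omega)" "!!omega theta. omega : {0<..<1} ==> A omega theta > 0"
   "!!omega theta. omega : {0<..<1} ==> A omega (theta+pi/2) = A omega theta"
  and A_lip: "!!omega. omega : {0<..<1} ==> lipschitz_on C UNIV (A omega)" and A_conv: "uniform_limit UNIV A anis (at_right 0)"
  and G: "!!omega. omega : {0<..<1} ==> is_flow (A omega) (G omega) {t. 0 <= t & t < Tom A c0 omega} & range (slice (G omega) 0) = range c0"
  and K: "K > 0"
begin

lemma eventually_parameter: "eventually (%omega. omega : {0<..<1 :: real}) (at_right 0)" by (rule eventually_at_right_real) simp

lemma C_nonneg: "C >= 0" and A_lipschitz: "omega : {0<..<1} ==> abs (A omega theta - A omega theta') <= C*abs (theta-theta')"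
 using A_lip[of "1/2"] A_lip[of omega] by (auto simp: lipschitz_on_def dist_real_def)

lemma anis_lipschitz: "abs (anis theta - anis theta') <= C*abs (theta-theta')"
proof (rule tendsto_upperbound)
 show "((%omega. abs (A omega theta - A omega theta')) \<longlongrightarrow> abs (anis theta - anis theta')) (at_right 0)"
  by (intro tendsto_intros tendsto_uniform_limitI[OF A_conv]) auto
 show "eventually (%omega. abs (A omega theta - A omega theta') <= C*abs (theta-theta')) (at_right 0)"
  using eventually_parameter by eventually_elim (rule A_lipschitz)
qed simp

lemma integral_A_lower_bound:
 assumes w: "omega : {0<..<1}" and a: "!!theta. theta : {0..2*pi} ==> a <= A omega theta" shows "2*pi*a <= integral {0..2*pi} (A omega)"
proof -
 have "integral {0..2*pi} (%_. a) <= integral {0..2*pi} (A omega)"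
  by (intro integral_le integrable_continuous_real continuous_on_subset[OF A(1)[OF w]] a) auto
 thus ?thesis by simp
qed

lemma Tom_pos:
 assumes w: "omega : {0<..<1}" shows "0 < Tom A c0 omega"
proof -
 have "continuous_on {0..2*pi} (A omega)" by (rule continuous_on_subset[OF A(1)[OF w]]) simp
 from continuous_attains_inf[OF compact_Icc _ this] obtain x where x: "ALL y : {0..2*pi}. A omega x <= A omega y" by auto
 have "0 < 2*pi*A omega x" using A(2)[OF w] by simp
 thus ?thesis using integral_A_lower_bound[OF w bspec[OF x]] area_pos[OF c(1)] unfolding Tom_def c(2) by auto
qed

definition controlled :: "real => real => bool" where
 "controlled t omega \<longleftrightarrow> omega : {0<..<1} & t < Tom A c0 omega & (ALL s : {0..t}. ALL u. abs (curv (G omega) s u) <= K/2)"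

lemma eventually_controlled:
 assumes "Limsup (at_right 0) (%omega. Msup A c0 G omega t) < ereal (K/2)"
 shows "eventually (controlled t) (at_right 0)"
 using Limsup_lessD[OF assms] eventually_parameter
proof eventually_elim
 case (elim omega)
 hence T: "t < Tom A c0 omega" by (auto simp: Msup_def split: if_splits)
 have "abs (curv (G omega) s u) <= K/2" if "s : {0..t}" for s u
 proof -
  have "ereal (abs (curv (G omega) s u)) <= (SUP u \<in> UNIV. ereal (abs (curv (G omega) s u)))" by (rule SUP_upper) simp
  also have "... <= (SUP s \<in> {0..t}. SUP u \<in> UNIV. ereal (abs (curv (G omega) s u)))" by (rule SUP_upper[OF that])
  also have "... < ereal (K/2)" using elim T by (simp add: Msup_def)
  finally show ?thesis by simp
 qed
 thus ?case using elim T by (simp add: controlled_def)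
qed

lemma eventually_controlled_below_TK:
 assumes "ereal s < TK A c0 G K" shows "eventually (controlled s) (at_right 0)"
proof -
 obtain t where t: "Limsup (at_right 0) (%omega. Msup A c0 G omega t) < ereal (K/2)" "s < t"
  using assms unfolding TK_def less_Sup_iff by auto
 from eventually_controlled[OF t(1)] show ?thesis by eventually_elim (use t(2) in \<open>auto simp: controlled_def\<close>)
qed

lemma eventually_A_close: "d > 0 ==> eventually (%omega. ALL theta. abs (A omega theta - anis theta) < d) (at_right 0)"
 using uniform_limitD[OF A_conv] by (simp add: dist_real_def)

lemma TK_real: obtains tau where "tau >= 0" "TK A c0 G K = ereal tau"
proof -
 have "ereal t <= TK A c0 G K" if "t < 0" for t
 proof -
  have "eventually (%omega. Msup A c0 G omega t <= -\<infinity>) (at_right 0)"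
   using eventually_parameter by eventually_elim (use Tom_pos that in \<open>force simp: Msup_def bot_ereal_def\<close>)
  hence "Limsup (at_right 0) (%omega. Msup A c0 G omega t) <= -\<infinity>" by (rule Limsup_bounded)
  thus ?thesis unfolding TK_def by (intro Sup_upper) auto
 qed
 hence "0 <= TK A c0 G K" using ereal_dense2[of "TK A c0 G K" 0] by force
 moreover have "t <= enclosed_area c0/(pi/4)"
  if "Limsup (at_right 0) (%omega. Msup A c0 G omega t) < ereal (K/2)" for t
 proof -
  have "eventually (%omega. controlled t omega & (ALL theta. abs (A omega theta - anis theta) < 1/8)) (at_right 0)"
   by (intro eventually_conj eventually_controlled[OF that] eventually_A_close) simp
  then obtain omega where w: "controlled t omega" "!!theta. abs (A omega theta - anis theta) < 1/8"
   using eventually_happens'[OF trivial_limit_at_right_real] by blast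
  have "1/8 <= A omega theta" for theta using w(2)[of theta] anis_bounds(1)[of theta] by linarith
  hence "pi/4 <= integral {0..2*pi} (A omega)" using integral_A_lower_bound[of omega "1/8"] w(1) by (simp add: controlled_def)
  hence "Tom A c0 omega <= enclosed_area c0/(pi/4)" unfolding Tom_def using less_le_trans[of 0 "pi/4"] by (intro divide_left_mono) auto
  thus ?thesis using w(1) by (simp add: controlled_def)
 qed
 hence "TK A c0 G K <= ereal (enclosed_area c0/(pi/4))" unfolding TK_def by (intro Sup_least) auto
 ultimately show thesis using that by (cases "TK A c0 G K") auto
qed

lemma controlled_sequence:
 assumes tau: "TK A c0 G K = ereal tau" "tau > 0" and q: "!!n. q n < 1"
 obtains omega where "!!n :: nat. controlled (q n*tau) (omega n)" "!!n theta. abs (A (omega n) theta - anis theta) < 1/(real n + 8)"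
proof -
 have "EX omega. controlled (q n*tau) omega & (ALL theta. abs (A omega theta - anis theta) < 1/(real n + 8))" for n
 proof -
  have "eventually (%omega. controlled (q n*tau) omega & (ALL theta. abs (A omega theta - anis theta) < 1/(real n + 8))) (at_right 0)"
   using q tau(2) tau(1) by (intro eventually_conj eventually_controlled_below_TK eventually_A_close) auto
  thus ?thesis using eventually_happens'[OF trivial_limit_at_right_real] by blast
 qed
 thus thesis using that by metis
qed

text \<open>The curvature bound holds only strictly before TK; slowing the approximating flows down by factors tending to 1
 makes them live, with bounded curvature, on the whole closed interval.\<close>
lemma limit_flow_until_TK:
 assumes tau: "TK A c0 G K = ereal tau" "tau > 0"
 obtains gam where "is_flow anis gam {0..tau}" "range (slice gam 0) = range c0"
  "!!t. t : {0..tau} ==> enclosed_area (slice gam t) = enclosed_area c0 - 2*t"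
proof -
 define q where "q n = real (n+1)/real (n+2)" for n :: nat
 have q: "1/2 <= q n" "q n < 1" "1 - q n <= 1/(real n + 1)" for n by (auto simp: q_def field_simps)
 obtain omega where w: "!!n. controlled (q n*tau) (omega n)" "!!n theta. abs (A (omega n) theta - anis theta) < 1/(real n + 8)"
  by (rule controlled_sequence[where q = q, OF tau q(2)]) blast
 have w01: "omega n : {0<..<1}" for n using w(1)[of n] by (simp add: controlled_def)
 have "1/(real n + 8) <= 1/8" for n by (intro divide_left_mono) auto
 hence near: "abs (A (omega n) theta - anis theta) < 1/8" for n theta using less_le_trans[OF w(2)] by blast
 have Ab: "1/8 <= A (omega n) theta" "A (omega n) theta <= 1" for n theta using near[of n theta] anis_bounds(1,2)[of theta] by linarith+
 define P B where "P n u t = G (omega n) u (q n*t)" and "B n theta = q n*A (omega n) theta" for n u t theta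
 have sl: "slice (P n) t = slice (G (omega n)) (q n*t)" for n t by (simp add: slice_def P_def)
 have qt: "q n*t : {0..q n*tau}" if "t : {0..tau}" for n t using that q(1)[of n] by auto
 have close: "abs (B n theta - anis theta) <= 2/(real n + 1)" for n theta
 proof -
  have "abs (q n*A (omega n) theta - anis theta) <= 1/(real n + 8) + 1/(real n + 1)"
   by (rule rescaled_close[OF less_imp_le[OF w(2)] q(2,3)]) (use Ab[of n theta] in auto)
  also have "1/(real n + 8) <= 1/(real n + 1)" by (intro divide_left_mono) auto
  finally show ?thesis by (simp add: B_def)
 qed
 show thesis
 proof (rule limit_flow_exists[of "1/16" C "K/2" tau c f' B P, OF _ C_nonneg _ tau(2) c(1) f'])
  show "is_flow (B n) (P n) {0..tau}" for n unfolding P_def[abs_def] B_def[abs_def]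
  proof (rule is_flow_rescale[OF conjunct1[OF G[OF w01]]])
   show "q n*t : {t. 0 <= t & t < Tom A c0 (omega n)}" if "t : {0..tau}" for t
    using qt[OF that, of n] w(1)[of n] by (auto simp: controlled_def)
  qed (use q(1)[of n] in auto)
  show "B n (theta+pi/2) = B n theta" for n theta unfolding B_def using A(3)[OF w01] by simp
  have "1/2*(1/8) <= q n*A (omega n) theta" "q n*A (omega n) theta <= 1*1" for n theta
   using q(1,2)[of n] Ab[of n theta] by (intro mult_mono; simp)+
  thus "1/16 <= B n theta & B n theta <= 1" for n theta by (simp add: B_def)
  show "abs (B n theta - B n theta') <= C*abs (theta-theta')" for n theta theta'
  proof -
   have "abs (B n theta - B n theta') = q n*abs (A (omega n) theta - A (omega n) theta')"
    unfolding B_def right_diff_distrib[symmetric] using q(1)[of n] by (simp add: abs_mult)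
   also have "... <= 1*abs (A (omega n) theta - A (omega n) theta')" using q(2)[of n] by (intro mult_right_mono) auto
   also have "... <= C*abs (theta-theta')" using A_lipschitz[OF w01] by simp
   finally show ?thesis .
  qed
  show "abs (curv (P n) t u) <= K/2" if "t : {0..tau}" for n t u
   using w(1)[of n] qt[OF that, of n] unfolding controlled_def curv_def sl by blast
  show "range (slice (P n) 0) = range c" for n using G[OF w01, of n] unfolding sl c(2) by simp
  show "uniform_limit UNIV B anis sequentially"
  proof (rule uniform_limitI)
   fix e :: real assume "e > 0"
   have "(%n. 2/(real n + 1)) \<longlonglongrightarrow> 0" by real_asymp
   from order_tendstoD(2)[OF this \<open>e > 0\<close>] show "eventually (%n. ALL theta : UNIV. dist (B n theta) (anis theta) < e) sequentially"
    by eventually_elim (auto simp: dist_real_def intro: le_less_trans[OF close])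
  qed
 qed (use K that c(2) in auto)
qed

lemma flow_until_TK_exists:
 obtains tau gam where "times (TK A c0 G K) = {0..tau}" "is_flow anis gam {0..tau}" "range (slice gam 0) = range c0"
  "!!t. t : {0..tau} ==> enclosed_area (slice gam t) = enclosed_area c0 - 2*t"
proof -
 obtain tau where tau: "tau >= 0" "TK A c0 G K = ereal tau" by (rule TK_real)
 hence times: "times (TK A c0 G K) = {0..tau}" by (auto simp: times_def)
 show thesis
 proof (cases "tau = 0")
  case True
  have half: "(1/2 :: real) : {0<..<1}" by simp
  have "is_flow (A (1/2)) (G (1/2)) {0}" by (rule is_flow_subset[OF conjunct1[OF G[OF half]]]) (use Tom_pos[OF half] in simp)
  hence "is_flow anis (G (1/2)) {0}" by (simp add: is_flow_def)
  thus thesis using that[of 0 "G (1/2)"] times True G[OF half] by simp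
 next
  case False
  hence "tau > 0" using tau(1) by simp
  from limit_flow_until_TK[OF tau(2) this] show thesis using that[OF times] by blast
 qed
qed

end

lemma smooth_real_continuous: "smooth_real f ==> continuous_on S f"
proof -
 assume "smooth_real f"
 hence "(deriv^^0) f differentiable (at x)" for x unfolding smooth_real_def by blast
 thus ?thesis by (auto intro!: continuous_at_imp_continuous_on differentiable_imp_continuous_within)
qed

theorem theorem3p1:
  fixes c0 :: "real \<Rightarrow> complex" and L K :: real
    and A :: "real \<Rightarrow> real \<Rightarrow> real"
    and G :: "real \<Rightarrow> real \<Rightarrow> real \<Rightarrow> complex"
  assumes L_pos: "L > 0"
    and c0_periodic: "\<forall>s. c0 (s + L) = c0 s"
    and c0_jordan: "inj_on c0 {0..<L}"
    and c0_arclength: "\<forall>s. c0 differentiable (at s) \<and> d1 c0 differentiable (at s) \<and> cmod (d1 c0 s) = 1"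
    and c0_smooth_curv: "smooth_real (curv1 c0)"
    and c0_inflections: "finite {s \<in> {0..<L}. inflection (curv1 c0) s}"
    and A_props: "\<forall>\<omega>\<in>{0<..<1}. smooth_real (A \<omega>) \<and> (\<forall>\<theta>. A \<omega> \<theta> > 0)
                    \<and> (\<forall>\<theta>. A \<omega> (\<theta> + pi / 2) = A \<omega> \<theta>)"
    and A_lipschitz: "\<exists>C. \<forall>\<omega>\<in>{0<..<1}. lipschitz_on C UNIV (A \<omega>)"
    and A_conv: "uniform_limit UNIV A anis (at_right 0)"
    and G_flow: "\<forall>\<omega>\<in>{0<..<1}. is_flow (A \<omega>) (G \<omega>) {t. 0 \<le> t \<and> t < Tom A c0 \<omega>}
                    \<and> range (slice (G \<omega>) 0) = range c0"
    and K_pos: "K > 0"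
  shows "\<exists>gam. is_flow anis gam (times (TK A c0 G K))
            \<and> range (slice gam 0) = range c0
            \<and> (\<forall>gam'. is_flow anis gam' (times (TK A c0 G K)) \<and> range (slice gam' 0) = range c0
                  \<longrightarrow> (\<forall>t\<in>times (TK A c0 G K). range (slice gam' t) = range (slice gam t)))
            \<and> (\<forall>t\<in>times (TK A c0 G K).
                  measure lebesgue (inside (range (slice gam t)))
                    = 2 * (measure lebesgue (inside (range c0)) / 2 - t))
            \<and> (\<forall>\<epsilon>>0. \<exists>\<delta>>0. \<forall>t\<in>times (TK A c0 G K). \<forall>t'\<in>times (TK A c0 G K).
                  \<forall>p\<in>range (slice gam t). \<forall>p'\<in>range (slice gam t').
                    \<bar>t - t'\<bar> \<le> \<delta> \<and> cmod (p - p') \<le> \<delta>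
                    \<longrightarrow> \<bar>curv_pt gam t p - curv_pt gam t' p'\<bar> \<le> \<epsilon>)"
proof -
 obtain c f' where c: "c2loop c" "range c = range c0" "!!u. DERIV (%u. Im (cnj (d1 c u)*d2 c u)) u :> f' u" "continuous_on UNIV f'"
  using arclength_loop[OF L_pos _ c0_jordan _ c0_smooth_curv] c0_periodic c0_arclength by metis
 obtain C where C: "!!omega. omega : {0<..<1} ==> lipschitz_on C UNIV (A omega)" using A_lipschitz by blast
 have A: "continuous_on UNIV (A omega)" "A omega theta > 0" "A omega (theta+pi/2) = A omega theta" if "omega : {0<..<1}" for omega theta
  using A_props that smooth_real_continuous by blast+
 note hyps = c A C A_conv bspec[OF G_flow] K_pos
 obtain tau gam where tau: "times (TK A c0 G K) = {0..tau}" and gam: "is_flow anis gam {0..tau}" "range (slice gam 0) = range c0"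
  "!!t. t : {0..tau} ==> enclosed_area (slice gam t) = enclosed_area c0 - 2*t"
  by (rule flow_until_TK_exists[OF hyps]) blast+
 have unique: "range (slice gam' t) = range (slice gam t)"
  if "is_flow anis gam' {0..tau}" "range (slice gam' 0) = range c0" "t : {0..tau}" for gam' t
  using flow_unique[OF that(1) gam(1) C_nonneg[OF hyps] anis_lipschitz[OF hyps] _ that(3)] that(2) gam(2) by simp
 have equicontinuous: "\<exists>delta>0. \<forall>t\<in>{0..tau}. \<forall>t'\<in>{0..tau}. \<forall>p\<in>range (slice gam t). \<forall>p'\<in>range (slice gam t').
   \<bar>t - t'\<bar> \<le> delta \<and> cmod (p - p') \<le> delta \<longrightarrow> \<bar>curv_pt gam t p - curv_pt gam t' p'\<bar> \<le> eps" if "eps > 0" for eps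
  by (rule flow_curvature_equicontinuous[OF gam(1) that]) blast
 show ?thesis unfolding tau by (intro exI[of _ gam] conjI allI impI gam(1, 2) equicontinuous) (use unique gam(3) in auto)
qed

end
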